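(* Let $\mathcal{C}$ be the category of nonnegatively lower graded differential modules over a (commutative) ring $\Bbbk$. Let $(A,\phi)$ be an algebra in $\mathcal{C}$ over a cofibrant prop $\mathsf{P}$ in $\mathcal{C}$. If both $A$ and its homology $H_*(A)$ are projective as $\Bbbk$-modules, then $H_*(A)$ (viewed as an object of $\mathcal{C}$ with zero differential) inherits a $\mathsf{P}$-action $\theta$ so that the $\mathsf{P}$-algebra $(H_*(A),\theta)$ is connected to $(A,\phi)$ by weak equivalences of $\mathsf{P}$-algebras $$(H_*(A),\theta)\xrightarrow{\sim}\cdot\xleftarrow{\sim}\cdot\xrightarrow{\sim}(A,\phi).$$
   Context: **Base category.** $\mathcal{C}$ is the category of chain complexes of $\Bbbk$-modules concentrated in degrees $\geq 0$, with the usual symmetric tensor product $\otimes=\otimes_{\Bbbk}$, unit $\mathbf{1}=\Bbbk$, internal hom $\operatorname{Hom}_{\mathcal{C}}$, and the standard projective model structure (weak equivalences are the quasi-isomorphisms, fibrations are the morphisms which are surjective in positive degrees). **Props.** A prop $\mathsf{P}$ in $\mathcal{C}$ is a symmetric monoidal category enriched over $\mathcal{C}$ with the integers $n\in\mathbb{N}$ as objects and tensor product $m\otimes n=m+n$ on objects. It is determined by hom-objects $\mathsf{P}(m,n)\in\mathcal{C}$ ($m$ inputs, $n$ outputs), with a right $\Sigma_m$- and a left $\Sigma_n$-action, horizontal products $\mathsf{P}(k,m)\otimes\mathsf{P}(l,n)\to\mathsf{P}(k+l,m+n)$, vertical products $\mathsf{P}(k,m)\otimes\mathsf{P}(n,k)\to\mathsf{P}(n,m)$,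 and units $\mathbf{1}\to\mathsf{P}(n,n)$. Prop morphisms are collections $\mathsf{P}(m,n)\to\mathsf{Q}(m,n)$ preserving these structures. The initial prop $I$ has $I(n,n)=\Bbbk[\Sigma_n]$ and $I(m,n)=0$ for $m\neq n$. **Homotopy theory of props.** A prop morphism is a weak equivalence (resp. fibration) if all its components $\mathsf{P}(m,n)\to\mathsf{Q}(m,n)$ are so in $\mathcal{C}$; it is a cofibration if it has the left lifting property with respect to acyclic fibrations of props. A prop $\mathsf{P}$ is cofibrant if $I\to\mathsf{P}$ is a cofibration. These notions are considered in the category of all props in $\mathcal{C}$ if this category, with these classes, forms a semi-model category (i.e. the lifting and factorization axioms of model categories hold for morphisms with a cofibrant domain); otherwise one works in the full subcategory of props with non-empty inputs, i.e. such that $\mathsf{P}(0,0)=\mathbf{1}$ and $\mathsf{P}(0,n)=0$ for $n\neq 0$ (components with $m=0$ are then discarded in the definition of weak equivalences and fibrations), or symmetrically in the full subcategory of props with non-empty outputs. **Algebras.** The endomorphism prop of $X\in\mathcal{C}$ is $\operatorname{End}_X(m,n)=\operatorname{Hom}_{\mathcal{C}}(X^{\otimes m},X^{\otimes n})$ with the evident structure. A $\mathsf{P}$-algebra is a pair $(X,\phi)$ with $X\in\mathcal{C}$ and $\phi:\mathsf{P}\to\operatorname{End}_X$ a prop morphism (a $\mathsf{P}$-action on $X$). A morphism of $\mathsf{P}$-algebras is a morphism of $\mathcal{C}$ commuting with the actions. A weak equivalence of $\mathsf{P}$-algebras is a morphism of $\mathsf{P}$-algebras which is a weak equivalence in $\mathcal{C}$.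 *)

theory Defs
  imports
    "HOL.Hull"
    "HOL-Algebra.Module"
    "HOL-Algebra.AbelCoset"
    "HOL-Combinatorics.Permutations"
begin

section \<open>Modules over a fixed commutative ring\<close>

definition linear_maps ::
    "'k ring \<Rightarrow> ('k, 'a) module \<Rightarrow> ('k, 'b) module \<Rightarrow> ('a \<Rightarrow> 'b) set" where
  "linear_maps R M N = {f \<in> carrier M \<rightarrow> carrier N.
     (\<forall>x \<in> carrier M. \<forall>y \<in> carrier M. f (x \<oplus>\<^bsub>M\<^esub> y) = f x \<oplus>\<^bsub>N\<^esub> f y) \<and>
     (\<forall>a \<in> carrier R. \<forall>x \<in> carrier M. f (a \<odot>\<^bsub>M\<^esub> x) = a \<odot>\<^bsub>N\<^esub> f x)}"

text \<open>The multiplicative part of the library's record for modules plays no role and is left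
  undefined in the constructions below.\<close>

definition quotient_module :: "('k, 'a) module \<Rightarrow> 'a set \<Rightarrow> ('k, 'a set) module" where
  "quotient_module M N =
    \<lparr>carrier = a_rcosets\<^bsub>M\<^esub> N, monoid.mult = undefined, one = undefined,
     zero = N, add = set_add M, smult = (\<lambda>a \<xi>. \<Union>x\<in>\<xi>. N +>\<^bsub>M\<^esub> (a \<odot>\<^bsub>M\<^esub> x))\<rparr>"

definition free_module :: "'k ring \<Rightarrow> 's set \<Rightarrow> ('k, 's \<Rightarrow> 'k) module" where
  "free_module R S =
    \<lparr>carrier = {c. range c \<subseteq> carrier R \<and> (\<forall>s. s \<notin> S \<longrightarrow> c s = \<zero>\<^bsub>R\<^esub>) \<and>
                   finite {s. c s \<noteq> \<zero>\<^bsub>R\<^esub>}},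
     monoid.mult = undefined, one = undefined,
     zero = (\<lambda>_. \<zero>\<^bsub>R\<^esub>), add = (\<lambda>c c' s. c s \<oplus>\<^bsub>R\<^esub> c' s),
     smult = (\<lambda>a c s. a \<otimes>\<^bsub>R\<^esub> c s)\<rparr>"

definition basis_elt :: "'k ring \<Rightarrow> 's \<Rightarrow> 's \<Rightarrow> 'k" where
  "basis_elt R s = (\<lambda>t. if t = s then \<one>\<^bsub>R\<^esub> else \<zero>\<^bsub>R\<^esub>)"

text \<open>Projective modules are the direct summands of free modules. Taking the basis in the
  type of elements of \<open>M\<close> itself is no restriction: a summand of some free module
  is also a summand of the free module on its own underlying set.\<close>

definition projective_module :: "'k ring \<Rightarrow> ('k, 'a) module \<Rightarrow> bool" where
  "projective_module R M \<longleftrightarrow> module R M \<and>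
     (\<exists>(S :: 'a set) i r. i \<in> linear_maps R M (free_module R S) \<and>
        r \<in> linear_maps R (free_module R S) M \<and> (\<forall>x \<in> carrier M. r (i x) = x))"

text \<open>\<open>signed M e x\<close> is $(-1)^e x$.\<close>

definition signed :: "('k, 'a) module \<Rightarrow> int \<Rightarrow> 'a \<Rightarrow> 'a" where
  "signed M e x = (if even e then x else \<ominus>\<^bsub>M\<^esub> x)"

section \<open>Chain complexes\<close>

text \<open>Degrees are integers and complexes are required to vanish in negative degrees. This
  keeps degree arithmetic free of truncated subtraction.\<close>

record ('k, 'a) cx =
  gr :: "int \<Rightarrow> ('k, 'a) module"
  diff :: "int \<Rightarrow> 'a \<Rightarrow> 'a"

locale chain_complex =
  fixes R :: "'k ring" and X :: "('k, 'a) cx"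
  assumes modules: "module R (gr X n)"
    and nonneg: "n < 0 \<Longrightarrow> carrier (gr X n) = {\<zero>\<^bsub>gr X n\<^esub>}"
    and diff_linear: "diff X n \<in> linear_maps R (gr X n) (gr X (n - 1))"
    and diff_diff: "x \<in> carrier (gr X n) \<Longrightarrow> diff X (n - 1) (diff X n x) = \<zero>\<^bsub>gr X (n - 2)\<^esub>"

definition chain_map ::
    "'k ring \<Rightarrow> ('k, 'a) cx \<Rightarrow> ('k, 'b) cx \<Rightarrow> (int \<Rightarrow> 'a \<Rightarrow> 'b) \<Rightarrow> bool" where
  "chain_map R X Y f \<longleftrightarrow> (\<forall>n. f n \<in> linear_maps R (gr X n) (gr Y n) \<and>
     (\<forall>x \<in> carrier (gr X n). f (n - 1) (diff X n x) = diff Y n (f n x)))"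

definition cycles :: "('k, 'a) cx \<Rightarrow> int \<Rightarrow> 'a set" where
  "cycles X n = {x \<in> carrier (gr X n). diff X n x = \<zero>\<^bsub>gr X (n - 1)\<^esub>}"

definition boundaries :: "('k, 'a) cx \<Rightarrow> int \<Rightarrow> 'a set" where
  "boundaries X n = diff X (n + 1) ` carrier (gr X (n + 1))"

definition homology :: "('k, 'a) cx \<Rightarrow> int \<Rightarrow> ('k, 'a set) module" where
  "homology X n = quotient_module ((gr X n)\<lparr>carrier := cycles X n\<rparr>) (boundaries X n)"

definition homology_cx :: "('k, 'a) cx \<Rightarrow> ('k, 'a set) cx" where
  "homology_cx X = \<lparr>gr = homology X, diff = (\<lambda>n _. \<zero>\<^bsub>homology X (n - 1)\<^esub>)\<rparr>"

definition homology_map ::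
    "('k, 'b) cx \<Rightarrow> (int \<Rightarrow> 'a \<Rightarrow> 'b) \<Rightarrow> int \<Rightarrow> 'a set \<Rightarrow> 'b set" where
  "homology_map Y f n \<xi> = (\<Union>x\<in>\<xi>. boundaries Y n +>\<^bsub>gr Y n\<^esub> f n x)"

definition quasi_iso :: "('k, 'a) cx \<Rightarrow> ('k, 'b) cx \<Rightarrow> (int \<Rightarrow> 'a \<Rightarrow> 'b) \<Rightarrow> bool" where
  "quasi_iso X Y f \<longleftrightarrow>
     (\<forall>n. bij_betw (homology_map Y f n) (carrier (homology X n)) (carrier (homology Y n)))"

definition cx_fibration :: "('k, 'a) cx \<Rightarrow> ('k, 'b) cx \<Rightarrow> (int \<Rightarrow> 'a \<Rightarrow> 'b) \<Rightarrow> bool" where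
  "cx_fibration X Y f \<longleftrightarrow> (\<forall>n > 0. f n ` carrier (gr X n) = carrier (gr Y n))"

text \<open>A morphism of complexes $X \otimes Y \to Z$, given as a family of bilinear maps
  satisfying the Leibniz rule.\<close>

definition dg_bilinear ::
    "'k ring \<Rightarrow> ('k, 'a) cx \<Rightarrow> ('k, 'b) cx \<Rightarrow> ('k, 'c) cx \<Rightarrow>
     (int \<Rightarrow> int \<Rightarrow> 'a \<Rightarrow> 'b \<Rightarrow> 'c) \<Rightarrow> bool" where
  "dg_bilinear R X Y Z \<mu> \<longleftrightarrow> (\<forall>p q.
     (\<forall>x \<in> carrier (gr X p). \<mu> p q x \<in> linear_maps R (gr Y q) (gr Z (p + q))) \<and>
     (\<forall>y \<in> carrier (gr Y q). (\<lambda>x. \<mu> p q x y) \<in> linear_maps R (gr X p) (gr Z (p + q))) \<and>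
     (\<forall>x \<in> carrier (gr X p). \<forall>y \<in> carrier (gr Y q).
        diff Z (p + q) (\<mu> p q x y) =
          \<mu> (p - 1) q (diff X p x) y
          \<oplus>\<^bsub>gr Z (p + q - 1)\<^esub> signed (gr Z (p + q - 1)) p (\<mu> p (q - 1) x (diff Y q y))))"

text \<open>The internal hom of nonnegatively graded complexes: all homogeneous maps in positive
  degrees, chain maps in degree zero. A homogeneous map of degree \<open>p\<close> is a family \<open>f\<close>
  with \<open>f d\<close> defined on degree \<open>d\<close>, made extensional so that equality of maps is equality
  in the type.\<close>

definition hom_cx ::
    "'k ring \<Rightarrow> ('k, 'a) cx \<Rightarrow> ('k, 'b) cx \<Rightarrow> ('k, int \<Rightarrow> 'a \<Rightarrow> 'b) cx" where
  "hom_cx R X Y =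
    \<lparr>gr = (\<lambda>p.
       \<lparr>carrier = {f. (\<forall>d. f d \<in> linear_maps R (gr X d) (gr Y (d + p)) \<inter>
                                  extensional (carrier (gr X d))) \<and>
                       (p = 0 \<longrightarrow> chain_map R X Y f) \<and>
                       (p < 0 \<longrightarrow> (\<forall>d. \<forall>x \<in> carrier (gr X d). f d x = \<zero>\<^bsub>gr Y (d + p)\<^esub>))},
        monoid.mult = undefined, one = undefined,
        zero = (\<lambda>d. \<lambda>x \<in> carrier (gr X d). \<zero>\<^bsub>gr Y (d + p)\<^esub>),
        add = (\<lambda>f g d. \<lambda>x \<in> carrier (gr X d). f d x \<oplus>\<^bsub>gr Y (d + p)\<^esub> g d x),
        smult = (\<lambda>a f d. \<lambda>x \<in> carrier (gr X d). a \<odot>\<^bsub>gr Y (d + p)\<^esub> f d x)\<rparr>),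
     diff = (\<lambda>p f d. \<lambda>x \<in> carrier (gr X d).
       diff Y (d + p) (f d x)
       \<ominus>\<^bsub>gr Y (d + p - 1)\<^esub> signed (gr Y (d + p - 1)) p (f (d - 1) (diff X d x)))\<rparr>"

section \<open>Tensor powers\<close>

text \<open>The tensor powers of a complex are constructed in an unbiased way. The degree \<open>d\<close> part of
  the \<open>m\<close>-th power is the free module on words of length \<open>m\<close> in homogeneous
  elements, with degrees adding up to \<open>d\<close>, modulo linearity in each letter. A letter is a
  pair consisting of a degree and an element of that degree. The zeroth power is the unit complex, with
  generator the empty word, and concatenation of words gives the associativity
  isomorphisms.\<close>

type_synonym 'a word = "(int \<times> 'a) list"
type_synonym ('k, 'a) tensor = "('a word \<Rightarrow> 'k) set"

definition wdeg :: "'a word \<Rightarrow> int" where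
  "wdeg w = sum_list (map fst w)"

definition words :: "('k, 'a) cx \<Rightarrow> nat \<Rightarrow> int \<Rightarrow> 'a word set" where
  "words X m d = {w. length w = m \<and> wdeg w = d \<and> (\<forall>(n, x) \<in> set w. x \<in> carrier (gr X n))}"

definition tensor_relations ::
    "'k ring \<Rightarrow> ('k, 'a) cx \<Rightarrow> nat \<Rightarrow> int \<Rightarrow> ('a word \<Rightarrow> 'k) set" where
  "tensor_relations R X m d =
     (let F = free_module R (words X m d); e = basis_elt R in
      (\<lambda>N. submodule N R F) hull
        ({e (u @ (n, x \<oplus>\<^bsub>gr X n\<^esub> y) # v) \<ominus>\<^bsub>F\<^esub> (e (u @ (n, x) # v) \<oplus>\<^bsub>F\<^esub> e (u @ (n, y) # v)) | u n x y v.
            u @ (n, x) # v \<in> words X m d \<and> u @ (n, y) # v \<in> words X m d} \<union>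
         {e (u @ (n, a \<odot>\<^bsub>gr X n\<^esub> x) # v) \<ominus>\<^bsub>F\<^esub> a \<odot>\<^bsub>F\<^esub> e (u @ (n, x) # v) | u n a x v.
            a \<in> carrier R \<and> u @ (n, x) # v \<in> words X m d}))"

definition tensor_module ::
    "'k ring \<Rightarrow> ('k, 'a) cx \<Rightarrow> nat \<Rightarrow> int \<Rightarrow> ('k, ('k, 'a) tensor) module" where
  "tensor_module R X m d =
     quotient_module (free_module R (words X m d)) (tensor_relations R X m d)"

definition pure_tensor :: "'k ring \<Rightarrow> ('k, 'a) cx \<Rightarrow> 'a word \<Rightarrow> ('k, 'a) tensor" where
  "pure_tensor R X w =
     tensor_relations R X (length w) (wdeg w)
       +>\<^bsub>free_module R (words X (length w) (wdeg w))\<^esub> basis_elt R w"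

text \<open>\<open>tensor_lift R N g\<close> is the linear map on a tensor power, with values in \<open>N\<close>, that sends the
  pure tensor of a word \<open>w\<close> to \<open>g w\<close>. It is used only for multilinear \<open>g\<close>, so that the value
  does not depend on the representative.\<close>

definition tensor_lift ::
    "'k ring \<Rightarrow> ('k, 'b) module \<Rightarrow> ('a word \<Rightarrow> 'b) \<Rightarrow> ('k, 'a) tensor \<Rightarrow> 'b" where
  "tensor_lift R N g \<xi> =
     the_elem ((\<lambda>c. \<Oplus>\<^bsub>N\<^esub>w \<in> {w. c w \<noteq> \<zero>\<^bsub>R\<^esub>}. c w \<odot>\<^bsub>N\<^esub> g w) ` \<xi>)"

definition tensor_diff ::
    "'k ring \<Rightarrow> ('k, 'a) cx \<Rightarrow> nat \<Rightarrow> int \<Rightarrow> ('k, 'a) tensor \<Rightarrow> ('k, 'a) tensor" where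
  "tensor_diff R X m d =
     (let N = tensor_module R X m (d - 1) in
      tensor_lift R N (\<lambda>w. \<Oplus>\<^bsub>N\<^esub>i \<in> {..<m}.
        signed N (wdeg (take i w))
          (pure_tensor R X (w[i := (fst (w ! i) - 1, diff X (fst (w ! i)) (snd (w ! i)))]))))"

definition tensor_power ::
    "'k ring \<Rightarrow> ('k, 'a) cx \<Rightarrow> nat \<Rightarrow> ('k, ('k, 'a) tensor) cx" where
  "tensor_power R X m = \<lparr>gr = tensor_module R X m, diff = tensor_diff R X m\<rparr>"

definition tensor_map ::
    "'k ring \<Rightarrow> ('k, 'b) cx \<Rightarrow> (int \<Rightarrow> 'a \<Rightarrow> 'b) \<Rightarrow> nat \<Rightarrow> int \<Rightarrow>
     ('k, 'a) tensor \<Rightarrow> ('k, 'b) tensor" where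
  "tensor_map R Y f m d =
     tensor_lift R (tensor_module R Y m d)
       (\<lambda>w. pure_tensor R Y (map (\<lambda>(n, x). (n, f n x)) w))"

text \<open>Left action of permutations, moving the letter at position \<open>i\<close> to position \<open>\<sigma> i\<close>, with the
  Koszul sign.\<close>

definition koszul_exponent :: "(nat \<Rightarrow> nat) \<Rightarrow> 'a word \<Rightarrow> int" where
  "koszul_exponent \<sigma> w =
     (\<Sum>(i, j) \<in> {(i, j). i < j \<and> j < length w \<and> \<sigma> j < \<sigma> i}. fst (w ! i) * fst (w ! j))"

definition tensor_perm ::
    "'k ring \<Rightarrow> ('k, 'a) cx \<Rightarrow> nat \<Rightarrow> (nat \<Rightarrow> nat) \<Rightarrow> int \<Rightarrow>
     ('k, 'a) tensor \<Rightarrow> ('k, 'a) tensor" where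
  "tensor_perm R X m \<sigma> d =
     (let N = tensor_module R X m d in
      tensor_lift R N
        (\<lambda>w. signed N (koszul_exponent \<sigma> w)
          (pure_tensor R X (permute_list (Hilbert_Choice.inv \<sigma>) w))))"

text \<open>The concatenation product of a tensor of length \<open>m\<close> and degree \<open>d\<close> with one of length \<open>n\<close>
  and degree \<open>e\<close>.\<close>

definition tensor_concat ::
    "'k ring \<Rightarrow> ('k, 'a) cx \<Rightarrow> nat \<Rightarrow> nat \<Rightarrow> int \<Rightarrow> int \<Rightarrow>
     ('k, 'a) tensor \<Rightarrow> ('k, 'a) tensor \<Rightarrow> ('k, 'a) tensor" where
  "tensor_concat R X m n d e \<xi> \<eta> =
     (let N = tensor_module R X (m + n) (d + e) in
      tensor_lift R N (\<lambda>u. tensor_lift R N (\<lambda>v. pure_tensor R X (u @ v)) \<eta>) \<xi>)"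

section \<open>Props\<close>

text \<open>\<open>ops P m n\<close> is the complex of operations with \<open>m\<close> inputs and \<open>n\<close> outputs. The other
  components take as arguments the arities, then (for the actions) the permutation,
  then the degrees of the elements they are applied to:
  \<^item> \<open>lact P m n \<sigma> p f\<close> and \<open>ract P m n \<sigma> p f\<close> for \<open>f\<close> in \<open>P(m,n)\<close>;
  \<^item> \<open>horiz P k m l n p q f g\<close> for \<open>f\<close> in \<open>P(k,m)\<close> and \<open>g\<close> in \<open>P(l,n)\<close>;
  \<^item> \<open>vert P n k m p q f g\<close> for \<open>f\<close> in \<open>P(k,m)\<close> and \<open>g\<close> in \<open>P(n,k)\<close>.\<close>

record ('k, 'p) prop_data =
  ops :: "nat \<Rightarrow> nat \<Rightarrow> ('k, 'p) cx"
  lact :: "nat \<Rightarrow> nat \<Rightarrow> (nat \<Rightarrow> nat) \<Rightarrow> int \<Rightarrow> 'p \<Rightarrow> 'p"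
  ract :: "nat \<Rightarrow> nat \<Rightarrow> (nat \<Rightarrow> nat) \<Rightarrow> int \<Rightarrow> 'p \<Rightarrow> 'p"
  horiz :: "nat \<Rightarrow> nat \<Rightarrow> nat \<Rightarrow> nat \<Rightarrow> int \<Rightarrow> int \<Rightarrow> 'p \<Rightarrow> 'p \<Rightarrow> 'p"
  vert :: "nat \<Rightarrow> nat \<Rightarrow> nat \<Rightarrow> int \<Rightarrow> int \<Rightarrow> 'p \<Rightarrow> 'p \<Rightarrow> 'p"
  punit :: "nat \<Rightarrow> 'p"

abbreviation ops_in :: "('k, 'p) prop_data \<Rightarrow> nat \<Rightarrow> nat \<Rightarrow> int \<Rightarrow> 'p set" where
  "ops_in P m n p \<equiv> carrier (gr (ops P m n) p)"

definition perms :: "nat \<Rightarrow> (nat \<Rightarrow> nat) set" where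
  "perms n = {\<sigma>. \<sigma> permutes {..<n}}"

definition perm_sum :: "nat \<Rightarrow> (nat \<Rightarrow> nat) \<Rightarrow> (nat \<Rightarrow> nat) \<Rightarrow> nat \<Rightarrow> nat" where
  "perm_sum m \<sigma> \<tau> i = (if i < m then \<sigma> i else \<tau> (i - m) + m)"

definition block_swap :: "nat \<Rightarrow> nat \<Rightarrow> nat \<Rightarrow> nat" where
  "block_swap m n i = (if i < m then i + n else if i < m + n then i - m else i)"

text \<open>A symmetric strict monoidal category enriched in complexes with the natural numbers as
  objects and addition as tensor product on objects. The symmetry isomorphisms are the
  block permutations.\<close>

locale dg_prop =
  fixes R :: "'k ring" and P :: "('k, 'p) prop_data"
  assumes complexes: "chain_complex R (ops P m n)"
    and lact_chain_map: "\<sigma> \<in> perms n \<Longrightarrow> chain_map R (ops P m n) (ops P m n) (lact P m n \<sigma>)"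
    and lact_id: "f \<in> ops_in P m n p \<Longrightarrow> lact P m n id p f = f"
    and lact_comp: "\<lbrakk>\<sigma> \<in> perms n; \<tau> \<in> perms n; f \<in> ops_in P m n p\<rbrakk> \<Longrightarrow>
      lact P m n (\<sigma> \<circ> \<tau>) p f = lact P m n \<sigma> p (lact P m n \<tau> p f)"
    and ract_chain_map: "\<sigma> \<in> perms m \<Longrightarrow> chain_map R (ops P m n) (ops P m n) (ract P m n \<sigma>)"
    and ract_id: "f \<in> ops_in P m n p \<Longrightarrow> ract P m n id p f = f"
    and ract_comp: "\<lbrakk>\<sigma> \<in> perms m; \<tau> \<in> perms m; f \<in> ops_in P m n p\<rbrakk> \<Longrightarrow>
      ract P m n (\<sigma> \<circ> \<tau>) p f = ract P m n \<tau> p (ract P m n \<sigma> p f)"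
    and lact_ract: "\<lbrakk>\<sigma> \<in> perms n; \<tau> \<in> perms m; f \<in> ops_in P m n p\<rbrakk> \<Longrightarrow>
      lact P m n \<sigma> p (ract P m n \<tau> p f) = ract P m n \<tau> p (lact P m n \<sigma> p f)"

    and vert_bilinear: "dg_bilinear R (ops P k m) (ops P n k) (ops P n m) (vert P n k m)"
    and vert_assoc: "\<lbrakk>f \<in> ops_in P k m p; g \<in> ops_in P l k q; h \<in> ops_in P n l r\<rbrakk> \<Longrightarrow>
      vert P n l m (p + q) r (vert P l k m p q f g) h =
      vert P n k m p (q + r) f (vert P n l k q r g h)"
    and unit_closed: "punit P n \<in> ops_in P n n 0"
    and vert_unit_left: "f \<in> ops_in P m n p \<Longrightarrow> vert P m n n 0 p (punit P n) f = f"
    and vert_unit_right: "f \<in> ops_in P m n p \<Longrightarrow> vert P m m n p 0 f (punit P m) = f"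
    and vert_lact: "\<lbrakk>\<sigma> \<in> perms m; f \<in> ops_in P k m p; g \<in> ops_in P n k q\<rbrakk> \<Longrightarrow>
      vert P n k m p q (lact P k m \<sigma> p f) g = lact P n m \<sigma> (p + q) (vert P n k m p q f g)"
    and vert_ract: "\<lbrakk>\<sigma> \<in> perms n; f \<in> ops_in P k m p; g \<in> ops_in P n k q\<rbrakk> \<Longrightarrow>
      vert P n k m p q f (ract P n k \<sigma> q g) = ract P n m \<sigma> (p + q) (vert P n k m p q f g)"
    and vert_balanced: "\<lbrakk>\<sigma> \<in> perms k; f \<in> ops_in P k m p; g \<in> ops_in P n k q\<rbrakk> \<Longrightarrow>
      vert P n k m p q (ract P k m \<sigma> p f) g = vert P n k m p q f (lact P n k \<sigma> q g)"

    and horiz_bilinear: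
      "dg_bilinear R (ops P k m) (ops P l n) (ops P (k + l) (m + n)) (horiz P k m l n)"
    and horiz_assoc: "\<lbrakk>f \<in> ops_in P k m p; g \<in> ops_in P k' m' q; h \<in> ops_in P k'' m'' r\<rbrakk> \<Longrightarrow>
      horiz P (k + k') (m + m') k'' m'' (p + q) r (horiz P k m k' m' p q f g) h =
      horiz P k m (k' + k'') (m' + m'') p (q + r) f (horiz P k' m' k'' m'' q r g h)"
    and horiz_unit_left: "f \<in> ops_in P m n p \<Longrightarrow> horiz P 0 0 m n 0 p (punit P 0) f = f"
    and horiz_unit_right: "f \<in> ops_in P m n p \<Longrightarrow> horiz P m n 0 0 p 0 f (punit P 0) = f"
    and horiz_units: "horiz P m m n n 0 0 (punit P m) (punit P n) = punit P (m + n)"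
    and horiz_lact:
      "\<lbrakk>\<sigma> \<in> perms m; \<tau> \<in> perms n; f \<in> ops_in P k m p; g \<in> ops_in P l n q\<rbrakk> \<Longrightarrow>
      horiz P k m l n p q (lact P k m \<sigma> p f) (lact P l n \<tau> q g) =
      lact P (k + l) (m + n) (perm_sum m \<sigma> \<tau>) (p + q) (horiz P k m l n p q f g)"
    and horiz_ract:
      "\<lbrakk>\<sigma> \<in> perms k; \<tau> \<in> perms l; f \<in> ops_in P k m p; g \<in> ops_in P l n q\<rbrakk> \<Longrightarrow>
      horiz P k m l n p q (ract P k m \<sigma> p f) (ract P l n \<tau> q g) =
      ract P (k + l) (m + n) (perm_sum k \<sigma> \<tau>) (p + q) (horiz P k m l n p q f g)"

    and interchange:
      "\<lbrakk>f \<in> ops_in P k m p; g \<in> ops_in P k' m' q; f' \<in> ops_in P l k r; g' \<in> ops_in P l' k' s\<rbrakk> \<Longrightarrow>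
      vert P (l + l') (k + k') (m + m') (p + q) (r + s)
        (horiz P k m k' m' p q f g) (horiz P l k l' k' r s f' g') =
      signed (gr (ops P (l + l') (m + m')) (p + q + r + s)) (q * r)
        (horiz P l m l' m' (p + r) (q + s) (vert P l k m p r f f') (vert P l' k' m' q s g g'))"
    and symmetry:
      "\<lbrakk>f \<in> ops_in P k m p; g \<in> ops_in P l n q\<rbrakk> \<Longrightarrow>
      lact P (k + l) (n + m) (block_swap m n) (p + q) (horiz P k m l n p q f g) =
      signed (gr (ops P (k + l) (n + m)) (p + q)) (p * q)
        (ract P (k + l) (n + m) (block_swap k l) (p + q) (horiz P l n k m q p g f))"

type_synonym ('p, 'q) prop_map = "nat \<Rightarrow> nat \<Rightarrow> int \<Rightarrow> 'p \<Rightarrow> 'q"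

locale prop_hom =
  fixes R :: "'k ring" and P :: "('k, 'p) prop_data" and Q :: "('k, 'q) prop_data"
    and \<phi> :: "('p, 'q) prop_map"
  assumes hom_chain_map: "chain_map R (ops P m n) (ops Q m n) (\<phi> m n)"
    and hom_lact: "\<lbrakk>\<sigma> \<in> perms n; f \<in> ops_in P m n p\<rbrakk> \<Longrightarrow>
      \<phi> m n p (lact P m n \<sigma> p f) = lact Q m n \<sigma> p (\<phi> m n p f)"
    and hom_ract: "\<lbrakk>\<sigma> \<in> perms m; f \<in> ops_in P m n p\<rbrakk> \<Longrightarrow>
      \<phi> m n p (ract P m n \<sigma> p f) = ract Q m n \<sigma> p (\<phi> m n p f)"
    and hom_horiz: "\<lbrakk>f \<in> ops_in P k m p; g \<in> ops_in P l n q\<rbrakk> \<Longrightarrow>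
      \<phi> (k + l) (m + n) (p + q) (horiz P k m l n p q f g) =
      horiz Q k m l n p q (\<phi> k m p f) (\<phi> l n q g)"
    and hom_vert: "\<lbrakk>f \<in> ops_in P k m p; g \<in> ops_in P n k q\<rbrakk> \<Longrightarrow>
      \<phi> n m (p + q) (vert P n k m p q f g) = vert Q n k m p q (\<phi> k m p f) (\<phi> n k q g)"
    and hom_unit: "\<phi> n n 0 (punit P n) = punit Q n"

text \<open>The initial prop: group rings of the symmetric groups, in degree zero. Since the elements
  are functions on all maps that vanish outside the relevant symmetric group, no case
  distinction on the arities is needed in the operations.\<close>

definition initial_prop :: "'k ring \<Rightarrow> ('k, (nat \<Rightarrow> nat) \<Rightarrow> 'k) prop_data" where
  "initial_prop R =
    \<lparr>ops = (\<lambda>m n. \<lparr>gr = (\<lambda>p. free_module R (if m = n \<and> p = 0 then perms n else {})),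
                   diff = (\<lambda>_ _ _. \<zero>\<^bsub>R\<^esub>)\<rparr>),
     lact = (\<lambda>m n \<sigma> p c \<tau>. c (Hilbert_Choice.inv \<sigma> \<circ> \<tau>)),
     ract = (\<lambda>m n \<sigma> p c \<tau>. c (\<tau> \<circ> Hilbert_Choice.inv \<sigma>)),
     horiz = (\<lambda>k m l n p q c c' \<tau>.
       \<Oplus>\<^bsub>R\<^esub>\<rho> \<in> {\<rho> \<in> perms m \<times> perms n. perm_sum m (fst \<rho>) (snd \<rho>) = \<tau>}.
         c (fst \<rho>) \<otimes>\<^bsub>R\<^esub> c' (snd \<rho>)),
     vert = (\<lambda>n k m p q c c' \<tau>. \<Oplus>\<^bsub>R\<^esub>\<rho> \<in> perms k. c \<rho> \<otimes>\<^bsub>R\<^esub> c' (Hilbert_Choice.inv \<rho> \<circ> \<tau>)),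
     punit = (\<lambda>n. basis_elt R id)\<rparr>"

definition initial_map ::
    "'k ring \<Rightarrow> ('k, 'p) prop_data \<Rightarrow> ((nat \<Rightarrow> nat) \<Rightarrow> 'k, 'p) prop_map" where
  "initial_map R P m n p c =
     (\<Oplus>\<^bsub>gr (ops P m n) p\<^esub>\<sigma> \<in> {\<sigma>. c \<sigma> \<noteq> \<zero>\<^bsub>R\<^esub>}.
        c \<sigma> \<odot>\<^bsub>gr (ops P m n) p\<^esub> lact P m n \<sigma> p (punit P n))"

section \<open>Cofibrant props\<close>

text \<open>The three categories in which the homotopy theory of props is considered, and the arities
  that count for weak equivalences and fibrations in each of them.\<close>

datatype prop_category = All_Props | Nonempty_Inputs | Nonempty_Outputs

fun counted_arities :: "prop_category \<Rightarrow> (nat \<times> nat) set" where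
  "counted_arities All_Props = UNIV"
| "counted_arities Nonempty_Inputs = {(m, n). m \<noteq> 0}"
| "counted_arities Nonempty_Outputs = {(m, n). n \<noteq> 0}"

definition zero_cx :: "('k, 'a) cx \<Rightarrow> bool" where
  "zero_cx X \<longleftrightarrow> (\<forall>d. carrier (gr X d) = {\<zero>\<^bsub>gr X d\<^esub>})"

text \<open>The unit morphism from the ground ring to $P(0,0)$ is an isomorphism.\<close>

definition unital_at_0 :: "'k ring \<Rightarrow> ('k, 'p) prop_data \<Rightarrow> bool" where
  "unital_at_0 R P \<longleftrightarrow>
     bij_betw (\<lambda>a. a \<odot>\<^bsub>gr (ops P 0 0) 0\<^esub> punit P 0) (carrier R) (ops_in P 0 0 0) \<and>
     (\<forall>d. d \<noteq> 0 \<longrightarrow> ops_in P 0 0 d = {\<zero>\<^bsub>gr (ops P 0 0) d\<^esub>})"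

fun in_category :: "'k ring \<Rightarrow> prop_category \<Rightarrow> ('k, 'p) prop_data \<Rightarrow> bool" where
  "in_category R All_Props P \<longleftrightarrow> dg_prop R P"
| "in_category R Nonempty_Inputs P \<longleftrightarrow>
     dg_prop R P \<and> unital_at_0 R P \<and> (\<forall>n. n \<noteq> 0 \<longrightarrow> zero_cx (ops P 0 n))"
| "in_category R Nonempty_Outputs P \<longleftrightarrow>
     dg_prop R P \<and> unital_at_0 R P \<and> (\<forall>m. m \<noteq> 0 \<longrightarrow> zero_cx (ops P m 0))"

definition acyclic_fibration ::
    "prop_category \<Rightarrow> ('k, 'p) prop_data \<Rightarrow> ('k, 'q) prop_data \<Rightarrow> ('p, 'q) prop_map \<Rightarrow> bool" where
  "acyclic_fibration \<C> X Y \<pi> \<longleftrightarrow> (\<forall>(m, n) \<in> counted_arities \<C>.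
     quasi_iso (ops X m n) (ops Y m n) (\<pi> m n) \<and> cx_fibration (ops X m n) (ops Y m n) (\<pi> m n))"

text \<open>Cofibrations are defined by the left lifting property with respect to the acyclic
  fibrations between props whose elements live in a type \<open>'u\<close>, which plays the role of a
  universe.\<close>

definition cofibration ::
    "'u itself \<Rightarrow> 'k ring \<Rightarrow> prop_category \<Rightarrow> ('k, 'p) prop_data \<Rightarrow> ('k, 'q) prop_data \<Rightarrow>
     ('p, 'q) prop_map \<Rightarrow> bool" where
  "cofibration U R \<C> P Q i \<longleftrightarrow> prop_hom R P Q i \<and>
     (\<forall>(X :: ('k, 'u) prop_data) (Y :: ('k, 'u) prop_data) \<pi> \<alpha> \<beta>.
        in_category R \<C> X \<longrightarrow> in_category R \<C> Y \<longrightarrow>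
        prop_hom R X Y \<pi> \<longrightarrow> acyclic_fibration \<C> X Y \<pi> \<longrightarrow>
        prop_hom R P X \<alpha> \<longrightarrow> prop_hom R Q Y \<beta> \<longrightarrow>
        (\<forall>m n p. \<forall>f \<in> ops_in P m n p. \<pi> m n p (\<alpha> m n p f) = \<beta> m n p (i m n p f)) \<longrightarrow>
        (\<exists>\<gamma>. prop_hom R Q X \<gamma> \<and>
           (\<forall>m n p. \<forall>f \<in> ops_in P m n p. \<gamma> m n p (i m n p f) = \<alpha> m n p f) \<and>
           (\<forall>m n p. \<forall>f \<in> ops_in Q m n p. \<pi> m n p (\<gamma> m n p f) = \<beta> m n p f)))"

definition cofibrant ::
    "'u itself \<Rightarrow> 'k ring \<Rightarrow> prop_category \<Rightarrow> ('k, 'p) prop_data \<Rightarrow> bool" where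
  "cofibrant U R \<C> P \<longleftrightarrow>
     in_category R \<C> P \<and> cofibration U R \<C> (initial_prop R) P (initial_map R P)"

section \<open>Algebras over a prop\<close>

type_synonym ('k, 'a) endo = "int \<Rightarrow> ('k, 'a) tensor \<Rightarrow> ('k, 'a) tensor"

definition End_prop :: "'k ring \<Rightarrow> ('k, 'a) cx \<Rightarrow> ('k, ('k, 'a) endo) prop_data" where
  "End_prop R X =
    \<lparr>ops = (\<lambda>m n. hom_cx R (tensor_power R X m) (tensor_power R X n)),
     lact = (\<lambda>m n \<sigma> p f d. \<lambda>\<xi> \<in> carrier (tensor_module R X m d).
       tensor_perm R X n \<sigma> (d + p) (f d \<xi>)),
     ract = (\<lambda>m n \<sigma> p f d. \<lambda>\<xi> \<in> carrier (tensor_module R X m d).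
       f d (tensor_perm R X m \<sigma> d \<xi>)),
     horiz = (\<lambda>k m l n p q f g d. \<lambda>\<xi> \<in> carrier (tensor_module R X (k + l) d).
       (let N = tensor_module R X (m + n) (d + p + q) in
        tensor_lift R N (\<lambda>w. let u = take k w; v = drop k w in
          signed N (q * wdeg u)
            (tensor_concat R X m n (wdeg u + p) (wdeg v + q)
              (f (wdeg u) (pure_tensor R X u)) (g (wdeg v) (pure_tensor R X v)))) \<xi>)),
     vert = (\<lambda>n k m p q f g d. \<lambda>\<xi> \<in> carrier (tensor_module R X n d). f (d + q) (g d \<xi>)),
     punit = (\<lambda>n d. \<lambda>\<xi> \<in> carrier (tensor_module R X n d). \<xi>)\<rparr>"

definition prop_algebra ::
    "'k ring \<Rightarrow> ('k, 'p) prop_data \<Rightarrow> ('k, 'a) cx \<Rightarrow> ('p, ('k, 'a) endo) prop_map \<Rightarrow> bool" where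
  "prop_algebra R P X \<phi> \<longleftrightarrow> chain_complex R X \<and> prop_hom R P (End_prop R X) \<phi>"

definition algebra_hom ::
    "'k ring \<Rightarrow> ('k, 'p) prop_data \<Rightarrow>
     ('k, 'a) cx \<Rightarrow> ('p, ('k, 'a) endo) prop_map \<Rightarrow>
     ('k, 'b) cx \<Rightarrow> ('p, ('k, 'b) endo) prop_map \<Rightarrow> (int \<Rightarrow> 'a \<Rightarrow> 'b) \<Rightarrow> bool" where
  "algebra_hom R P X \<phi> Y \<psi> f \<longleftrightarrow> chain_map R X Y f \<and>
     (\<forall>m n p. \<forall>a \<in> ops_in P m n p. \<forall>d. \<forall>\<xi> \<in> carrier (tensor_module R X m d).
        tensor_map R Y f n (d + p) (\<phi> m n p a d \<xi>) =
        \<psi> m n p a d (tensor_map R Y f m d \<xi>))"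

definition algebra_weq ::
    "'k ring \<Rightarrow> ('k, 'p) prop_data \<Rightarrow>
     ('k, 'a) cx \<Rightarrow> ('p, ('k, 'a) endo) prop_map \<Rightarrow>
     ('k, 'b) cx \<Rightarrow> ('p, ('k, 'b) endo) prop_map \<Rightarrow> (int \<Rightarrow> 'a \<Rightarrow> 'b) \<Rightarrow> bool" where
  "algebra_weq R P X \<phi> Y \<psi> f \<longleftrightarrow> algebra_hom R P X \<phi> Y \<psi> f \<and> quasi_iso X Y f"

text \<open>\<open>'a roomy\<close> holds finite and infinite tuples of elements of a complex with elements in \<open>'a\<close> and
  of its homology. \<open>('k, 'a, 'p) universe\<close> is infinite, at least as large as \<open>'k\<close> and \<open>'p\<close>,
  and has room for the elements of the endomorphism props of complexes with
  elements in \<open>'a\<close>, \<open>'a set\<close> or \<open>'a roomy\<close> and for those of their products. Restricting the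
  test props of \<open>cofibration\<close> to this type makes cofibrancy, used as a hypothesis, at most weaker
  than cofibrancy with respect to props of all sizes.\<close>

type_synonym 'a roomy = "nat \<Rightarrow> 'a set"

type_synonym ('k, 'a, 'p) universe =
  "'p \<times> ('k, 'a) endo \<times> ('k, 'a set) endo \<times> (nat \<Rightarrow> ('k, 'a roomy) endo)"

end

theory Submission
  imports Defs
begin

text \<open>Projectivity of \<open>A\<close> and of its homology \<open>H\<close> makes \<open>H\<close> a deformation retract of \<open>A\<close>. A mapping
  cylinder \<open>Y\<close> of the retraction then carries a surjective quasi-isomorphism \<open>q : Y \<rightarrow> H\<close> and a
  quasi-isomorphism \<open>p : Y \<rightarrow> A\<close>, both with chain sections \<open>j\<close> and \<open>t\<close>. The triples \<open>(f, h, y)\<close> of an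
  operation \<open>f\<close> of \<open>P\<close> and operations \<open>h\<close> on \<open>H\<close> and \<open>y\<close> on \<open>Y\<close> with \<open>q y = h q\<close> and \<open>p y = \<phi>(f) p\<close> form
  a prop. Its projection to \<open>P\<close> is an acyclic fibration: over \<open>f\<close> one starts from \<open>y = t \<phi>(f) p\<close> and
  adds a boundary to make \<open>q y\<close> factor through \<open>q\<close>, which does not disturb \<open>p y\<close> because \<open>q\<close> has a linear section
  killed by \<open>p\<close> in positive degrees. As \<open>P\<close> is cofibrant, this projection has a section, that is,
  there are actions on \<open>H\<close> and \<open>Y\<close> for which \<open>q\<close> and \<open>p\<close> are morphisms of algebras. The third object
  of the zigzag is a copy of \<open>H\<close> with elements in the type of those of \<open>Y\<close>.\<close>

text \<open>Relating \<open>A\<close> and \<open>H\<close> directly by the retraction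
  \<open>r\<close> fails: an operation on \<open>A\<close> need not descend along \<open>r\<close>,
  and a boundary added to make it descend changes the prescribed operation on \<open>A\<close>. The
  cylinder makes room for the correction. It is \<open>A\<close> plus a contractible summand which
  \<open>p\<close> forgets and which \<open>q\<close> maps onto \<open>H\<close> in positive
  degrees. In degree zero there is no such room, because complexes vanish below zero; this does no
  harm, as the section of \<open>q\<close> that \<open>p\<close> kills only matters in positive
  degrees.

  Cofibrancy only speaks about test props that have elements in the type \<open>universe\<close> and
  lie in the given category. Hence a copy of \<open>P\<close> in that type takes the place of
  \<open>P\<close> as base of the acyclic fibration, and the triples are cut down so that they stay
  in the category.

  The map \<open>q\<close> points from \<open>Y\<close> to \<open>H\<close>, against the first arrow
  of the zigzag. The copy of \<open>H\<close> provides that arrow: \<open>H\<close> maps to it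
  isomorphically, and \<open>Y\<close> maps to it through \<open>q\<close>.\<close>

abbreviation mem_carrier (infix ":>" 50) where "x :> M \<equiv> x \<in> carrier M"
abbreviation module_add ("(_ +[_]/ _)" [65, 0, 66] 65) where "x +[M] y \<equiv> x \<oplus>\<^bsub>M\<^esub> y"
abbreviation module_minus ("(_ -[_]/ _)" [65, 0, 66] 65) where "x -[M] y \<equiv> x \<ominus>\<^bsub>M\<^esub> y"
abbreviation module_neg ("-[_] _" [0, 81] 80) where "-[M] x \<equiv> \<ominus>\<^bsub>M\<^esub> x"
abbreviation module_smult ("(_ *[_]/ _)" [70, 0, 71] 70) where "a *[M] x \<equiv> a \<odot>\<^bsub>M\<^esub> x"
abbreviation module_coset ("(_ +>[_]/ _)" [61, 0, 62] 61) where "N +>[M] x \<equiv> N +>\<^bsub>M\<^esub> x"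
abbreviation module_zero ("0[_]") where "0[M] \<equiv> \<zero>\<^bsub>M\<^esub>"

lemma (in abelian_group) minus_zero': "\<ominus> \<zero> = \<zero>"
  by (metis r_zero r_neg2 zero_closed a_inv_closed)

text \<open>Rules that let the \<open>algebra\<close> method normalise terms in an additive group
  alone, as is needed for elements of a module, which have no product.\<close>

lemmas (in abelian_group) [algebra agroup "zero G" "add G" "a_inv G" "a_minus G"] =
  a_closed zero_closed a_inv_closed minus_closed
  a_assoc l_zero l_neg a_comm minus_eq
  r_zero r_neg r_neg2 r_neg1 minus_add minus_minus minus_zero' a_lcomm

locale ground_ring = cring R for R :: "'k ring" (structure)
begin

abbreviation "Lin \<equiv> linear_maps R"
abbreviation "Tens \<equiv> tensor_module R"
abbreviation "Pure \<equiv> pure_tensor R"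
abbreviation "tcat \<equiv> tensor_concat R"
abbreviation "tdiff \<equiv> tensor_diff R"
abbreviation "tmap \<equiv> tensor_map R"
abbreviation "tpow \<equiv> tensor_power R"
abbreviation "Hom \<equiv> hom_cx R"
abbreviation "End \<equiv> End_prop R"
abbreviation "cplx \<equiv> chain_complex R"
abbreviation "cmap \<equiv> chain_map R"
abbreviation "tlift \<equiv> tensor_lift R"
abbreviation "FreeM \<equiv> free_module R"
abbreviation "basis \<equiv> basis_elt R"
abbreviation "init \<equiv> initial_prop R"
abbreviation "tperm \<equiv> tensor_perm R"

subsection \<open>Linear maps\<close>

lemma mod_abelian_group: "module R M \<Longrightarrow> abelian_group M"
  by (simp add: module_def)

lemmas mod_abelian_monoid = abelian_group.axioms(1)[OF mod_abelian_group]
text \<open>Module laws with \<open>module R M\<close> as an explicit premise. The modules in play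
  are mostly the degrees \<open>gr X n\<close> of a complex, with several values of \<open>n\<close>
  in one formula, so a locale interpretation for each of them would be clumsy.\<close>

lemmas mod_zero_closed [simp, intro] = abelian_monoid.zero_closed[OF mod_abelian_monoid]
  and mod_add_closed [simp, intro] = abelian_monoid.a_closed[OF mod_abelian_monoid]
  and mod_neg_closed [simp, intro] = abelian_group.a_inv_closed[OF mod_abelian_group]
  and mod_minus_closed [simp, intro] = abelian_group.minus_closed[OF mod_abelian_group]
  and mod_smult_closed [simp, intro] = module.smult_closed[of R]
  and mod_l_zero [simp] = abelian_monoid.l_zero[OF mod_abelian_monoid]
  and mod_r_zero [simp] = abelian_monoid.r_zero[OF mod_abelian_monoid]
  and mod_neg_zero [simp] = abelian_group.minus_zero'[OF mod_abelian_group]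
  and mod_neg_neg [simp] = abelian_group.minus_minus[OF mod_abelian_group]
  and mod_smult_zero [simp] = module.smult_r_null[of R]
  and mod_zero_smult [simp] = module.smult_l_null[of R]
  and mod_one_smult [simp] = module.smult_one[of R]
  and mod_smult_neg = module.smult_r_minus[of R]
  and mod_neg_smult = module.smult_l_minus[of R]
  and mod_smult_add = module.smult_r_distr[of R]
  and mod_add_smult = module.smult_l_distr[of R]
  and mod_mult_smult = module.smult_assoc1[of R]

lemma mod_assoc: "\<lbrakk>module R M; x :> M; y :> M; z :> M\<rbrakk> \<Longrightarrow>
    x +[M] y +[M] z = x +[M] (y +[M] z)"
  by (rule abelian_monoid.a_assoc[OF abelian_group.axioms(1)[OF mod_abelian_group]])

lemma mod_minus_eq_zero_iff:
  assumes M: "module R M" and "x :> M" "y :> M"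
  shows "x -[M] y = 0[M] \<longleftrightarrow> x = y"
proof -
  interpret M: module R M by (rule M)
  have "x = (x -[M] y) +[M] y" using assms(2,3) by algebra
  moreover have "y -[M] y = 0[M]" using assms(3) by algebra
  ultimately show ?thesis using assms(2,3) M by auto
qed

lemma lin_closed [intro]: "f \<in> Lin M N \<Longrightarrow> x :> M \<Longrightarrow> f x :> N"
  by (auto simp: linear_maps_def)

lemma lin_add: "\<lbrakk>f \<in> Lin M N; x :> M; y :> M\<rbrakk> \<Longrightarrow>
    f (x +[M] y) = f x +[N] f y"
  by (auto simp: linear_maps_def)

lemma lin_smult: "\<lbrakk>f \<in> Lin M N; a :> R; x :> M\<rbrakk> \<Longrightarrow>
    f (a *[M] x) = a *[N] f x"
  by (auto simp: linear_maps_def)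

lemma linI:
  assumes "\<And>x. x :> M \<Longrightarrow> f x :> N"
    and "\<And>x y. \<lbrakk>x :> M; y :> M\<rbrakk> \<Longrightarrow> f (x +[M] y) = f x +[N] f y"
    and "\<And>a x. \<lbrakk>a :> R; x :> M\<rbrakk> \<Longrightarrow> f (a *[M] x) = a *[N] f x"
  shows "f \<in> Lin M N"
  using assms by (auto simp: linear_maps_def)

text \<open>Homogeneity for the scalar zero gives this without any cancellation in
  \<open>N\<close>.\<close>

lemma lin_zero:
  assumes "module R M" "module R N" "f \<in> Lin M N"
  shows "f 0[M] = 0[N]"
  using lin_smult[OF assms(3), of \<zero> "0[M]"] lin_closed[OF assms(3), of "0[M]"] assms(1,2) by simp

lemma lin_neg:
  assumes "module R M" "module R N" "f \<in> Lin M N" "x :> M"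
  shows "f (-[M] x) = -[N] f x"
  using lin_smult[OF assms(3), of "\<ominus> \<one>" x] lin_closed[OF assms(3), of x] assms
  by (simp add: mod_neg_smult)

lemma lin_minus:
  assumes "module R M" "module R N" "f \<in> Lin M N" "x :> M" "y :> M"
  shows "f (x -[M] y) = f x -[N] f y"
  using assms by (simp add: a_minus_def lin_add lin_neg)

lemma lin_cong: "\<lbrakk>f \<in> Lin M N; \<And>x. x :> M \<Longrightarrow> g x = f x; module R M\<rbrakk> \<Longrightarrow>
    g \<in> Lin M N"
  by (auto intro!: linI simp: lin_add lin_smult lin_closed)

lemma lin_comp: "\<lbrakk>f \<in> Lin M N; g \<in> Lin N L\<rbrakk> \<Longrightarrow>
    (\<lambda>x. g (f x)) \<in> Lin M L"
  by (auto intro!: linI simp: lin_add lin_smult lin_closed)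

lemma lin_id: "(\<lambda>x. x) \<in> Lin M M"
  by (auto intro!: linI)

lemma lin_zerof: "module R N \<Longrightarrow> (\<lambda>x. 0[N]) \<in> Lin M N"
  by (auto intro!: linI)

lemma lin_addf:
  assumes N: "module R N" and f: "f \<in> Lin M N" and g: "g \<in> Lin M N"
  shows "(\<lambda>x. f x +[N] g x) \<in> Lin M N"
proof -
  interpret N: module R N by fact
  show ?thesis
    using lin_closed[OF f] lin_closed[OF g] f g
    by (auto intro!: linI simp: lin_add lin_smult N.M.a_ac N.smult_r_distr)
qed

lemma lin_negf:
  assumes N: "module R N" and f: "f \<in> Lin M N"
  shows "(\<lambda>x. -[N] f x) \<in> Lin M N"
proof -
  interpret N: module R N by fact
  show ?thesis
    using lin_closed[OF f] f
    by (auto intro!: linI simp: lin_add lin_smult N.M.a_ac N.M.minus_add N.smult_r_minus)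
qed

lemma lin_minusf:
  assumes "module R N" "f \<in> Lin M N" "g \<in> Lin M N"
  shows "(\<lambda>x. f x -[N] g x) \<in> Lin M N"
  unfolding a_minus_def using assms by (intro lin_addf lin_negf)

lemma lin_smultf:
  assumes N: "module R N" and f: "f \<in> Lin M N" and b: "b :> R"
  shows "(\<lambda>x. b *[N] f x) \<in> Lin M N"
proof -
  interpret N: module R N by fact
  show ?thesis
    using lin_closed[OF f] f b
    by (auto intro!: linI simp: lin_add lin_smult N.smult_r_distr N.smult_assoc1[symmetric] m_comm)
qed

lemma mod_finsum_closed: "\<lbrakk>module R M; \<And>i. i \<in> I \<Longrightarrow> g i :> M\<rbrakk> \<Longrightarrow>
    (\<Oplus>\<^bsub>M\<^esub>i\<in>I. g i) :> M"
proof -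
  assume "module R M" "\<And>i. i \<in> I \<Longrightarrow> g i :> M"
  then interpret M: module R M by simp
  show ?thesis using \<open>\<And>i. i \<in> I \<Longrightarrow> g i :> M\<close> by (intro M.M.finsum_closed) auto
qed

lemma lin_finsum:
  assumes M: "module R M" and N: "module R N" and f: "f \<in> Lin M N"
    and fin: "finite I" and g: "\<And>i. i \<in> I \<Longrightarrow> g i :> M"
  shows "f (\<Oplus>\<^bsub>M\<^esub>i\<in>I. g i) = (\<Oplus>\<^bsub>N\<^esub>i\<in>I. f (g i))"
proof -
  interpret M: module R M by fact
  interpret N: module R N by fact
  show ?thesis using fin g
  proof (induction I)
    case empty
    then show ?case by (simp add: lin_zero[OF M N f])
  next
    case (insert i I)
    have "g \<in> I \<rightarrow> carrier M" "(\<lambda>i. f (g i)) \<in> I \<rightarrow> carrier N"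
      using insert.prems lin_closed[OF f] by auto
    then show ?case using insert lin_closed[OF f]
      by (simp add: lin_add[OF f])
  qed
qed

lemma lin_finsumf:
  assumes M: "module R M" and N: "module R N" and f: "\<And>i. i \<in> I \<Longrightarrow> f i \<in> Lin M N"
    and fin: "finite I"
  shows "(\<lambda>x. \<Oplus>\<^bsub>N\<^esub>i\<in>I. f i x) \<in> Lin M N"
  using fin f
proof (induction I)
  case empty
  interpret N: module R N by fact
  show ?case by (simp add: lin_zerof[OF N])
next
  case (insert i I)
  interpret N: module R N by fact
  have "(\<lambda>x. f i x +[N] (\<Oplus>\<^bsub>N\<^esub>i\<in>I. f i x)) \<in> Lin M N"
    using insert by (intro lin_addf N) auto
  then show ?case
    by (rule lin_cong) (use insert M lin_closed in \<open>auto intro!: N.M.finsum_insert\<close>)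
qed

lemma finsum_cong_mod:
  assumes "module R N" "\<And>i. i \<in> I \<Longrightarrow> f i = g i" "\<And>i. i \<in> I \<Longrightarrow> g i :> N"
  shows "(\<Oplus>\<^bsub>N\<^esub>i\<in>I. f i) = (\<Oplus>\<^bsub>N\<^esub>i\<in>I. g i)"
proof -
  interpret N: module R N by fact
  show ?thesis using assms by (intro N.M.finsum_cong') auto
qed

subsection \<open>Signs\<close>

lemma signed_closed [simp, intro]: "\<lbrakk>module R M; x :> M\<rbrakk> \<Longrightarrow> signed M e x :> M"
  by (simp add: signed_def)

lemma signed_lin: "module R M \<Longrightarrow> signed M e \<in> Lin M M"
  using lin_id[of M] lin_negf[OF _ lin_id, of M] by (cases "even e") (simp_all add: signed_def[abs_def])

lemma signed_linf: "\<lbrakk>module R N; f \<in> Lin M N\<rbrakk> \<Longrightarrow> (\<lambda>x. signed N e (f x)) \<in> Lin M N"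
  by (erule lin_comp) (rule signed_lin)

lemma signed_zero [simp]: "module R M \<Longrightarrow> signed M e 0[M] = 0[M]"
  by (simp add: signed_def)

lemma signed_signed: "\<lbrakk>module R M; x :> M\<rbrakk> \<Longrightarrow> signed M a (signed M b x) = signed M (a + b) x"
  by (auto simp: signed_def)

text \<open>Only the parity of an exponent matters; comparisons of signs below mostly end in this
  rule or in a case split on parities.\<close>

lemma signed_cong: "even a = even b \<Longrightarrow> signed M a x = signed M b x"
  by (simp add: signed_def)

lemma signed_0 [simp]: "signed M 0 x = x"
  by (simp add: signed_def)

lemma lin_signed: "\<lbrakk>module R M; module R N; f \<in> Lin M N; x :> M\<rbrakk> \<Longrightarrow>
    f (signed M e x) = signed N e (f x)"
  by (simp add: signed_def lin_neg)

subsection \<open>Quotients\<close>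

lemma submodule_abelian_subgroup: "\<lbrakk>module R M; submodule N R M\<rbrakk> \<Longrightarrow> abelian_subgroup N M"
  by (simp add: abelian_subgroupI3 additive_subgroup_def mod_abelian_group submodule_def)

lemma submodule_subset: "submodule N R M \<Longrightarrow> N \<subseteq> carrier M"
  using subgroup.subset[of N "add_monoid M"] by (simp add: submodule_def)

context
  fixes M :: "('k, 'a) module" and N :: "'a set"
  assumes M: "module R M" and N: "submodule N R M"
begin

lemma coset_eq_iff: "\<lbrakk>x :> M; y :> M\<rbrakk> \<Longrightarrow>
    N +>[M] x = N +>[M] y \<longleftrightarrow> x -[M] y \<in> N"
proof -
  interpret abelian_subgroup N M by (rule submodule_abelian_subgroup[OF M N])
  assume "x :> M" "y :> M"
  then show ?thesis
    by (metis a_rcos_module a_repr_independence' a_repr_independenceD a_minus_def)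
qed

lemma coset_self: "x :> M \<Longrightarrow> x \<in> N +>[M] x"
  by (rule abelian_subgroup.a_rcos_self[OF submodule_abelian_subgroup[OF M N]])

lemma coset_mem: "\<lbrakk>x :> M; y \<in> N +>[M] x\<rbrakk> \<Longrightarrow> y :> M \<and> N +>[M] y = N +>[M] x"
proof -
  interpret abelian_subgroup N M by (rule submodule_abelian_subgroup[OF M N])
  assume "x :> M" "y \<in> N +>[M] x"
  then show ?thesis
    using a_elemrcos_carrier a_repr_independence' by blast
qed

lemma quotient_carrier: "carrier (quotient_module M N) = (\<lambda>x. N +>[M] x) ` carrier M"
  by (auto simp: quotient_module_def A_RCOSETS_def' a_r_coset_def')

lemma quotient_add: "\<lbrakk>x :> M; y :> M\<rbrakk> \<Longrightarrow>
    (N +>[M] x) +[quotient_module M N] (N +>[M] y) = N +>[M] (x +[M] y)"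
  using abelian_subgroup.a_rcos_sum[OF submodule_abelian_subgroup[OF M N]]
  by (simp add: quotient_module_def)

lemma quotient_smult:
  assumes "a :> R" "x :> M"
  shows "a *[quotient_module M N] (N +>[M] x) = N +>[M] (a *[M] x)"
proof -
  have "N +>[M] (a *[M] y) = N +>[M] (a *[M] x)" if "y \<in> N +>[M] x" for y
  proof -
    have y: "y :> M" "y -[M] x \<in> N"
      using coset_mem[OF assms(2) that] assms coset_eq_iff by auto
    have "a *[M] (y -[M] x) \<in> N"
      using N assms(1) y(2) by (rule submodule.smult_closed)
    then have "a *[M] y -[M] a *[M] x \<in> N"
      using assms y(1) M by (simp add: a_minus_def mod_smult_add mod_smult_neg)
    then show ?thesis
      using assms y(1) M by (intro coset_eq_iff[THEN iffD2] mod_smult_closed)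
  qed
  then have "(\<Union>y\<in>N +>[M] x. N +>[M] (a *[M] y)) = N +>[M] (a *[M] x)"
    using coset_self[OF assms(2)] by blast
  then show ?thesis by (simp add: quotient_module_def)
qed

lemma quotient_zero: "0[quotient_module M N] = N +>[M] 0[M]"
  using abelian_group.a_coset_add_zero[OF mod_abelian_group[OF M] submodule_subset[OF N]]
  by (simp add: quotient_module_def)

lemma quotient_cases:
  assumes "\<xi> :> quotient_module M N"
  obtains x where "x :> M" "\<xi> = N +>[M] x"
  using assms by (auto simp: quotient_carrier)

lemma coset_closed: "x :> M \<Longrightarrow> N +>[M] x :> quotient_module M N"
  by (simp add: quotient_carrier)

lemma quotient_module: "module R (quotient_module M N)"
proof (intro moduleI abelian_groupI)
  interpret M: module R M by (rule M)
  let ?Q = "quotient_module M N"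
  note Q = quotient_add quotient_zero quotient_smult coset_closed
  show "cring R" ..
  show "0[?Q] :> ?Q" by (simp add: Q)
  fix x assume "x :> ?Q"
  then obtain x' where x': "x' :> M" and x: "x = N +>[M] x'" by (rule quotient_cases)
  show "0[?Q] +[?Q] x = x" "\<one> *[?Q] x = x" using x' by (simp_all add: x Q)
  show "\<exists>y\<in>carrier ?Q. y +[?Q] x = 0[?Q]"
    using x' by (intro bexI[of _ "N +>[M] -[M] x'"]) (simp_all add: x Q M.M.l_neg)
  fix a assume a: "a :> R"
  show "a *[?Q] x :> ?Q" using x' a by (simp add: x Q)
  { fix b assume b: "b :> R"
    show "(a \<oplus> b) *[?Q] x = a *[?Q] x +[?Q] b *[?Q] x"
      "a \<otimes> b *[?Q] x = a *[?Q] (b *[?Q] x)"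
      using x' a b by (simp_all add: x Q M.smult_l_distr M.smult_assoc1) }
  fix y assume "y :> ?Q"
  then obtain y' where y': "y' :> M" and y: "y = N +>[M] y'" by (rule quotient_cases)
  show "a *[?Q] (x +[?Q] y) = a *[?Q] x +[?Q] a *[?Q] y"
    using x' y' a by (simp add: x y Q M.smult_r_distr)
next
  interpret M: module R M by (rule M)
  let ?Q = "quotient_module M N"
  note Q = quotient_add quotient_zero quotient_smult coset_closed
  fix x y assume "x :> ?Q" "y :> ?Q"
  then obtain x' y' where x': "x' :> M" and x: "x = N +>[M] x'"
    and y': "y' :> M" and y: "y = N +>[M] y'" by (meson quotient_cases)
  show "x +[?Q] y :> ?Q" "x +[?Q] y = y +[?Q] x"
    using x' y' by (simp_all add: x y Q M.M.a_comm)
  fix z assume "z :> ?Q"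
  then obtain z' where z': "z' :> M" and z: "z = N +>[M] z'" by (rule quotient_cases)
  show "x +[?Q] y +[?Q] z = x +[?Q] (y +[?Q] z)"
    using x' y' z' by (simp add: x y z Q M.M.a_assoc)
qed

lemma coset_lin: "(\<lambda>x. N +>[M] x) \<in> Lin M (quotient_module M N)"
  by (intro linI) (simp_all add: coset_closed quotient_add quotient_smult)

text \<open>A linear map that kills \<open>N\<close> is constant on cosets, so the image of a coset
  is a singleton. This is what justifies \<open>the_elem\<close> in
  \<open>tensor_lift\<close>.\<close>

lemma quotient_lift_eq:
  assumes L: "module R L" and f: "f \<in> Lin M L" and z: "\<And>x. x \<in> N \<Longrightarrow> f x = 0[L]"
    and x: "x :> M"
  shows "the_elem (f ` (N +>[M] x)) = f x"
proof -
  interpret L: module R L by (rule L)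
  have "f y = f x" if "y \<in> N +>[M] x" for y
  proof -
    have y: "y :> M" "y -[M] x \<in> N"
      using coset_mem[OF x that] x coset_eq_iff by auto
    have "f y -[L] f x = 0[L]"
      using z[OF y(2)] lin_minus[OF M L f y(1) x] by simp
    then show ?thesis
      using mod_minus_eq_zero_iff[OF L lin_closed[OF f y(1)] lin_closed[OF f x]] by simp
  qed
  then have "f ` (N +>[M] x) = {f x}" using coset_self[OF x] by blast
  then show ?thesis by simp
qed

lemma quotient_lift_lin:
  assumes L: "module R L" and f: "f \<in> Lin M L" and z: "\<And>x. x \<in> N \<Longrightarrow> f x = 0[L]"
  shows "(\<lambda>\<xi>. the_elem (f ` \<xi>)) \<in> Lin (quotient_module M N) L"
proof (intro linI)
  note E = quotient_lift_eq[OF L f z]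
  fix x assume "x :> quotient_module M N"
  then obtain x' where x': "x' :> M" and x: "x = N +>[M] x'" by (rule quotient_cases)
  show "the_elem (f ` x) :> L" using x' lin_closed[OF f] by (simp add: x E)
  { fix a assume "a :> R"
    then show "the_elem (f ` (a *[quotient_module M N] x)) = a *[L] the_elem (f ` x)"
      using x' M by (simp add: x E quotient_smult lin_smult[OF f]) }
  fix y assume "y :> quotient_module M N"
  then obtain y' where y': "y' :> M" and y: "y = N +>[M] y'" by (rule quotient_cases)
  show "the_elem (f ` (x +[quotient_module M N] y)) = the_elem (f ` x) +[L] the_elem (f ` y)"
    using x' y' M by (simp add: x y E quotient_add lin_add[OF f])
qed

end

text \<open>The hull is an intersection of submodules. The whole module is one of the submodules
  containing \<open>S\<close>, which keeps the intersection inside the carrier.\<close>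

lemma submodule_hull:
  assumes M: "module R M" and S: "S \<subseteq> carrier M"
  shows "submodule ((\<lambda>N. submodule N R M) hull S) R M"
proof -
  interpret M: module R M by (rule M)
  have c: "(\<lambda>N. submodule N R M) hull S \<subseteq> carrier M"
    using hull_minimal[of S "carrier M" "\<lambda>N. submodule N R M"] S M.carrier_is_submodule by blast
  show ?thesis
    using c by (intro M.submoduleI)
      (auto simp: hull_def dest: M.submoduleE subgroup.one_closed[OF submodule.axioms(1)])
qed

text \<open>The kernel of \<open>f\<close> is a submodule that contains \<open>S\<close>, hence it
  contains the hull.\<close>

lemma lin_vanish_hull:
  assumes M: "module R M" and L: "module R L" and f: "f \<in> Lin M L"
    and S: "S \<subseteq> carrier M" "\<And>x. x \<in> S \<Longrightarrow> f x = 0[L]"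
    and x: "x \<in> (\<lambda>N. submodule N R M) hull S"
  shows "f x = 0[L]"
proof -
  interpret M: module R M by (rule M)
  have "submodule {x \<in> carrier M. f x = 0[L]} R M"
    using M L by (intro M.submoduleI) (auto simp: lin_zero[OF M L f] lin_neg[OF M L f] lin_add[OF f] lin_smult[OF f])
  then have "(\<lambda>N. submodule N R M) hull S \<subseteq> {x \<in> carrier M. f x = 0[L]}"
    using S by (intro hull_minimal) auto
  then show ?thesis using x by auto
qed

subsection \<open>Free modules\<close>

lemma free_carrierD:
  assumes "c :> FreeM S"
  shows "c s :> R" "s \<notin> S \<Longrightarrow> c s = \<zero>" "finite {s. c s \<noteq> \<zero>}" "{s. c s \<noteq> \<zero>} \<subseteq> S"
  using assms by (auto simp: free_module_def)

lemma free_carrierI: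
  assumes "\<And>s. c s :> R" "\<And>s. s \<notin> S \<Longrightarrow> c s = \<zero>" "finite {s. c s \<noteq> \<zero>}"
  shows "c :> FreeM S"
  using assms by (auto simp: free_module_def)

lemma free_simps: "0[FreeM S] = (\<lambda>_. \<zero>)" "c +[FreeM S] c' = (\<lambda>s. c s \<oplus> c' s)"
  "a *[FreeM S] c = (\<lambda>s. a \<otimes> c s)"
  by (simp_all add: free_module_def)

lemma free_add_closed:
  assumes "c :> FreeM S" "c' :> FreeM S"
  shows "(\<lambda>s. c s \<oplus> c' s) :> FreeM S"
proof (rule free_carrierI)
  have "{s. c s \<oplus> c' s \<noteq> \<zero>} \<subseteq> {s. c s \<noteq> \<zero>} \<union> {s. c' s \<noteq> \<zero>}"
    using free_carrierD(1)[OF assms(1)] by auto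
  then show "finite {s. c s \<oplus> c' s \<noteq> \<zero>}"
    using free_carrierD(3)[OF assms(1)] free_carrierD(3)[OF assms(2)] finite_subset by blast
qed (use assms in \<open>auto simp: free_carrierD(1) free_carrierD(2)[OF assms(1)] free_carrierD(2)[OF assms(2)]\<close>)

lemma free_smult_closed:
  assumes "a :> R" "c :> FreeM S"
  shows "(\<lambda>s. a \<otimes> c s) :> FreeM S"
proof (rule free_carrierI)
  have "{s. a \<otimes> c s \<noteq> \<zero>} \<subseteq> {s. c s \<noteq> \<zero>}"
    using assms by auto
  then show "finite {s. a \<otimes> c s \<noteq> \<zero>}"
    using free_carrierD(3)[OF assms(2)] finite_subset by blast
qed (use assms in \<open>auto dest: free_carrierD\<close>)

lemma free_zero_closed: "(\<lambda>s. \<zero>) :> FreeM S"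
  by (rule free_carrierI) auto

lemma free_module: "module R (FreeM S)"
proof (intro moduleI abelian_groupI)
  fix x assume x: "x :> FreeM S"
  show "\<exists>y\<in>carrier (FreeM S). y +[FreeM S] x = 0[FreeM S]"
    using free_smult_closed[OF _ x, of "\<ominus> \<one>"] free_carrierD(1)[OF x]
    by (intro bexI[of _ "\<lambda>s. \<ominus> \<one> \<otimes> x s"]) (auto simp: free_simps l_minus l_neg)
qed (auto simp: free_simps free_add_closed free_smult_closed free_zero_closed free_carrierD(1)
    a_ac m_assoc l_distr r_distr intro: is_cring)

lemma basis_closed: "s \<in> S \<Longrightarrow> basis s :> FreeM S"
proof (rule free_carrierI)
  have "{t. basis s t \<noteq> \<zero>} \<subseteq> {s}" by (auto simp: basis_elt_def)
  then show "finite {t. basis s t \<noteq> \<zero>}" using finite_subset by blast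
qed (auto simp: basis_elt_def)

text \<open>The linear extension of \<open>g\<close> from a basis. Its body is the very sum that
  occurs in \<open>tensor_lift\<close> and in \<open>initial_map\<close>, so that both become
  instances of it.\<close>

definition free_lift :: "('k, 'b) module \<Rightarrow> ('s \<Rightarrow> 'b) \<Rightarrow> ('s \<Rightarrow> 'k) \<Rightarrow> 'b" where
  "free_lift N g c = (\<Oplus>\<^bsub>N\<^esub>s\<in>{s. c s \<noteq> \<zero>}. c s *[N] g s)"

context
  fixes N :: "('k, 'b) module" and S :: "'s set" and g :: "'s \<Rightarrow> 'b"
  assumes N: "module R N" and g: "\<And>s. s \<in> S \<Longrightarrow> g s :> N"
begin

text \<open>Two elements and their sum have different supports. Adding zero terms lets the three
  sums run over one common finite set.\<close>

lemma free_lift_superset: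
  assumes c: "c :> FreeM S" and T: "finite T" "{s. c s \<noteq> \<zero>} \<subseteq> T" "T \<subseteq> S"
  shows "free_lift N g c = (\<Oplus>\<^bsub>N\<^esub>s\<in>T. c s *[N] g s)"
proof -
  interpret N: module R N by (rule N)
  show ?thesis unfolding free_lift_def
    using T g free_carrierD(1)[OF c] by (intro N.M.add.finprod_mono_neutral_cong_left) auto
qed

lemma free_lift_lin: "free_lift N g \<in> Lin (FreeM S) N"
proof (intro linI)
  interpret N: module R N by (rule N)
  fix c assume c: "c :> FreeM S"
  note c1 = free_carrierD(1)[OF c] and c2 = free_carrierD(3,4)[OF c]
  show "free_lift N g c :> N"
    unfolding free_lift_def using c2(2) g c1 by (intro mod_finsum_closed[OF N]) auto
  { fix a assume a: "a :> R"
    have "free_lift N g (\<lambda>s. a \<otimes> c s) = (\<Oplus>\<^bsub>N\<^esub>s\<in>{s. c s \<noteq> \<zero>}. (a \<otimes> c s) *[N] g s)"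
      using a c1 c2 by (intro free_lift_superset free_smult_closed c) auto
    also have "\<dots> = a *[N] free_lift N g c"
      unfolding free_lift_def using a c1 c2 g
      by (subst N.finsum_smult_ldistr) (auto intro!: finsum_cong_mod N simp: N.smult_assoc1)
    finally show "free_lift N g (a *[FreeM S] c) = a *[N] free_lift N g c"
      by (simp add: free_simps) }
  fix d assume d: "d :> FreeM S"
  note d1 = free_carrierD(1)[OF d] and d2 = free_carrierD(3,4)[OF d]
  let ?T = "{s. c s \<noteq> \<zero>} \<union> {s. d s \<noteq> \<zero>}"
  have T: "finite ?T" "?T \<subseteq> S" using c2 d2 by auto
  have "free_lift N g (\<lambda>s. c s \<oplus> d s) = (\<Oplus>\<^bsub>N\<^esub>s\<in>?T. (c s \<oplus> d s) *[N] g s)"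
    using T c1 d1 by (intro free_lift_superset free_add_closed c d) auto
  also have "\<dots> = (\<Oplus>\<^bsub>N\<^esub>s\<in>?T. c s *[N] g s +[N] d s *[N] g s)"
    using T g c1 d1 by (intro finsum_cong_mod N) (auto simp: N.smult_l_distr)
  also have "\<dots> = (\<Oplus>\<^bsub>N\<^esub>s\<in>?T. c s *[N] g s) +[N] (\<Oplus>\<^bsub>N\<^esub>s\<in>?T. d s *[N] g s)"
    using T g c1 d1 by (intro N.M.finsum_addf) auto
  also have "\<dots> = free_lift N g c +[N] free_lift N g d"
    using T by (subst (1 2) free_lift_superset[where T = ?T]) (auto simp: c d)
  finally show "free_lift N g (c +[FreeM S] d) = free_lift N g c +[N] free_lift N g d"
    by (simp add: free_simps)
qed

lemma free_lift_basis:
  assumes "s \<in> S"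
  shows "free_lift N g (basis s) = g s"
proof -
  interpret N: module R N by (rule N)
  have "free_lift N g (basis s) = (\<Oplus>\<^bsub>N\<^esub>t\<in>{s}. basis s t *[N] g t)"
    using assms by (intro free_lift_superset basis_closed) (auto simp: basis_elt_def)
  then show ?thesis using assms g by (simp add: basis_elt_def)
qed

end

lemma free_expand:
  assumes c: "c :> FreeM S"
  shows "free_lift (FreeM S) (basis) c = c"
proof -
  let ?F = "FreeM S"
  interpret F: module R ?F by (rule free_module)
  \<comment> \<open>The partial sum over \<open>T\<close> is computed by induction: it is
    \<open>c\<close> cut off outside \<open>T\<close>. The support of \<open>c\<close> is then a
    legitimate choice of \<open>T\<close>.\<close>
  have ev: "(\<Oplus>\<^bsub>?F\<^esub>s\<in>T. c s *[?F] basis s) = (\<lambda>t. if t \<in> T then c t else \<zero>)"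
    if "finite T" "T \<subseteq> S" for T
    using that
  proof (induction T)
    case empty
    then show ?case by (simp add: free_simps)
  next
    case (insert s T)
    have cl: "c t *[?F] basis t :> ?F" if "t \<in> S" for t
      using that free_carrierD(1)[OF c] basis_closed free_module by (intro mod_smult_closed) auto
    then have "(\<Oplus>\<^bsub>?F\<^esub>s\<in>insert s T. c s *[?F] basis s) =
      c s *[?F] basis s +[?F] (\<lambda>t. if t \<in> T then c t else \<zero>)"
      using insert by (subst F.M.finsum_insert) auto
    then show ?case
      using insert(2) free_carrierD(1)[OF c] by (auto simp: free_simps basis_elt_def fun_eq_iff)
  qed
  show ?thesis
    unfolding free_lift_def using free_carrierD[OF c] by (subst ev) auto
qed

lemma free_ext:
  assumes N: "module R N" and f: "f \<in> Lin (FreeM S) N"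
    and f': "f' \<in> Lin (FreeM S) N"
    and eq: "\<And>s. s \<in> S \<Longrightarrow> f (basis s) = f' (basis s)"
    and c: "c :> FreeM S"
  shows "f c = f' c"
proof -
  let ?F = "FreeM S" and ?T = "{s. c s \<noteq> \<zero>}"
  have bt: "basis t :> ?F" if "t \<in> ?T" for t
    using that free_carrierD(4)[OF c] by (intro basis_closed) auto
  note c1 = free_carrierD(1)[OF c]
  have "h c = (\<Oplus>\<^bsub>N\<^esub>s\<in>?T. c s *[N] h (basis s))" if h: "h \<in> Lin ?F N" for h
  proof -
    have "h c = h (\<Oplus>\<^bsub>?F\<^esub>s\<in>?T. c s *[?F] basis s)"
      using free_expand[OF c] by (simp add: free_lift_def)
    also have "\<dots> = (\<Oplus>\<^bsub>N\<^esub>s\<in>?T. h (c s *[?F] basis s))"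
      by (rule lin_finsum[OF free_module N h free_carrierD(3)[OF c]])
        (rule mod_smult_closed[OF free_module c1 bt])
    also have "\<dots> = (\<Oplus>\<^bsub>N\<^esub>s\<in>?T. c s *[N] h (basis s))"
      by (intro finsum_cong_mod N mod_smult_closed lin_smult[OF h] c1 bt lin_closed[OF h])
    finally show ?thesis .
  qed
  note exp = this
  have "(\<Oplus>\<^bsub>N\<^esub>s\<in>?T. c s *[N] f (basis s)) = (\<Oplus>\<^bsub>N\<^esub>s\<in>?T. c s *[N] f' (basis s))"
    using eq free_carrierD(4)[OF c]
    by (intro finsum_cong_mod N mod_smult_closed c1 lin_closed[OF f'] bt) (auto intro!: arg_cong2[where f = "smult N"])
  then show ?thesis by (simp only: exp[OF f] exp[OF f'])
qed

text \<open>Preimages under \<open>g\<close> are chosen for the images of the basis elements,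
  extended linearly, and restricted to \<open>M\<close> along its embedding into the free module.
  The assumption compares images instead of asking \<open>g\<close> to be onto, because
  \<open>g\<close> will also be a differential.\<close>

lemma projective_lift:
  fixes M :: "('k, 'a) module"
  assumes P: "projective_module R M" and L: "module R L" and N: "module R N"
    and g: "g \<in> Lin L N" and f: "f \<in> Lin M N"
    and im: "\<And>x. x :> M \<Longrightarrow> f x \<in> g ` carrier L"
  obtains h where "h \<in> Lin M L" "\<And>x. x :> M \<Longrightarrow> g (h x) = f x"
proof -
  obtain S :: "'a set" and i r where i: "i \<in> Lin M (FreeM S)"
    and r: "r \<in> Lin (FreeM S) M" and ri: "\<And>x. x :> M \<Longrightarrow> r (i x) = x"
    using P by (auto simp: projective_module_def)
  let ?F = "FreeM S"
  have "\<forall>s\<in>S. \<exists>y\<in>carrier L. g y = f (r (basis s))"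
    using im[OF lin_closed[OF r basis_closed]] by (metis image_iff)
  then obtain k where k: "\<And>s. s \<in> S \<Longrightarrow> k s :> L" "\<And>s. s \<in> S \<Longrightarrow> g (k s) = f (r (basis s))"
    by metis
  have lift: "free_lift L k \<in> Lin ?F L" by (rule free_lift_lin[OF L k(1)])
  have "g (free_lift L k c) = f (r c)" if "c :> ?F" for c
    by (rule free_ext[OF N lin_comp[OF lift g] lin_comp[OF r f] _ that])
      (simp add: free_lift_basis[OF L k(1)] k(2))
  then show ?thesis
    using lin_comp[OF i lift] lin_closed[OF i] ri by (intro that[of "\<lambda>x. free_lift L k (i x)"]) auto
qed

subsection \<open>Tensor powers\<close>

lemma cx_module [simp]: "cplx X \<Longrightarrow> module R (gr X n)"
  by (rule chain_complex.modules)

lemma words_iff: "w \<in> words X m d \<longleftrightarrow> length w = m \<and> wdeg w = d \<and>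
    (\<forall>i<length w. snd (w ! i) :> gr X (fst (w ! i)))"
  by (auto simp: words_def all_set_conv_all_nth case_prod_unfold)

lemma words_nth: "\<lbrakk>w \<in> words X m d; i < m\<rbrakk> \<Longrightarrow> snd (w ! i) :> gr X (fst (w ! i))"
  by (simp add: words_iff)

lemma words_length: "w \<in> words X m d \<Longrightarrow> length w = m"
  and words_wdeg: "w \<in> words X m d \<Longrightarrow> wdeg w = d"
  by (simp_all add: words_iff)

lemma wdeg_simps [simp]: "wdeg [] = 0" "wdeg (a # w) = fst a + wdeg w" "wdeg (u @ v) = wdeg u + wdeg v"
  by (simp_all add: wdeg_def)

lemma wdeg_update: "i < length w \<Longrightarrow> wdeg (w[i := a]) = wdeg w - fst (w ! i) + fst a"
  by (induction w arbitrary: i) (auto split: nat.split)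

lemma words_update: "\<lbrakk>w \<in> words X m d; i < m; x :> gr X n\<rbrakk> \<Longrightarrow>
    w[i := (n, x)] \<in> words X m (d - fst (w ! i) + n)"
  by (auto simp: words_iff wdeg_update nth_list_update)

lemma words_update_same: "\<lbrakk>w \<in> words X m d; i < m; x :> gr X (fst (w ! i))\<rbrakk> \<Longrightarrow>
    w[i := (fst (w ! i), x)] \<in> words X m d"
  using words_update[of w X m d i x "fst (w ! i)"] by simp

lemma words_append: "\<lbrakk>u \<in> words X m d; v \<in> words X n e\<rbrakk> \<Longrightarrow> u @ v \<in> words X (m + n) (d + e)"
  by (auto simp: words_def)

lemma words_split:
  assumes "w \<in> words X (m + n) d"
  obtains u v where "w = u @ v" "u \<in> words X m (wdeg u)" "v \<in> words X n (wdeg v)" "wdeg u + wdeg v = d"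
proof (rule that)
  show "w = take m w @ drop m w" by simp
  have "set (take m w) \<subseteq> set w" "set (drop m w) \<subseteq> set w" by (auto dest: in_set_takeD in_set_dropD)
  then show "take m w \<in> words X m (wdeg (take m w))" "drop m w \<in> words X n (wdeg (drop m w))"
    using assms by (auto simp: words_def)
  show "wdeg (take m w) + wdeg (drop m w) = d"
    using assms by (metis append_take_drop_id wdeg_simps(3) words_wdeg)
qed

lemma words_Nil: "[] \<in> words X 0 0"
  by (simp add: words_iff)

lemma words_Cons: "(n, x) # w \<in> words X (Suc m) d \<longleftrightarrow> x :> gr X n \<and> w \<in> words X m (d - n)"
  by (auto simp: words_def)

lemma words_singleton: "x :> gr X n \<Longrightarrow> [(n, x)] \<in> words X 1 n"
  by (simp add: words_def)

text \<open>Linearity is tested by overwriting one letter of a word while keeping its degree. This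
  matches the shape of the generators of \<open>tensor_relations\<close>.\<close>

definition multilinear ::
    "('k, 'a) cx \<Rightarrow> nat \<Rightarrow> int \<Rightarrow> ('k, 'b) module \<Rightarrow> ('a word \<Rightarrow> 'b) \<Rightarrow> bool" where
  "multilinear X m d N g \<longleftrightarrow> (\<forall>w \<in> words X m d. g w :> N \<and>
     (\<forall>i<m. (\<lambda>x. g (w[i := (fst (w ! i), x)])) \<in> Lin (gr X (fst (w ! i))) N))"

lemma multilinearI:
  assumes "\<And>w. w \<in> words X m d \<Longrightarrow> g w :> N"
    and "\<And>w i. \<lbrakk>w \<in> words X m d; i < m\<rbrakk> \<Longrightarrow>
      (\<lambda>x. g (w[i := (fst (w ! i), x)])) \<in> Lin (gr X (fst (w ! i))) N"
  shows "multilinear X m d N g"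
  using assms by (simp add: multilinear_def)

lemma multilinear_closed: "\<lbrakk>multilinear X m d N g; w \<in> words X m d\<rbrakk> \<Longrightarrow> g w :> N"
  by (simp add: multilinear_def)

lemma multilinear_lin: "\<lbrakk>multilinear X m d N g; w \<in> words X m d; i < m\<rbrakk> \<Longrightarrow>
    (\<lambda>x. g (w[i := (fst (w ! i), x)])) \<in> Lin (gr X (fst (w ! i))) N"
  by (simp add: multilinear_def)

lemma multilinear_lincomp:
  assumes "multilinear X m d N g" "h \<in> Lin N L"
  shows "multilinear X m d L (\<lambda>w. h (g w))"
  by (rule multilinearI)
    (rule lin_closed[OF assms(2) multilinear_closed[OF assms(1)]] lin_comp[OF multilinear_lin[OF assms(1)] assms(2)]; assumption)+

lemma multilinear_finsum:
  assumes X: "cplx X" and N: "module R N" and fin: "finite I"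
    and g: "\<And>i. i \<in> I \<Longrightarrow> multilinear X m d N (g i)"
  shows "multilinear X m d N (\<lambda>w. \<Oplus>\<^bsub>N\<^esub>i\<in>I. g i w)"
proof (rule multilinearI)
  fix w assume w: "w \<in> words X m d"
  show "(\<Oplus>\<^bsub>N\<^esub>i\<in>I. g i w) :> N"
    by (rule mod_finsum_closed[OF N multilinear_closed[OF g w]])
  fix i assume i: "i < m"
  show "(\<lambda>x. \<Oplus>\<^bsub>N\<^esub>j\<in>I. g j (w[i := (fst (w ! i), x)])) \<in> Lin (gr X (fst (w ! i))) N"
    by (rule lin_finsumf[OF cx_module[OF X] N multilinear_lin[OF g w i] fin])
qed

lemma map_fst_update: "map fst (w[i := (fst (w ! i), x)]) = map fst w"
  by (metis fst_conv list_update_beyond list_update_id map_update not_le_imp_less nth_map)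

text \<open>Signs such as prefix or Koszul signs depend only on the degrees of the letters, and
  these do not change when a letter is overwritten in its degree.\<close>

lemma multilinear_signed:
  assumes N: "module R N" and g: "multilinear X m d N g"
    and e: "\<And>w w'. map fst w = map fst w' \<Longrightarrow> e w = e w'"
  shows "multilinear X m d N (\<lambda>w. signed N (e w) (g w))"
proof (rule multilinearI)
  fix w i assume w: "w \<in> words X m d" "i < m"
  have "e (w[i := (fst (w ! i), x)]) = e w" for x by (rule e[OF map_fst_update])
  then show "(\<lambda>x. signed N (e (w[i := (fst (w ! i), x)])) (g (w[i := (fst (w ! i), x)])))
      \<in> Lin (gr X (fst (w ! i))) N"
    using signed_linf[OF N multilinear_lin[OF g w]] by simp
qed (rule signed_closed[OF N multilinear_closed[OF g]])

text \<open>The common reason why concatenation, functoriality, permutations and the single terms of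
  the differential are multilinear: a change of letter \<open>i\<close> affects exactly one letter
  \<open>k\<close> of the transformed word, and does so through a linear map
  \<open>l\<close>.\<close>

lemma multilinear_word:
  assumes X: "cplx X" and g: "multilinear Y m' d' N g"
    and \<tau>: "\<And>w. w \<in> words X m d \<Longrightarrow> \<tau> w \<in> words Y m' d'"
    and l: "\<And>w i. \<lbrakk>w \<in> words X m d; i < m\<rbrakk> \<Longrightarrow> \<exists>k<m'.
      \<exists>l\<in>Lin (gr X (fst (w ! i))) (gr Y (fst (\<tau> w ! k))).
        \<forall>x\<in>carrier (gr X (fst (w ! i))).
          \<tau> (w[i := (fst (w ! i), x)]) = (\<tau> w)[k := (fst (\<tau> w ! k), l x)]"
  shows "multilinear X m d N (\<lambda>w. g (\<tau> w))"
proof (rule multilinearI)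
  fix w i assume w: "w \<in> words X m d" "i < m"
  from l[OF w] obtain k l where k: "k < m'"
    and l: "l \<in> Lin (gr X (fst (w ! i))) (gr Y (fst (\<tau> w ! k)))"
    and eq: "\<And>x. x :> gr X (fst (w ! i)) \<Longrightarrow>
      \<tau> (w[i := (fst (w ! i), x)]) = (\<tau> w)[k := (fst (\<tau> w ! k), l x)]" by auto
  show "(\<lambda>x. g (\<tau> (w[i := (fst (w ! i), x)]))) \<in> Lin (gr X (fst (w ! i))) N"
    by (rule lin_cong[OF lin_comp[OF l multilinear_lin[OF g \<tau>[OF w(1)] k]]]) (simp_all add: eq X)
qed (rule multilinear_closed[OF g \<tau>])

lemma multilinear_zero:
  assumes X: "cplx X" and N: "module R N" and g: "multilinear X m d N g"
    and w: "w \<in> words X m d" "i < m" "snd (w ! i) = 0[gr X (fst (w ! i))]"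
  shows "g w = 0[N]"
proof -
  have "w = w[i := (fst (w ! i), 0[gr X (fst (w ! i))])]"
    using w by (metis list_update_id prod.collapse)
  then show ?thesis
    using lin_zero[OF _ N multilinear_lin[OF g w(1,2)]] X by simp
qed

text \<open>The set inside the hull of \<open>tensor_relations\<close>, given a name because
  vanishing on the relations is checked on it.\<close>

definition tensor_generators :: "('k, 'a) cx \<Rightarrow> nat \<Rightarrow> int \<Rightarrow> ('a word \<Rightarrow> 'k) set" where
  "tensor_generators X m d = (let F = FreeM (words X m d); e = basis in
     {e (u @ (n, x +[gr X n] y) # v) -[F] (e (u @ (n, x) # v) +[F] e (u @ (n, y) # v)) | u n x y v.
            u @ (n, x) # v \<in> words X m d \<and> u @ (n, y) # v \<in> words X m d} \<union>
         {e (u @ (n, a *[gr X n] x) # v) -[F] a *[F] e (u @ (n, x) # v) | u n a x v.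
            a :> R \<and> u @ (n, x) # v \<in> words X m d})"

lemma tensor_generators_add:
  "\<lbrakk>u @ (n, x) # v \<in> words X m d; u @ (n, y) # v \<in> words X m d\<rbrakk> \<Longrightarrow>
    basis (u @ (n, x +[gr X n] y) # v) -[FreeM (words X m d)]
      (basis (u @ (n, x) # v) +[FreeM (words X m d)] basis (u @ (n, y) # v))
    \<in> tensor_generators X m d"
  unfolding tensor_generators_def Let_def
  by (rule UnI1, rule CollectI, rule exI[of _ u], rule exI[of _ n], rule exI[of _ x], rule exI[of _ y],
      rule exI[of _ v]) simp

lemma tensor_generators_smult:
  "\<lbrakk>u @ (n, x) # v \<in> words X m d; a :> R\<rbrakk> \<Longrightarrow>
    basis (u @ (n, a *[gr X n] x) # v) -[FreeM (words X m d)]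
      a *[FreeM (words X m d)] basis (u @ (n, x) # v) \<in> tensor_generators X m d"
  unfolding tensor_generators_def Let_def
  by (rule UnI2, rule CollectI, rule exI[of _ u], rule exI[of _ n], rule exI[of _ a], rule exI[of _ x],
      rule exI[of _ v]) simp

lemma tensor_relations_hull:
  "tensor_relations R X m d = (\<lambda>N. submodule N R (FreeM (words X m d))) hull tensor_generators X m d"
  by (simp add: tensor_relations_def tensor_generators_def Let_def)

context
  fixes X :: "('k, 'a) cx"
  assumes X: "cplx X"
begin

lemma words_middle:
  "u @ (n, x) # v \<in> words X m d \<longleftrightarrow> x :> gr X n \<and> length u + length v + 1 = m \<and>
     wdeg u + n + wdeg v = d \<and> (\<forall>(n, x) \<in> set u \<union> set v. x :> gr X n)"
  by (auto simp: words_def)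

lemma words_middle_add: "\<lbrakk>u @ (n, x) # v \<in> words X m d; u @ (n, y) # v \<in> words X m d\<rbrakk> \<Longrightarrow>
    u @ (n, x +[gr X n] y) # v \<in> words X m d"
  using X by (simp add: words_middle)

lemma words_middle_smult: "\<lbrakk>u @ (n, x) # v \<in> words X m d; a :> R\<rbrakk> \<Longrightarrow>
    u @ (n, a *[gr X n] x) # v \<in> words X m d"
  using X by (simp add: words_middle)

lemma tensor_generators_closed: "tensor_generators X m d \<subseteq> carrier (FreeM (words X m d))"
  unfolding tensor_generators_def Let_def
  by (auto intro!: mod_minus_closed mod_add_closed mod_smult_closed free_module basis_closed
      words_middle_add words_middle_smult)

lemma tensor_relations_submodule: "submodule (tensor_relations R X m d) R (FreeM (words X m d))"
  unfolding tensor_relations_hull by (rule submodule_hull[OF free_module tensor_generators_closed])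

lemma tensor_module [simp]: "module R (Tens X m d)"
  unfolding tensor_module_def by (rule quotient_module[OF free_module tensor_relations_submodule])

lemma pure_tensor_eq: "w \<in> words X m d \<Longrightarrow>
    Pure X w = tensor_relations R X m d +>[FreeM (words X m d)] basis w"
  by (simp add: pure_tensor_def words_length words_wdeg)

lemma pure_closed: "w \<in> words X m d \<Longrightarrow> Pure X w :> Tens X m d"
  by (simp add: pure_tensor_eq tensor_module_def coset_closed[OF free_module tensor_relations_submodule] basis_closed)

text \<open>The two families of generators are additivity and homogeneity in the letter that follows
  \<open>u\<close>; taking for \<open>u\<close> the first \<open>i\<close> letters gives linearity
  at position \<open>i\<close>.\<close>

lemma pure_multilinear: "multilinear X m d (Tens X m d) (Pure X)"
proof (intro multilinearI pure_closed)
  fix w i assume w: "w \<in> words X m d" and i: "i < m"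
  let ?n = "fst (w ! i)" and ?u = "take i w" and ?v = "drop (Suc i) w" and ?F = "FreeM (words X m d)"
  let ?N = "tensor_relations R X m d"
  have upd: "w[i := (?n, x)] = ?u @ (?n, x) # ?v" for x
    using w i by (simp add: upd_conv_take_nth_drop words_length)
  have in_w: "?u @ (?n, x) # ?v \<in> words X m d" if "x :> gr X ?n" for x
    using words_update_same[OF w i that] by (simp add: upd)
  note sub = tensor_relations_submodule[of m d]
  have gen: "tensor_generators X m d \<subseteq> ?N"
    unfolding tensor_relations_hull by (rule hull_subset)
  note coset = coset_eq_iff[OF free_module sub, THEN iffD2]
  note [simp] = free_module basis_closed in_w
  show "(\<lambda>x. Pure X (w[i := (?n, x)])) \<in> Lin (gr X ?n) (Tens X m d)"
  proof (rule linI)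
    fix x assume x: "x :> gr X ?n"
    show "Pure X (w[i := (?n, x)]) :> Tens X m d"
      using w i x by (simp add: pure_closed words_update_same)
    { fix a assume a: "a :> R"
      have "basis (?u @ (?n, a *[gr X ?n] x) # ?v) -[?F] a *[?F] basis (?u @ (?n, x) # ?v) \<in> ?N"
        by (intro subsetD[OF gen] tensor_generators_smult in_w x a)
      then show "Pure X (w[i := (?n, a *[gr X ?n] x)]) =
          a *[Tens X m d] Pure X (w[i := (?n, x)])"
        using x a X by (simp add: upd pure_tensor_eq[of _ m d] tensor_module_def quotient_smult[OF free_module sub] coset) }
    fix y assume y: "y :> gr X ?n"
    have "basis (?u @ (?n, x +[gr X ?n] y) # ?v) -[?F]
        (basis (?u @ (?n, x) # ?v) +[?F] basis (?u @ (?n, y) # ?v)) \<in> ?N"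
      by (intro subsetD[OF gen] tensor_generators_add in_w x y)
    then show "Pure X (w[i := (?n, x +[gr X ?n] y)]) =
        Pure X (w[i := (?n, x)]) +[Tens X m d] Pure X (w[i := (?n, y)])"
      using x y X by (simp add: upd pure_tensor_eq[of _ m d] tensor_module_def quotient_add[OF free_module sub] coset)
  qed
qed

text \<open>Pure tensors are the classes of the basis of the free module. Most identities between
  maps on tensor powers below are reduced to words in this way.\<close>

lemma tensor_ext:
  assumes N: "module R N" and f: "f \<in> Lin (Tens X m d) N"
    and g: "g \<in> Lin (Tens X m d) N"
    and eq: "\<And>w. w \<in> words X m d \<Longrightarrow> f (Pure X w) = g (Pure X w)"
    and \<xi>: "\<xi> :> Tens X m d"
  shows "f \<xi> = g \<xi>"
proof -
  let ?F = "FreeM (words X m d)" and ?cl = "\<lambda>x. tensor_relations R X m d +>[FreeM (words X m d)] x"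
  have cl: "?cl \<in> Lin ?F (Tens X m d)"
    unfolding tensor_module_def by (rule coset_lin[OF free_module tensor_relations_submodule])
  obtain c where c: "c :> ?F" "\<xi> = ?cl c"
    using \<xi> quotient_cases[OF free_module tensor_relations_submodule] unfolding tensor_module_def by metis
  have "f (?cl c) = g (?cl c)"
    using eq by (intro free_ext[OF N lin_comp[OF cl f] lin_comp[OF cl g] _ c(1)]) (simp add: pure_tensor_eq)
  then show ?thesis by (simp add: c)
qed

context
  fixes N :: "('k, 'b) module" and g :: "'a word \<Rightarrow> 'b" and m d
  assumes N: "module R N" and g: "multilinear X m d N g"
begin

lemma free_lift_vanish:
  assumes "c \<in> tensor_relations R X m d"
  shows "free_lift N g c = 0[N]"
proof (rule lin_vanish_hull[OF free_module N free_lift_lin tensor_generators_closed])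
  interpret N: module R N by (rule N)
  note gc = multilinear_closed[OF g]
  note fl = free_lift_lin[OF N gc] free_lift_basis[OF N gc]
  note [simp] = free_module basis_closed N
  show "c \<in> (\<lambda>N. submodule N R (FreeM (words X m d))) hull tensor_generators X m d"
    using assms unfolding tensor_relations_hull .
  fix r assume "r \<in> tensor_generators X m d"
  then consider (add) u n x y v where "u @ (n, x) # v \<in> words X m d" "u @ (n, y) # v \<in> words X m d"
      "r = basis (u @ (n, x +[gr X n] y) # v) -[FreeM (words X m d)]
        (basis (u @ (n, x) # v) +[FreeM (words X m d)] basis (u @ (n, y) # v))"
    | (smult) u n a x v where "a :> R" "u @ (n, x) # v \<in> words X m d"
      "r = basis (u @ (n, a *[gr X n] x) # v) -[FreeM (words X m d)]
        a *[FreeM (words X m d)] basis (u @ (n, x) # v)"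
    unfolding tensor_generators_def Let_def by blast
  then show "free_lift N g r = 0[N]"
  proof cases
    case add
    have lu: "length u < m" using add(1) by (auto simp: words_def)
    have xy: "x :> gr X n" "y :> gr X n" using add(1,2) by (auto simp: words_middle)
    have "g (u @ (n, x +[gr X n] y) # v) = g (u @ (n, x) # v) +[N] g (u @ (n, y) # v)"
      using lin_add[OF multilinear_lin[OF g add(1) lu]] xy by simp
    then show ?thesis
      using add(1,2) words_middle_add[OF add(1,2)] gc[OF add(1)] gc[OF add(2)]
      by (simp add: add(3) lin_minus[OF free_module N fl(1)] lin_add[OF fl(1)] fl(2) mod_minus_eq_zero_iff)
  next
    case smult
    have lu: "length u < m" using smult(2) by (auto simp: words_def)
    have x: "x :> gr X n" using smult(2) by (auto simp: words_middle)
    have "g (u @ (n, a *[gr X n] x) # v) = a *[N] g (u @ (n, x) # v)"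
      using lin_smult[OF multilinear_lin[OF g smult(2) lu]] x smult(1) by simp
    then show ?thesis
      using smult(1,2) words_middle_smult[OF smult(2,1)] gc[OF smult(2)]
      by (simp add: smult(3) lin_minus[OF free_module N fl(1)] lin_smult[OF fl(1)] fl(2) mod_minus_eq_zero_iff)
  qed
qed (auto simp: N multilinear_closed[OF g])

lemma tensor_lift_free: "tlift N g \<xi> = the_elem (free_lift N g ` \<xi>)"
proof -
  have "free_lift N g = (\<lambda>c. \<Oplus>\<^bsub>N\<^esub>w\<in>{w. c w \<noteq> \<zero>}. c w *[N] g w)" by (simp add: free_lift_def fun_eq_iff)
  then show ?thesis by (simp add: tensor_lift_def)
qed

lemma tensor_lift_lin: "tlift N g \<in> Lin (Tens X m d) N"
  unfolding tensor_module_def tensor_lift_free[abs_def]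
  by (rule quotient_lift_lin[OF free_module tensor_relations_submodule N
        free_lift_lin[OF N multilinear_closed[OF g]] free_lift_vanish])

lemma tensor_lift_pure:
  assumes w: "w \<in> words X m d"
  shows "tlift N g (Pure X w) = g w"
proof -
  note gc = multilinear_closed[OF g]
  show ?thesis
    unfolding tensor_lift_free pure_tensor_eq[OF w]
    using quotient_lift_eq[OF free_module tensor_relations_submodule N free_lift_lin[OF N gc]
        free_lift_vanish basis_closed[OF w]] free_lift_basis[OF N gc w] by simp
qed

end

lemma tensor_induct_lin:
  assumes N: "module R N" and f: "f \<in> Lin (Tens X m d) N"
    and eq: "\<And>w. w \<in> words X m d \<Longrightarrow> f (Pure X w) = 0[N]"
    and \<xi>: "\<xi> :> Tens X m d"
  shows "f \<xi> = 0[N]"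
  using tensor_ext[OF N f lin_zerof[OF N] _ \<xi>] eq by blast

subsection \<open>Concatenation\<close>

lemma append_right_multilinear:
  assumes u: "u \<in> words X m d"
  shows "multilinear X n e (Tens X (m + n) (d + e)) (\<lambda>v. Pure X (u @ v))"
proof (rule multilinear_word[OF X pure_multilinear])
  fix w i assume w: "w \<in> words X n e" "i < n"
  have l: "length u = m" "length w = n" using u w by (auto simp: words_length)
  show "\<exists>k<m + n. \<exists>l\<in>Lin (gr X (fst (w ! i))) (gr X (fst ((u @ w) ! k))).
     \<forall>x\<in>carrier (gr X (fst (w ! i))). u @ w[i := (fst (w ! i), x)] = (u @ w)[k := (fst ((u @ w) ! k), l x)]"
    using w(2) l lin_id
    by (intro exI[of _ "m + i"]) (auto simp: list_update_append nth_append intro!: bexI[of _ "\<lambda>x. x"])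
qed (rule words_append[OF u])

lemma append_left_multilinear:
  assumes v: "v \<in> words X n e"
  shows "multilinear X m d (Tens X (m + n) (d + e)) (\<lambda>u. Pure X (u @ v))"
proof (rule multilinear_word[OF X pure_multilinear])
  fix w i assume w: "w \<in> words X m d" "i < m"
  have l: "length v = n" "length w = m" using v w by (auto simp: words_length)
  show "\<exists>k<m + n. \<exists>l\<in>Lin (gr X (fst (w ! i))) (gr X (fst ((w @ v) ! k))).
     \<forall>x\<in>carrier (gr X (fst (w ! i))). w[i := (fst (w ! i), x)] @ v = (w @ v)[k := (fst ((w @ v) ! k), l x)]"
    using w(2) l lin_id
    by (intro exI[of _ i]) (auto simp: list_update_append nth_append intro!: bexI[of _ "\<lambda>x. x"])
qed (rule words_append[OF _ v])

text \<open>\<open>tensor_concat\<close> nests two lifts, so the inner lift has to be multilinear in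
  the word \<open>u\<close> for an arbitrary tensor \<eta>. Each linearity equation is itself linear
  in \<eta>, hence it can be verified on pure tensors.\<close>

lemma concat_aux:
  assumes \<eta>: "\<eta> :> Tens X n e"
  shows "multilinear X m d (Tens X (m + n) (d + e))
    (\<lambda>u. tlift (Tens X (m + n) (d + e)) (\<lambda>v. Pure X (u @ v)) \<eta>)"
    (is "multilinear X m d ?N (\<lambda>u. ?L u \<eta>)")
proof (rule multilinearI)
  have L: "?L u \<in> Lin (Tens X n e) ?N" if "u \<in> words X m d" for u
    by (rule tensor_lift_lin[OF tensor_module append_right_multilinear[OF that]])
  have P: "?L u (Pure X v) = Pure X (u @ v)" if "u \<in> words X m d" "v \<in> words X n e" for u v
    by (rule tensor_lift_pure[OF tensor_module append_right_multilinear[OF that(1)] that(2)])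
  fix w assume w: "w \<in> words X m d"
  show "?L w \<eta> :> ?N" by (rule lin_closed[OF L[OF w] \<eta>])
  fix i assume i: "i < m"
  let ?n = "fst (w ! i)"
  note W = words_update_same[OF w i]
  have ml: "(\<lambda>x. Pure X (w[i := (?n, x)] @ v)) \<in> Lin (gr X ?n) ?N" if "v \<in> words X n e" for v
    by (rule multilinear_lin[OF append_left_multilinear[OF that] w i])
  show "(\<lambda>x. ?L (w[i := (?n, x)]) \<eta>) \<in> Lin (gr X ?n) ?N"
  proof (rule linI)
    fix x assume x: "x :> gr X ?n"
    show "?L (w[i := (?n, x)]) \<eta> :> ?N" by (rule lin_closed[OF L[OF W[OF x]] \<eta>])
    { fix a assume a: "a :> R"
      have ax: "a *[gr X ?n] x :> gr X ?n" using X a x by simp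
      show "?L (w[i := (?n, a *[gr X ?n] x)]) \<eta> = a *[?N] ?L (w[i := (?n, x)]) \<eta>"
        by (rule tensor_ext[OF tensor_module L[OF W[OF ax]] lin_smultf[OF tensor_module L[OF W[OF x]] a] _ \<eta>])
          (simp add: P W x ax lin_smult[OF ml] a) }
    fix y assume y: "y :> gr X ?n"
    have xy: "x +[gr X ?n] y :> gr X ?n" using X x y by simp
    show "?L (w[i := (?n, x +[gr X ?n] y)]) \<eta> = ?L (w[i := (?n, x)]) \<eta> +[?N] ?L (w[i := (?n, y)]) \<eta>"
      by (rule tensor_ext[OF tensor_module L[OF W[OF xy]] lin_addf[OF tensor_module L[OF W[OF x]] L[OF W[OF y]]] _ \<eta>])
        (simp add: P W x y xy lin_add[OF ml])
  qed
qed

lemma concat_lin_left: "\<eta> :> Tens X n e \<Longrightarrow>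
    (\<lambda>\<xi>. tcat X m n d e \<xi> \<eta>) \<in> Lin (Tens X m d) (Tens X (m + n) (d + e))"
  unfolding tensor_concat_def Let_def by (rule tensor_lift_lin[OF tensor_module concat_aux])

lemma concat_pure_left: "\<lbrakk>u \<in> words X m d; \<eta> :> Tens X n e\<rbrakk> \<Longrightarrow>
    tcat X m n d e (Pure X u) \<eta> =
    tlift (Tens X (m + n) (d + e)) (\<lambda>v. Pure X (u @ v)) \<eta>"
  unfolding tensor_concat_def Let_def by (rule tensor_lift_pure[OF tensor_module concat_aux])

lemma concat_pure: "\<lbrakk>u \<in> words X m d; v \<in> words X n e\<rbrakk> \<Longrightarrow>
    tcat X m n d e (Pure X u) (Pure X v) = Pure X (u @ v)"
  by (simp add: concat_pure_left pure_closed tensor_lift_pure[OF tensor_module append_right_multilinear])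

lemma concat_closed: "\<lbrakk>\<xi> :> Tens X m d; \<eta> :> Tens X n e\<rbrakk> \<Longrightarrow>
    tcat X m n d e \<xi> \<eta> :> Tens X (m + n) (d + e)"
  by (rule lin_closed[OF concat_lin_left])

lemma concat_lin_right:
  assumes \<xi>: "\<xi> :> Tens X m d"
  shows "tcat X m n d e \<xi> \<in> Lin (Tens X n e) (Tens X (m + n) (d + e))"
    (is "?c \<xi> \<in> Lin ?M ?N")
proof (rule linI)
  have L: "?c (Pure X u) \<in> Lin ?M ?N" if "u \<in> words X m d" for u
    by (rule lin_cong[OF tensor_lift_lin[OF tensor_module append_right_multilinear[OF that]]])
      (simp_all add: concat_pure_left that)
  fix x assume x: "x :> ?M"
  show "?c \<xi> x :> ?N" by (rule concat_closed[OF \<xi> x])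
  { fix a assume a: "a :> R"
    then have ax: "a *[?M] x :> ?M" using x by simp
    show "?c \<xi> (a *[?M] x) = a *[?N] ?c \<xi> x"
      by (rule tensor_ext[OF tensor_module concat_lin_left[OF ax] lin_smultf[OF tensor_module concat_lin_left[OF x] a] _ \<xi>])
        (simp add: lin_smult[OF L] a x) }
  fix y assume y: "y :> ?M"
  then have xy: "x +[?M] y :> ?M" using x by simp
  show "?c \<xi> (x +[?M] y) = ?c \<xi> x +[?N] ?c \<xi> y"
    by (rule tensor_ext[OF tensor_module concat_lin_left[OF xy] lin_addf[OF tensor_module concat_lin_left[OF x] concat_lin_left[OF y]] _ \<xi>])
      (simp add: lin_add[OF L] x y)
qed

text \<open>A word of length \<open>m + n\<close> is cut after \<open>m\<close> letters. The degree
  of the first part is not determined by \<open>D\<close>, so all pairs of degrees adding up to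
  \<open>D\<close> occur in the premise.\<close>

lemma concat_ext:
  assumes N: "module R N" and f: "f \<in> Lin (Tens X (m + n) D) N"
    and g: "g \<in> Lin (Tens X (m + n) D) N"
    and eq: "\<And>d e \<xi> \<eta>. \<lbrakk>d + e = D; \<xi> :> Tens X m d; \<eta> :> Tens X n e\<rbrakk> \<Longrightarrow>
      f (tcat X m n d e \<xi> \<eta>) = g (tcat X m n d e \<xi> \<eta>)"
    and \<xi>: "\<xi> :> Tens X (m + n) D"
  shows "f \<xi> = g \<xi>"
proof (rule tensor_ext[OF N f g _ \<xi>])
  fix w assume "w \<in> words X (m + n) D"
  then obtain u v where w: "w = u @ v" "u \<in> words X m (wdeg u)" "v \<in> words X n (wdeg v)" "wdeg u + wdeg v = D"
    by (rule words_split)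
  show "f (Pure X w) = g (Pure X w)"
    using eq[OF w(4) pure_closed[OF w(2)] pure_closed[OF w(3)]] by (simp add: concat_pure w)
qed

text \<open>The companion of \<open>concat_ext\<close> for expressions that are bilinear in two
  given tensors of fixed degrees: the first argument is reduced to a word, then the second.\<close>

lemma concat_ext2:
  assumes N: "module R N" 
    and f1: "\<And>\<eta>. \<eta> :> Tens X n e \<Longrightarrow> (\<lambda>\<xi>. f \<xi> \<eta>) \<in> Lin (Tens X m d) N"
    and f2: "\<And>\<xi>. \<xi> :> Tens X m d \<Longrightarrow> f \<xi> \<in> Lin (Tens X n e) N"
    and g1: "\<And>\<eta>. \<eta> :> Tens X n e \<Longrightarrow> (\<lambda>\<xi>. g \<xi> \<eta>) \<in> Lin (Tens X m d) N"
    and g2: "\<And>\<xi>. \<xi> :> Tens X m d \<Longrightarrow> g \<xi> \<in> Lin (Tens X n e) N"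
    and eq: "\<And>u v. \<lbrakk>u \<in> words X m d; v \<in> words X n e\<rbrakk> \<Longrightarrow>
      f (Pure X u) (Pure X v) = g (Pure X u) (Pure X v)"
    and \<xi>: "\<xi> :> Tens X m d" and \<eta>: "\<eta> :> Tens X n e"
  shows "f \<xi> \<eta> = g \<xi> \<eta>"
  by (rule tensor_ext[OF N f1[OF \<eta>] g1[OF \<eta>] _ \<xi>],
      rule tensor_ext[OF N f2[OF pure_closed] g2[OF pure_closed] _ \<eta>]) (simp_all add: eq)

lemma concat_assoc:
  assumes \<xi>: "\<xi> :> Tens X m d" and \<eta>: "\<eta> :> Tens X n e"
    and \<zeta>: "\<zeta> :> Tens X l c"
  shows "tcat X (m + n) l (d + e) c (tcat X m n d e \<xi> \<eta>) \<zeta> =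
    tcat X m (n + l) d (e + c) \<xi> (tcat X n l e c \<eta> \<zeta>)"
proof (rule concat_ext2[OF tensor_module[of "m + n + l" "d + e + c"] _ _ _ _ _ \<xi> \<eta>])
  note C = concat_lin_left concat_lin_right concat_closed
  show "(\<lambda>\<xi>. tcat X (m + n) l (d + e) c (tcat X m n d e \<xi> \<eta>) \<zeta>)
      \<in> Lin (Tens X m d) (Tens X (m + n + l) (d + e + c))"
    if "\<eta> :> Tens X n e" for \<eta>
    by (rule lin_comp[OF C(1)[OF that] C(1)[OF \<zeta>]])
  show "(\<lambda>\<eta>. tcat X (m + n) l (d + e) c (tcat X m n d e \<xi> \<eta>) \<zeta>)
      \<in> Lin (Tens X n e) (Tens X (m + n + l) (d + e + c))"
    if "\<xi> :> Tens X m d" for \<xi>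
    by (rule lin_comp[OF C(2)[OF that] C(1)[OF \<zeta>]])
  show "(\<lambda>\<xi>. tcat X m (n + l) d (e + c) \<xi> (tcat X n l e c \<eta> \<zeta>))
      \<in> Lin (Tens X m d) (Tens X (m + n + l) (d + e + c))"
    if "\<eta> :> Tens X n e" for \<eta>
    using C(1)[OF C(3)[OF that \<zeta>], of m d] by (simp add: add.assoc)
  show "(\<lambda>\<eta>. tcat X m (n + l) d (e + c) \<xi> (tcat X n l e c \<eta> \<zeta>))
      \<in> Lin (Tens X n e) (Tens X (m + n + l) (d + e + c))"
    if "\<xi> :> Tens X m d" for \<xi>
    using lin_comp[OF C(1)[OF \<zeta>, of n e] C(2)[OF that]] by (simp add: add.assoc)
  fix u v assume u: "u \<in> words X m d" and v: "v \<in> words X n e"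
  have L: "tcat X m (n + l) d (e + c) (Pure X u)
      \<in> Lin (Tens X (n + l) (e + c)) (Tens X (m + n + l) (d + e + c))"
    using C(2)[OF pure_closed[OF u], of "n + l" "e + c"] by (simp add: add.assoc)
  show "tcat X (m + n) l (d + e) c (tcat X m n d e (Pure X u) (Pure X v)) \<zeta> =
      tcat X m (n + l) d (e + c) (Pure X u) (tcat X n l e c (Pure X v) \<zeta>)"
    unfolding concat_pure[OF u v]
    by (rule tensor_ext[OF tensor_module C(2)[OF pure_closed[OF words_append[OF u v]]]
          lin_comp[OF C(2)[OF pure_closed[OF v]] L] _ \<zeta>])
      (simp add: concat_pure u v words_append)
qed

lemma concat_unit_left:
  assumes "\<xi> :> Tens X m d"
  shows "tcat X 0 m 0 d (Pure X []) \<xi> = \<xi>"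
proof (rule tensor_ext[OF tensor_module _ lin_id _ assms])
  show "tcat X 0 m 0 d (Pure X []) \<in> Lin (Tens X m d) (Tens X m d)"
    using concat_lin_right[OF pure_closed[OF words_Nil], of m d] by simp
qed (simp add: concat_pure[OF words_Nil])

lemma concat_unit_right:
  assumes "\<xi> :> Tens X m d"
  shows "tcat X m 0 d 0 \<xi> (Pure X []) = \<xi>"
proof (rule tensor_ext[OF tensor_module _ lin_id _ assms])
  show "(\<lambda>\<xi>. tcat X m 0 d 0 \<xi> (Pure X [])) \<in> Lin (Tens X m d) (Tens X m d)"
    using concat_lin_left[OF pure_closed[OF words_Nil], of m d] by simp
qed (simp add: concat_pure[OF _ words_Nil])

end

subsection \<open>The differential on tensor powers\<close>

lemma finsum_lessThan_add:
  fixes m n :: nat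
  assumes N: "module R N" and f: "\<And>i. i < m + n \<Longrightarrow> f i :> N"
  shows "(\<Oplus>\<^bsub>N\<^esub>i\<in>{..<m + n}. f i) = (\<Oplus>\<^bsub>N\<^esub>i\<in>{..<m}. f i) +[N] (\<Oplus>\<^bsub>N\<^esub>i\<in>{..<n}. f (m + i))"
proof -
  interpret N: module R N by (rule N)
  have "{..<m + n} = {..<m} \<union> (\<lambda>i. m + i) ` {..<n}"
  proof (intro equalityI subsetI)
    fix x assume x: "x \<in> {..<m + n}"
    show "x \<in> {..<m} \<union> (\<lambda>i. m + i) ` {..<n}"
      using x by (cases "x < m") (auto intro!: image_eqI[of _ _ "x - m"])
  qed auto
  then have "(\<Oplus>\<^bsub>N\<^esub>i\<in>{..<m + n}. f i) = (\<Oplus>\<^bsub>N\<^esub>i\<in>{..<m}. f i) +[N] (\<Oplus>\<^bsub>N\<^esub>i\<in>(\<lambda>i. m + i) ` {..<n}. f i)"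
    using f by (simp only:) (rule N.M.finsum_Un_disjoint, auto)
  also have "(\<Oplus>\<^bsub>N\<^esub>i\<in>(\<lambda>i. m + i) ` {..<n}. f i) = (\<Oplus>\<^bsub>N\<^esub>i\<in>{..<n}. f (m + i))"
    using f by (intro N.M.finsum_reindex) auto
  finally show ?thesis .
qed

lemma signed_cancel:
  assumes N: "module R N" and x: "x :> N" and odd: "odd (a + b)"
  shows "signed N a x +[N] signed N b x = 0[N]"
proof -
  interpret N: module R N by (rule N)
  show ?thesis using x odd by (cases "even a") (auto simp: signed_def N.M.l_neg N.M.r_neg)
qed

lemma finsum_single: "\<lbrakk>module R N; f j :> N\<rbrakk> \<Longrightarrow> (\<Oplus>\<^bsub>N\<^esub>i\<in>{j}. f i) = f j"
proof -
  assume N: "module R N" and "f j :> N"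
  then interpret N: module R N by simp
  show ?thesis using \<open>f j :> N\<close> N.M.finsum_insert[of "{}" j f] by simp
qed

lemma finsum_none: "module R N \<Longrightarrow> (\<Oplus>\<^bsub>N\<^esub>i\<in>{}. f i) = 0[N]"
  by (intro abelian_monoid.finsum_empty abelian_group.axioms(1) mod_abelian_group)

definition diff_at :: "('k, 'a) cx \<Rightarrow> nat \<Rightarrow> 'a word \<Rightarrow> 'a word" where
  "diff_at X i w = w[i := (fst (w ! i) - 1, diff X (fst (w ! i)) (snd (w ! i)))]"

lemma cx_diff_lin: "cplx X \<Longrightarrow> diff X n \<in> Lin (gr X n) (gr X (n - 1))"
  by (rule chain_complex.diff_linear)

lemma cx_diff_diff: "\<lbrakk>cplx X; x :> gr X n\<rbrakk> \<Longrightarrow> diff X (n - 1) (diff X n x) = 0[gr X (n - 2)]"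
  by (rule chain_complex.diff_diff)

context
  fixes X :: "('k, 'a) cx"
  assumes X: "cplx X"
begin

lemma diff_at_words: "\<lbrakk>w \<in> words X m d; i < m\<rbrakk> \<Longrightarrow> diff_at X i w \<in> words X m (d - 1)"
  unfolding diff_at_def
  using words_update[of w X m d i _ "fst (w ! i) - 1"] lin_closed[OF cx_diff_lin[OF X] words_nth] by force

lemma diff_term_multilinear:
  assumes i0: "i0 < m"
  shows "multilinear X m d (Tens X m (d - 1))
    (\<lambda>w. signed (Tens X m (d - 1)) (wdeg (take i0 w)) (Pure X (diff_at X i0 w)))"
proof (rule multilinear_signed[OF tensor_module[OF X] multilinear_word[OF X pure_multilinear[OF X]]])
  show "wdeg (take i0 w) = wdeg (take i0 w')" if "map fst w = map fst w'" for w w' :: "'a word"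
    using that by (simp add: wdeg_def take_map[symmetric])
  fix w i assume w: "w \<in> words X m d" and i: "i < m"
  have l: "length w = m" using w by (rule words_length)
  show "\<exists>k<m. \<exists>l\<in>Lin (gr X (fst (w ! i))) (gr X (fst (diff_at X i0 w ! k))).
     \<forall>x\<in>carrier (gr X (fst (w ! i))). diff_at X i0 (w[i := (fst (w ! i), x)]) =
       (diff_at X i0 w)[k := (fst (diff_at X i0 w ! k), l x)]"
  \<comment> \<open>At the differentiated letter the linear map is the differential, at any other
    letter it is the identity; the position does not move.\<close>
  proof (cases "i = i0")
    case True
    then show ?thesis using i l cx_diff_lin[OF X]
      by (intro exI[of _ i] conjI bexI[of _ "diff X (fst (w ! i))"]) (auto simp: diff_at_def)
  next
    case False
    then show ?thesis using i l lin_id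
      by (intro exI[of _ i] conjI bexI[of _ "\<lambda>x. x"]) (auto simp: diff_at_def list_update_swap)
  qed
qed (rule diff_at_words[OF _ i0])

lemma tensor_diff_eq: "tdiff X m d = tlift (Tens X m (d - 1))
    (\<lambda>w. \<Oplus>\<^bsub>Tens X m (d - 1)\<^esub>i\<in>{..<m}. signed (Tens X m (d - 1)) (wdeg (take i w))
      (Pure X (diff_at X i w)))"
  by (simp add: tensor_diff_def Let_def diff_at_def)

lemma diff_sum_multilinear: "multilinear X m d (Tens X m (d - 1))
    (\<lambda>w. \<Oplus>\<^bsub>Tens X m (d - 1)\<^esub>i\<in>{..<m}. signed (Tens X m (d - 1)) (wdeg (take i w))
      (Pure X (diff_at X i w)))"
  by (rule multilinear_finsum[OF X tensor_module[OF X] finite_lessThan diff_term_multilinear]) simp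

lemma tensor_diff_lin: "tdiff X m d \<in> Lin (Tens X m d) (Tens X m (d - 1))"
  unfolding tensor_diff_eq by (rule tensor_lift_lin[OF X tensor_module[OF X] diff_sum_multilinear])

lemma tensor_diff_pure: "w \<in> words X m d \<Longrightarrow> tdiff X m d (Pure X w) =
    (\<Oplus>\<^bsub>Tens X m (d - 1)\<^esub>i\<in>{..<m}. signed (Tens X m (d - 1)) (wdeg (take i w))
      (Pure X (diff_at X i w)))"
  unfolding tensor_diff_eq by (rule tensor_lift_pure[OF X tensor_module[OF X] diff_sum_multilinear])

lemma tensor_diff_closed: "\<xi> :> Tens X m d \<Longrightarrow>
    tdiff X m d \<xi> :> Tens X m (d - 1)"
  by (rule lin_closed[OF tensor_diff_lin])

text \<open>The sum over the letters of \<open>u @ v\<close> is cut at \<open>m\<close>. A letter of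
  \<open>v\<close> has the whole of \<open>u\<close> in its prefix, which produces the additional
  sign with exponent \<open>d\<close>.\<close>

lemma tensor_diff_concat:
  assumes \<xi>: "\<xi> :> Tens X m d" and \<eta>: "\<eta> :> Tens X n e"
  shows "tdiff X (m + n) (d + e) (tcat X m n d e \<xi> \<eta>) =
    tcat X m n (d - 1) e (tdiff X m d \<xi>) \<eta> +[Tens X (m + n) (d + e - 1)]
    signed (Tens X (m + n) (d + e - 1)) d (tcat X m n d (e - 1) \<xi> (tdiff X n e \<eta>))"
proof (rule concat_ext2[OF X tensor_module[OF X, of "m + n" "d + e - 1"] _ _ _ _ _ \<xi> \<eta>])
  note C = concat_lin_left[OF X] concat_lin_right[OF X]
  note T = tensor_module[OF X]
  let ?N = "Tens X (m + n) (d + e - 1)"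
  have e1: "d - 1 + e = d + e - 1" "d + (e - 1) = d + e - 1" by simp_all
  note C' = C(1)[of _ n e m "d - 1", unfolded e1] C(1)[of _ n "e - 1" m d, unfolded e1]
    C(2)[of _ m "d - 1" n e, unfolded e1] C(2)[of _ m d n "e - 1", unfolded e1]
  show "(\<lambda>\<xi>. tdiff X (m + n) (d + e) (tcat X m n d e \<xi> \<eta>)) \<in> Lin (Tens X m d) ?N"
    if "\<eta> :> Tens X n e" for \<eta>
    by (rule lin_comp[OF C(1)[OF that] tensor_diff_lin])
  show "(\<lambda>\<eta>. tdiff X (m + n) (d + e) (tcat X m n d e \<xi> \<eta>)) \<in> Lin (Tens X n e) ?N"
    if "\<xi> :> Tens X m d" for \<xi>
    by (rule lin_comp[OF C(2)[OF that] tensor_diff_lin])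
  show "(\<lambda>\<xi>. tcat X m n (d - 1) e (tdiff X m d \<xi>) \<eta> +[?N]
      signed ?N d (tcat X m n d (e - 1) \<xi> (tdiff X n e \<eta>))) \<in> Lin (Tens X m d) ?N"
    if "\<eta> :> Tens X n e" for \<eta>
    by (rule lin_addf[OF T lin_comp[OF tensor_diff_lin C'(1)[OF that]]
          signed_linf[OF T C'(2)[OF tensor_diff_closed[OF that]]]])
  show "(\<lambda>\<eta>. tcat X m n (d - 1) e (tdiff X m d \<xi>) \<eta> +[?N]
      signed ?N d (tcat X m n d (e - 1) \<xi> (tdiff X n e \<eta>))) \<in> Lin (Tens X n e) ?N"
    if "\<xi> :> Tens X m d" for \<xi>
    by (rule lin_addf[OF T C'(3)[OF tensor_diff_closed[OF that]]
          signed_linf[OF T lin_comp[OF tensor_diff_lin C'(4)[OF that]]]])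
  fix u v assume u: "u \<in> words X m d" and v: "v \<in> words X n e"
  have l: "length u = m" "length v = n" "wdeg u = d" using u v by (auto simp: words_iff)
  let ?M = "Tens X m (d - 1)" and ?K = "Tens X n (e - 1)"
  have uv: "u @ v \<in> words X (m + n) (d + e)" by (rule words_append[OF u v])
  have 1: "signed ?N (wdeg (take i (u @ v))) (Pure X (diff_at X i (u @ v))) =
      tcat X m n (d - 1) e (signed ?M (wdeg (take i u)) (Pure X (diff_at X i u))) (Pure X v)"
    if "i \<in> {..<m}" for i
  proof -
    have i: "i < m" using that by simp
    have "diff_at X i (u @ v) = diff_at X i u @ v"
      using i l by (simp add: diff_at_def nth_append list_update_append)
    then show ?thesis
      using i l by (simp add: lin_signed[OF T T C'(1)[OF pure_closed[OF X v]]] pure_closed[OF X] diff_at_words[OF u]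
        concat_pure[OF X diff_at_words[OF u] v])
  qed
  have 2: "signed ?N (wdeg (take (m + i) (u @ v))) (Pure X (diff_at X (m + i) (u @ v))) =
      signed ?N d (tcat X m n d (e - 1) (Pure X u)
        (signed ?K (wdeg (take i v)) (Pure X (diff_at X i v))))"
    if "i \<in> {..<n}" for i
  proof -
    have i: "i < n" using that by simp
    have "diff_at X (m + i) (u @ v) = u @ diff_at X i v"
      using i l by (simp add: diff_at_def nth_append list_update_append)
    moreover have "Pure X (u @ diff_at X i v) :> ?N"
      using pure_closed[OF X words_append[OF u diff_at_words[OF v i]]] by (simp add: e1)
    ultimately show ?thesis
      using i l by (simp add: lin_signed[OF T T C'(4)[OF pure_closed[OF X u]]] pure_closed[OF X] diff_at_words[OF v]
        concat_pure[OF X u diff_at_words[OF v]] signed_signed[OF T])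
  qed
  have cl: "signed ?N (wdeg (take i (u @ v))) (Pure X (diff_at X i (u @ v))) :> ?N" if "i < m + n" for i
    using T pure_closed[OF X diff_at_words[OF uv that]] by simp
  have cu: "signed ?M (wdeg (take i u)) (Pure X (diff_at X i u)) :> ?M" if "i \<in> {..<m}" for i
    using T pure_closed[OF X diff_at_words[OF u]] that by simp
  have cv: "signed ?K (wdeg (take i v)) (Pure X (diff_at X i v)) :> ?K" if "i \<in> {..<n}" for i
    using T pure_closed[OF X diff_at_words[OF v]] that by simp
  note L1 = C'(1)[OF pure_closed[OF X v]] and L2 = signed_linf[OF T C'(4)[OF pure_closed[OF X u]]]
  have "tdiff X (m + n) (d + e) (tcat X m n d e (Pure X u) (Pure X v)) =
     (\<Oplus>\<^bsub>?N\<^esub>i\<in>{..<m}. signed ?N (wdeg (take i (u @ v))) (Pure X (diff_at X i (u @ v)))) +[?N]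
     (\<Oplus>\<^bsub>?N\<^esub>i\<in>{..<n}. signed ?N (wdeg (take (m + i) (u @ v))) (Pure X (diff_at X (m + i) (u @ v))))"
    unfolding concat_pure[OF X u v] tensor_diff_pure[OF uv] by (rule finsum_lessThan_add[OF T cl])
  also have "(\<Oplus>\<^bsub>?N\<^esub>i\<in>{..<m}. signed ?N (wdeg (take i (u @ v))) (Pure X (diff_at X i (u @ v)))) =
     tcat X m n (d - 1) e (tdiff X m d (Pure X u)) (Pure X v)"
    unfolding tensor_diff_pure[OF u]
    by (rule trans[OF finsum_cong_mod[OF T 1 lin_closed[OF L1 cu]] lin_finsum[symmetric, OF T T L1 finite_lessThan cu]])
  also have "(\<Oplus>\<^bsub>?N\<^esub>i\<in>{..<n}. signed ?N (wdeg (take (m + i) (u @ v))) (Pure X (diff_at X (m + i) (u @ v)))) =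
     signed ?N d (tcat X m n d (e - 1) (Pure X u) (tdiff X n e (Pure X v)))"
    unfolding tensor_diff_pure[OF v]
    by (rule trans[OF finsum_cong_mod[OF T 2 lin_closed[OF L2 cv]] lin_finsum[symmetric, OF T T L2 finite_lessThan cv]])
  finally show "tdiff X (m + n) (d + e) (tcat X m n d e (Pure X u) (Pure X v)) =
    tcat X m n (d - 1) e (tdiff X m d (Pure X u)) (Pure X v) +[?N]
     signed ?N d (tcat X m n d (e - 1) (Pure X u) (tdiff X n e (Pure X v)))" .
qed

lemma tensor_diff_singleton:
  assumes x: "x :> gr X n"
  shows "tdiff X 1 n (Pure X [(n, x)]) = Pure X [(n - 1, diff X n x)]"
proof -
  have "Pure X [(n - 1, diff X n x)] :> Tens X 1 (n - 1)"
    using x by (intro pure_closed X words_singleton lin_closed[OF cx_diff_lin[OF X]])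
  then show ?thesis
    using tensor_diff_pure[OF words_singleton[OF x]]
      finsum_single[OF tensor_module[OF X, of 1 "n - 1"], of "\<lambda>i. signed (Tens X 1 (n - 1)) (wdeg (take i [(n, x)]))
      (Pure X (diff_at X i [(n, x)]))" 0]
    by (simp add: diff_at_def lessThan_Suc)
qed

text \<open>Induction on the word by means of the Leibniz rule, which replaces the usual double sum
  over positions. Splitting off the first letter, of degree \<open>n\<close>, leaves two equal cross
  terms with signs \<open>n - 1\<close> and \<open>n\<close>, and these cancel.\<close>

lemma tensor_diff_diff:
  assumes \<xi>: "\<xi> :> Tens X m d"
  shows "tdiff X m (d - 1) (tdiff X m d \<xi>) = 0[Tens X m (d - 2)]"
proof -
  note T = tensor_module[OF X]
  have e: "d - 1 - 1 = d - (2::int)" for d by simp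
  have dd: "(\<lambda>\<xi>. tdiff X m (d - 1) (tdiff X m d \<xi>)) \<in> Lin (Tens X m d) (Tens X m (d - 2))"
    for m d using lin_comp[OF tensor_diff_lin tensor_diff_lin, of m d] by (simp add: e)
  show ?thesis
  proof (rule tensor_induct_lin[OF X T dd _ \<xi>])
    fix w assume "w \<in> words X m d"
    then show "tdiff X m (d - 1) (tdiff X m d (Pure X w)) = 0[Tens X m (d - 2)]"
    proof (induction w arbitrary: m d)
      case Nil
      then have [simp]: "m = 0" by (simp add: words_iff)
      show ?case using tensor_diff_pure[OF Nil] lin_zero[OF T T tensor_diff_lin, of 0 "d - 1"]
        by (simp add: e finsum_none[OF T])
    next
      case (Cons a w)
      obtain n x where a: "a = (n, x)" by force
      obtain l where m: "m = 1 + l" using Cons.prems by (cases m) (auto simp: words_iff)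
      have x: "x :> gr X n" and w: "w \<in> words X l (d - n)"
        using Cons.prems by (auto simp: a m words_Cons)
      have dx: "diff X n x :> gr X (n - 1)" by (rule lin_closed[OF cx_diff_lin[OF X] x])
      define e' where "e' = d - n"
      have d: "d = n + e'" by (simp add: e'_def)
      let ?x = "Pure X [(n, x)]" and ?dx = "Pure X [(n - 1, diff X n x)]" and ?w = "Pure X w"
      let ?dw = "tdiff X l e' ?w"
      have w': "w \<in> words X l e'" using w by (simp add: e'_def)
      have cx: "?x :> Tens X 1 n" "?dx :> Tens X 1 (n - 1)"
        "?w :> Tens X l e'" "?dw :> Tens X l (e' - 1)"
        using x dx w' by (auto intro!: pure_closed X words_singleton[simplified] tensor_diff_closed)
      have ar: "n - 1 + e' = n + e' - 1" "n + (e' - 1) = n + e' - 1" "n + e' - 1 - 1 = n + e' - 2" "n - 1 - 1 = n - 2"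
        "n - 1 + (e' - 1) = n + e' - 2" "n - 2 + e' = n + e' - 2" "n + (e' - 2) = n + e' - 2" "e' - 1 - 1 = e' - 2" by simp_all
      let ?N = "Tens X (1 + l) (n + e' - 2)"
      have pw: "Pure X (a # w) = tcat X 1 l n e' ?x ?w"
        using concat_pure[OF X words_singleton[OF x] w'] by (simp add: a)
      have s: "tdiff X 1 (n - 1) ?dx = 0[Tens X 1 (n - 2)]"
      proof -
        have "diff X (n - 1) (diff X n x) = 0[gr X (n - 2)]" by (rule cx_diff_diff[OF X x])
        moreover have "Pure X [(n - 2, 0[gr X (n - 2)])] = 0[Tens X 1 (n - 2)]"
          using X by (intro multilinear_zero[OF X T pure_multilinear[OF X], of _ _ _ 0]) (auto intro!: words_singleton[simplified])
        ultimately show ?thesis using tensor_diff_singleton[OF dx] by (simp add: ar)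
      qed
      have A: "tdiff X (1 + l) (n + e' - 1) (tcat X 1 l (n - 1) e' ?dx ?w) =
          signed ?N (n - 1) (tcat X 1 l (n - 1) (e' - 1) ?dx ?dw)"
        using tensor_diff_concat[OF cx(2,3)] concat_closed[OF X cx(2,4)]
          lin_zero[OF T T concat_lin_left[OF X cx(3), of 1 "n - 2"]]
        by (simp add: s ar T del: One_nat_def plus_1_eq_Suc)
      have B: "tdiff X (1 + l) (n + e' - 1) (tcat X 1 l n (e' - 1) ?x ?dw) =
          tcat X 1 l (n - 1) (e' - 1) ?dx ?dw"
        using tensor_diff_concat[OF cx(1,4)] Cons.IH[OF w'] concat_closed[OF X cx(2,4)]
          lin_zero[OF T T concat_lin_right[OF X cx(1), of l "e' - 2"]]
        by (simp add: tensor_diff_singleton[OF x] ar T del: One_nat_def plus_1_eq_Suc)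
      have C: "tcat X 1 l (n - 1) (e' - 1) ?dx ?dw :> ?N"
        using concat_closed[OF X cx(2,4)] by (simp add: ar)
      have c1: "tcat X 1 l (n - 1) e' ?dx ?w :> Tens X (1 + l) (n + e' - 1)"
        "tcat X 1 l n (e' - 1) ?x ?dw :> Tens X (1 + l) (n + e' - 1)"
        using concat_closed[OF X cx(2,3)] concat_closed[OF X cx(1,4)] by (simp_all add: ar)
      note L = tensor_diff_lin[of "1 + l" "n + e' - 1", unfolded ar]
      have "tdiff X (1 + l) (n + e' - 1) (tdiff X (1 + l) (n + e') (tcat X 1 l n e' ?x ?w)) =
         signed ?N (n - 1) (tcat X 1 l (n - 1) (e' - 1) ?dx ?dw) +[?N]
         signed ?N n (tcat X 1 l (n - 1) (e' - 1) ?dx ?dw)"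
        unfolding tensor_diff_concat[OF cx(1,3)] tensor_diff_singleton[OF x]
        using c1 by (simp add: lin_add[OF L] lin_signed[OF T T L] A B T del: One_nat_def plus_1_eq_Suc)
      also have "\<dots> = 0[?N]"
        by (rule signed_cancel[OF T C]) simp
      finally show ?case unfolding pw m d .
    qed
  qed
qed

text \<open>In a word of negative total degree some letter has negative degree, so this letter is
  zero.\<close>

lemma tensor_negative:
  assumes d: "d < 0"
  shows "carrier (Tens X m d) = {0[Tens X m d]}"
proof -
  note T = tensor_module[OF X, of m d]
  have "\<xi> = 0[Tens X m d]" if "\<xi> :> Tens X m d" for \<xi>
  proof (rule tensor_induct_lin[OF X T lin_id _ that])
    fix w assume w: "w \<in> words X m d"
    have "\<exists>i<m. fst (w ! i) < 0"
    proof (rule ccontr)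
      assume "\<not> ?thesis"
      then have neg: "fst (w ! i) \<ge> 0" if "i < m" for i using that by force
      have "z \<ge> 0" if "z \<in> set (map fst w)" for z
      proof -
        obtain i where "i < length w" "z = fst (w ! i)"
          using \<open>z \<in> set (map fst w)\<close> by (metis in_set_conv_nth length_map nth_map)
        then show ?thesis using neg words_length[OF w] by simp
      qed
      then have "wdeg w \<ge> 0"
        unfolding wdeg_def by (intro sum_list_nonneg) blast
      then show False using w d by (simp add: words_wdeg)
    qed
    then obtain i where i: "i < m" "fst (w ! i) < 0" by auto
    then have "snd (w ! i) = 0[gr X (fst (w ! i))]"
      using words_nth[OF w i(1)] chain_complex.nonneg[OF X i(2)] by auto
    then show "Pure X w = 0[Tens X m d]"
      by (rule multilinear_zero[OF X T pure_multilinear[OF X] w i(1)])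
  qed
  then show ?thesis using T by auto
qed

lemma tensor_power_complex: "cplx (tpow X m)"
  by (rule chain_complex.intro)
    (simp_all add: tensor_power_def tensor_module[OF X] tensor_negative tensor_diff_lin tensor_diff_diff)

end

subsection \<open>Functoriality\<close>

context
  fixes X :: "('k, 'a) cx" and Y :: "('k, 'b) cx" and f :: "int \<Rightarrow> 'a \<Rightarrow> 'b"
  assumes X: "cplx X" and Y: "cplx Y"
    and f: "\<And>n. f n \<in> Lin (gr X n) (gr Y n)"
begin

lemma words_map: "w \<in> words X m d \<Longrightarrow> map (\<lambda>(n, x). (n, f n x)) w \<in> words Y m d"
  using lin_closed[OF f] by (fastforce simp: words_def wdeg_def case_prod_unfold comp_def)

lemma map_multilinear: "multilinear X m d (Tens Y m d) (\<lambda>w. Pure Y (map (\<lambda>(n, x). (n, f n x)) w))"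
proof (rule multilinear_word[OF X pure_multilinear[OF Y] words_map])
  fix w i assume w: "w \<in> words X m d" and i: "i < m"
  then show "\<exists>k<m. \<exists>l\<in>Lin (gr X (fst (w ! i))) (gr Y (fst (map (\<lambda>(n, x). (n, f n x)) w ! k))).
     \<forall>x\<in>carrier (gr X (fst (w ! i))). map (\<lambda>(n, x). (n, f n x)) (w[i := (fst (w ! i), x)]) =
       (map (\<lambda>(n, x). (n, f n x)) w)[k := (fst (map (\<lambda>(n, x). (n, f n x)) w ! k), l x)]"
    using f by (intro exI[of _ i] conjI bexI[of _ "f (fst (w ! i))"]) (auto simp: map_update words_length case_prod_unfold)
qed

lemma tensor_map_lin: "tmap Y f m d \<in> Lin (Tens X m d) (Tens Y m d)"
  unfolding tensor_map_def by (rule tensor_lift_lin[OF X tensor_module[OF Y] map_multilinear])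

lemma tensor_map_pure: "w \<in> words X m d \<Longrightarrow>
    tmap Y f m d (Pure X w) = Pure Y (map (\<lambda>(n, x). (n, f n x)) w)"
  unfolding tensor_map_def by (rule tensor_lift_pure[OF X tensor_module[OF Y] map_multilinear])

lemma tensor_map_closed: "\<xi> :> Tens X m d \<Longrightarrow>
    tmap Y f m d \<xi> :> Tens Y m d"
  by (rule lin_closed[OF tensor_map_lin])

lemma tensor_map_concat:
  assumes "\<xi> :> Tens X m d" "\<eta> :> Tens X n e"
  shows "tmap Y f (m + n) (d + e) (tcat X m n d e \<xi> \<eta>) =
    tcat Y m n d e (tmap Y f m d \<xi>) (tmap Y f n e \<eta>)"
proof (rule concat_ext2[OF X tensor_module[OF Y] _ _ _ _ _ assms])
  show "(\<lambda>\<xi>. tmap Y f (m + n) (d + e) (tcat X m n d e \<xi> \<eta>))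
      \<in> Lin (Tens X m d) (Tens Y (m + n) (d + e))"
    if "\<eta> :> Tens X n e" for \<eta>
    by (rule lin_comp[OF concat_lin_left[OF X that] tensor_map_lin])
  show "(\<lambda>\<eta>. tmap Y f (m + n) (d + e) (tcat X m n d e \<xi> \<eta>))
      \<in> Lin (Tens X n e) (Tens Y (m + n) (d + e))"
    if "\<xi> :> Tens X m d" for \<xi>
    by (rule lin_comp[OF concat_lin_right[OF X that] tensor_map_lin])
  show "(\<lambda>\<xi>. tcat Y m n d e (tmap Y f m d \<xi>) (tmap Y f n e \<eta>))
      \<in> Lin (Tens X m d) (Tens Y (m + n) (d + e))"
    if "\<eta> :> Tens X n e" for \<eta>
    by (rule lin_comp[OF tensor_map_lin concat_lin_left[OF Y tensor_map_closed[OF that]]])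
  show "(\<lambda>\<eta>. tcat Y m n d e (tmap Y f m d \<xi>) (tmap Y f n e \<eta>))
      \<in> Lin (Tens X n e) (Tens Y (m + n) (d + e))"
    if "\<xi> :> Tens X m d" for \<xi>
    by (rule lin_comp[OF tensor_map_lin concat_lin_right[OF Y tensor_map_closed[OF that]]])
qed (simp add: concat_pure[OF X] concat_pure[OF Y] tensor_map_pure words_append words_map)

text \<open>This holds term by term: applying \<open>f\<close> to all letters commutes with
  differentiating one of them, and it does not change degrees, hence not the prefix signs
  either.\<close>

lemma tensor_map_diff:
  assumes c: "cmap X Y f" and \<xi>: "\<xi> :> Tens X m d"
  shows "tmap Y f m (d - 1) (tdiff X m d \<xi>) = tdiff Y m d (tmap Y f m d \<xi>)"
proof (rule tensor_ext[OF X tensor_module[OF Y] lin_comp[OF tensor_diff_lin[OF X] tensor_map_lin]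
      lin_comp[OF tensor_map_lin tensor_diff_lin[OF Y]] _ \<xi>])
  fix w assume w: "w \<in> words X m d"
  note TX = tensor_module[OF X] and TY = tensor_module[OF Y]
  let ?f = "map (\<lambda>(n, x). (n, f n x))"
  have eq: "tmap Y f m (d - 1) (signed (Tens X m (d - 1)) (wdeg (take i w)) (Pure X (diff_at X i w)))
     = signed (Tens Y m (d - 1)) (wdeg (take i (?f w))) (Pure Y (diff_at Y i (?f w)))"
    if "i \<in> {..<m}" for i
  proof -
    have i: "i < m" using that by simp
    have "?f (diff_at X i w) = diff_at Y i (?f w)"
      using i w c words_nth[OF w i]
      by (simp add: diff_at_def map_update words_length case_prod_unfold chain_map_def)
    moreover have "wdeg (take i (?f w)) = wdeg (take i w)"
      by (simp add: wdeg_def take_map case_prod_unfold comp_def)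
    ultimately show ?thesis
      using pure_closed[OF X diff_at_words[OF X w i]]
      by (simp add: lin_signed[OF TX TY tensor_map_lin] tensor_map_pure[OF diff_at_words[OF X w i]])
  qed
  show "tmap Y f m (d - 1) (tdiff X m d (Pure X w)) =
      tdiff Y m d (tmap Y f m d (Pure X w))"
    unfolding tensor_diff_pure[OF X w] tensor_map_pure[OF w] tensor_diff_pure[OF Y words_map[OF w]]
  proof (rule trans[OF lin_finsum[OF TX TY tensor_map_lin finite_lessThan] finsum_cong_mod[OF TY eq]])
    fix i assume i: "i \<in> {..<m}"
    show "signed (Tens X m (d - 1)) (wdeg (take i w)) (Pure X (diff_at X i w))
      :> Tens X m (d - 1)"
      using i by (intro signed_closed TX pure_closed[OF X] diff_at_words[OF X w]) simp
    show "signed (Tens Y m (d - 1)) (wdeg (take i (?f w))) (Pure Y (diff_at Y i (?f w)))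
      :> Tens Y m (d - 1)"
      using i by (intro signed_closed TY pure_closed[OF Y] diff_at_words[OF Y words_map[OF w]]) simp
  qed
qed

text \<open>In a word of positive total degree some letter has positive degree and is killed by
  \<open>f\<close>. It will be applied to the composite of \<open>p\<close> with the section
  \<open>s\<close> of \<open>q\<close>, which vanishes in positive degrees only.\<close>

lemma tensor_map_zero_positive:
  assumes z: "\<And>n x. \<lbrakk>n > 0; x :> gr X n\<rbrakk> \<Longrightarrow> f n x = 0[gr Y n]"
    and d: "d > 0" and \<xi>: "\<xi> :> Tens X m d"
  shows "tmap Y f m d \<xi> = 0[Tens Y m d]"
proof (rule tensor_induct_lin[OF X tensor_module[OF Y] tensor_map_lin _ \<xi>])
  fix w assume w: "w \<in> words X m d"
  have "\<exists>i<m. fst (w ! i) > 0"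
  proof (rule ccontr)
    assume "\<not> ?thesis"
    then have neg: "fst (w ! i) \<le> 0" if "i < m" for i using that by force
    have "z \<le> 0" if "z \<in> set (map fst w)" for z
    proof -
      obtain i where "i < length w" "z = fst (w ! i)"
        using \<open>z \<in> set (map fst w)\<close> by (metis in_set_conv_nth length_map nth_map)
      then show ?thesis using neg words_length[OF w] by simp
    qed
    then have "wdeg w \<le> 0"
      unfolding wdeg_def by (intro sum_list_nonpos) blast
    then show False using w d by (simp add: words_wdeg)
  qed
  then obtain i where i: "i < m" "fst (w ! i) > 0" by auto
  then have "Pure Y (map (\<lambda>(n, x). (n, f n x)) w) = 0[Tens Y m d]"
    using w z[OF i(2) words_nth[OF w i(1)]]
    by (intro multilinear_zero[OF Y tensor_module[OF Y] pure_multilinear[OF Y] words_map[OF w] i(1)])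
      (simp add: words_length case_prod_unfold)
  then show "tmap Y f m d (Pure X w) = 0[Tens Y m d]"
    by (simp add: tensor_map_pure[OF w])
qed

end

lemma tensor_map_chain:
  assumes X: "cplx X" and Y: "cplx Y" and c: "cmap X Y f"
  shows "cmap (tpow X m) (tpow Y m) (tmap Y f m)"
proof -
  have f: "\<And>n. f n \<in> Lin (gr X n) (gr Y n)" using c by (simp add: chain_map_def)
  show ?thesis
    using tensor_map_lin[where f = f, OF X Y f] tensor_map_diff[where f = f, OF X Y f c]
    by (simp add: chain_map_def tensor_power_def)
qed

text \<open>The composite enters as a separate family \<open>h\<close> that agrees with it on
  carriers. One rule then covers honest composites as well as sections, where \<open>h\<close> is
  the identity.\<close>

lemma tensor_map_comp:
  assumes X: "cplx X" and Y: "cplx Y" and Z: "cplx Z"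
    and f: "\<And>n. f n \<in> Lin (gr X n) (gr Y n)" and g: "\<And>n. g n \<in> Lin (gr Y n) (gr Z n)"
    and h: "\<And>n. h n \<in> Lin (gr X n) (gr Z n)"
    and eq: "\<And>n x. x :> gr X n \<Longrightarrow> g n (f n x) = h n x"
    and \<xi>: "\<xi> :> Tens X m d"
  shows "tmap Z g m d (tmap Y f m d \<xi>) = tmap Z h m d \<xi>"
proof (rule tensor_ext[OF X tensor_module[OF Z] lin_comp[OF tensor_map_lin[where f = f, OF X Y f]
      tensor_map_lin[where f = g, OF Y Z g]] tensor_map_lin[where f = h, OF X Z h] _ \<xi>])
  fix w assume w: "w \<in> words X m d"
  have "map (\<lambda>(n, x). (n, g n x)) (map (\<lambda>(n, x). (n, f n x)) w) = map (\<lambda>(n, x). (n, h n x)) w"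
    using w by (auto simp: words_def intro!: eq)
  then show "tmap Z g m d (tmap Y f m d (Pure X w)) = tmap Z h m d (Pure X w)"
    by (simp only: tensor_map_pure[where f = f, OF X Y f w] tensor_map_pure[where f = h, OF X Z h w]
        tensor_map_pure[where f = g, OF Y Z g words_map[where f = f, OF X Y f w]])
qed

lemma tensor_map_id:
  assumes X: "cplx X" and f: "\<And>n. f n \<in> Lin (gr X n) (gr X n)"
    and eq: "\<And>n x. x :> gr X n \<Longrightarrow> f n x = x"
    and \<xi>: "\<xi> :> Tens X m d"
  shows "tmap X f m d \<xi> = \<xi>"
proof (rule tensor_ext[OF X tensor_module[OF X] tensor_map_lin[where f = f, OF X X f] lin_id _ \<xi>])
  fix w assume w: "w \<in> words X m d"
  have "map (\<lambda>(n, x). (n, f n x)) w = w"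
    using w by (intro map_idI) (auto simp: words_def intro!: eq)
  then show "tmap X f m d (Pure X w) = Pure X w"
    by (simp only: tensor_map_pure[where f = f, OF X X f w])
qed

end

subsection \<open>Koszul signs\<close>

abbreviation pinv :: "('a \<Rightarrow> 'b) \<Rightarrow> 'b \<Rightarrow> 'a" where
  "pinv \<equiv> Hilbert_Choice.inv"

text \<open>The symmetric form of being an inversion, independent of the order in which the two
  positions are named.\<close>

definition inverted :: "(nat \<Rightarrow> nat) \<Rightarrow> nat \<Rightarrow> nat \<Rightarrow> bool" where
  "inverted \<sigma> i j \<longleftrightarrow> i < j \<and> \<sigma> j < \<sigma> i \<or> j < i \<and> \<sigma> i < \<sigma> j"

lemma even_diff_cases:
  fixes a b c d :: int
  shows "even (a - b - c) \<Longrightarrow> even a = even (b + c)" "even (a + b - c - d) \<Longrightarrow> even (a + b) = even (c + d)"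
    "2 * a = 2 * b + 2 * c - 2 * (2 * d) \<Longrightarrow> even (a - b - c)"
  by presburger+

lemma no_nat_between: "{j. i < j \<and> j < i} = {}" for i :: nat
  by auto

definition koszul_sum :: "nat \<Rightarrow> (nat \<Rightarrow> nat) \<Rightarrow> (nat \<Rightarrow> int) \<Rightarrow> int" where
  "koszul_sum m \<sigma> a = (\<Sum>i<m. \<Sum>j<m. of_bool (i < j \<and> \<sigma> j < \<sigma> i) * (a i * a j))"

lemma koszul_exponent_sum: "koszul_exponent \<sigma> w = koszul_sum (length w) \<sigma> (\<lambda>i. fst (w ! i))"
proof -
  have "koszul_exponent \<sigma> w = (\<Sum>(i, j) \<in> {..<length w} \<times> {..<length w}.
      of_bool (i < j \<and> \<sigma> j < \<sigma> i) * (fst (w ! i) * fst (w ! j)))"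
    unfolding koszul_exponent_def by (rule sum.mono_neutral_cong_left) auto
  then show ?thesis unfolding koszul_sum_def sum.cartesian_product .
qed

text \<open>The diagonal contributes nothing, and transposition exchanges the two triangles.\<close>

lemma sum_square_symmetric:
  fixes S :: "nat \<Rightarrow> nat \<Rightarrow> int"
  assumes sym: "\<And>i j. S i j = S j i" and z: "\<And>i. S i i = 0"
  shows "(\<Sum>i<m. \<Sum>j<m. S i j) = 2 * (\<Sum>i<m. \<Sum>j<m. of_bool (i < j) * S i j)"
proof -
  have "(\<Sum>i<m. \<Sum>j<m. S i j) = (\<Sum>i<m. \<Sum>j<m. of_bool (i < j) * S i j + of_bool (j < i) * S i j)"
    by (intro sum.cong refl) (metis (full_types) add.right_neutral add_0 linorder_neqE_nat mult_1 mult_zero_left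
        not_less_iff_gr_or_eq of_bool_eq(1) of_bool_eq(2) z)
  also have "\<dots> = (\<Sum>i<m. \<Sum>j<m. of_bool (i < j) * S i j) + (\<Sum>i<m. \<Sum>j<m. of_bool (j < i) * S i j)"
    by (simp add: sum.distrib)
  also have "(\<Sum>i<m. \<Sum>j<m. of_bool (j < i) * S i j) = (\<Sum>j<m. \<Sum>i<m. of_bool (j < i) * S j i)"
    by (subst sum.swap) (intro sum.cong refl, simp add: sym)
  finally show ?thesis by simp
qed

text \<open>A permutation maps the square of all pairs to itself, but not the triangle of pairs with
  \<open>i < j\<close>. Doubling passes from the triangle to the square and makes reindexing
  possible.\<close>

lemma koszul_sum_double: "2 * koszul_sum m \<sigma> a = (\<Sum>i<m. \<Sum>j<m. of_bool (inverted \<sigma> i j) * (a i * a j))"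
proof -
  have "(\<Sum>i<m. \<Sum>j<m. of_bool (inverted \<sigma> i j) * (a i * a j)) =
      2 * (\<Sum>i<m. \<Sum>j<m. of_bool (i < j) * (of_bool (inverted \<sigma> i j) * (a i * a j)))"
    by (rule sum_square_symmetric) (auto simp: inverted_def)
  also have "\<dots> = 2 * koszul_sum m \<sigma> a"
    unfolding koszul_sum_def by (intro arg_cong[where f = "\<lambda>x. 2 * x"] sum.cong refl) (auto simp: inverted_def)
  finally show ?thesis by simp
qed

text \<open>A pair is inverted by the composite iff exactly one of the two permutations inverts it,
  the outer one after the pair has been moved. Exclusive or is the sum minus twice the conjunction;
  the doubled exponents therefore differ by four times a sum over the triangle, and the exponents
  themselves by an even number.\<close>

lemma koszul_sum_comp:
  assumes \<sigma>: "\<sigma> permutes {..<m}" and \<tau>: "\<tau> permutes {..<m}"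
  shows "even (koszul_sum m (\<sigma> \<circ> \<tau>) a - koszul_sum m \<tau> a - koszul_sum m \<sigma> (\<lambda>i. a (pinv \<tau> i)))"
proof -
  have i\<sigma>: "\<sigma> i = \<sigma> j \<longleftrightarrow> i = j" and i\<tau>: "\<tau> i = \<tau> j \<longleftrightarrow> i = j" for i j
    using permutes_inj[OF \<sigma>] permutes_inj[OF \<tau>] by (auto dest: injD)
  let ?both = "\<lambda>i j. inverted \<tau> i j \<and> inverted \<sigma> (\<tau> i) (\<tau> j)"
  have xor: "of_bool (inverted (\<sigma> \<circ> \<tau>) i j) * c = of_bool (inverted \<tau> i j) * c
      + of_bool (inverted \<sigma> (\<tau> i) (\<tau> j)) * c - 2 * (of_bool (?both i j) * c)" for i j and c :: int
  proof -
    consider "i < j" | "i = j" | "j < i" by linarith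
    then show ?thesis
      using i\<sigma>[of "\<tau> i" "\<tau> j"] i\<tau>[of i j] 
      by cases (cases "\<tau> i < \<tau> j"; cases "\<sigma> (\<tau> i) < \<sigma> (\<tau> j)"; auto simp: inverted_def)+
  qed
  \<comment> \<open>Both summation indices are moved by \<tau>, which permutes the square.\<close>
  have re: "(\<Sum>i<m. \<Sum>j<m. F (\<tau> i) (\<tau> j)) = (\<Sum>i<m. \<Sum>j<m. F i j)" for F :: "nat \<Rightarrow> nat \<Rightarrow> int"
    by (subst (3) sum.permute[OF \<tau>], subst (2) sum.permute[OF \<tau>]) (simp add: comp_def)
  let ?S = "\<Sum>i<m. \<Sum>j<m. of_bool (inverted \<sigma> (\<tau> i) (\<tau> j)) * (a i * a j)"
  let ?B = "\<Sum>i<m. \<Sum>j<m. of_bool (?both i j) * (a i * a j)"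
  have 1: "?S = 2 * koszul_sum m \<sigma> (\<lambda>i. a (pinv \<tau> i))"
    unfolding koszul_sum_double
    using re[of "\<lambda>i j. of_bool (inverted \<sigma> i j) * (a (pinv \<tau> i) * a (pinv \<tau> j))"]
    by (simp only: permutes_inverses(2)[OF \<tau>])
  have 2: "?B = 2 * (\<Sum>i<m. \<Sum>j<m. of_bool (i < j) * (of_bool (?both i j) * (a i * a j)))" (is "_ = 2 * ?H")
    by (rule sum_square_symmetric) (auto simp: inverted_def)
  have "2 * koszul_sum m (\<sigma> \<circ> \<tau>) a = 2 * koszul_sum m \<tau> a + ?S - 2 * ?B"
    unfolding koszul_sum_double xor by (simp only: sum.distrib sum_subtractf sum_distrib_left[symmetric])
  then show ?thesis unfolding 1 2 by (rule even_diff_cases(3))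
qed

text \<open>Needed for the differential, which lowers the degree of one letter by one. No position
  is inverted with itself, so the exponent is affine in \<open>a k\<close>, with slope the total
  degree of the letters inverted with \<open>k\<close>.\<close>

lemma koszul_sum_decrease:
  assumes k: "k < m"
  shows "koszul_sum m \<sigma> (a(k := a k - 1)) = koszul_sum m \<sigma> a - (\<Sum>j<m. of_bool (inverted \<sigma> k j) * a j)"
proof -
  define c where "c i j = (of_bool (inverted \<sigma> i j) :: int)" for i j
  have c: "c i j = c j i" "c i i = 0" for i j by (auto simp: c_def inverted_def)
  have "c i j * ((a(k := a k - 1)) i * (a(k := a k - 1)) j) = c i j * (a i * a j)
      - (if i = k then c k j * a j else 0) - (if j = k then c k i * a i else 0)" for i j
    by (cases "i = k"; cases "j = k") (auto simp: c algebra_simps)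
  then have "(\<Sum>i<m. \<Sum>j<m. c i j * ((a(k := a k - 1)) i * (a(k := a k - 1)) j)) =
     (\<Sum>i<m. \<Sum>j<m. c i j * (a i * a j)) - (\<Sum>i<m. \<Sum>j<m. if i = k then c k j * a j else 0)
      - (\<Sum>i<m. \<Sum>j<m. if j = k then c k i * a i else 0)"
    by (simp only: sum_subtractf)
  also have "(\<Sum>i<m. \<Sum>j<m. if i = k then c k j * a j else 0) = (\<Sum>j<m. c k j * a j)"
    by (subst sum.swap) (use k in simp)
  also have "(\<Sum>i<m. \<Sum>j<m. if j = k then c k i * a i else 0) = (\<Sum>j<m. c k j * a j)"
    using k by simp
  finally have "2 * koszul_sum m \<sigma> (a(k := a k - 1)) = 2 * koszul_sum m \<sigma> a - 2 * (\<Sum>j<m. c k j * a j)"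
    unfolding koszul_sum_double c_def by simp
  then show ?thesis by (simp add: c_def)
qed

lemma koszul_sum_cong: "(\<And>i. i < m \<Longrightarrow> a i = b i) \<Longrightarrow> koszul_sum m \<sigma> a = koszul_sum m \<sigma> b"
  unfolding koszul_sum_def by (intro sum.cong refl) simp

lemma sum_lessThan_add: "(\<Sum>i<m + n. f i) = (\<Sum>i<m. f i) + (\<Sum>i<n. f (m + i))" for f :: "nat \<Rightarrow> int" and m n :: nat
  by (induction n) simp_all

lemma wdeg_sum: "wdeg w = (\<Sum>i<length w. fst (w ! i))"
  by (simp add: wdeg_def sum_list_sum_nth atLeast0LessThan)

lemma wdeg_take: "k \<le> length w \<Longrightarrow> wdeg (take k w) = (\<Sum>i<length w. of_bool (i < k) * fst (w ! i))"
proof -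
  assume k: "k \<le> length w"
  have "wdeg (take k w) = (\<Sum>i<k. fst (w ! i))"
    using k by (simp add: wdeg_sum)
  also have "\<dots> = (\<Sum>i<length w. of_bool (i < k) * fst (w ! i))"
    using k by (intro sum.mono_neutral_cong_left) auto
  finally show ?thesis .
qed

text \<open>\<open>permute_list\<close> reads letters through the permutation it is given. For the
  letter at \<open>i\<close> to arrive at \<open>\<sigma> i\<close> it must be given the
  inverse.\<close>

lemma permute_list_update:
  assumes \<sigma>: "\<sigma> permutes {..<length w}" and i: "i < length w"
  shows "permute_list (pinv \<sigma>) (w[i := a]) = (permute_list (pinv \<sigma>) w)[\<sigma> i := a]"
proof (rule nth_equalityI)
  fix k assume "k < length (permute_list (pinv \<sigma>) (w[i := a]))"
  then have k: "k < length w" by simp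
  have inv: "pinv \<sigma> permutes {..<length w}" by (rule permutes_inv[OF \<sigma>])
  have k': "pinv \<sigma> k < length w" using permutes_in_image[OF inv, of k] k by simp
  have "pinv \<sigma> k = i \<longleftrightarrow> k = \<sigma> i" using permutes_inverses[OF \<sigma>] by metis
  moreover have "\<sigma> i < length w" using permutes_in_image[OF \<sigma>, of i] i by simp
  ultimately show "permute_list (pinv \<sigma>) (w[i := a]) ! k = (permute_list (pinv \<sigma>) w)[\<sigma> i := a] ! k"
    using k k' inv by (auto simp: permute_list_nth nth_list_update)
qed simp

lemma koszul_exponent_comp:
  assumes \<sigma>: "\<sigma> permutes {..<length w}" and \<tau>: "\<tau> permutes {..<length w}"
  shows "even (koszul_exponent (\<sigma> \<circ> \<tau>) w - koszul_exponent \<tau> w - koszul_exponent \<sigma> (permute_list (pinv \<tau>) w))"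
proof -
  have "koszul_exponent \<sigma> (permute_list (pinv \<tau>) w) = koszul_sum (length w) \<sigma> (\<lambda>i. fst (w ! pinv \<tau> i))"
    unfolding koszul_exponent_sum length_permute_list
    by (rule koszul_sum_cong) (simp add: permute_list_nth[OF permutes_inv[OF \<tau>]])
  then show ?thesis using koszul_sum_comp[OF assms, of "\<lambda>i. fst (w ! i)"] by (simp add: koszul_exponent_sum)
qed

text \<open>For each position \<open>j\<close>, an even number of the following holds:
  \<open>j\<close> precedes \<open>i\<close>, the pair is inverted, the image of \<open>j\<close>
  precedes the image of \<open>i\<close>. These three conditions give the coefficients of the degree
  of letter \<open>j\<close> in the exponents being compared.\<close>

lemma koszul_exponent_diff:
  assumes \<sigma>: "\<sigma> permutes {..<length w}" and i: "i < length w"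
  shows "even (wdeg (take i w) + koszul_exponent \<sigma> (w[i := (fst (w ! i) - 1, x)])
    - koszul_exponent \<sigma> w - wdeg (take (\<sigma> i) (permute_list (pinv \<sigma>) w)))"
proof -
  let ?m = "length w" and ?a = "\<lambda>i. fst (w ! i)"
  have i\<sigma>: "\<sigma> j = \<sigma> k \<longleftrightarrow> j = k" for j k
    using permutes_inj[OF \<sigma>] by (auto dest: injD)
  have "koszul_exponent \<sigma> (w[i := (fst (w ! i) - 1, x)]) = koszul_sum ?m \<sigma> (?a(i := ?a i - 1))"
    unfolding koszul_exponent_sum length_list_update by (rule koszul_sum_cong) (auto simp: nth_list_update)
  also have "\<dots> = koszul_exponent \<sigma> w - (\<Sum>j<?m. of_bool (inverted \<sigma> i j) * ?a j)"
    using koszul_sum_decrease[OF i, of \<sigma> ?a] by (simp only: koszul_exponent_sum)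
  finally have 1: "koszul_exponent \<sigma> (w[i := (fst (w ! i) - 1, x)]) =
      koszul_exponent \<sigma> w - (\<Sum>j<?m. of_bool (inverted \<sigma> i j) * ?a j)" .
  have "\<sigma> i < ?m" using permutes_in_image[OF \<sigma>, of i] i by simp
  then have "wdeg (take (\<sigma> i) (permute_list (pinv \<sigma>) w)) = (\<Sum>j<?m. of_bool (j < \<sigma> i) * ?a (pinv \<sigma> j))"
    by (simp add: wdeg_take permute_list_nth[OF permutes_inv[OF \<sigma>]])
  also have "\<dots> = (\<Sum>j<?m. of_bool (\<sigma> j < \<sigma> i) * ?a j)"
    by (subst sum.permute[OF \<sigma>]) (simp add: permutes_inverses(2)[OF \<sigma>])
  finally have 2: "wdeg (take (\<sigma> i) (permute_list (pinv \<sigma>) w)) = (\<Sum>j<?m. of_bool (\<sigma> j < \<sigma> i) * ?a j)" .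
  have "wdeg (take i w) + koszul_exponent \<sigma> (w[i := (fst (w ! i) - 1, x)])
    - koszul_exponent \<sigma> w - wdeg (take (\<sigma> i) (permute_list (pinv \<sigma>) w)) =
    (\<Sum>j<?m. (of_bool (j < i) - of_bool (inverted \<sigma> i j) - of_bool (\<sigma> j < \<sigma> i)) * ?a j)"
    using i by (simp add: 1 2 wdeg_take sum_subtractf left_diff_distrib)
  moreover have "even ((of_bool (j < i) - of_bool (inverted \<sigma> i j) - of_bool (\<sigma> j < \<sigma> i)) * ?a j)" for j
  proof -
    consider "i < j" | "i = j" | "j < i" by linarith
    then show ?thesis
      using i\<sigma>[of i j] by cases (cases "\<sigma> i < \<sigma> j"; auto simp: inverted_def)+
  qed
  ultimately show ?thesis by (simp add: dvd_sum)
qed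

section \<open>Block sums and block swaps of permutations, with their Koszul signs\<close>

lemma permsD: "\<sigma> \<in> perms m \<Longrightarrow> \<sigma> permutes {..<m}"
  by (simp add: perms_def)

lemma perms_lt: "\<lbrakk>\<sigma> \<in> perms m; i < m\<rbrakk> \<Longrightarrow> \<sigma> i < m"
  using permutes_in_image[of \<sigma> "{..<m}" i] by (simp add: perms_def)

lemma perms_id: "id \<in> perms m"
  by (simp add: perms_def permutes_id)

lemma perms_comp: "\<lbrakk>\<sigma> \<in> perms m; \<tau> \<in> perms m\<rbrakk> \<Longrightarrow> \<sigma> \<circ> \<tau> \<in> perms m"
  by (simp add: perms_def permutes_compose)

lemma perms_inv: "\<sigma> \<in> perms m \<Longrightarrow> pinv \<sigma> \<in> perms m"
  by (simp add: perms_def permutes_inv)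

lemma finite_perms: "finite (perms m)"
  by (simp add: perms_def finite_permutations)

lemma permutesI_finite:
  assumes "\<And>i. i < m \<Longrightarrow> \<sigma> i < m" "\<And>i. i \<ge> m \<Longrightarrow> \<sigma> i = i" "\<And>i. \<tau> (\<sigma> i) = i" "\<And>i. \<sigma> (\<tau> i) = i"
  shows "\<sigma> \<in> perms m" "pinv \<sigma> = \<tau>"
proof -
  have "bij \<sigma>" using assms(3,4) by (intro o_bij[of \<tau>]) auto
  then show "\<sigma> \<in> perms m"
    unfolding perms_def mem_Collect_eq permutes_def using assms(2)
    by (metis bij_pointE lessThan_iff not_less)
  show "pinv \<sigma> = \<tau>" using assms(3,4) by (intro inv_unique_comp) auto
qed

lemma perm_sum_perms:
  assumes "\<sigma> \<in> perms m" "\<tau> \<in> perms n"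
  shows "perm_sum m \<sigma> \<tau> \<in> perms (m + n)" "pinv (perm_sum m \<sigma> \<tau>) = perm_sum m (pinv \<sigma>) (pinv \<tau>)"
proof -
  have *: "\<sigma> (pinv \<sigma> i) = i" "pinv \<sigma> (\<sigma> i) = i" "\<tau> (pinv \<tau> i) = i" "pinv \<tau> (\<tau> i) = i" for i
    using permutes_inverses[OF permsD] assms by auto
  have lt: "perm_sum m \<sigma> \<tau> i < m + n" if "i < m + n" for i
    using that perms_lt[OF assms(1), of i] perms_lt[OF assms(2), of "i - m"] by (auto simp: perm_sum_def)
  have ge: "perm_sum m \<sigma> \<tau> i = i" if "i \<ge> m + n" for i
    using that permutes_not_in[OF permsD[OF assms(2)], of "i - m"] by (auto simp: perm_sum_def)
  have inv: "perm_sum m (pinv \<sigma>) (pinv \<tau>) (perm_sum m \<sigma> \<tau> i) = i" "perm_sum m \<sigma> \<tau> (perm_sum m (pinv \<sigma>) (pinv \<tau>) i) = i" for i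
    using perms_lt[OF assms(1), of i] perms_lt[OF perms_inv[OF assms(1)], of i] by (auto simp: perm_sum_def *)
  show "perm_sum m \<sigma> \<tau> \<in> perms (m + n)" "pinv (perm_sum m \<sigma> \<tau>) = perm_sum m (pinv \<sigma>) (pinv \<tau>)"
    using permutesI_finite[of "m + n" "perm_sum m \<sigma> \<tau>", OF lt ge inv] by auto
qed

lemma block_swap_perms: "block_swap m n \<in> perms (m + n)" "pinv (block_swap m n) = block_swap n m"
proof -
  have *: "\<And>i. i < m + n \<Longrightarrow> block_swap m n i < m + n" "\<And>i. i \<ge> m + n \<Longrightarrow> block_swap m n i = i"
    "\<And>i. block_swap n m (block_swap m n i) = i" "\<And>i. block_swap m n (block_swap n m i) = i"
    by (auto simp: block_swap_def)
  show "block_swap m n \<in> perms (m + n)" "pinv (block_swap m n) = block_swap n m"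
    by (rule permutesI_finite[OF *]; assumption)+
qed

lemma permute_list_perm_sum:
  assumes "\<sigma> \<in> perms (length u)" "\<tau> \<in> perms (length v)"
  shows "permute_list (perm_sum (length u) \<sigma> \<tau>) (u @ v) = permute_list \<sigma> u @ permute_list \<tau> v"
proof (rule nth_equalityI)
  fix i assume "i < length (permute_list (perm_sum (length u) \<sigma> \<tau>) (u @ v))"
  then have i: "i < length u + length v" by simp
  have "permute_list (perm_sum (length u) \<sigma> \<tau>) (u @ v) ! i = (u @ v) ! perm_sum (length u) \<sigma> \<tau> i"
    using i permsD[OF perm_sum_perms(1)[OF assms]] by (intro permute_list_nth) auto
  also have "\<dots> = (permute_list \<sigma> u @ permute_list \<tau> v) ! i"
    using i perms_lt[OF assms(1), of i] perms_lt[OF assms(2), of "i - length u"]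
    by (auto simp: perm_sum_def nth_append permute_list_nth[OF permsD[OF assms(1)]] permute_list_nth[OF permsD[OF assms(2)]])
  finally show "permute_list (perm_sum (length u) \<sigma> \<tau>) (u @ v) ! i = (permute_list \<sigma> u @ permute_list \<tau> v) ! i" .
qed simp

lemma permute_list_block_swap: "permute_list (block_swap (length v) (length u)) (u @ v) = v @ u"
proof (rule nth_equalityI)
  fix i assume "i < length (permute_list (block_swap (length v) (length u)) (u @ v))"
  then have i: "i < length v + length u" by simp
  then have "permute_list (block_swap (length v) (length u)) (u @ v) ! i = (u @ v) ! block_swap (length v) (length u) i"
    using permsD[OF block_swap_perms(1)[of "length v" "length u"]] by (intro permute_list_nth) (auto simp: add.commute)
  also have "\<dots> = (v @ u) ! i" using i by (auto simp: block_swap_def nth_append)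
  finally show "permute_list (block_swap (length v) (length u)) (u @ v) ! i = (v @ u) ! i" .
qed simp

text \<open>A block sum creates no inversion between a letter of \<open>u\<close> and a letter of
  \<open>v\<close>.\<close>

lemma koszul_exponent_perm_sum:
  assumes "\<sigma> \<in> perms (length u)" "\<tau> \<in> perms (length v)"
  shows "koszul_exponent (perm_sum (length u) \<sigma> \<tau>) (u @ v) = koszul_exponent \<sigma> u + koszul_exponent \<tau> v"
proof -
  let ?m = "length u" and ?n = "length v" and ?\<rho> = "perm_sum (length u) \<sigma> \<tau>"
  have lt: "?\<rho> i < ?m" "?\<rho> i = \<sigma> i" if "i < ?m" for i using that perms_lt[OF assms(1) that] by (simp_all add: perm_sum_def)
  have ge: "?\<rho> (?m + i) = ?m + \<tau> i" for i by (simp add: perm_sum_def)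
  have 1: "(\<Sum>j<?m + ?n. of_bool (i < j \<and> ?\<rho> j < ?\<rho> i) * (fst ((u @ v) ! i) * fst ((u @ v) ! j))) =
    (\<Sum>j<?m. of_bool (i < j \<and> \<sigma> j < \<sigma> i) * (fst (u ! i) * fst (u ! j)))" if i: "i < ?m" for i
  proof -
    have "\<not> ?\<rho> (?m + j) < ?\<rho> i" for j
      using lt[OF i] ge by simp
    then show ?thesis using i lt by (simp add: sum_lessThan_add nth_append del: sum_mult_of_bool_eq sum_of_bool_mult_eq)
  qed
  have 2: "(\<Sum>j<?m + ?n. of_bool (?m + i < j \<and> ?\<rho> j < ?\<rho> (?m + i)) * (fst ((u @ v) ! (?m + i)) * fst ((u @ v) ! j))) =
    (\<Sum>j<?n. of_bool (i < j \<and> \<tau> j < \<tau> i) * (fst (v ! i) * fst (v ! j)))" for i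
    using ge by (simp add: sum_lessThan_add nth_append del: sum_mult_of_bool_eq sum_of_bool_mult_eq)
  show ?thesis
    unfolding koszul_exponent_sum koszul_sum_def length_append
    by (subst sum_lessThan_add) (intro arg_cong2[where f = "(+)"] sum.cong refl 1 2, simp)
qed

text \<open>The inversions are exactly the pairs with one letter in each block, so the exponent is
  the product of the two total degrees.\<close>

lemma koszul_exponent_block_swap: "koszul_exponent (block_swap (length u) (length v)) (u @ v) = wdeg u * wdeg v"
proof -
  let ?m = "length u" and ?n = "length v" and ?\<rho> = "block_swap (length u) (length v)"
  have 1: "(\<Sum>j<?m + ?n. of_bool (i < j \<and> ?\<rho> j < ?\<rho> i) * (fst ((u @ v) ! i) * fst ((u @ v) ! j))) =
    (\<Sum>j<?n. fst (u ! i) * fst (v ! j))" if i: "i < ?m" for i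
    using i by (simp add: sum_lessThan_add nth_append block_swap_def no_nat_between)
  have 2: "(\<Sum>j<?m + ?n. of_bool (?m + i < j \<and> ?\<rho> j < ?\<rho> (?m + i)) * (fst ((u @ v) ! (?m + i)) * fst ((u @ v) ! j))) = 0"
    if i: "i < ?n" for i
    using i by (simp add: sum_lessThan_add nth_append block_swap_def no_nat_between)
  show ?thesis
    unfolding koszul_exponent_sum koszul_sum_def length_append
    by (subst sum_lessThan_add, subst sum.cong[OF refl 1], simp, subst sum.cong[OF refl 2], simp)
      (simp add: wdeg_sum sum_product)
qed

section \<open>The signed action of permutations on tensor powers\<close>

context ground_ring begin

context
  fixes X :: "('k, 'a) cx"
  assumes X: "cplx X"
begin

lemma wdeg_permute: "\<rho> permutes {..<length w} \<Longrightarrow> wdeg (permute_list \<rho> w) = wdeg w"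
  unfolding wdeg_def by (metis mset_map mset_permute_list sum_mset_sum_list)

lemma words_permute:
  assumes "w \<in> words X m d" "\<rho> \<in> perms m"
  shows "permute_list \<rho> w \<in> words X m d"
  using assms wdeg_permute[of \<rho> w] by (auto simp: words_def perms_def)

lemma perm_multilinear:
  assumes \<sigma>: "\<sigma> \<in> perms m"
  shows "multilinear X m d (Tens X m d)
    (\<lambda>w. signed (Tens X m d) (koszul_exponent \<sigma> w) (Pure X (permute_list (pinv \<sigma>) w)))"
proof (rule multilinear_signed[OF tensor_module[OF X] multilinear_word[OF X pure_multilinear[OF X]]])
  show "koszul_exponent \<sigma> w = koszul_exponent \<sigma> w'" if "map fst w = map fst w'" for w w' :: "'a word"
  proof -
    have l: "length w = length w'" using that by (metis length_map)
    show ?thesis unfolding koszul_exponent_sum l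
      by (rule koszul_sum_cong) (metis that l nth_map)
  qed
  fix w i assume w: "w \<in> words X m d" and i: "i < m"
  have l: "length w = m" using w by (rule words_length)
  have p: "\<sigma> permutes {..<length w}" using \<sigma> by (simp add: l perms_def)
  have k: "\<sigma> i < m" by (rule perms_lt[OF \<sigma> i])
  \<comment> \<open>The letter at position \<open>i\<close> reappears unchanged at
    \<open>\<sigma> i\<close>; this is the position required by
    \<open>multilinear_word\<close>.\<close>
  have nth: "permute_list (pinv \<sigma>) w ! \<sigma> i = w ! i"
    using k by (simp add: permute_list_nth[OF permutes_inv[OF p]] l permutes_inverses(2)[OF p])
  show "\<exists>k<m. \<exists>l\<in>Lin (gr X (fst (w ! i))) (gr X (fst (permute_list (pinv \<sigma>) w ! k))).
     \<forall>x\<in>carrier (gr X (fst (w ! i))). permute_list (pinv \<sigma>) (w[i := (fst (w ! i), x)]) =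
       (permute_list (pinv \<sigma>) w)[k := (fst (permute_list (pinv \<sigma>) w ! k), l x)]"
    using i lin_id k by (intro exI[of _ "\<sigma> i"] conjI bexI[of _ "\<lambda>x. x"])
      (auto simp: nth permute_list_update[OF p] l)
qed (rule words_permute[OF _ perms_inv[OF \<sigma>]])

lemma tensor_perm_lin: "\<sigma> \<in> perms m \<Longrightarrow>
    tperm X m \<sigma> d \<in> Lin (Tens X m d) (Tens X m d)"
  unfolding tensor_perm_def Let_def by (rule tensor_lift_lin[OF X tensor_module[OF X] perm_multilinear])

lemma tensor_perm_pure: "\<lbrakk>\<sigma> \<in> perms m; w \<in> words X m d\<rbrakk> \<Longrightarrow> tperm X m \<sigma> d (Pure X w) =
    signed (Tens X m d) (koszul_exponent \<sigma> w) (Pure X (permute_list (pinv \<sigma>) w))"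
  unfolding tensor_perm_def Let_def by (rule tensor_lift_pure[OF X tensor_module[OF X] perm_multilinear])

lemma tensor_perm_closed: "\<lbrakk>\<sigma> \<in> perms m; \<xi> :> Tens X m d\<rbrakk> \<Longrightarrow>
    tperm X m \<sigma> d \<xi> :> Tens X m d"
  by (rule lin_closed[OF tensor_perm_lin])

lemma permuted_closed: "\<lbrakk>\<sigma> \<in> perms m; w \<in> words X m d\<rbrakk> \<Longrightarrow>
    Pure X (permute_list (pinv \<sigma>) w) :> Tens X m d"
  by (intro pure_closed[OF X] words_permute perms_inv)

lemma tensor_perm_id:
  assumes "\<xi> :> Tens X m d"
  shows "tperm X m id d \<xi> = \<xi>"
proof (rule tensor_ext[OF X tensor_module[OF X] tensor_perm_lin[OF perms_id] lin_id _ assms])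
  fix w assume w: "w \<in> words X m d"
  have "koszul_exponent id w = 0" by (simp add: koszul_exponent_sum koszul_sum_def no_nat_between)
  then show "tperm X m id d (Pure X w) = Pure X w"
    by (simp add: tensor_perm_pure[OF perms_id w] inv_id)
qed

lemma tensor_perm_comp:
  assumes \<sigma>: "\<sigma> \<in> perms m" and \<tau>: "\<tau> \<in> perms m" and \<xi>: "\<xi> :> Tens X m d"
  shows "tperm X m (\<sigma> \<circ> \<tau>) d \<xi> = tperm X m \<sigma> d (tperm X m \<tau> d \<xi>)"
proof (rule tensor_ext[OF X tensor_module[OF X] tensor_perm_lin[OF perms_comp[OF \<sigma> \<tau>]]
      lin_comp[OF tensor_perm_lin[OF \<tau>] tensor_perm_lin[OF \<sigma>]] _ \<xi>])
  note T = tensor_module[OF X, of m d]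
  fix w assume w: "w \<in> words X m d"
  have l: "length w = m" using w by (rule words_length)
  have p: "\<sigma> permutes {..<length w}" "\<tau> permutes {..<length w}" using \<sigma> \<tau> by (simp_all add: l perms_def)
  have "pinv (\<sigma> \<circ> \<tau>) = pinv \<tau> \<circ> pinv \<sigma>"
    using p by (intro o_inv_distrib permutes_bij)
  then have pl: "permute_list (pinv (\<sigma> \<circ> \<tau>)) w = permute_list (pinv \<sigma>) (permute_list (pinv \<tau>) w)"
    using permute_list_compose[OF permutes_inv[OF p(1)], of "pinv \<tau>"] by simp
  have w': "permute_list (pinv \<tau>) w \<in> words X m d" by (rule words_permute[OF w perms_inv[OF \<tau>]])
  have "even (koszul_exponent (\<sigma> \<circ> \<tau>) w) = even (koszul_exponent \<tau> w + koszul_exponent \<sigma> (permute_list (pinv \<tau>) w))"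
    by (rule even_diff_cases(1)[OF koszul_exponent_comp[OF p]])
  then have "signed (Tens X m d) (koszul_exponent (\<sigma> \<circ> \<tau>) w) y =
      signed (Tens X m d) (koszul_exponent \<tau> w + koszul_exponent \<sigma> (permute_list (pinv \<tau>) w)) y" for y
    by (rule signed_cong)
  then show "tperm X m (\<sigma> \<circ> \<tau>) d (Pure X w) =
      tperm X m \<sigma> d (tperm X m \<tau> d (Pure X w))"
    using pure_closed[OF X w'] permuted_closed[OF \<sigma> w']
    by (simp add: tensor_perm_pure[OF perms_comp[OF \<sigma> \<tau>] w] tensor_perm_pure[OF \<tau> w] tensor_perm_pure[OF \<sigma> w']
        lin_signed[OF T T tensor_perm_lin[OF \<sigma>]] pl signed_signed[OF T])
qed

text \<open>Differentiating letter \<open>i\<close> before the permutation corresponds to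
  differentiating letter \<open>\<sigma> i\<close> after it. The signs of corresponding terms agree
  by \<open>koszul_exponent_diff\<close>, and the sum is reindexed by \<sigma>.\<close>

lemma tensor_perm_diff:
  assumes \<sigma>: "\<sigma> \<in> perms m" and \<xi>: "\<xi> :> Tens X m d"
  shows "tperm X m \<sigma> (d - 1) (tdiff X m d \<xi>) = tdiff X m d (tperm X m \<sigma> d \<xi>)"
proof (rule tensor_ext[OF X tensor_module[OF X] lin_comp[OF tensor_diff_lin[OF X] tensor_perm_lin[OF \<sigma>]]
      lin_comp[OF tensor_perm_lin[OF \<sigma>] tensor_diff_lin[OF X]] _ \<xi>])
  note T = tensor_module[OF X]
  fix w assume w: "w \<in> words X m d"
  have l: "length w = m" using w by (rule words_length)
  have p: "\<sigma> permutes {..<length w}" using \<sigma> by (simp_all add: l perms_def)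
  let ?w = "permute_list (pinv \<sigma>) w" and ?N = "Tens X m (d - 1)" and ?k = "koszul_exponent \<sigma> w"
  have w': "?w \<in> words X m d" by (rule words_permute[OF w perms_inv[OF \<sigma>]])
  interpret N: module R ?N by (rule T)
  have term_cl: "signed ?N (wdeg (take i v)) (Pure X (diff_at X i v)) :> ?N"
    if "v \<in> words X m d" "i \<in> {..<m}" for v i
    using that by (intro signed_closed T pure_closed[OF X] diff_at_words[OF X]) auto
  have eq: "tperm X m \<sigma> (d - 1) (signed ?N (wdeg (take i w)) (Pure X (diff_at X i w))) =
    signed ?N ?k (signed ?N (wdeg (take (\<sigma> i) ?w)) (Pure X (diff_at X (\<sigma> i) ?w)))" if "i \<in> {..<m}" for i
  proof -
    have i: "i < m" using that by simp
    have k: "\<sigma> i < m" by (rule perms_lt[OF \<sigma> i])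
    have nth: "?w ! \<sigma> i = w ! i"
      using k by (simp add: permute_list_nth[OF permutes_inv[OF p]] l permutes_inverses(2)[OF p])
    have d: "permute_list (pinv \<sigma>) (diff_at X i w) = diff_at X (\<sigma> i) ?w"
      using i l by (simp add: diff_at_def permute_list_update[OF p] nth)
    have "even (wdeg (take i w) + koszul_exponent \<sigma> (diff_at X i w)) = even (?k + wdeg (take (\<sigma> i) ?w))"
      unfolding diff_at_def by (rule even_diff_cases(2)[OF koszul_exponent_diff[OF p]]) (simp add: i l)
    then have "signed ?N (wdeg (take i w) + koszul_exponent \<sigma> (diff_at X i w)) y = signed ?N (?k + wdeg (take (\<sigma> i) ?w)) y" for y
      by (rule signed_cong)
    then show ?thesis
      using pure_closed[OF X diff_at_words[OF X w i]] pure_closed[OF X diff_at_words[OF X w' k]]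
      by (simp add: lin_signed[OF T T tensor_perm_lin[OF \<sigma>]] tensor_perm_pure[OF \<sigma> diff_at_words[OF X w i]] d
          signed_signed[OF T])
  qed
  have "tperm X m \<sigma> (d - 1) (tdiff X m d (Pure X w)) =
    (\<Oplus>\<^bsub>?N\<^esub>i\<in>{..<m}. signed ?N ?k (signed ?N (wdeg (take (\<sigma> i) ?w)) (Pure X (diff_at X (\<sigma> i) ?w))))"
    unfolding tensor_diff_pure[OF X w]
  proof (rule trans[OF lin_finsum[OF T T tensor_perm_lin[OF \<sigma>] finite_lessThan] finsum_cong_mod[OF T eq]])
    show "signed ?N (wdeg (take i w)) (Pure X (diff_at X i w)) :> ?N" if "i \<in> {..<m}" for i
      by (rule term_cl[OF w that])
    show "signed ?N ?k (signed ?N (wdeg (take (\<sigma> i) ?w)) (Pure X (diff_at X (\<sigma> i) ?w))) :> ?N"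
      if "i \<in> {..<m}" for i
      using that by (intro signed_closed[OF T] term_cl[OF w']) (simp add: perms_lt[OF \<sigma>])
  qed
  also have "\<dots> = (\<Oplus>\<^bsub>?N\<^esub>i\<in>\<sigma> ` {..<m}. signed ?N ?k (signed ?N (wdeg (take i ?w)) (Pure X (diff_at X i ?w))))"
  proof (rule N.M.finsum_reindex[symmetric])
    show "inj_on \<sigma> {..<m}" by (rule inj_on_subset[OF permutes_inj[OF p]]) simp
    show "(\<lambda>i. signed ?N ?k (signed ?N (wdeg (take i ?w)) (Pure X (diff_at X i ?w)))) \<in> \<sigma> ` {..<m} \<rightarrow> carrier ?N"
      by (rule funcsetI, intro signed_closed[OF T] term_cl[OF w']) (auto simp: perms_lt[OF \<sigma>])
  qed
  also have "\<sigma> ` {..<m} = {..<m}" using permutes_image[OF permsD[OF \<sigma>]] .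
  also have "(\<Oplus>\<^bsub>?N\<^esub>i\<in>{..<m}. signed ?N ?k (signed ?N (wdeg (take i ?w)) (Pure X (diff_at X i ?w)))) =
      signed ?N ?k (tdiff X m d (Pure X ?w))"
    unfolding tensor_diff_pure[OF X w']
    by (rule lin_finsum[symmetric, OF T T signed_lin[OF T] finite_lessThan term_cl[OF w']])
  also have "\<dots> = tdiff X m d (tperm X m \<sigma> d (Pure X w))"
    unfolding tensor_perm_pure[OF \<sigma> w]
    by (rule lin_signed[symmetric, OF T T tensor_diff_lin[OF X] pure_closed[OF X w']])
  finally show "tperm X m \<sigma> (d - 1) (tdiff X m d (Pure X w)) =
      tdiff X m d (tperm X m \<sigma> d (Pure X w))" .
qed

lemma tensor_perm_chain: "\<sigma> \<in> perms m \<Longrightarrow> cmap (tpow X m) (tpow X m) (tperm X m \<sigma>)"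
  by (simp add: chain_map_def tensor_power_def tensor_perm_lin tensor_perm_diff)

lemma tensor_perm_concat:
  assumes \<sigma>: "\<sigma> \<in> perms m" and \<tau>: "\<tau> \<in> perms n"
    and \<xi>: "\<xi> :> Tens X m d" and \<eta>: "\<eta> :> Tens X n e"
  shows "tperm X (m + n) (perm_sum m \<sigma> \<tau>) (d + e) (tcat X m n d e \<xi> \<eta>) =
    tcat X m n d e (tperm X m \<sigma> d \<xi>) (tperm X n \<tau> e \<eta>)"
proof (rule concat_ext2[OF X tensor_module[OF X] _ _ _ _ _ \<xi> \<eta>])
  note \<rho> = perm_sum_perms[OF \<sigma> \<tau>] and T = tensor_module[OF X]
  show "(\<lambda>\<xi>. tperm X (m + n) (perm_sum m \<sigma> \<tau>) (d + e) (tcat X m n d e \<xi> \<eta>))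
      \<in> Lin (Tens X m d) (Tens X (m + n) (d + e))"
    if "\<eta> :> Tens X n e" for \<eta>
    by (rule lin_comp[OF concat_lin_left[OF X that] tensor_perm_lin[OF \<rho>(1)]])
  show "(\<lambda>\<eta>. tperm X (m + n) (perm_sum m \<sigma> \<tau>) (d + e) (tcat X m n d e \<xi> \<eta>))
      \<in> Lin (Tens X n e) (Tens X (m + n) (d + e))"
    if "\<xi> :> Tens X m d" for \<xi>
    by (rule lin_comp[OF concat_lin_right[OF X that] tensor_perm_lin[OF \<rho>(1)]])
  show "(\<lambda>\<xi>. tcat X m n d e (tperm X m \<sigma> d \<xi>) (tperm X n \<tau> e \<eta>))
      \<in> Lin (Tens X m d) (Tens X (m + n) (d + e))"
    if "\<eta> :> Tens X n e" for \<eta>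
    by (rule lin_comp[OF tensor_perm_lin[OF \<sigma>] concat_lin_left[OF X tensor_perm_closed[OF \<tau> that]]])
  show "(\<lambda>\<eta>. tcat X m n d e (tperm X m \<sigma> d \<xi>) (tperm X n \<tau> e \<eta>))
      \<in> Lin (Tens X n e) (Tens X (m + n) (d + e))"
    if "\<xi> :> Tens X m d" for \<xi>
    by (rule lin_comp[OF tensor_perm_lin[OF \<tau>] concat_lin_right[OF X tensor_perm_closed[OF \<sigma> that]]])
  fix u v assume u: "u \<in> words X m d" and v: "v \<in> words X n e"
  have l: "length u = m" "length v = n" using u v by (simp_all add: words_length)
  let ?u = "permute_list (pinv \<sigma>) u" and ?v = "permute_list (pinv \<tau>) v"
  have u': "?u \<in> words X m d" and v': "?v \<in> words X n e"
    using words_permute u v perms_inv \<sigma> \<tau> by auto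
  have pl: "permute_list (pinv (perm_sum m \<sigma> \<tau>)) (u @ v) = ?u @ ?v"
    using permute_list_perm_sum[of "pinv \<sigma>" u "pinv \<tau>" v] perms_inv[OF \<sigma>] perms_inv[OF \<tau>] by (simp add: l \<rho>(2))
  have ke: "koszul_exponent (perm_sum m \<sigma> \<tau>) (u @ v) = koszul_exponent \<sigma> u + koszul_exponent \<tau> v"
    using koszul_exponent_perm_sum[of \<sigma> u \<tau> v] \<sigma> \<tau> by (simp add: l)
  show "tperm X (m + n) (perm_sum m \<sigma> \<tau>) (d + e) (tcat X m n d e (Pure X u) (Pure X v)) =
      tcat X m n d e (tperm X m \<sigma> d (Pure X u)) (tperm X n \<tau> e (Pure X v))"
    using pure_closed[OF X u'] pure_closed[OF X v'] pure_closed[OF X words_append[OF u' v']]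
    by (simp add: concat_pure[OF X u v] tensor_perm_pure[OF \<rho>(1) words_append[OF u v]] tensor_perm_pure[OF \<sigma> u]
        tensor_perm_pure[OF \<tau> v] lin_signed[OF T T concat_lin_left[OF X]] lin_signed[OF T T concat_lin_right[OF X]]
        signed_closed[OF T] concat_pure[OF X u' v'] pl ke signed_signed[OF T] add.commute)
qed

lemma tensor_perm_swap:
  assumes \<xi>: "\<xi> :> Tens X m d" and \<eta>: "\<eta> :> Tens X n e"
  shows "tperm X (m + n) (block_swap m n) (d + e) (tcat X m n d e \<xi> \<eta>) =
    signed (Tens X (m + n) (d + e)) (d * e) (tcat X n m e d \<eta> \<xi>)"
proof (rule concat_ext2[OF X tensor_module[OF X] _ _ _ _ _ \<xi> \<eta>])
  note \<rho> = block_swap_perms[of m n] and T = tensor_module[OF X]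
  have comm: "Tens X (n + m) (e + d) = Tens X (m + n) (d + e)" by (simp add: add.commute)
  note C = concat_lin_left[OF X, of _ m d n e, unfolded comm] concat_lin_right[OF X, of _ n e m d, unfolded comm]
  show "(\<lambda>\<xi>. tperm X (m + n) (block_swap m n) (d + e) (tcat X m n d e \<xi> \<eta>))
      \<in> Lin (Tens X m d) (Tens X (m + n) (d + e))"
    if "\<eta> :> Tens X n e" for \<eta>
    by (rule lin_comp[OF concat_lin_left[OF X that] tensor_perm_lin[OF \<rho>(1)]])
  show "(\<lambda>\<eta>. tperm X (m + n) (block_swap m n) (d + e) (tcat X m n d e \<xi> \<eta>))
      \<in> Lin (Tens X n e) (Tens X (m + n) (d + e))"
    if "\<xi> :> Tens X m d" for \<xi>
    by (rule lin_comp[OF concat_lin_right[OF X that] tensor_perm_lin[OF \<rho>(1)]])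
  show "(\<lambda>\<xi>. signed (Tens X (m + n) (d + e)) (d * e) (tcat X n m e d \<eta> \<xi>))
      \<in> Lin (Tens X m d) (Tens X (m + n) (d + e))"
    if "\<eta> :> Tens X n e" for \<eta>
    by (rule signed_linf[OF T C(2)[OF that]])
  show "(\<lambda>\<eta>. signed (Tens X (m + n) (d + e)) (d * e) (tcat X n m e d \<eta> \<xi>))
      \<in> Lin (Tens X n e) (Tens X (m + n) (d + e))"
    if "\<xi> :> Tens X m d" for \<xi>
    by (rule signed_linf[OF T C(1)[OF that]])
  fix u v assume u: "u \<in> words X m d" and v: "v \<in> words X n e"
  have l: "length u = m" "length v = n" "wdeg u = d" "wdeg v = e" using u v by (simp_all add: words_length words_wdeg)
  show "tperm X (m + n) (block_swap m n) (d + e) (tcat X m n d e (Pure X u) (Pure X v)) =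
      signed (Tens X (m + n) (d + e)) (d * e) (tcat X n m e d (Pure X v) (Pure X u))"
    using permute_list_block_swap[of v u] koszul_exponent_block_swap[of u v]
    by (simp add: concat_pure[OF X u v] concat_pure[OF X v u] tensor_perm_pure[OF \<rho>(1) words_append[OF u v]] \<rho>(2) l)
qed

end

lemma tensor_map_perm:
  assumes X: "cplx X" and Y: "cplx Y"
    and f: "\<And>n. f n \<in> Lin (gr X n) (gr Y n)"
    and \<sigma>: "\<sigma> \<in> perms m" and \<xi>: "\<xi> :> Tens X m d"
  shows "tmap Y f m d (tperm X m \<sigma> d \<xi>) = tperm Y m \<sigma> d (tmap Y f m d \<xi>)"
proof (rule tensor_ext[OF X tensor_module[OF Y] lin_comp[OF tensor_perm_lin[OF X \<sigma>] tensor_map_lin[where f = f, OF X Y f]]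
      lin_comp[OF tensor_map_lin[where f = f, OF X Y f] tensor_perm_lin[OF Y \<sigma>]] _ \<xi>])
  fix w assume w: "w \<in> words X m d"
  note TX = tensor_module[OF X] and TY = tensor_module[OF Y]
  let ?f = "map (\<lambda>(n, x). (n, f n x))"
  have l: "length w = m" using w by (rule words_length)
  note w' = words_permute[OF X w perms_inv[OF \<sigma>]]
  have p: "pinv \<sigma> permutes {..<length w}" using perms_inv[OF \<sigma>] by (simp add: l perms_def)
  have 1: "permute_list (pinv \<sigma>) (?f w) = ?f (permute_list (pinv \<sigma>) w)"
    by (rule permute_list_map[OF p])
  have 2: "koszul_exponent \<sigma> (?f w) = koszul_exponent \<sigma> w"
    unfolding koszul_exponent_sum length_map by (rule koszul_sum_cong) (simp add: case_prod_unfold)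
  show "tmap Y f m d (tperm X m \<sigma> d (Pure X w)) =
    tperm Y m \<sigma> d (tmap Y f m d (Pure X w))"
    using pure_closed[OF X w']
    by (simp add: tensor_perm_pure[OF X \<sigma> w] tensor_map_pure[where f = f, OF X Y f w] tensor_map_pure[where f = f, OF X Y f w']
      tensor_perm_pure[OF Y \<sigma> words_map[where f = f, OF X Y f w]] 1 2 lin_signed[OF TX TY tensor_map_lin[where f = f, OF X Y f]])
qed

subsection \<open>Complexes of homogeneous maps\<close>

lemmas deg_simps = add_diff_eq diff_add_eq add.assoc add.commute add.left_commute

text \<open>Homogeneity without the further conditions of \<open>hom_cx\<close>. Differentials and
  Leibniz rules are established at this level, so that they apply before membership in the truncated
  complex is known, and also to homotopies that are not made extensional.\<close>

definition hom_fam :: "('k, 'a) cx \<Rightarrow> ('k, 'b) cx \<Rightarrow> int \<Rightarrow> (int \<Rightarrow> 'a \<Rightarrow> 'b) \<Rightarrow> bool" where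
  "hom_fam U V p f \<longleftrightarrow> (\<forall>d. f d \<in> Lin (gr U d) (gr V (d + p)))"

lemma hom_famD: "\<lbrakk>hom_fam U V p f; e = d + p\<rbrakk> \<Longrightarrow> f d \<in> Lin (gr U d) (gr V e)"
  by (simp add: hom_fam_def)

lemma chain_mapD:
  assumes "cmap X Y f"
  shows "f n \<in> Lin (gr X n) (gr Y n)"
    "x :> gr X n \<Longrightarrow> f (n - 1) (diff X n x) = diff Y n (f n x)"
  using assms by (auto simp: chain_map_def)

lemma chain_map_fam: "cmap U V f \<Longrightarrow> hom_fam U V 0 f"
  by (simp add: chain_map_def hom_fam_def)

lemma lin_restrict: "module R M \<Longrightarrow> (\<lambda>x\<in>carrier M. f x) \<in> Lin M N \<longleftrightarrow> f \<in> Lin M N"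
  by (auto intro: lin_cong)

lemma sign_square:
  assumes N: "module R N" and y: "y :> N"
  shows "(0[N] -[N] signed N p y) -[N] signed N (p - 1) (y -[N] 0[N]) = 0[N]"
proof -
  interpret N: module R N by (rule N)
  show ?thesis using y by (cases "even p"; simp add: signed_def; algebra)
qed

context
  fixes U :: "('k, 'a) cx" and V :: "('k, 'b) cx"
  assumes U: "cplx U" and V: "cplx V"
begin

lemma hom_carrier_iff: "f :> gr (Hom U V) p \<longleftrightarrow> hom_fam U V p f \<and>
    (\<forall>d. f d \<in> extensional (carrier (gr U d))) \<and> (p = 0 \<longrightarrow> cmap U V f) \<and>
    (p < 0 \<longrightarrow> (\<forall>d. \<forall>x\<in>carrier (gr U d). f d x = 0[gr V (d + p)]))"
  by (auto simp: hom_cx_def hom_fam_def)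

lemma hom_carrierD:
  assumes "f :> gr (Hom U V) p"
  shows "hom_fam U V p f" "f d \<in> extensional (carrier (gr U d))" "p = 0 \<Longrightarrow> cmap U V f"
    "\<lbrakk>p < 0; x :> gr U d\<rbrakk> \<Longrightarrow> f d x = 0[gr V (d + p)]"
  using assms by (auto simp: hom_carrier_iff)

lemma hom_app_lin: "\<lbrakk>f :> gr (Hom U V) p; e = d + p\<rbrakk> \<Longrightarrow> f d \<in> Lin (gr U d) (gr V e)"
  by (rule hom_famD[OF hom_carrierD(1)])

lemma hom_app_closed: "\<lbrakk>f :> gr (Hom U V) p; e = d + p; x :> gr U d\<rbrakk> \<Longrightarrow>
    f d x :> gr V e"
  by (rule lin_closed[OF hom_app_lin])

lemma hom_eqI:
  assumes "f :> gr (Hom U V) p" "g :> gr (Hom U V) p"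
    and "\<And>d x. x :> gr U d \<Longrightarrow> f d x = g d x"
  shows "f = g"
proof (rule ext)
  show "f d = g d" for d
    by (rule extensionalityI[OF hom_carrierD(2)[OF assms(1)] hom_carrierD(2)[OF assms(2)] assms(3)])
qed

text \<open>The usual way to enter \<open>hom_cx\<close>: only degree zero asks for compatibility
  with differentials, and only negative degrees ask for vanishing. In positive degrees both premises
  are void.\<close>

lemma hom_restrictI:
  assumes fam: "hom_fam U V p f" and chain: "\<And>d x. \<lbrakk>p = 0; x :> gr U d\<rbrakk> \<Longrightarrow>
      f (d - 1) (diff U d x) = diff V d (f d x)"
    and neg: "\<And>d x. \<lbrakk>p < 0; x :> gr U d\<rbrakk> \<Longrightarrow> f d x = 0[gr V (d + p)]"
  shows "(\<lambda>d. \<lambda>x\<in>carrier (gr U d). f d x) :> gr (Hom U V) p"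
  using fam chain neg lin_closed[OF cx_diff_lin[OF U]]
  by (auto simp: hom_carrier_iff hom_fam_def chain_map_def lin_restrict U)

lemma hom_app_simps:
  assumes "x :> gr U d"
  shows "0[gr (Hom U V) p] d x = 0[gr V (d + p)]"
    "(f +[gr (Hom U V) p] g) d x = f d x +[gr V (d + p)] g d x"
    "(a *[gr (Hom U V) p] f) d x = a *[gr V (d + p)] f d x"
    "diff (Hom U V) p f d x = diff V (d + p) (f d x) -[gr V (d + p - 1)]
       signed (gr V (d + p - 1)) p (f (d - 1) (diff U d x))"
  using assms by (simp_all add: hom_cx_def)

lemma hom_zero_closed: "0[gr (Hom U V) p] :> gr (Hom U V) p"
proof -
  have "(\<lambda>d. \<lambda>x\<in>carrier (gr U d). 0[gr V (d + p)]) :> gr (Hom U V) p"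
    using lin_zero[OF _ _ cx_diff_lin[OF V]] V
    by (intro hom_restrictI) (simp_all add: hom_fam_def lin_zerof)
  then show ?thesis by (simp add: hom_cx_def)
qed

lemma hom_add_closed:
  assumes f: "f :> gr (Hom U V) p" and g: "g :> gr (Hom U V) p"
  shows "f +[gr (Hom U V) p] g :> gr (Hom U V) p"
proof -
  note cl = lin_closed[OF cx_diff_lin[OF U]]
  have "(\<lambda>d. \<lambda>x\<in>carrier (gr U d). f d x +[gr V (d + p)] g d x) :> gr (Hom U V) p"
  proof (rule hom_restrictI)
    show "hom_fam U V p (\<lambda>d x. f d x +[gr V (d + p)] g d x)"
      using hom_app_lin[OF f] hom_app_lin[OF g] V by (simp add: hom_fam_def lin_addf)
    fix d x assume x: "x :> gr U d"
    { assume p: "p = 0"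
      show "f (d - 1) (diff U d x) +[gr V (d - 1 + p)] g (d - 1) (diff U d x) = diff V d (f d x +[gr V (d + p)] g d x)"
        using p x hom_app_closed[OF f _ x, of d] hom_app_closed[OF g _ x, of d]
        by (simp add: lin_add[OF cx_diff_lin[OF V]] chain_mapD(2)[OF hom_carrierD(3)[OF f p]] chain_mapD(2)[OF hom_carrierD(3)[OF g p]]) }
    { assume p: "p < 0"
      show "f d x +[gr V (d + p)] g d x = 0[gr V (d + p)]"
        using V by (simp add: hom_carrierD(4)[OF f p x] hom_carrierD(4)[OF g p x]) }
  qed
  then show ?thesis by (simp add: hom_cx_def)
qed

lemma hom_smult_closed:
  assumes f: "f :> gr (Hom U V) p" and a: "a :> R"
  shows "a *[gr (Hom U V) p] f :> gr (Hom U V) p"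
proof -
  have "(\<lambda>d. \<lambda>x\<in>carrier (gr U d). a *[gr V (d + p)] f d x) :> gr (Hom U V) p"
  proof (rule hom_restrictI)
    show "hom_fam U V p (\<lambda>d x. a *[gr V (d + p)] f d x)"
      using hom_app_lin[OF f] V a by (simp add: hom_fam_def lin_smultf)
    fix d x assume x: "x :> gr U d"
    { assume p: "p = 0"
      show "a *[gr V (d - 1 + p)] f (d - 1) (diff U d x) = diff V d (a *[gr V (d + p)] f d x)"
        using p x a hom_app_closed[OF f _ x, of d]
        by (simp add: lin_smult[OF cx_diff_lin[OF V]] chain_mapD(2)[OF hom_carrierD(3)[OF f p]]) }
    { assume p: "p < 0"
      show "a *[gr V (d + p)] f d x = 0[gr V (d + p)]"
        using V a by (simp add: hom_carrierD(4)[OF f p x]) }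
  qed
  then show ?thesis by (simp add: hom_cx_def)
qed

lemma hom_module: "module R (gr (Hom U V) p)"
proof (intro moduleI abelian_groupI)
  let ?H = "gr (Hom U V) p"
  note cl = hom_zero_closed hom_add_closed hom_smult_closed
  show "cring R" by (rule is_cring)
  show "0[?H] :> ?H" by (rule hom_zero_closed)
  fix f assume f: "f :> ?H"
  note fc = hom_app_closed[OF f refl]
  show "0[?H] +[?H] f = f" using V by (intro hom_eqI[where p = p] cl f) (simp add: hom_app_simps fc)
  show "\<one> *[?H] f = f" using V by (intro hom_eqI[where p = p] cl f) (simp_all add: hom_app_simps fc)
  show "\<exists>g\<in>carrier ?H. g +[?H] f = 0[?H]"
  proof (rule bexI)
    show n: "(\<ominus> \<one>) *[?H] f :> ?H" by (intro cl f) simp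
    show "(\<ominus> \<one>) *[?H] f +[?H] f = 0[?H]"
    proof (rule hom_eqI[OF hom_add_closed[OF n f] hom_zero_closed])
      fix d x assume x: "x :> gr U d"
      interpret M: module R "gr V (d + p)" using V by simp
      show "((\<ominus> \<one>) *[?H] f +[?H] f) d x = 0[?H] d x"
        using fc[OF x] x by (simp add: hom_app_simps M.smult_l_minus M.M.l_neg)
    qed
  qed
  fix a assume a: "a :> R"
  show "a *[?H] f :> ?H" by (intro cl f a)
  { fix b assume b: "b :> R"
    show "(a \<oplus> b) *[?H] f = a *[?H] f +[?H] b *[?H] f"
      using V by (intro hom_eqI[where p = p] cl f a b add.m_closed) (simp_all add: hom_app_simps fc a b mod_add_smult)
    show "a \<otimes> b *[?H] f = a *[?H] (b *[?H] f)"
      using V by (intro hom_eqI[where p = p] cl f a b m_closed) (simp_all add: hom_app_simps fc a b mod_mult_smult) }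
  fix g assume g: "g :> ?H"
  note gc = hom_app_closed[OF g refl]
  show "a *[?H] (f +[?H] g) = a *[?H] f +[?H] a *[?H] g"
    using V by (intro hom_eqI[where p = p] cl f g a) (simp_all add: hom_app_simps fc gc a mod_smult_add)
next
  let ?H = "gr (Hom U V) p"
  note cl = hom_zero_closed hom_add_closed hom_smult_closed
  fix f g assume f: "f :> ?H" and g: "g :> ?H"
  note fc = hom_app_closed[OF f refl] and gc = hom_app_closed[OF g refl]
  have comm: "x +[gr V n] y = y +[gr V n] x" if "x :> gr V n" "y :> gr V n" for x y n
    using that abelian_monoid.a_comm[OF abelian_group.axioms(1)[OF mod_abelian_group[OF cx_module[OF V]]]] by blast
  show "f +[?H] g :> ?H" by (rule cl(2)[OF f g])
  show "f +[?H] g = g +[?H] f"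
    by (intro hom_eqI[where p = p] cl f g) (simp_all add: hom_app_simps comm fc gc)
  fix h assume h: "h :> ?H"
  show "f +[?H] g +[?H] h = f +[?H] (g +[?H] h)"
    using V by (intro hom_eqI[where p = p] cl f g h) (simp_all add: hom_app_simps mod_assoc fc gc hom_app_closed[OF h refl])
qed

lemma hom_eval_lin: "x :> gr U d \<Longrightarrow> e = d + p \<Longrightarrow>
    (\<lambda>f. f d x) \<in> Lin (gr (Hom U V) p) (gr V e)"
  by (auto intro!: linI simp: hom_app_simps hom_app_closed)

lemma hom_linI:
  assumes M: "module R M" and F: "\<And>y. y :> M \<Longrightarrow> F y :> gr (Hom U V) p"
    and l: "\<And>d x. x :> gr U d \<Longrightarrow> (\<lambda>y. F y d x) \<in> Lin M (gr V (d + p))"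
  shows "F \<in> Lin M (gr (Hom U V) p)"
proof (rule linI)
  fix y assume y: "y :> M"
  show "F y :> gr (Hom U V) p" by (rule F[OF y])
  { fix a assume a: "a :> R"
    show "F (a *[M] y) = a *[gr (Hom U V) p] F y"
      using M y a by (intro hom_eqI[where p = p] F hom_smult_closed) (auto simp: hom_app_simps lin_smult[OF l]) }
  fix z assume z: "z :> M"
  show "F (y +[M] z) = F y +[gr (Hom U V) p] F z"
    using M y z by (intro hom_eqI[where p = p] F hom_add_closed) (auto simp: hom_app_simps lin_add[OF l])
qed

lemma hom_signed_app: "\<lbrakk>f :> gr (Hom U V) p; x :> gr U d; e = d + p\<rbrakk> \<Longrightarrow>
    signed (gr (Hom U V) p) s f d x = signed (gr V e) s (f d x)"
  using lin_signed[OF hom_module cx_module[OF V] hom_eval_lin] by blast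

lemma hom_diff_fam: "hom_fam U V p f \<Longrightarrow> hom_fam U V (p - 1) (diff (Hom U V) p f)"
proof -
  assume f: "hom_fam U V p f"
  have "(\<lambda>x. diff V (d + p) (f d x) -[gr V (d + p - 1)] signed (gr V (d + p - 1)) p (f (d - 1) (diff U d x)))
    \<in> Lin (gr U d) (gr V (d + p - 1))" for d
    by (intro lin_minusf signed_linf lin_comp[OF hom_famD[OF f] cx_diff_lin[OF V]]
        lin_comp[OF cx_diff_lin[OF U] hom_famD[OF f]] cx_module[OF V]) simp_all
  then show ?thesis
    by (simp add: hom_fam_def hom_cx_def lin_restrict U add_diff_eq)
qed

text \<open>Chain maps are the degree zero cycles of the untruncated complex of homogeneous maps.
  This is why \<open>hom_cx\<close> is its truncation to nonnegative degrees.\<close>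

lemma hom_diff_zero_iff_chain:
  assumes f: "hom_fam U V 0 f" and x: "x :> gr U d"
  shows "diff (Hom U V) 0 f d x = 0[gr V (d - 1)] \<longleftrightarrow> f (d - 1) (diff U d x) = diff V d (f d x)"
proof -
  have 1: "f (d - 1) (diff U d x) :> gr V (d - 1)"
    by (rule lin_closed[OF hom_famD[OF f] lin_closed[OF cx_diff_lin[OF U] x]]) simp
  have 2: "diff V d (f d x) :> gr V (d - 1)"
    by (rule lin_closed[OF cx_diff_lin[OF V] lin_closed[OF hom_famD[OF f] x]]) simp
  show ?thesis
    using mod_minus_eq_zero_iff[OF cx_module[OF V] 2 1] x by (auto simp: hom_app_simps)
qed

lemma hom_diff_diff_app:
  assumes f: "hom_fam U V p f" and x: "x :> gr U d"
  shows "diff (Hom U V) (p - 1) (diff (Hom U V) p f) d x = 0[gr V (d + p - 2)]"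
proof -
  let ?N = "gr V (d + p - 2)"
  note T = cx_module[OF V]
  have ar: "d + p - 1 - 1 = d + p - 2" "d - 1 + p = d + p - 1" "d + (p - 1) = d + p - 1" "d - 1 + p - 1 = d + p - 2"
    "d - 1 - 1 + p = d + p - 2" "d - 1 - 1 = d - 2"
    by simp_all
  have dx: "diff U d x :> gr U (d - 1)" by (rule lin_closed[OF cx_diff_lin[OF U] x])
  have fx: "f d x :> gr V (d + p)" by (rule lin_closed[OF hom_famD[OF f refl] x])
  have fdx: "f (d - 1) (diff U d x) :> gr V (d + p - 1)"
    by (rule lin_closed[OF hom_famD[OF f] dx]) simp
  note dV = cx_diff_lin[OF V]
  note DV = dV[of "d + p - 1", unfolded ar]
  have y: "diff V (d + p - 1) (f (d - 1) (diff U d x)) :> ?N" (is "?y \<in> _")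
    by (rule lin_closed[OF DV fdx])
  have dd: "f (d - 2) (diff U (d - 1) (diff U d x)) = 0[?N]"
    using lin_zero[OF cx_module[OF U] T hom_famD[OF f, of "d + p - 2" "d - 2"]] cx_diff_diff[OF U x] by simp
  have "diff (Hom U V) (p - 1) (diff (Hom U V) p f) d x =
     diff V (d + p - 1) (diff V (d + p) (f d x) -[gr V (d + p - 1)] signed (gr V (d + p - 1)) p (f (d - 1) (diff U d x)))
     -[?N] signed ?N (p - 1) (diff V (d + p - 1) (f (d - 1) (diff U d x)) -[?N] signed ?N p (f (d - 2) (diff U (d - 1) (diff U d x))))"
    using x dx by (simp add: hom_app_simps ar)
  also have "\<dots> = (0[?N] -[?N] signed ?N p ?y) -[?N] signed ?N (p - 1) (?y -[?N] 0[?N])"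
    using fdx y lin_closed[OF dV fx] cx_diff_diff[OF V fx] T
    by (simp add: dd lin_minus[OF T T DV] lin_signed[OF T T DV])
  also have "\<dots> = 0[?N]"
    by (rule sign_square[OF T y])
  finally show ?thesis .
qed

text \<open>Only the edge of the truncation requires an argument. Out of degree one, the result is a
  chain map since the differential squares to zero; out of degree zero, the result vanishes since
  the argument is a chain map.\<close>

lemma hom_diff_closed:
  assumes f: "f :> gr (Hom U V) p"
  shows "diff (Hom U V) p f :> gr (Hom U V) (p - 1)"
proof -
  note fam = hom_diff_fam[OF hom_carrierD(1)[OF f]]
  have "diff (Hom U V) p f d \<in> extensional (carrier (gr U d))" for d
    by (simp add: hom_cx_def)
  moreover have "cmap U V (diff (Hom U V) p f)" if p: "p - 1 = 0"
  proof -
    have p': "p = 1" using p by simp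
    have "diff (Hom U V) 0 (diff (Hom U V) p f) d x = 0[gr V (d - 1)]" if "x :> gr U d" for d x
      using hom_diff_diff_app[OF hom_carrierD(1)[OF f] that] by (simp add: p')
    then show ?thesis
      using fam hom_diff_zero_iff_chain[of "diff (Hom U V) p f"] by (simp add: chain_map_def p' hom_fam_def)
  qed
  moreover have "diff (Hom U V) p f d x = 0[gr V (d + (p - 1))]" if p: "p - 1 < 0" and x: "x :> gr U d" for d x
  proof (cases "p = 0")
    case True
    then show ?thesis using hom_diff_zero_iff_chain[of f x d] x hom_carrierD(1,3)[OF f] by (auto simp: chain_map_def)
  next
    case False
    then have p: "p < 0" using p by simp
    have dx: "diff U d x :> gr U (d - 1)" by (rule lin_closed[OF cx_diff_lin[OF U] x])
    have e: "d - 1 + p = d + p - 1" by simp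
    show ?thesis
      using hom_carrierD(4)[OF f p x] hom_carrierD(4)[OF f p dx] V lin_zero[OF _ _ cx_diff_lin[OF V, of "d + p"]] x
      by (simp add: hom_app_simps add_diff_eq mod_minus_eq_zero_iff e)
  qed
  ultimately show ?thesis using fam by (simp add: hom_carrier_iff)
qed

lemma hom_diff_lin: "diff (Hom U V) p \<in> Lin (gr (Hom U V) p) (gr (Hom U V) (p - 1))"
proof (rule hom_linI[OF hom_module hom_diff_closed])
  fix d x assume x: "x :> gr U d"
  have "(\<lambda>f. diff V (d + p) (f d x) -[gr V (d + p - 1)] signed (gr V (d + p - 1)) p (f (d - 1) (diff U d x)))
     \<in> Lin (gr (Hom U V) p) (gr V (d + p - 1))"
    by (intro lin_minusf signed_linf lin_comp[OF hom_eval_lin[OF x] cx_diff_lin[OF V]]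
        hom_eval_lin[OF lin_closed[OF cx_diff_lin[OF U] x]] cx_module[OF V]) simp_all
  then show "(\<lambda>f. diff (Hom U V) p f d x) \<in> Lin (gr (Hom U V) p) (gr V (d + (p - 1)))"
    using x by (simp add: hom_app_simps add_diff_eq)
qed

lemma hom_complex: "cplx (Hom U V)"
proof (rule chain_complex.intro)
  fix n
  show "module R (gr (Hom U V) n)" by (rule hom_module)
  show "diff (Hom U V) n \<in> Lin (gr (Hom U V) n) (gr (Hom U V) (n - 1))"
    by (rule hom_diff_lin)
  { assume n: "n < 0"
    have "f = 0[gr (Hom U V) n]" if f: "f :> gr (Hom U V) n" for f
      by (rule hom_eqI[OF f hom_zero_closed]) (simp add: hom_app_simps hom_carrierD(4)[OF f n])
    then show "carrier (gr (Hom U V) n) = {0[gr (Hom U V) n]}" using hom_zero_closed by blast }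
  fix f assume f: "f :> gr (Hom U V) n"
  have "n - 1 - 1 = n - 2" by simp
  then have cl: "diff (Hom U V) (n - 1) (diff (Hom U V) n f) :> gr (Hom U V) (n - 2)"
    using hom_diff_closed[OF hom_diff_closed[OF f]] by simp
  show "diff (Hom U V) (n - 1) (diff (Hom U V) n f) = 0[gr (Hom U V) (n - 2)]"
    by (rule hom_eqI[OF cl hom_zero_closed], subst hom_diff_diff_app[OF hom_carrierD(1)[OF f]])
      (simp_all add: hom_app_simps(1) add_diff_eq)
qed

end

text \<open>No sign appears, because \<open>s\<close> has degree zero. With a permutation for
  \<open>s\<close> this is the left action, with a tensor power of a map it is one half of a
  conjugation; \<open>hom_precomp\<close> supplies the right action and the other half.\<close>

lemma hom_postcomp:
  assumes U: "cplx U" and V: "cplx V" and W: "cplx W" and s: "cmap V W s"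
  shows "cmap (Hom U V) (Hom U W) (\<lambda>p f d. \<lambda>x\<in>carrier (gr U d). s (d + p) (f d x))"
proof -
  note sl = chain_mapD(1)[OF s] and sd = chain_mapD(2)[OF s]
  have cl: "(\<lambda>d. \<lambda>x\<in>carrier (gr U d). s (d + p) (f d x)) :> gr (Hom U W) p"
    if f: "f :> gr (Hom U V) p" for p f
  proof (rule hom_restrictI[OF U W])
    note fl = hom_app_lin[OF U V f] and fc = hom_app_closed[OF U V f]
    show "hom_fam U W p (\<lambda>d x. s (d + p) (f d x))"
      unfolding hom_fam_def by (auto intro: lin_comp[OF fl[OF refl] sl])
    fix d x assume x: "x :> gr U d"
    { assume p: "p = 0"
      show "s (d - 1 + p) (f (d - 1) (diff U d x)) = diff W d (s (d + p) (f d x))"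
        using chain_mapD(2)[OF hom_carrierD(3)[OF U V f p] x] sd[OF fc[OF _ x], of d] by (simp add: p) }
    { assume p: "p < 0"
      show "s (d + p) (f d x) = 0[gr W (d + p)]"
        using hom_carrierD(4)[OF U V f p x] lin_zero[OF cx_module[OF V] cx_module[OF W] sl] by simp }
  qed
  show ?thesis
    unfolding chain_map_def
  proof (intro allI conjI ballI)
    fix p
    show "(\<lambda>f d. \<lambda>x\<in>carrier (gr U d). s (d + p) (f d x)) \<in> Lin (gr (Hom U V) p) (gr (Hom U W) p)"
      by (rule hom_linI[OF U W hom_module[OF U V] cl])
        (auto intro: lin_comp[OF hom_eval_lin[OF U V _ refl] sl])
    fix f assume f: "f :> gr (Hom U V) p"
    note fc = hom_app_closed[OF U V f] and df = hom_diff_closed[OF U V f]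
    show "(\<lambda>d. \<lambda>x\<in>carrier (gr U d). s (d + (p - 1)) (diff (Hom U V) p f d x)) =
        diff (Hom U W) p (\<lambda>d. \<lambda>x\<in>carrier (gr U d). s (d + p) (f d x))"
    proof (rule hom_eqI[OF U W cl[OF df] hom_diff_closed[OF U W cl[OF f]]])
      fix d x assume x: "x :> gr U d"
      have dx: "diff U d x :> gr U (d - 1)" by (rule lin_closed[OF cx_diff_lin[OF U] x])
      have c1: "f (d - 1) (diff U d x) :> gr V (d + p - 1)" by (rule fc[OF _ dx]) simp
      have c2: "diff V (d + p) (f d x) :> gr V (d + p - 1)"
        by (rule lin_closed[OF cx_diff_lin[OF V] fc[OF refl x]])
      note T = cx_module[OF V] cx_module[OF W]
      show "(\<lambda>d. \<lambda>x\<in>carrier (gr U d). s (d + (p - 1)) (diff (Hom U V) p f d x)) d x =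
        diff (Hom U W) p (\<lambda>d. \<lambda>x\<in>carrier (gr U d). s (d + p) (f d x)) d x"
        using x dx c1 c2 sd[OF fc[OF refl x]]
        by (simp add: hom_app_simps[OF U V] hom_app_simps[OF U W] add_diff_eq diff_add_eq lin_minus[OF T sl] lin_signed[OF T sl] signed_closed[OF T(1)])
    qed
  qed
qed

lemma hom_precomp:
  assumes U: "cplx U" and V: "cplx V" and W: "cplx W" and s: "cmap W U s"
  shows "cmap (Hom U V) (Hom W V) (\<lambda>p f d. \<lambda>x\<in>carrier (gr W d). f d (s d x))"
proof -
  note sl = chain_mapD(1)[OF s] and sd = chain_mapD(2)[OF s]
  note sc = lin_closed[OF sl]
  have cl: "(\<lambda>d. \<lambda>x\<in>carrier (gr W d). f d (s d x)) :> gr (Hom W V) p"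
    if f: "f :> gr (Hom U V) p" for p f
  proof (rule hom_restrictI[OF W V])
    note fl = hom_app_lin[OF U V f] and fc = hom_app_closed[OF U V f]
    show "hom_fam W V p (\<lambda>d x. f d (s d x))"
      unfolding hom_fam_def by (auto intro: lin_comp[OF sl fl[OF refl]])
    fix d x assume x: "x :> gr W d"
    { assume p: "p = 0"
      show "f (d - 1) (s (d - 1) (diff W d x)) = diff V d (f d (s d x))"
        using chain_mapD(2)[OF hom_carrierD(3)[OF U V f p] sc[OF x]] sd[OF x] by simp }
    { assume p: "p < 0"
      show "f d (s d x) = 0[gr V (d + p)]"
        by (rule hom_carrierD(4)[OF U V f p sc[OF x]]) }
  qed
  show ?thesis
    unfolding chain_map_def
  proof (intro allI conjI ballI)
    fix p
    show "(\<lambda>f d. \<lambda>x\<in>carrier (gr W d). f d (s d x)) \<in> Lin (gr (Hom U V) p) (gr (Hom W V) p)"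
    proof (rule hom_linI[OF W V hom_module[OF U V] cl])
      fix d x assume x: "x :> gr W d"
      then show "(\<lambda>f. (\<lambda>x\<in>carrier (gr W d). f d (s d x)) x) \<in> Lin (gr (Hom U V) p) (gr V (d + p))"
        using hom_eval_lin[OF U V sc[OF x] refl] by simp
    qed
    fix f assume f: "f :> gr (Hom U V) p"
    show "(\<lambda>d. \<lambda>x\<in>carrier (gr W d). diff (Hom U V) p f d (s d x)) =
        diff (Hom W V) p (\<lambda>d. \<lambda>x\<in>carrier (gr W d). f d (s d x))"
    proof (rule hom_eqI[OF W V cl[OF hom_diff_closed[OF U V f]] hom_diff_closed[OF W V cl[OF f]]])
      fix d x assume x: "x :> gr W d"
      have dx: "diff W d x :> gr W (d - 1)" by (rule lin_closed[OF cx_diff_lin[OF W] x])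
      show "(\<lambda>d. \<lambda>x\<in>carrier (gr W d). diff (Hom U V) p f d (s d x)) d x =
        diff (Hom W V) p (\<lambda>d. \<lambda>x\<in>carrier (gr W d). f d (s d x)) d x"
        using x dx sc[OF x] sd[OF x] by (simp add: hom_app_simps[OF U V] hom_app_simps[OF W V])
    qed
  qed
qed

text \<open>The formula of \<open>vert\<close> in \<open>End_prop\<close>, for arbitrary complexes
  in place of tensor powers.\<close>

definition hom_comp :: "('k, 'a) cx \<Rightarrow> int \<Rightarrow> int \<Rightarrow> (int \<Rightarrow> 'b \<Rightarrow> 'c) \<Rightarrow> (int \<Rightarrow> 'a \<Rightarrow> 'b) \<Rightarrow> int \<Rightarrow> 'a \<Rightarrow> 'c" where
  "hom_comp U p q f g = (\<lambda>d. \<lambda>x\<in>carrier (gr U d). f (d + q) (g d x))"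

lemma hom_comp_closed:
  assumes U: "cplx U" and V: "cplx V" and W: "cplx W"
    and f: "f :> gr (Hom V W) p" and g: "g :> gr (Hom U V) q"
  shows "hom_comp U p q f g :> gr (Hom U W) (p + q)"
  unfolding hom_comp_def
proof (rule hom_restrictI[OF U W])
  note gl = hom_app_lin[OF U V g] and gc = hom_app_closed[OF U V g refl]
  have fl: "f (d + q) \<in> Lin (gr V (d + q)) (gr W (d + (p + q)))" for d
    by (rule hom_app_lin[OF V W f]) simp
  show "hom_fam U W (p + q) (\<lambda>d x. f (d + q) (g d x))"
    unfolding hom_fam_def by (auto intro: lin_comp[OF gl[OF refl] fl])
  fix d x assume x: "x :> gr U d"
  have neg: "f (d + q) (g d x) = 0[gr W (d + (p + q))]" if n: "p < 0 \<or> q < 0" and x: "x :> gr U d" for d x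
    using n
  proof
    assume "p < 0"
    then show ?thesis using hom_carrierD(4)[OF V W f _ gc[OF x]] by (simp add: deg_simps)
  next
    assume "q < 0"
    then show ?thesis
      using hom_carrierD(4)[OF U V g _ x] lin_zero[OF cx_module[OF V] cx_module[OF W] fl] by simp
  qed
  show "p + q < 0 \<Longrightarrow> f (d + q) (g d x) = 0[gr W (d + (p + q))]"
    using x by (intro neg) auto
  assume pq: "p + q = 0"
  show "f (d - 1 + q) (g (d - 1) (diff U d x)) = diff W d (f (d + q) (g d x))"
  \<comment> \<open>If the degrees add up to zero, either both vanish and two chain maps are
    composed, or one of them is negative and everything is zero.\<close>
  proof (cases "p = 0")
    case True
    then have z: "p = 0" "q = 0" using pq by auto
    show ?thesis
      using chain_mapD(2)[OF hom_carrierD(3)[OF V W f z(1)] gc[OF x]] chain_mapD(2)[OF hom_carrierD(3)[OF U V g z(2)] x]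
      by (simp add: z)
  next
    case False
    then have n: "p < 0 \<or> q < 0" using pq by linarith
    have dx: "diff U d x :> gr U (d - 1)" by (rule lin_closed[OF cx_diff_lin[OF U] x])
    show ?thesis
      using neg[OF n x] neg[OF n dx] lin_zero[OF cx_module[OF W] cx_module[OF W] cx_diff_lin[OF W, of d]] by (simp add: pq)
  qed
qed

lemma hom_comp_app: "x :> gr U d \<Longrightarrow> hom_comp U p q f g d x = f (d + q) (g d x)"
  by (simp add: hom_comp_def)

text \<open>\<open>b\<close> is the term in which the differential stands between the two maps. It
  is subtracted and added again, with the sign \<open>p\<close>, to separate the contributions of
  the two factors.\<close>

lemma leibniz_signs:
  assumes N: "module R N" and "a :> N" "b :> N" "c :> N"
  shows "a -[N] signed N (p + q) c = (a -[N] signed N p b) +[N] signed N p (b -[N] signed N q c)"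
proof -
  interpret N: module R N by (rule N)
  show ?thesis
    using assms(2-) by (cases "even p"; cases "even q"; simp add: signed_def; algebra)
qed

lemma hom_comp_bilinear:
  assumes U: "cplx U" and V: "cplx V" and W: "cplx W"
  shows "dg_bilinear R (Hom V W) (Hom U V) (Hom U W) (hom_comp U)"
  unfolding dg_bilinear_def
proof (intro allI conjI ballI)
  fix p q
  note cl = hom_comp_closed[OF U V W]
  show "hom_comp U p q f \<in> Lin (gr (Hom U V) q) (gr (Hom U W) (p + q))"
    if f: "f :> gr (Hom V W) p" for f
  proof (rule hom_linI[OF U W hom_module[OF U V] cl[OF f]])
    fix d x assume x: "x :> gr U d"
    show "(\<lambda>g. hom_comp U p q f g d x) \<in> Lin (gr (Hom U V) q) (gr W (d + (p + q)))"
      using lin_comp[OF hom_eval_lin[OF U V x refl] hom_app_lin[OF V W f], of "d + (p + q)"]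
      by (simp add: hom_comp_app[OF x])
  qed
  show "(\<lambda>f. hom_comp U p q f g) \<in> Lin (gr (Hom V W) p) (gr (Hom U W) (p + q))"
    if g: "g :> gr (Hom U V) q" for g
  proof (rule hom_linI[OF U W hom_module[OF V W] cl[OF _ g]])
    fix d x assume x: "x :> gr U d"
    show "(\<lambda>f. hom_comp U p q f g d x) \<in> Lin (gr (Hom V W) p) (gr W (d + (p + q)))"
      using hom_eval_lin[OF V W hom_app_closed[OF U V g refl x], of "d + (p + q)" p]
      by (simp add: hom_comp_app[OF x])
  qed
  fix f g assume f: "f :> gr (Hom V W) p" and g: "g :> gr (Hom U V) q"
  note df = hom_diff_closed[OF V W f] and dg = hom_diff_closed[OF U V g]
  let ?H = "gr (Hom U W) (p + q - 1)"
  have c1: "hom_comp U (p - 1) q (diff (Hom V W) p f) g :> ?H"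
    using cl[OF df g] by (simp add: diff_add_eq)
  have c2: "hom_comp U p (q - 1) f (diff (Hom U V) q g) :> ?H"
    using cl[OF f dg] by (simp add: add_diff_eq)
  note H = hom_module[OF U W]
  show "diff (Hom U W) (p + q) (hom_comp U p q f g) =
     hom_comp U (p - 1) q (diff (Hom V W) p f) g +[?H] signed ?H p (hom_comp U p (q - 1) f (diff (Hom U V) q g))"
  proof (rule hom_eqI[OF U W hom_diff_closed[OF U W cl[OF f g]] mod_add_closed[OF H c1 signed_closed[OF H c2]]])
    fix d x assume x: "x :> gr U d"
    let ?N = "gr W (d + p + q - 1)"
    note TV = cx_module[OF V] and TW = cx_module[OF W]
    have dx: "diff U d x :> gr U (d - 1)" by (rule lin_closed[OF cx_diff_lin[OF U] x])
    have gx: "g d x :> gr V (d + q)" by (rule hom_app_closed[OF U V g refl x])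
    have gdx: "g (d - 1) (diff U d x) :> gr V (d + q - 1)" by (rule hom_app_closed[OF U V g _ dx]) simp
    have dgx: "diff V (d + q) (g d x) :> gr V (d + q - 1)" by (rule lin_closed[OF cx_diff_lin[OF V] gx])
    have fl: "f (d + q - 1) \<in> Lin (gr V (d + q - 1)) ?N" by (rule hom_app_lin[OF V W f]) simp
    have a: "diff W (d + p + q) (f (d + q) (g d x)) :> ?N" 
      by (rule lin_closed[OF cx_diff_lin[OF W] hom_app_closed[OF V W f _ gx]]) simp
    have e: "d + (p + q - 1) = d + p + q - 1" "d + (p + q) = d + p + q" "d + q + p = d + p + q" "d + (q - 1) = d + q - 1" "d - 1 + q = d + q - 1"
      "d + p + q = p + (q + d)" by simp_all
    have "diff (Hom U W) (p + q) (hom_comp U p q f g) d x =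
       diff W (d + p + q) (f (d + q) (g d x)) -[?N] signed ?N (p + q) (f (d + q - 1) (g (d - 1) (diff U d x)))"
      using x dx by (simp add: hom_app_simps[OF U W] hom_comp_app e(2,5))
    also have "\<dots> = (diff W (d + p + q) (f (d + q) (g d x)) -[?N] signed ?N p (f (d + q - 1) (diff V (d + q) (g d x))))
        +[?N] signed ?N p (f (d + q - 1) (diff V (d + q) (g d x)) -[?N] signed ?N q (f (d + q - 1) (g (d - 1) (diff U d x))))"
      by (rule leibniz_signs[OF TW a lin_closed[OF fl dgx] lin_closed[OF fl gdx]])
    also have "f (d + q - 1) (diff V (d + q) (g d x)) -[?N] signed ?N q (f (d + q - 1) (g (d - 1) (diff U d x))) =
       hom_comp U p (q - 1) f (diff (Hom U V) q g) d x"
      using x dgx gdx by (simp add: hom_comp_app hom_app_simps[OF U V] e(4) lin_minus[OF TV TW fl] lin_signed[OF TV TW fl] signed_closed[OF TV])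
    also have "diff W (d + p + q) (f (d + q) (g d x)) -[?N] signed ?N p (f (d + q - 1) (diff V (d + q) (g d x))) =
       hom_comp U (p - 1) q (diff (Hom V W) p f) g d x"
      using x gx by (simp add: hom_comp_app hom_app_simps[OF V W] e(3))
    also have "signed ?N p (hom_comp U p (q - 1) f (diff (Hom U V) q g) d x) =
        signed ?H p (hom_comp U p (q - 1) f (diff (Hom U V) q g)) d x"
      by (rule hom_signed_app[OF U W c2 x, symmetric]) simp
    finally show "diff (Hom U W) (p + q) (hom_comp U p q f g) d x =
      (hom_comp U (p - 1) q (diff (Hom V W) p f) g +[?H] signed ?H p (hom_comp U p (q - 1) f (diff (Hom U V) q g))) d x"
      using x by (simp add: hom_app_simps[OF U W] e(1))
  qed
qed

subsection \<open>The endomorphism prop\<close>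

lemma tensor_power_simps [simp]: "gr (tpow X m) = Tens X m"
  "diff (tpow X m) = tdiff X m"
  by (simp_all add: tensor_power_def)

lemma multilinear_cong:
  assumes g: "multilinear X m d N g" and X: "cplx X" and eq: "\<And>w. w \<in> words X m d \<Longrightarrow> h w = g w"
  shows "multilinear X m d N h"
proof (rule multilinearI)
  fix w assume w: "w \<in> words X m d"
  show "h w :> N" using multilinear_closed[OF g w] by (simp add: eq w)
  fix i assume i: "i < m"
  show "(\<lambda>x. h (w[i := (fst (w ! i), x)])) \<in> Lin (gr X (fst (w ! i))) N"
    by (rule lin_cong[OF multilinear_lin[OF g w i]]) (simp_all add: eq words_update_same[OF w i] X)
qed

text \<open>A letter lies in one of the two halves of the word, so it suffices to have
  multilinearity in each half with the other one fixed, in all possible degrees.\<close>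

lemma multilinear_split:
  assumes F1: "\<And>a b v. \<lbrakk>a + b = D; v \<in> words X l b\<rbrakk> \<Longrightarrow> multilinear X k a N (\<lambda>u. F u v)"
    and F2: "\<And>a b u. \<lbrakk>a + b = D; u \<in> words X k a\<rbrakk> \<Longrightarrow> multilinear X l b N (F u)"
  shows "multilinear X (k + l) D N (\<lambda>w. F (take k w) (drop k w))"
proof (rule multilinearI)
  fix w assume "w \<in> words X (k + l) D"
  then obtain u v where w: "w = u @ v" "u \<in> words X k (wdeg u)" "v \<in> words X l (wdeg v)" "wdeg u + wdeg v = D"
    by (rule words_split)
  have l: "length u = k" "length v = l" using w by (simp_all add: words_length)
  show "F (take k w) (drop k w) :> N"
    using multilinear_closed[OF F1[OF w(4,3)] w(2)] by (simp add: w(1) l)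
  fix i assume i: "i < k + l"
  show "(\<lambda>x. F (take k (w[i := (fst (w ! i), x)])) (drop k (w[i := (fst (w ! i), x)]))) \<in> Lin (gr X (fst (w ! i))) N"
  proof (cases "i < k")
    case True
    then show ?thesis
      using multilinear_lin[OF F1[OF w(4,3)] w(2) True] by (simp add: w(1) l list_update_append nth_append)
  next
    case False
    then have "i - k < l" using i by simp
    then show ?thesis
      using multilinear_lin[OF F2[OF w(4,2)] w(3), of "i - k"] False by (simp add: w(1) l list_update_append nth_append)
  qed
qed

context
  fixes X :: "('k, 'a) cx"
  assumes X: "cplx X"
begin

abbreviation "TP \<equiv> tpow X"
abbreviation "TM \<equiv> Tens X"
abbreviation "cc \<equiv> tcat X"
abbreviation "hz \<equiv> horiz (End X)"

lemma TP_complex: "cplx (TP m)"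
  by (rule tensor_power_complex[OF X])

lemma TM_module: "module R (TM m d)"
  by (rule tensor_module[OF X])

lemma TP_fam: "\<lbrakk>hom_fam (TP k) (TP m) p f; b = a + p\<rbrakk> \<Longrightarrow> f a \<in> Lin (TM k a) (TM m b)"
  using hom_famD[of "TP k" "TP m" p f b a] by simp

lemma TP_fam_closed: "\<lbrakk>hom_fam (TP k) (TP m) p f; b = a + p; \<xi> :> TM k a\<rbrakk> \<Longrightarrow> f a \<xi> :> TM m b"
  by (rule lin_closed[OF TP_fam])

lemma concat_lin_left': "\<lbrakk>\<eta> :> TM n e; D = d + e\<rbrakk> \<Longrightarrow>
    (\<lambda>\<xi>. cc m n d e \<xi> \<eta>) \<in> Lin (TM m d) (TM (m + n) D)"
  by (simp add: concat_lin_left[OF X])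

lemma concat_lin_right': "\<lbrakk>\<xi> :> TM m d; D = d + e\<rbrakk> \<Longrightarrow>
    cc m n d e \<xi> \<in> Lin (TM n e) (TM (m + n) D)"
  by (simp add: concat_lin_right[OF X])

lemma concat_closed': "\<lbrakk>\<xi> :> TM m d; \<eta> :> TM n e; D = d + e\<rbrakk> \<Longrightarrow>
    cc m n d e \<xi> \<eta> :> TM (m + n) D"
  by (simp add: concat_closed[OF X])

section \<open>The horizontal product of homogeneous maps\<close>

context
  fixes k m l n p q f g
  assumes f: "hom_fam (TP k) (TP m) p f" and g: "hom_fam (TP l) (TP n) q g"
begin

lemma horiz_multilinear: "multilinear X (k + l) d (TM (m + n) (d + p + q)) (\<lambda>w. let u = take k w; v = drop k w in
          signed (TM (m + n) (d + p + q)) (q * wdeg u)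
            (cc m n (wdeg u + p) (wdeg v + q) (f (wdeg u) (Pure X u)) (g (wdeg v) (Pure X v))))"
  unfolding Let_def
proof (rule multilinear_split)
  let ?N = "TM (m + n) (d + p + q)"
  fix a b assume d: "a + b = d"
  then have e: "d + p + q = a + p + (b + q)" by simp
  { fix v assume v: "v \<in> words X l b"
    have gv: "g b (Pure X v) :> TM n (b + q)"
      by (rule TP_fam_closed[OF g refl pure_closed[OF X v]])
    have "multilinear X k a ?N (\<lambda>u. signed ?N (q * a) (cc m n (a + p) (b + q) (f a (Pure X u)) (g b (Pure X v))))"
      by (rule multilinear_lincomp[OF pure_multilinear[OF X]
            signed_linf[OF TM_module lin_comp[OF TP_fam[OF f refl] concat_lin_left'[OF gv e]]]])
    then show "multilinear X k a ?N (\<lambda>u. signed ?N (q * wdeg u) (cc m n (wdeg u + p) (wdeg v + q)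
        (f (wdeg u) (Pure X u)) (g (wdeg v) (Pure X v))))"
      by (rule multilinear_cong[OF _ X]) (simp add: words_wdeg words_wdeg[OF v]) }
  { fix u assume u: "u \<in> words X k a"
    have fu: "f a (Pure X u) :> TM m (a + p)"
      by (rule TP_fam_closed[OF f refl pure_closed[OF X u]])
    have "multilinear X l b ?N (\<lambda>v. signed ?N (q * a) (cc m n (a + p) (b + q) (f a (Pure X u)) (g b (Pure X v))))"
      by (rule multilinear_lincomp[OF pure_multilinear[OF X]
            signed_linf[OF TM_module lin_comp[OF TP_fam[OF g refl] concat_lin_right'[OF fu e]]]])
    then show "multilinear X l b ?N (\<lambda>v. signed ?N (q * wdeg u) (cc m n (wdeg u + p) (wdeg v + q)
        (f (wdeg u) (Pure X u)) (g (wdeg v) (Pure X v))))"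
      by (rule multilinear_cong[OF _ X]) (simp add: words_wdeg words_wdeg[OF u]) }
qed

lemma horiz_app: "x :> TM (k + l) d \<Longrightarrow> hz k m l n p q f g d x =
  tlift (TM (m + n) (d + p + q)) (\<lambda>w. let u = take k w; v = drop k w in
          signed (TM (m + n) (d + p + q)) (q * wdeg u)
            (cc m n (wdeg u + p) (wdeg v + q) (f (wdeg u) (Pure X u)) (g (wdeg v) (Pure X v)))) x"
  by (simp add: End_prop_def Let_def)

lemma horiz_lin:
  assumes e: "e = d + p + q"
  shows "hz k m l n p q f g d \<in> Lin (TM (k + l) d) (TM (m + n) e)"
  unfolding e
  by (rule lin_cong[OF tensor_lift_lin[OF X TM_module horiz_multilinear]]) (rule horiz_app TM_module, assumption?)+

lemma horiz_fam: "hom_fam (TP (k + l)) (TP (m + n)) (p + q) (hz k m l n p q f g)"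
  by (simp add: hom_fam_def horiz_lin add.assoc)

lemma horiz_ext: "hz k m l n p q f g d \<in> extensional (carrier (TM (k + l) d))"
  by (simp add: End_prop_def)

text \<open>This formula characterises the horizontal product and replaces its definition from here
  on. The sign comes from moving \<open>g\<close>, of degree \<open>q\<close>, past \<xi>, of degree
  \<open>a\<close>. The degrees \<open>d\<close> and \<open>e\<close> are separate variables so that
  the rule matches sums bracketed in any way.\<close>

lemma horiz_concat:
  assumes \<xi>: "\<xi> :> TM k a" and \<eta>: "\<eta> :> TM l b" and d: "d = a + b" and e: "e = d + p + q"
  shows "hz k m l n p q f g d (cc k l a b \<xi> \<eta>) = signed (TM (m + n) e) (q * a) (cc m n (a + p) (b + q) (f a \<xi>) (g b \<eta>))"
proof (rule concat_ext2[OF X TM_module[of "m + n" e] _ _ _ _ _ \<xi> \<eta>])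
  have e': "e = a + p + (b + q)" using d e by simp
  show "(\<lambda>\<xi>. hz k m l n p q f g d (cc k l a b \<xi> \<eta>)) \<in> Lin (TM k a) (TM (m + n) e)"
    if "\<eta> :> TM l b" for \<eta>
    by (rule lin_comp[OF concat_lin_left'[OF that d] horiz_lin[OF e]])
  show "(\<lambda>\<eta>. hz k m l n p q f g d (cc k l a b \<xi> \<eta>)) \<in> Lin (TM l b) (TM (m + n) e)"
    if "\<xi> :> TM k a" for \<xi>
    by (rule lin_comp[OF concat_lin_right'[OF that d] horiz_lin[OF e]])
  show "(\<lambda>\<xi>. signed (TM (m + n) e) (q * a) (cc m n (a + p) (b + q) (f a \<xi>) (g b \<eta>))) \<in> Lin (TM k a) (TM (m + n) e)"
    if "\<eta> :> TM l b" for \<eta>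
    by (rule signed_linf[OF TM_module lin_comp[OF TP_fam[OF f refl] concat_lin_left'[OF TP_fam_closed[OF g refl that] e']]])
  show "(\<lambda>\<eta>. signed (TM (m + n) e) (q * a) (cc m n (a + p) (b + q) (f a \<xi>) (g b \<eta>))) \<in> Lin (TM l b) (TM (m + n) e)"
    if "\<xi> :> TM k a" for \<xi>
    by (rule signed_linf[OF TM_module lin_comp[OF TP_fam[OF g refl] concat_lin_right'[OF TP_fam_closed[OF f refl that] e']]])
  fix u v assume u: "u \<in> words X k a" and v: "v \<in> words X l b"
  have uv: "u @ v \<in> words X (k + l) d" using words_append[OF u v] by (simp add: d)
  show "hz k m l n p q f g d (cc k l a b (Pure X u) (Pure X v)) =
    signed (TM (m + n) e) (q * a) (cc m n (a + p) (b + q) (f a (Pure X u)) (g b (Pure X v)))"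
    unfolding concat_pure[OF X u v] horiz_app[OF pure_closed[OF X uv]]
      tensor_lift_pure[OF X TM_module horiz_multilinear uv]
    by (simp add: words_length[OF u] words_wdeg[OF u] words_wdeg[OF v] e)
qed

end

text \<open>The sign identity in the Leibniz rule for the horizontal product. \<open>A\<close> and
  \<open>B\<close> stand for the terms in which the differential comes after \<open>f\<close> or
  \<open>g\<close>, \<open>C\<close> and \<open>D\<close> for those in which it acts first, on \<xi>
  or \<eta>.\<close>

lemma horiz_signs:
  assumes N: "module R N" and "A :> N" "B :> N" "C :> N" "D :> N"
  shows "signed N (q * a) (A +[N] signed N (a + p) B) -[N]
      signed N (p + q) (signed N (q * (a - 1)) C +[N] signed N a (signed N (q * a) D)) =
    signed N (q * a) (A -[N] signed N p C) +[N] signed N p (signed N ((q - 1) * a) (B -[N] signed N q D))"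
proof -
  interpret N: module R N by (rule N)
  show ?thesis
    using assms(2-) by (cases "even p"; cases "even q"; cases "even a"; simp add: signed_def; algebra)
qed

text \<open>Stated for families and on product tensors, because closure of \<open>hom_cx\<close>
  under the horizontal product is deduced from it, and because homotopies on tensor powers are built
  by applying it to families outside \<open>hom_cx\<close>.\<close>

lemma horiz_diff_concat:
  assumes f: "hom_fam (TP k) (TP m) p f" and g: "hom_fam (TP l) (TP n) q g"
    and \<xi>: "\<xi> :> TM k a" and \<eta>: "\<eta> :> TM l b" and d: "d = a + b" and e: "e = d + p + q - 1"
  shows "diff (Hom (TP (k + l)) (TP (m + n))) (p + q) (hz k m l n p q f g) d (cc k l a b \<xi> \<eta>) =
    hz k m l n (p - 1) q (diff (Hom (TP k) (TP m)) p f) g d (cc k l a b \<xi> \<eta>) +[TM (m + n) e]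
    signed (TM (m + n) e) p (hz k m l n p (q - 1) f (diff (Hom (TP l) (TP n)) q g) d (cc k l a b \<xi> \<eta>))"
proof -
  let ?N = "TM (m + n) e"
  note T = TM_module
  have df: "hom_fam (TP k) (TP m) (p - 1) (diff (Hom (TP k) (TP m)) p f)"
    by (rule hom_diff_fam[OF TP_complex TP_complex f])
  have dg: "hom_fam (TP l) (TP n) (q - 1) (diff (Hom (TP l) (TP n)) q g)"
    by (rule hom_diff_fam[OF TP_complex TP_complex g])
  have d\<xi>: "tdiff X k a \<xi> :> TM k (a - 1)" and d\<eta>: "tdiff X l b \<eta> :> TM l (b - 1)"
    by (rule tensor_diff_closed[OF X \<xi>], rule tensor_diff_closed[OF X \<eta>])
  have fc: "f a \<xi> :> TM m (a + p)" "f (a - 1) (tdiff X k a \<xi>) :> TM m (a + p - 1)"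
    "tdiff X m (a + p) (f a \<xi>) :> TM m (a + p - 1)"
    by (rule TP_fam_closed[OF f refl \<xi>], rule TP_fam_closed[OF f _ d\<xi>], simp,
        rule tensor_diff_closed[OF X TP_fam_closed[OF f refl \<xi>]])
  have gc: "g b \<eta> :> TM n (b + q)" "g (b - 1) (tdiff X l b \<eta>) :> TM n (b + q - 1)"
    "tdiff X n (b + q) (g b \<eta>) :> TM n (b + q - 1)"
    by (rule TP_fam_closed[OF g refl \<eta>], rule TP_fam_closed[OF g _ d\<eta>], simp,
        rule tensor_diff_closed[OF X TP_fam_closed[OF g refl \<eta>]])
  have ee: "e = a + p - 1 + (b + q)" "e = a + p + (b + q - 1)" using d e by simp_all
  define A where "A = cc m n (a + p - 1) (b + q) (tdiff X m (a + p) (f a \<xi>)) (g b \<eta>)"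
  define B where "B = cc m n (a + p) (b + q - 1) (f a \<xi>) (tdiff X n (b + q) (g b \<eta>))"
  define C where "C = cc m n (a + p - 1) (b + q) (f (a - 1) (tdiff X k a \<xi>)) (g b \<eta>)"
  define D where "D = cc m n (a + p) (b + q - 1) (f a \<xi>) (g (b - 1) (tdiff X l b \<eta>))"
  have cl: "A :> ?N" "B :> ?N" "C :> ?N" "D :> ?N"
    unfolding A_def B_def C_def D_def by (intro concat_closed' fc gc ee)+
  have x: "cc k l a b \<xi> \<eta> :> TM (k + l) d" by (rule concat_closed'[OF \<xi> \<eta> d])
  have hx: "hz k m l n p q f g d (cc k l a b \<xi> \<eta>) = signed (TM (m + n) (d + p + q)) (q * a) (cc m n (a + p) (b + q) (f a \<xi>) (g b \<eta>))"
    by (rule horiz_concat[OF f g \<xi> \<eta> d refl])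
  have c0: "cc m n (a + p) (b + q) (f a \<xi>) (g b \<eta>) :> TM (m + n) (d + p + q)"
    by (rule concat_closed'[OF fc(1) gc(1)]) (simp add: d)
  have dl: "tdiff X (m + n) (d + p + q) \<in> Lin (TM (m + n) (d + p + q)) ?N"
    unfolding e by (rule tensor_diff_lin[OF X])
  have dd: "tdiff X (m + n) (d + p + q) (cc m n (a + p) (b + q) (f a \<xi>) (g b \<eta>)) = A +[?N] signed ?N (a + p) B"
    using tensor_diff_concat[OF X fc(1) gc(1)] unfolding A_def B_def by (simp add: d e deg_simps)
  have 1: "tdiff X (m + n) (d + p + q) (hz k m l n p q f g d (cc k l a b \<xi> \<eta>)) =
      signed ?N (q * a) (A +[?N] signed ?N (a + p) B)"
    unfolding hx by (simp add: lin_signed[OF T T dl c0] dd)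
  have hl: "hz k m l n p q f g (d - 1) \<in> Lin (TM (k + l) (d - 1)) ?N"
    by (rule horiz_lin[OF f g]) (simp add: e)
  have c2: "cc k l (a - 1) b (tdiff X k a \<xi>) \<eta> :> TM (k + l) (d - 1)"
    "cc k l a (b - 1) \<xi> (tdiff X l b \<eta>) :> TM (k + l) (d - 1)"
    by (rule concat_closed'[OF d\<xi> \<eta>], simp add: d, rule concat_closed'[OF \<xi> d\<eta>], simp add: d)
  have dc: "tdiff X (k + l) d (cc k l a b \<xi> \<eta>) = cc k l (a - 1) b (tdiff X k a \<xi>) \<eta> +[TM (k + l) (d - 1)]
      signed (TM (k + l) (d - 1)) a (cc k l a (b - 1) \<xi> (tdiff X l b \<eta>))"
    using tensor_diff_concat[OF X \<xi> \<eta>] by (simp add: d)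
  have h1: "hz k m l n p q f g (d - 1) (cc k l (a - 1) b (tdiff X k a \<xi>) \<eta>) = signed ?N (q * (a - 1)) C"
    using horiz_concat[OF f g d\<xi> \<eta>, of "d - 1" e] by (simp add: d e C_def diff_add_eq)
  have h2: "hz k m l n p q f g (d - 1) (cc k l a (b - 1) \<xi> (tdiff X l b \<eta>)) = signed ?N (q * a) D"
    using horiz_concat[OF f g \<xi> d\<eta>, of "d - 1" e] by (simp add: d e D_def diff_add_eq)
  have 2: "hz k m l n p q f g (d - 1) (tdiff X (k + l) d (cc k l a b \<xi> \<eta>)) =
      signed ?N (q * (a - 1)) C +[?N] signed ?N a (signed ?N (q * a) D)"
    unfolding dc by (simp add: lin_add[OF hl] lin_signed[OF T T hl] c2 signed_closed[OF T] h1 h2)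
  have e3: "d + (p + q) = d + p + q" "d + (p + q) - 1 = e" "d + p + q - 1 = e" by (simp_all add: e)
  have L: "diff (Hom (TP (k + l)) (TP (m + n))) (p + q) (hz k m l n p q f g) d (cc k l a b \<xi> \<eta>) =
     signed ?N (q * a) (A +[?N] signed ?N (a + p) B) -[?N]
      signed ?N (p + q) (signed ?N (q * (a - 1)) C +[?N] signed ?N a (signed ?N (q * a) D))"
    using hom_app_simps(4)[OF TP_complex TP_complex, of "cc k l a b \<xi> \<eta>" "k + l" d "m + n" "p + q" "hz k m l n p q f g"] x
    by (simp add: e3 1 2)
  have dfa: "diff (Hom (TP k) (TP m)) p f a \<xi> = tdiff X m (a + p) (f a \<xi>) -[TM m (a + p - 1)]
      signed (TM m (a + p - 1)) p (f (a - 1) (tdiff X k a \<xi>))"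
    using hom_app_simps(4)[OF TP_complex TP_complex, of \<xi> k a m p f] \<xi> by simp
  have dgb: "diff (Hom (TP l) (TP n)) q g b \<eta> = tdiff X n (b + q) (g b \<eta>) -[TM n (b + q - 1)]
      signed (TM n (b + q - 1)) q (g (b - 1) (tdiff X l b \<eta>))"
    using hom_app_simps(4)[OF TP_complex TP_complex, of \<eta> l b n q g] \<eta> by simp
  have r1: "hz k m l n (p - 1) q (diff (Hom (TP k) (TP m)) p f) g d (cc k l a b \<xi> \<eta>) =
      signed ?N (q * a) (A -[?N] signed ?N p C)"
  proof -
    note cl = concat_lin_left'[OF gc(1) ee(1), of m]
    have "hz k m l n (p - 1) q (diff (Hom (TP k) (TP m)) p f) g d (cc k l a b \<xi> \<eta>) =
      signed ?N (q * a) (cc m n (a + p - 1) (b + q) (diff (Hom (TP k) (TP m)) p f a \<xi>) (g b \<eta>))"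
      using horiz_concat[OF df g \<xi> \<eta> d, of e] by (simp add: e add_diff_eq)
    then show ?thesis
      unfolding dfa A_def C_def
      by (simp add: lin_minus[OF T T cl] lin_signed[OF T T cl] fc signed_closed[OF T])
  qed
  have r2: "hz k m l n p (q - 1) f (diff (Hom (TP l) (TP n)) q g) d (cc k l a b \<xi> \<eta>) =
      signed ?N ((q - 1) * a) (B -[?N] signed ?N q D)"
  proof -
    note cl = concat_lin_right'[OF fc(1) ee(2), of n]
    have "hz k m l n p (q - 1) f (diff (Hom (TP l) (TP n)) q g) d (cc k l a b \<xi> \<eta>) =
      signed ?N ((q - 1) * a) (cc m n (a + p) (b + q - 1) (f a \<xi>) (diff (Hom (TP l) (TP n)) q g b \<eta>))"
      using horiz_concat[OF f dg \<xi> \<eta> d, of e] by (simp add: e add_diff_eq)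
    then show ?thesis
      unfolding dgb B_def D_def
      by (simp add: lin_minus[OF T T cl] lin_signed[OF T T cl] gc signed_closed[OF T])
  qed
  show ?thesis unfolding L r1 r2 by (rule horiz_signs[OF T cl])
qed

lemma horiz_zero:
  assumes f: "hom_fam (TP k) (TP m) p f" and g: "hom_fam (TP l) (TP n) q g"
    and z: "(\<forall>a. \<forall>\<xi>\<in>carrier (TM k a). f a \<xi> = 0[TM m (a + p)]) \<or> (\<forall>b. \<forall>\<eta>\<in>carrier (TM l b). g b \<eta> = 0[TM n (b + q)])"
    and x: "x :> TM (k + l) d" and e: "e = d + p + q"
  shows "hz k m l n p q f g d x = 0[TM (m + n) e]"
proof (rule concat_ext[OF X TM_module horiz_lin[OF f g e] lin_zerof[OF TM_module] _ x])
  fix a b \<xi> \<eta> assume d: "a + b = d" and \<xi>: "\<xi> :> TM k a" and \<eta>: "\<eta> :> TM l b"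
  have e': "e = a + p + (b + q)" using d e by simp
  have "cc m n (a + p) (b + q) (f a \<xi>) (g b \<eta>) = 0[TM (m + n) e]"
    using z
  proof
    assume "\<forall>a. \<forall>\<xi>\<in>carrier (TM k a). f a \<xi> = 0[TM m (a + p)]"
    then show ?thesis
      using lin_zero[OF TM_module TM_module concat_lin_left'[OF TP_fam_closed[OF g refl \<eta>] e']] \<xi> by simp
  next
    assume "\<forall>b. \<forall>\<eta>\<in>carrier (TM l b). g b \<eta> = 0[TM n (b + q)]"
    then show ?thesis
      using lin_zero[OF TM_module TM_module concat_lin_right'[OF TP_fam_closed[OF f refl \<xi>] e']] \<eta> by simp
  qed
  then show "hz k m l n p q f g d (cc k l a b \<xi> \<eta>) = 0[TM (m + n) e]"
    by (simp add: horiz_concat[OF f g \<xi> \<eta> d[symmetric] e] TM_module)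
qed

abbreviation "EH m n p \<equiv> gr (Hom (TP m) (TP n)) p"

lemma EH_module: "module R (EH m n p)"
  by (rule hom_module[OF TP_complex TP_complex])

lemma EH_fam: "f :> EH m n p \<Longrightarrow> hom_fam (TP m) (TP n) p f"
  by (rule hom_carrierD(1)[OF TP_complex TP_complex])

lemma EH_app: "\<lbrakk>f :> EH m n p; \<xi> :> TM m d; e = d + p\<rbrakk> \<Longrightarrow> f d \<xi> :> TM n e"
  using TP_fam_closed[OF EH_fam] by blast

lemma EH_lin: "\<lbrakk>f :> EH m n p; e = d + p\<rbrakk> \<Longrightarrow> f d \<in> Lin (TM m d) (TM n e)"
  using TP_fam[OF EH_fam] by blast

lemma EH_simps:
  assumes "x :> TM m d"
  shows "0[EH m n p] d x = 0[TM n (d + p)]"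
    "(f +[EH m n p] g) d x = f d x +[TM n (d + p)] g d x"
    "(a *[EH m n p] f) d x = a *[TM n (d + p)] f d x"
    "diff (Hom (TP m) (TP n)) p f d x = tdiff X n (d + p) (f d x) -[TM n (d + p - 1)]
       signed (TM n (d + p - 1)) p (f (d - 1) (tdiff X m d x))"
  using hom_app_simps[OF TP_complex TP_complex, of x m d n] assms by simp_all

lemma EH_signed: "\<lbrakk>f :> EH m n p; x :> TM m d; e = d + p\<rbrakk> \<Longrightarrow>
    signed (EH m n p) s f d x = signed (TM n e) s (f d x)"
  using hom_signed_app[OF TP_complex TP_complex, of f m n p x d e] by simp

lemma EH_eqI:
  assumes "f :> EH m n p" "g :> EH m n p" "\<And>d x. x :> TM m d \<Longrightarrow> f d x = g d x"
  shows "f = g"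
  using hom_eqI[OF TP_complex TP_complex assms(1,2)] assms(3) by simp

text \<open>The test by which the prop axioms involving horizontal products are verified: the inputs
  are divided into two groups, where \<open>horiz_concat\<close> can be evaluated.\<close>

lemma EH_concat_eqI:
  assumes f: "f :> EH (k + l) n p" and g: "g :> EH (k + l) n p"
    and eq: "\<And>a b \<xi> \<eta>. \<lbrakk>\<xi> :> TM k a; \<eta> :> TM l b; cc k l a b \<xi> \<eta> :> TM (k + l) (a + b)\<rbrakk> \<Longrightarrow>
      f (a + b) (cc k l a b \<xi> \<eta>) = g (a + b) (cc k l a b \<xi> \<eta>)"
  shows "f = g"
proof (rule EH_eqI[OF f g])
  show "f d x = g d x" if "x :> TM (k + l) d" for d x
    using eq concat_closed'[OF _ _ refl] by (intro concat_ext[OF X TM_module EH_lin[OF f refl] EH_lin[OF g refl] _ that]) blast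
qed

lemma horiz_closed:
  assumes f: "f :> EH k m p" and g: "g :> EH l n q"
  shows "hz k m l n p q f g :> EH (k + l) (m + n) (p + q)"
proof -
  note ff = EH_fam[OF f] and gf = EH_fam[OF g]
  have neg: "hz k m l n p q f g d x = 0[TM (m + n) (d + (p + q))]" if "p < 0 \<or> q < 0" "x :> TM (k + l) d" for d x
    using that hom_carrierD(4)[OF TP_complex TP_complex f] hom_carrierD(4)[OF TP_complex TP_complex g]
    by (intro horiz_zero[OF ff gf]) auto
  have "cmap (TP (k + l)) (TP (m + n)) (hz k m l n p q f g)" if pq: "p + q = 0"
  proof -
    have fam0: "hom_fam (TP (k + l)) (TP (m + n)) 0 (hz k m l n p q f g)" using horiz_fam[OF ff gf] pq by simp
    have "diff (Hom (TP (k + l)) (TP (m + n))) 0 (hz k m l n p q f g) d x = 0[TM (m + n) (d - 1)]"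
      if x: "x :> TM (k + l) d" for d x
    \<comment> \<open>The same alternative as for composition: both factors are chain maps, and the
      Leibniz rule shows that their product is one, or one factor is zero for reasons of
      degree.\<close>
    proof (cases "p = 0")
      case True
      then have z: "p = 0" "q = 0" using pq by auto
      have df: "diff (Hom (TP k) (TP m)) p f a \<xi> = 0[TM m (a + (p - 1))]" if "\<xi> :> TM k a" for a \<xi>
        using hom_diff_zero_iff_chain[OF TP_complex TP_complex, of k m f \<xi> a] ff
          chain_mapD(2)[OF hom_carrierD(3)[OF TP_complex TP_complex f z(1)], of \<xi> a] that by (simp add: z)
      have dg: "diff (Hom (TP l) (TP n)) q g b \<eta> = 0[TM n (b + (q - 1))]" if "\<eta> :> TM l b" for b \<eta>
        using hom_diff_zero_iff_chain[OF TP_complex TP_complex, of l n g \<eta> b] gf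
          chain_mapD(2)[OF hom_carrierD(3)[OF TP_complex TP_complex g z(2)], of \<eta> b] that by (simp add: z)
      note dff = hom_diff_fam[OF TP_complex TP_complex ff] and dgf = hom_diff_fam[OF TP_complex TP_complex gf]
      have dl: "diff (Hom (TP (k + l)) (TP (m + n))) 0 (hz k m l n p q f g) d \<in> Lin (TM (k + l) d) (TM (m + n) (d - 1))"
        using hom_famD[OF hom_diff_fam[OF TP_complex TP_complex fam0], of "d - 1" d] by simp
      show ?thesis
      proof (rule concat_ext[OF X TM_module dl lin_zerof[OF TM_module] _ x])
        fix a b \<xi> \<eta> assume d: "a + b = d" and \<xi>: "\<xi> :> TM k a" and \<eta>: "\<eta> :> TM l b"
        have x: "cc k l a b \<xi> \<eta> :> TM (k + l) d" by (rule concat_closed'[OF \<xi> \<eta> d[symmetric]])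
        have e: "d - 1 = d + p + q - 1" "d - 1 = d + (p - 1) + q" "d - 1 = d + p + (q - 1)" by (simp_all add: z)
        have pq0: "p + q = 0" by (simp add: z)
        show "diff (Hom (TP (k + l)) (TP (m + n))) 0 (hz k m l n p q f g) d (cc k l a b \<xi> \<eta>) = 0[TM (m + n) (d - 1)]"
          using horiz_diff_concat[OF ff gf \<xi> \<eta> d[symmetric] e(1)] df dg
            horiz_zero[OF dff gf _ x e(2)] horiz_zero[OF ff dgf _ x e(3)] TM_module
          unfolding pq0 by simp
      qed
    next
      case False
      then have n: "p < 0 \<or> q < 0" using pq by linarith
      have dx: "tdiff X (k + l) d x :> TM (k + l) (d - 1)" by (rule tensor_diff_closed[OF X x])
      show ?thesis
        using neg[OF n x] neg[OF n dx] x lin_zero[OF TM_module TM_module tensor_diff_lin[OF X], of "m + n" d]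
        by (simp add: EH_simps pq TM_module mod_minus_eq_zero_iff)
    qed
    then show ?thesis
      using hom_diff_zero_iff_chain[OF TP_complex TP_complex fam0] horiz_lin[OF ff gf] pq
      by (simp add: chain_map_def add.assoc)
  qed
  moreover have "hz k m l n p q f g d x = 0[TM (m + n) (d + (p + q))]" if "p + q < 0" "x :> TM (k + l) d" for d x
    using that by (intro neg) auto
  ultimately show ?thesis
    using horiz_fam[OF ff gf] horiz_ext[OF ff gf] by (simp add: hom_carrier_iff[OF TP_complex TP_complex])
qed

section \<open>The axioms of a prop for the endomorphism prop\<close>

lemma End_simps:
  "ops (End X) m n = Hom (TP m) (TP n)"
  "lact (End X) m n \<sigma> p f = (\<lambda>d. \<lambda>\<xi>\<in>carrier (TM m d). tperm X n \<sigma> (d + p) (f d \<xi>))"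
  "ract (End X) m n \<sigma> p f = (\<lambda>d. \<lambda>\<xi>\<in>carrier (TM m d). f d (tperm X m \<sigma> d \<xi>))"
  "vert (End X) n k m = hom_comp (TP n)"
  "punit (End X) n = (\<lambda>d. \<lambda>\<xi>\<in>carrier (TM n d). \<xi>)"
  by (simp_all add: End_prop_def hom_comp_def fun_eq_iff)

lemma lact_chain: "\<sigma> \<in> perms n \<Longrightarrow>
    cmap (Hom (TP m) (TP n)) (Hom (TP m) (TP n)) (lact (End X) m n \<sigma>)"
  using hom_postcomp[OF TP_complex TP_complex TP_complex tensor_perm_chain[OF X], of \<sigma> n m] by (simp add: End_prop_def)

lemma ract_chain: "\<sigma> \<in> perms m \<Longrightarrow>
    cmap (Hom (TP m) (TP n)) (Hom (TP m) (TP n)) (ract (End X) m n \<sigma>)"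
  using hom_precomp[OF TP_complex TP_complex TP_complex tensor_perm_chain[OF X], of \<sigma> m n] by (simp add: End_prop_def)

lemma lact_closed: "\<lbrakk>\<sigma> \<in> perms n; f :> EH m n p\<rbrakk> \<Longrightarrow> lact (End X) m n \<sigma> p f :> EH m n p"
  by (rule lin_closed[OF chain_mapD(1)[OF lact_chain]])

lemma ract_closed: "\<lbrakk>\<sigma> \<in> perms m; f :> EH m n p\<rbrakk> \<Longrightarrow> ract (End X) m n \<sigma> p f :> EH m n p"
  by (rule lin_closed[OF chain_mapD(1)[OF ract_chain]])

lemma lact_app: "\<lbrakk>\<xi> :> TM m d; e = d + p\<rbrakk> \<Longrightarrow>
    lact (End X) m n \<sigma> p f d \<xi> = tperm X n \<sigma> e (f d \<xi>)"
  by (simp add: End_simps)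

lemma ract_app: "\<xi> :> TM m d \<Longrightarrow>
    ract (End X) m n \<sigma> p f d \<xi> = f d (tperm X m \<sigma> d \<xi>)"
  by (simp add: End_simps)

lemma vert_closed: "\<lbrakk>f :> EH k m p; g :> EH n k q\<rbrakk> \<Longrightarrow>
    hom_comp (TP n) p q f g :> EH n m (p + q)"
  by (rule hom_comp_closed[OF TP_complex TP_complex TP_complex])

lemma vert_app: "\<lbrakk>\<xi> :> TM n d; e = d + q\<rbrakk> \<Longrightarrow> hom_comp (TP n) p q f g d \<xi> = f e (g d \<xi>)"
  by (simp add: hom_comp_def)

lemma unit_closed: "(\<lambda>d. \<lambda>\<xi>\<in>carrier (TM n d). \<xi>) :> EH n n 0"
  using hom_restrictI[OF TP_complex TP_complex, of n n 0 "\<lambda>d x. x"] by (simp add: hom_fam_def lin_id)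

lemma horiz_app_concat:
  assumes "f :> EH k m p" "g :> EH l n q" "\<xi> :> TM k a" "\<eta> :> TM l b"
    "d = a + b" "e = d + p + q" "a' = a + p" "b' = b + q"
  shows "hz k m l n p q f g d (cc k l a b \<xi> \<eta>) = signed (TM (m + n) e) (q * a) (cc m n a' b' (f a \<xi>) (g b \<eta>))"
  unfolding assms(7,8) by (rule horiz_concat[OF EH_fam[OF assms(1)] EH_fam[OF assms(2)] assms(3-6)])

lemma perm_closed: "\<lbrakk>\<sigma> \<in> perms m; \<xi> :> TM m d\<rbrakk> \<Longrightarrow> tperm X m \<sigma> d \<xi> :> TM m d"
  by (rule tensor_perm_closed[OF X])

lemma horiz_bilinear_End: "dg_bilinear R (Hom (TP k) (TP m)) (Hom (TP l) (TP n))
    (Hom (TP (k + l)) (TP (m + n))) (hz k m l n)"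
  unfolding dg_bilinear_def
proof (intro allI conjI ballI)
  fix p q
  note T = TM_module and EH = EH_module
  let ?N = "\<lambda>a b. TM (m + n) (a + b + (p + q))"
  have e: "a + b + (p + q) = a + b + p + q" "a + b + (p + q) = a + p + (b + q)" for a b by simp_all
  show "hz k m l n p q f \<in> Lin (EH l n q) (EH (k + l) (m + n) (p + q))" if f: "f :> EH k m p" for f
  proof (rule linI)
    fix g assume g: "g :> EH l n q"
    show "hz k m l n p q f g :> EH (k + l) (m + n) (p + q)" by (rule horiz_closed[OF f g])
    { fix c assume c: "c :> R"
      note cg = mod_smult_closed[OF EH c g]
      show "hz k m l n p q f (c *[EH l n q] g) = c *[EH (k + l) (m + n) (p + q)] hz k m l n p q f g"
      proof (rule EH_concat_eqI[OF horiz_closed[OF f cg] mod_smult_closed[OF EH c horiz_closed[OF f g]]])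
        fix a b \<xi> \<eta> assume \<xi>: "\<xi> :> TM k a" and \<eta>: "\<eta> :> TM l b" and x: "cc k l a b \<xi> \<eta> :> TM (k + l) (a + b)"
        note cl = signed_linf[OF T concat_lin_right'[OF EH_app[OF f \<xi> refl] e(2)]]
        show "hz k m l n p q f (c *[EH l n q] g) (a + b) (cc k l a b \<xi> \<eta>) =
          (c *[EH (k + l) (m + n) (p + q)] hz k m l n p q f g) (a + b) (cc k l a b \<xi> \<eta>)"
          using lin_smult[OF cl c EH_app[OF g \<eta> refl], of "q * a"]
          by (simp add: EH_simps x \<eta> horiz_app_concat[OF f cg \<xi> \<eta> refl e(1) refl refl] horiz_app_concat[OF f g \<xi> \<eta> refl e(1) refl refl])
      qed }
    fix g' assume g': "g' :> EH l n q"
    note gg = mod_add_closed[OF EH g g']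
    show "hz k m l n p q f (g +[EH l n q] g') = hz k m l n p q f g +[EH (k + l) (m + n) (p + q)] hz k m l n p q f g'"
    proof (rule EH_concat_eqI[OF horiz_closed[OF f gg] mod_add_closed[OF EH horiz_closed[OF f g] horiz_closed[OF f g']]])
      fix a b \<xi> \<eta> assume \<xi>: "\<xi> :> TM k a" and \<eta>: "\<eta> :> TM l b" and x: "cc k l a b \<xi> \<eta> :> TM (k + l) (a + b)"
      note cl = signed_linf[OF T concat_lin_right'[OF EH_app[OF f \<xi> refl] e(2)]]
      show "hz k m l n p q f (g +[EH l n q] g') (a + b) (cc k l a b \<xi> \<eta>) =
        (hz k m l n p q f g +[EH (k + l) (m + n) (p + q)] hz k m l n p q f g') (a + b) (cc k l a b \<xi> \<eta>)"
        using lin_add[OF cl EH_app[OF g \<eta> refl] EH_app[OF g' \<eta> refl], of "q * a"]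
        by (simp add: EH_simps x \<eta> horiz_app_concat[OF f gg \<xi> \<eta> refl e(1) refl refl] horiz_app_concat[OF f g \<xi> \<eta> refl e(1) refl refl]
            horiz_app_concat[OF f g' \<xi> \<eta> refl e(1) refl refl])
    qed
  qed
  show "(\<lambda>f. hz k m l n p q f g) \<in> Lin (EH k m p) (EH (k + l) (m + n) (p + q))" if g: "g :> EH l n q" for g
  proof (rule linI)
    fix f assume f: "f :> EH k m p"
    show "hz k m l n p q f g :> EH (k + l) (m + n) (p + q)" by (rule horiz_closed[OF f g])
    { fix c assume c: "c :> R"
      note cf = mod_smult_closed[OF EH c f]
      show "hz k m l n p q (c *[EH k m p] f) g = c *[EH (k + l) (m + n) (p + q)] hz k m l n p q f g"
      proof (rule EH_concat_eqI[OF horiz_closed[OF cf g] mod_smult_closed[OF EH c horiz_closed[OF f g]]])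
        fix a b \<xi> \<eta> assume \<xi>: "\<xi> :> TM k a" and \<eta>: "\<eta> :> TM l b" and x: "cc k l a b \<xi> \<eta> :> TM (k + l) (a + b)"
        note cl = signed_linf[OF T concat_lin_left'[OF EH_app[OF g \<eta> refl] e(2)]]
        show "hz k m l n p q (c *[EH k m p] f) g (a + b) (cc k l a b \<xi> \<eta>) =
          (c *[EH (k + l) (m + n) (p + q)] hz k m l n p q f g) (a + b) (cc k l a b \<xi> \<eta>)"
          using lin_smult[OF cl c EH_app[OF f \<xi> refl], of "q * a"]
          by (simp add: EH_simps x \<xi> horiz_app_concat[OF cf g \<xi> \<eta> refl e(1) refl refl] horiz_app_concat[OF f g \<xi> \<eta> refl e(1) refl refl])
      qed }
    fix f' assume f': "f' :> EH k m p"
    note ff = mod_add_closed[OF EH f f']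
    show "hz k m l n p q (f +[EH k m p] f') g = hz k m l n p q f g +[EH (k + l) (m + n) (p + q)] hz k m l n p q f' g"
    proof (rule EH_concat_eqI[OF horiz_closed[OF ff g] mod_add_closed[OF EH horiz_closed[OF f g] horiz_closed[OF f' g]]])
      fix a b \<xi> \<eta> assume \<xi>: "\<xi> :> TM k a" and \<eta>: "\<eta> :> TM l b" and x: "cc k l a b \<xi> \<eta> :> TM (k + l) (a + b)"
      note cl = signed_linf[OF T concat_lin_left'[OF EH_app[OF g \<eta> refl] e(2)]]
      show "hz k m l n p q (f +[EH k m p] f') g (a + b) (cc k l a b \<xi> \<eta>) =
        (hz k m l n p q f g +[EH (k + l) (m + n) (p + q)] hz k m l n p q f' g) (a + b) (cc k l a b \<xi> \<eta>)"
        using lin_add[OF cl EH_app[OF f \<xi> refl] EH_app[OF f' \<xi> refl], of "q * a"]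
        by (simp add: EH_simps x \<xi> horiz_app_concat[OF ff g \<xi> \<eta> refl e(1) refl refl] horiz_app_concat[OF f g \<xi> \<eta> refl e(1) refl refl]
            horiz_app_concat[OF f' g \<xi> \<eta> refl e(1) refl refl])
    qed
  qed
  fix f g assume f: "f :> EH k m p" and g: "g :> EH l n q"
  let ?D = "\<lambda>m n. diff (Hom (TP m) (TP n))" and ?H = "EH (k + l) (m + n) (p + q - 1)"
  note df = hom_diff_closed[OF TP_complex TP_complex f] and dg = hom_diff_closed[OF TP_complex TP_complex g]
  have c1: "hz k m l n (p - 1) q (?D k m p f) g :> ?H"
    using horiz_closed[OF df g] by (simp add: diff_add_eq)
  have c2: "hz k m l n p (q - 1) f (?D l n q g) :> ?H"
    using horiz_closed[OF f dg] by (simp add: add_diff_eq)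
  show "?D (k + l) (m + n) (p + q) (hz k m l n p q f g) = hz k m l n (p - 1) q (?D k m p f) g +[?H]
      signed ?H p (hz k m l n p (q - 1) f (?D l n q g))"
  proof (rule EH_concat_eqI[OF hom_diff_closed[OF TP_complex TP_complex horiz_closed[OF f g]]
        mod_add_closed[OF EH c1 signed_closed[OF EH c2]]])
    fix a b \<xi> \<eta> assume \<xi>: "\<xi> :> TM k a" and \<eta>: "\<eta> :> TM l b" and x: "cc k l a b \<xi> \<eta> :> TM (k + l) (a + b)"
    have e: "a + b + (p + q - 1) = a + b + p + q - 1" by simp
    show "?D (k + l) (m + n) (p + q) (hz k m l n p q f g) (a + b) (cc k l a b \<xi> \<eta>) =
      (hz k m l n (p - 1) q (?D k m p f) g +[?H] signed ?H p (hz k m l n p (q - 1) f (?D l n q g))) (a + b) (cc k l a b \<xi> \<eta>)"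
      unfolding EH_simps(2)[OF x] EH_signed[OF c2 x refl] e
      by (rule horiz_diff_concat[OF EH_fam[OF f] EH_fam[OF g] \<xi> \<eta> refl refl])
  qed
qed

lemma horiz_lact_End:
  assumes \<sigma>: "\<sigma> \<in> perms m" and \<tau>: "\<tau> \<in> perms n" and f: "f :> EH k m p" and g: "g :> EH l n q"
  shows "hz k m l n p q (lact (End X) k m \<sigma> p f) (lact (End X) l n \<tau> q g) =
    lact (End X) (k + l) (m + n) (perm_sum m \<sigma> \<tau>) (p + q) (hz k m l n p q f g)"
proof (rule EH_concat_eqI[OF horiz_closed[OF lact_closed[OF \<sigma> f] lact_closed[OF \<tau> g]]
      lact_closed[OF perm_sum_perms(1)[OF \<sigma> \<tau>] horiz_closed[OF f g]]])
  fix a b \<xi> \<eta> assume \<xi>: "\<xi> :> TM k a" and \<eta>: "\<eta> :> TM l b" and x: "cc k l a b \<xi> \<eta> :> TM (k + l) (a + b)"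
  have e: "a + b + p + q = a + p + (b + q)" "a + b + (p + q) = a + p + (b + q)" by simp_all
  note fx = EH_app[OF f \<xi> refl] and gx = EH_app[OF g \<eta> refl]
  show "hz k m l n p q (lact (End X) k m \<sigma> p f) (lact (End X) l n \<tau> q g) (a + b) (cc k l a b \<xi> \<eta>) =
    lact (End X) (k + l) (m + n) (perm_sum m \<sigma> \<tau>) (p + q) (hz k m l n p q f g) (a + b) (cc k l a b \<xi> \<eta>)"
    unfolding horiz_app_concat[OF lact_closed[OF \<sigma> f] lact_closed[OF \<tau> g] \<xi> \<eta> refl refl refl refl]
      lact_app[OF x refl] lact_app[OF \<xi> refl] lact_app[OF \<eta> refl] horiz_app_concat[OF f g \<xi> \<eta> refl refl refl refl] e
      lin_signed[OF TM_module TM_module tensor_perm_lin[OF X perm_sum_perms(1)[OF \<sigma> \<tau>]] concat_closed[OF X fx gx]]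
      tensor_perm_concat[OF X \<sigma> \<tau> fx gx] ..
qed

lemma horiz_ract_End:
  assumes \<sigma>: "\<sigma> \<in> perms k" and \<tau>: "\<tau> \<in> perms l" and f: "f :> EH k m p" and g: "g :> EH l n q"
  shows "hz k m l n p q (ract (End X) k m \<sigma> p f) (ract (End X) l n \<tau> q g) =
    ract (End X) (k + l) (m + n) (perm_sum k \<sigma> \<tau>) (p + q) (hz k m l n p q f g)"
proof (rule EH_concat_eqI[OF horiz_closed[OF ract_closed[OF \<sigma> f] ract_closed[OF \<tau> g]]
      ract_closed[OF perm_sum_perms(1)[OF \<sigma> \<tau>] horiz_closed[OF f g]]])
  fix a b \<xi> \<eta> assume \<xi>: "\<xi> :> TM k a" and \<eta>: "\<eta> :> TM l b" and x: "cc k l a b \<xi> \<eta> :> TM (k + l) (a + b)"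
  show "hz k m l n p q (ract (End X) k m \<sigma> p f) (ract (End X) l n \<tau> q g) (a + b) (cc k l a b \<xi> \<eta>) =
    ract (End X) (k + l) (m + n) (perm_sum k \<sigma> \<tau>) (p + q) (hz k m l n p q f g) (a + b) (cc k l a b \<xi> \<eta>)"
    unfolding horiz_app_concat[OF ract_closed[OF \<sigma> f] ract_closed[OF \<tau> g] \<xi> \<eta> refl refl refl refl]
      ract_app[OF x] ract_app[OF \<xi>] ract_app[OF \<eta>] tensor_perm_concat[OF X \<sigma> \<tau> \<xi> \<eta>]
      horiz_app_concat[OF f g perm_closed[OF \<sigma> \<xi>] perm_closed[OF \<tau> \<eta>] refl refl refl refl] ..
qed

text \<open>On a product tensor both sides are the same product, with exponents
  \<open>s * a + q * (a + r)\<close> and \<open>q * r + (q + s) * a\<close>. These are equal as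
  integers.\<close>

lemma interchange_End:
  assumes f: "f :> EH k m p" and g: "g :> EH k' m' q" and f': "f' :> EH l k r" and g': "g' :> EH l' k' s"
  shows "hom_comp (TP (l + l')) (p + q) (r + s) (hz k m k' m' p q f g) (hz l k l' k' r s f' g') =
    signed (EH (l + l') (m + m') (p + q + r + s)) (q * r)
      (hz l m l' m' (p + r) (q + s) (hom_comp (TP l) p r f f') (hom_comp (TP l') q s g g'))"
proof -
  note h = horiz_closed[OF f g] and h' = horiz_closed[OF f' g'] and v = vert_closed[OF f f'] and v' = vert_closed[OF g g']
  have deg: "p + q + (r + s) = p + q + r + s" "p + r + (q + s) = p + q + r + s" by simp_all
  note c1 = vert_closed[OF h h', unfolded deg] and c2 = horiz_closed[OF v v', unfolded deg]
  show ?thesis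
  proof (rule EH_concat_eqI[OF c1 signed_closed[OF EH_module c2]])
    fix a b \<xi> \<eta> assume \<xi>: "\<xi> :> TM l a" and \<eta>: "\<eta> :> TM l' b" and x: "cc l l' a b \<xi> \<eta> :> TM (l + l') (a + b)"
    let ?E = "a + b + (p + q + r + s)"
    let ?N = "TM (m + m') ?E"
    let ?C = "cc m m' (a + (p + r)) (b + (q + s)) (f (a + r) (f' a \<xi>)) (g (b + s) (g' b \<eta>))"
    have e: "a + b + (r + s) = a + r + (b + s)" "a + r + (b + s) = a + b + r + s" by simp_all
    note fx = EH_app[OF f' \<xi> refl] and gx = EH_app[OF g' \<eta> refl]
    have C: "?C :> ?N"
      by (intro concat_closed' EH_app[OF f fx] EH_app[OF g gx]) simp_all
    have hl: "hz k m k' m' p q f g (a + r + (b + s)) \<in> Lin (TM (k + k') (a + r + (b + s))) ?N"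
      by (rule EH_lin[OF h]) simp
    have hc: "hz k m k' m' p q f g (a + r + (b + s)) (cc k k' (a + r) (b + s) (f' a \<xi>) (g' b \<eta>)) = signed ?N (q * (a + r)) ?C"
      by (rule horiz_app_concat[OF f g fx gx refl]) simp_all
    have "hom_comp (TP (l + l')) (p + q) (r + s) (hz k m k' m' p q f g) (hz l k l' k' r s f' g') (a + b) (cc l l' a b \<xi> \<eta>) =
       hz k m k' m' p q f g (a + r + (b + s)) (signed (TM (k + k') (a + r + (b + s))) (s * a) (cc k k' (a + r) (b + s) (f' a \<xi>) (g' b \<eta>)))"
      using horiz_app_concat[OF f' g' \<xi> \<eta> refl, of "a + r + (b + s)", OF _ refl refl]
      by (simp only: vert_app[OF x refl] e)
    also have "\<dots> = signed ?N (s * a + q * (a + r)) ?C"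
      unfolding lin_signed[OF TM_module TM_module hl concat_closed[OF X fx gx]] hc signed_signed[OF TM_module C] ..
    also have "\<dots> = signed ?N (q * r + (q + s) * a) ?C"
      by (rule signed_cong) (simp add: algebra_simps)
    also have "\<dots> = signed ?N (q * r) (hz l m l' m' (p + r) (q + s) (hom_comp (TP l) p r f f') (hom_comp (TP l') q s g g') (a + b) (cc l l' a b \<xi> \<eta>))"
    proof -
      have "hz l m l' m' (p + r) (q + s) (hom_comp (TP l) p r f f') (hom_comp (TP l') q s g g') (a + b) (cc l l' a b \<xi> \<eta>) =
        signed ?N ((q + s) * a) (cc m m' (a + (p + r)) (b + (q + s)) (hom_comp (TP l) p r f f' a \<xi>) (hom_comp (TP l') q s g g' b \<eta>))"
        by (rule horiz_app_concat[OF v v' \<xi> \<eta> refl _ refl refl]) simp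
      then show ?thesis by (simp only: vert_app[OF \<xi> refl] vert_app[OF \<eta> refl] signed_signed[OF TM_module C])
    qed
    finally show "hom_comp (TP (l + l')) (p + q) (r + s) (hz k m k' m' p q f g) (hz l k l' k' r s f' g') (a + b) (cc l l' a b \<xi> \<eta>) =
      signed (EH (l + l') (m + m') (p + q + r + s)) (q * r)
        (hz l m l' m' (p + r) (q + s) (hom_comp (TP l) p r f f') (hom_comp (TP l') q s g g')) (a + b) (cc l l' a b \<xi> \<eta>)"
      unfolding EH_signed[OF c2 x refl] .
  qed
qed

lemma symmetry_End:
  assumes f: "f :> EH k m p" and g: "g :> EH l n q"
  shows "lact (End X) (k + l) (n + m) (block_swap m n) (p + q) (hz k m l n p q f g) =
    signed (EH (k + l) (n + m) (p + q)) (p * q) (ract (End X) (k + l) (n + m) (block_swap k l) (p + q) (hz l n k m q p g f))"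
proof -
  have h: "hz k m l n p q f g :> EH (k + l) (n + m) (p + q)" using horiz_closed[OF f g] by (simp add: add.commute)
  have h': "hz l n k m q p g f :> EH (k + l) (n + m) (p + q)" using horiz_closed[OF g f] by (simp add: add.commute)
  have s: "block_swap m n \<in> perms (n + m)" "block_swap k l \<in> perms (k + l)"
    using block_swap_perms(1)[of m n] block_swap_perms(1)[of k l] by (simp_all add: add.commute)
  note r = ract_closed[OF s(2) h']
  show ?thesis
  proof (rule EH_concat_eqI[OF lact_closed[OF s(1) h] signed_closed[OF EH_module r]])
    fix a b \<xi> \<eta> assume \<xi>: "\<xi> :> TM k a" and \<eta>: "\<eta> :> TM l b" and x: "cc k l a b \<xi> \<eta> :> TM (k + l) (a + b)"
    let ?E = "a + b + (p + q)"
    let ?N = "TM (n + m) ?E"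
    let ?C = "cc n m (b + q) (a + p) (g b \<eta>) (f a \<xi>)"
    note fx = EH_app[OF f \<xi> refl] and gx = EH_app[OF g \<eta> refl]
    have e: "?E = a + p + (b + q)" "n + m = m + n" by simp_all
    have C: "?C :> ?N" by (rule concat_closed'[OF gx fx]) simp
    have C': "cc m n (a + p) (b + q) (f a \<xi>) (g b \<eta>) :> TM (m + n) (a + p + (b + q))" by (rule concat_closed[OF X fx gx])
    have hx: "hz k m l n p q f g (a + b) (cc k l a b \<xi> \<eta>) = signed (TM (m + n) (a + p + (b + q))) (q * a) (cc m n (a + p) (b + q) (f a \<xi>) (g b \<eta>))"
      by (rule horiz_app_concat[OF f g \<xi> \<eta> refl]) simp_all
    have "lact (End X) (k + l) (n + m) (block_swap m n) (p + q) (hz k m l n p q f g) (a + b) (cc k l a b \<xi> \<eta>) =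
       tperm X (m + n) (block_swap m n) (a + p + (b + q)) (signed (TM (m + n) (a + p + (b + q))) (q * a) (cc m n (a + p) (b + q) (f a \<xi>) (g b \<eta>)))"
      unfolding lact_app[OF x e(1)[symmetric]] hx e(2) ..
    also have "\<dots> = signed (TM (m + n) (a + p + (b + q))) (q * a) (signed (TM (m + n) (a + p + (b + q))) ((a + p) * (b + q)) ?C)"
      unfolding lin_signed[OF TM_module TM_module tensor_perm_lin[OF X block_swap_perms(1)] C'] tensor_perm_swap[OF X fx gx] ..
    also have "\<dots> = signed ?N (q * a + (a + p) * (b + q)) ?C"
      using signed_signed[OF TM_module C] by (simp only: e)
    \<comment> \<open>The two exponents differ by \<open>2 * q * a\<close>.\<close>
    also have "\<dots> = signed ?N (p * q + (a * b + p * b)) ?C"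
      by (rule signed_cong) (simp add: algebra_simps)
    also have "\<dots> = signed ?N (p * q) (signed ?N (a * b) (signed ?N (p * b) ?C))"
      using C by (simp add: signed_signed[OF TM_module] signed_closed[OF TM_module])
    also have "signed ?N (a * b) (signed ?N (p * b) ?C) =
       ract (End X) (k + l) (n + m) (block_swap k l) (p + q) (hz l n k m q p g f) (a + b) (cc k l a b \<xi> \<eta>)"
    proof -
      have hl: "hz l n k m q p g f (a + b) \<in> Lin (TM (k + l) (a + b)) ?N"
        by (rule EH_lin[OF h' refl])
      have y: "cc l k b a \<eta> \<xi> :> TM (k + l) (a + b)"
        using concat_closed[OF X \<eta> \<xi>] by (simp add: add.commute)
      have "hz l n k m q p g f (a + b) (cc l k b a \<eta> \<xi>) = signed ?N (p * b) ?C"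
        by (rule horiz_app_concat[OF g f \<eta> \<xi>]) simp_all
      then show ?thesis
        unfolding ract_app[OF x] tensor_perm_swap[OF X \<xi> \<eta>] lin_signed[OF TM_module TM_module hl y] by simp
    qed
    finally show "lact (End X) (k + l) (n + m) (block_swap m n) (p + q) (hz k m l n p q f g) (a + b) (cc k l a b \<xi> \<eta>) =
      signed (EH (k + l) (n + m) (p + q)) (p * q) (ract (End X) (k + l) (n + m) (block_swap k l) (p + q) (hz l n k m q p g f)) (a + b) (cc k l a b \<xi> \<eta>)"
      unfolding EH_signed[OF r x refl] .
  qed
qed

text \<open>Three groups of inputs are needed, so the first of the two factors given by
  \<open>EH_concat_eqI\<close> is divided once more.\<close>

lemma horiz_assoc_End:
  assumes f: "f :> EH k m p" and g: "g :> EH k' m' q" and h: "h :> EH k'' m'' r"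
  shows "hz (k + k') (m + m') k'' m'' (p + q) r (hz k m k' m' p q f g) h =
    hz k m (k' + k'') (m' + m'') p (q + r) f (hz k' m' k'' m'' q r g h)"
proof -
  note fg = horiz_closed[OF f g] and gh = horiz_closed[OF g h]
  have c2: "hz k m (k' + k'') (m' + m'') p (q + r) f (hz k' m' k'' m'' q r g h) :> EH (k + k' + k'') (m + m' + m'') (p + q + r)"
    using horiz_closed[OF f gh] by (simp add: add.assoc)
  note c1 = horiz_closed[OF fg h]
  show ?thesis
  proof (rule EH_concat_eqI[OF c1 c2])
    fix ab c \<xi> \<zeta> assume \<xi>: "\<xi> :> TM (k + k') ab" and \<zeta>: "\<zeta> :> TM k'' c"
    let ?E = "ab + c + (p + q + r)"
    have l1: "(\<lambda>\<xi>. hz (k + k') (m + m') k'' m'' (p + q) r (hz k m k' m' p q f g) h (ab + c) (cc (k + k') k'' ab c \<xi> \<zeta>))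
      \<in> Lin (TM (k + k') ab) (TM (m + m' + m'') ?E)"
      by (rule lin_comp[OF concat_lin_left[OF X \<zeta>] EH_lin[OF c1 refl]])
    have l2: "(\<lambda>\<xi>. hz k m (k' + k'') (m' + m'') p (q + r) f (hz k' m' k'' m'' q r g h) (ab + c) (cc (k + k') k'' ab c \<xi> \<zeta>))
      \<in> Lin (TM (k + k') ab) (TM (m + m' + m'') ?E)"
      by (rule lin_comp[OF concat_lin_left[OF X \<zeta>] EH_lin[OF c2 refl]])
    show "hz (k + k') (m + m') k'' m'' (p + q) r (hz k m k' m' p q f g) h (ab + c) (cc (k + k') k'' ab c \<xi> \<zeta>) =
      hz k m (k' + k'') (m' + m'') p (q + r) f (hz k' m' k'' m'' q r g h) (ab + c) (cc (k + k') k'' ab c \<xi> \<zeta>)"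
    proof (rule concat_ext[OF X TM_module l1 l2 _ \<xi>])
      fix a b \<xi> \<eta> assume ab: "a + b = ab" and \<xi>: "\<xi> :> TM k a" and \<eta>: "\<eta> :> TM k' b"
      note fx = EH_app[OF f \<xi> refl] and gx = EH_app[OF g \<eta> refl] and hx = EH_app[OF h \<zeta> refl]
      let ?N = "TM (m + m' + m'') ?E"
      let ?C = "cc (m + m') m'' (a + p + (b + q)) (c + r) (cc m m' (a + p) (b + q) (f a \<xi>) (g b \<eta>)) (h c \<zeta>)"
      have C: "?C :> ?N"
        by (rule concat_closed'[OF concat_closed[OF X fx gx] hx]) (simp add: ab[symmetric])
      have xy: "cc k k' a b \<xi> \<eta> :> TM (k + k') ab" by (rule concat_closed'[OF \<xi> \<eta> ab[symmetric]])
      have yz: "cc k' k'' b c \<eta> \<zeta> :> TM (k' + k'') (b + c)" by (rule concat_closed[OF X \<eta> \<zeta>])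
      have L: "hz (k + k') (m + m') k'' m'' (p + q) r (hz k m k' m' p q f g) h (ab + c) (cc (k + k') k'' ab c (cc k k' a b \<xi> \<eta>) \<zeta>) =
        signed ?N (r * ab) (signed ?N (q * a) ?C)"
      proof -
        have 1: "hz k m k' m' p q f g ab (cc k k' a b \<xi> \<eta>) = signed (TM (m + m') (a + p + (b + q))) (q * a) (cc m m' (a + p) (b + q) (f a \<xi>) (g b \<eta>))"
          by (rule horiz_app_concat[OF f g \<xi> \<eta> ab[symmetric]]) (simp_all add: ab[symmetric])
        have 2: "hz (k + k') (m + m') k'' m'' (p + q) r (hz k m k' m' p q f g) h (ab + c) (cc (k + k') k'' ab c (cc k k' a b \<xi> \<eta>) \<zeta>) =
          signed ?N (r * ab) (cc (m + m') m'' (a + p + (b + q)) (c + r) (hz k m k' m' p q f g ab (cc k k' a b \<xi> \<eta>)) (h c \<zeta>))"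
          by (rule horiz_app_concat[OF fg h xy \<zeta> refl]) (simp_all add: ab[symmetric])
        have cl: "(\<lambda>y. cc (m + m') m'' (a + p + (b + q)) (c + r) y (h c \<zeta>)) \<in> Lin (TM (m + m') (a + p + (b + q))) ?N"
          by (rule concat_lin_left'[OF hx]) (simp add: ab[symmetric])
        show ?thesis unfolding 2 1 lin_signed[OF TM_module TM_module cl concat_closed[OF X fx gx]] ..
      qed
      have R: "hz k m (k' + k'') (m' + m'') p (q + r) f (hz k' m' k'' m'' q r g h) (ab + c) (cc (k + k') k'' ab c (cc k k' a b \<xi> \<eta>) \<zeta>) =
        signed ?N ((q + r) * a) (signed ?N (r * b) ?C)"
      proof -
        have 0: "cc (k + k') k'' ab c (cc k k' a b \<xi> \<eta>) \<zeta> = cc k (k' + k'') a (b + c) \<xi> (cc k' k'' b c \<eta> \<zeta>)"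
          using concat_assoc[OF X \<xi> \<eta> \<zeta>] by (simp add: ab)
        have 1: "hz k' m' k'' m'' q r g h (b + c) (cc k' k'' b c \<eta> \<zeta>) =
          signed (TM (m' + m'') (b + q + (c + r))) (r * b) (cc m' m'' (b + q) (c + r) (g b \<eta>) (h c \<zeta>))"
          by (rule horiz_app_concat[OF g h \<eta> \<zeta> refl]) simp_all
        have N: "?N = TM (m + (m' + m'')) ?E" by (simp add: add.assoc)
        have 2: "hz k m (k' + k'') (m' + m'') p (q + r) f (hz k' m' k'' m'' q r g h) (ab + c) (cc k (k' + k'') a (b + c) \<xi> (cc k' k'' b c \<eta> \<zeta>)) =
          signed ?N ((q + r) * a) (cc m (m' + m'') (a + p) (b + q + (c + r)) (f a \<xi>) (hz k' m' k'' m'' q r g h (b + c) (cc k' k'' b c \<eta> \<zeta>)))"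
          unfolding N by (rule horiz_app_concat[OF f gh \<xi> yz]) (simp_all add: ab[symmetric])
        have cl: "cc m (m' + m'') (a + p) (b + q + (c + r)) (f a \<xi>) \<in> Lin (TM (m' + m'') (b + q + (c + r))) ?N"
          unfolding N by (rule concat_lin_right'[OF fx]) (simp add: ab[symmetric])
        show ?thesis unfolding 0 2 1 lin_signed[OF TM_module TM_module cl concat_closed[OF X gx hx]]
            concat_assoc[OF X fx gx hx] ..
      qed
      show "hz (k + k') (m + m') k'' m'' (p + q) r (hz k m k' m' p q f g) h (ab + c) (cc (k + k') k'' ab c (cc k k' a b \<xi> \<eta>) \<zeta>) =
        hz k m (k' + k'') (m' + m'') p (q + r) f (hz k' m' k'' m'' q r g h) (ab + c) (cc (k + k') k'' ab c (cc k k' a b \<xi> \<eta>) \<zeta>)"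
        \<comment> \<open>As \<open>ab\<close> is \<open>a + b\<close>, both exponents expand to
          \<open>q * a + r * a + r * b\<close>.\<close>
        unfolding L R signed_signed[OF TM_module C] by (rule signed_cong) (simp add: ab[symmetric] algebra_simps)
    qed
  qed
qed

theorem dg_prop_End: "dg_prop R (End X)"
proof (rule dg_prop.intro, unfold End_simps(1,4))
  fix m n
  show "cplx (Hom (TP m) (TP n))" by (rule hom_complex[OF TP_complex TP_complex])
  show "cmap (Hom (TP m) (TP n)) (Hom (TP m) (TP n)) (lact (End X) m n \<sigma>)" if "\<sigma> \<in> perms n" for \<sigma>
    by (rule lact_chain[OF that])
  show "cmap (Hom (TP m) (TP n)) (Hom (TP m) (TP n)) (ract (End X) m n \<sigma>)" if "\<sigma> \<in> perms m" for \<sigma>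
    by (rule ract_chain[OF that])
  show "punit (End X) n :> EH n n 0" unfolding End_simps(5) by (rule unit_closed)
  fix f p assume f: "f :> EH m n p"
  show "lact (End X) m n id p f = f"
    by (rule EH_eqI[OF lact_closed[OF perms_id f] f]) (simp add: lact_app tensor_perm_id[OF X] EH_app[OF f])
  show "ract (End X) m n id p f = f"
    by (rule EH_eqI[OF ract_closed[OF perms_id f] f]) (simp add: ract_app tensor_perm_id[OF X])
  show "lact (End X) m n (\<sigma> \<circ> \<tau>) p f = lact (End X) m n \<sigma> p (lact (End X) m n \<tau> p f)"
    if \<sigma>: "\<sigma> \<in> perms n" and \<tau>: "\<tau> \<in> perms n" for \<sigma> \<tau>
    by (rule EH_eqI[OF lact_closed[OF perms_comp[OF \<sigma> \<tau>] f] lact_closed[OF \<sigma> lact_closed[OF \<tau> f]]])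
      (simp add: lact_app tensor_perm_comp[OF X \<sigma> \<tau>] EH_app[OF f])
  show "ract (End X) m n (\<sigma> \<circ> \<tau>) p f = ract (End X) m n \<tau> p (ract (End X) m n \<sigma> p f)"
    if \<sigma>: "\<sigma> \<in> perms m" and \<tau>: "\<tau> \<in> perms m" for \<sigma> \<tau>
    by (rule EH_eqI[OF ract_closed[OF perms_comp[OF \<sigma> \<tau>] f] ract_closed[OF \<tau> ract_closed[OF \<sigma> f]]])
      (simp add: ract_app tensor_perm_comp[OF X \<sigma> \<tau>] perm_closed[OF \<tau>])
  show "lact (End X) m n \<sigma> p (ract (End X) m n \<tau> p f) = ract (End X) m n \<tau> p (lact (End X) m n \<sigma> p f)"
    if \<sigma>: "\<sigma> \<in> perms n" and \<tau>: "\<tau> \<in> perms m" for \<sigma> \<tau>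
    by (rule EH_eqI[OF lact_closed[OF \<sigma> ract_closed[OF \<tau> f]] ract_closed[OF \<tau> lact_closed[OF \<sigma> f]]])
      (simp add: lact_app ract_app perm_closed[OF \<tau>])
  show "hom_comp (TP m) 0 p (punit (End X) n) f = f"
    unfolding End_simps(5)
    using vert_closed[OF unit_closed f] by (intro EH_eqI[OF _ f]) (simp_all add: vert_app EH_app[OF f])
  show "hom_comp (TP m) p 0 f (punit (End X) m) = f"
    unfolding End_simps(5)
    using vert_closed[OF f unit_closed] by (intro EH_eqI[OF _ f]) (simp_all add: vert_app)
  have u0: "punit (End X) 0 :> EH 0 0 0" unfolding End_simps(5) by (rule unit_closed)
  \<comment> \<open>The generator of the zeroth power. An arbitrary tensor is its own product with
    the empty word, which brings the unit laws into the reach of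
    \<open>horiz_app_concat\<close>.\<close>
  have e: "Pure X [] :> TM 0 0" by (rule pure_closed[OF X words_Nil])
  show "hz 0 0 m n 0 p (punit (End X) 0) f = f"
  proof (rule EH_eqI)
    show h: "hz 0 0 m n 0 p (punit (End X) 0) f :> EH m n p" using horiz_closed[OF u0 f] by simp
    show "f :> EH m n p" by (rule f)
    fix d x assume x: "x :> TM m d"
    have "hz 0 0 m n 0 p (punit (End X) 0) f d (cc 0 m 0 d (Pure X []) x) =
       signed (TM (0 + n) (d + p)) (p * 0) (cc 0 n 0 (d + p) (punit (End X) 0 0 (Pure X [])) (f d x))"
      by (rule horiz_app_concat[OF u0 f e x]) simp_all
    then show "hz 0 0 m n 0 p (punit (End X) 0) f d x = f d x"
      using e EH_app[OF f x refl] x by (simp add: End_simps(5) concat_unit_left[OF X])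
  qed
  show "hz m n 0 0 p 0 f (punit (End X) 0) = f"
  proof (rule EH_eqI)
    show h: "hz m n 0 0 p 0 f (punit (End X) 0) :> EH m n p" using horiz_closed[OF f u0] by simp
    show "f :> EH m n p" by (rule f)
    fix d x assume x: "x :> TM m d"
    have "hz m n 0 0 p 0 f (punit (End X) 0) d (cc m 0 d 0 x (Pure X [])) =
       signed (TM (n + 0) (d + p)) (0 * d) (cc n 0 (d + p) 0 (f d x) (punit (End X) 0 0 (Pure X [])))"
      by (rule horiz_app_concat[OF f u0 x e]) simp_all
    then show "hz m n 0 0 p 0 f (punit (End X) 0) d x = f d x"
      using e EH_app[OF f x refl] x by (simp add: End_simps(5) concat_unit_right[OF X])
  qed
next
  fix k m n f g p q \<sigma> assume f: "f :> EH k m p" and g: "g :> EH n k q"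
  show "\<sigma> \<in> perms m \<Longrightarrow> hom_comp (TP n) p q (lact (End X) k m \<sigma> p f) g = lact (End X) n m \<sigma> (p + q) (hom_comp (TP n) p q f g)"
    by (rule EH_eqI[OF vert_closed[OF lact_closed[OF _ f] g] lact_closed[OF _ vert_closed[OF f g]]])
      (simp_all add: vert_app lact_app EH_app[OF g] deg_simps)
  show "\<sigma> \<in> perms n \<Longrightarrow> hom_comp (TP n) p q f (ract (End X) n k \<sigma> q g) = ract (End X) n m \<sigma> (p + q) (hom_comp (TP n) p q f g)"
    by (rule EH_eqI[OF vert_closed[OF f ract_closed[OF _ g]] ract_closed[OF _ vert_closed[OF f g]]])
      (simp_all add: vert_app ract_app perm_closed)
  show "\<sigma> \<in> perms k \<Longrightarrow> hom_comp (TP n) p q (ract (End X) k m \<sigma> p f) g = hom_comp (TP n) p q f (lact (End X) n k \<sigma> q g)"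
    by (rule EH_eqI[OF vert_closed[OF ract_closed[OF _ f] g] vert_closed[OF f lact_closed[OF _ g]]])
      (simp_all add: vert_app lact_app ract_app EH_app[OF g])
next
  fix k m n l f g h p q r assume f: "f :> EH k m p" and g: "g :> EH l k q" and h: "h :> EH n l r"
  show "hom_comp (TP n) (p + q) r (hom_comp (TP l) p q f g) h = hom_comp (TP n) p (q + r) f (hom_comp (TP n) q r g h)"
    by (rule EH_eqI[OF vert_closed[OF vert_closed[OF f g] h] vert_closed[OF f vert_closed[OF g h], folded add.assoc]])
      (simp_all add: vert_app EH_app[OF h] deg_simps)
next
  show "dg_bilinear R (Hom (TP k) (TP m)) (Hom (TP n) (TP k)) (Hom (TP n) (TP m)) (hom_comp (TP n))" for k m n
    by (rule hom_comp_bilinear[OF TP_complex TP_complex TP_complex])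
  show "dg_bilinear R (Hom (TP k) (TP m)) (Hom (TP l) (TP n)) (Hom (TP (k + l)) (TP (m + n))) (hz k m l n)" for k m l n
    by (rule horiz_bilinear_End)
  show "hz m m n n 0 0 (punit (End X) m) (punit (End X) n) = punit (End X) (m + n)" for m n
  proof (rule EH_concat_eqI)
    show "hz m m n n 0 0 (punit (End X) m) (punit (End X) n) :> EH (m + n) (m + n) 0"
      using horiz_closed[OF unit_closed unit_closed] by (simp add: End_simps(5))
    show "punit (End X) (m + n) :> EH (m + n) (m + n) 0" unfolding End_simps(5) by (rule unit_closed)
    fix a b \<xi> \<eta> assume \<xi>: "\<xi> :> TM m a" and \<eta>: "\<eta> :> TM n b" and x: "cc m n a b \<xi> \<eta> :> TM (m + n) (a + b)"
    have "hz m m n n 0 0 (punit (End X) m) (punit (End X) n) (a + b) (cc m n a b \<xi> \<eta>) =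
      signed (TM (m + n) (a + b)) (0 * a) (cc m n a b (punit (End X) m a \<xi>) (punit (End X) n b \<eta>))"
      unfolding End_simps(5) by (rule horiz_app_concat[OF unit_closed unit_closed \<xi> \<eta>]) simp_all
    then show "hz m m n n 0 0 (punit (End X) m) (punit (End X) n) (a + b) (cc m n a b \<xi> \<eta>) =
      punit (End X) (m + n) (a + b) (cc m n a b \<xi> \<eta>)"
      using \<xi> \<eta> x by (simp add: End_simps(5))
  qed
qed (rule horiz_assoc_End horiz_lact_End horiz_ract_End interchange_End symmetry_End; assumption)+

end

subsection \<open>The initial prop\<close>

definition init_basis :: "nat \<Rightarrow> nat \<Rightarrow> int \<Rightarrow> (nat \<Rightarrow> nat) set" where
  "init_basis m n p = (if m = n \<and> p = 0 then perms n else {})"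

lemma finite_init_basis: "finite (init_basis m n p)"
  by (simp add: init_basis_def finite_perms)

lemma init_basisD: "\<sigma> \<in> init_basis m n p \<Longrightarrow> m = n \<and> p = 0 \<and> \<sigma> \<in> perms n"
  by (simp add: init_basis_def split: if_splits)

lemma init_gr: "gr (ops (init) m n) p = FreeM (init_basis m n p)"
  by (simp add: initial_prop_def init_basis_def)

lemma free_finiteI:
  assumes "finite S" "\<And>s. c s :> R" "\<And>s. s \<notin> S \<Longrightarrow> c s = \<zero>"
  shows "c :> FreeM S"
proof (rule free_carrierI[OF assms(2,3)])
  have "{s. c s \<noteq> \<zero>} \<subseteq> S" using assms(3) by auto
  then show "finite {s. c s \<noteq> \<zero>}" using assms(1) finite_subset by blast
qed

lemma finsum_eq_single:
  assumes "finite A" "i \<in> A" "\<And>j. j \<in> A \<Longrightarrow> j \<noteq> i \<Longrightarrow> f j = \<zero>" "f i :> R"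
  shows "(\<Oplus>j\<in>A. f j) = f i"
proof -
  have "f j :> R" if "j \<in> A" for j
    using assms that by (cases "j = i") auto
  then have "(\<Oplus>j\<in>{i}. f j) = (\<Oplus>j\<in>A. f j)"
    using assms by (intro add.finprod_mono_neutral_cong_left) auto
  then show ?thesis using assms(4) by simp
qed

lemma finsum_eq_zero:
  assumes "\<And>j. j \<in> A \<Longrightarrow> f j = \<zero>"
  shows "(\<Oplus>j\<in>A. f j) = \<zero>"
  using assms by (rule add.finprod_one_eqI)

text \<open>Over a finite basis the condition of finite support is automatic, which leaves
  conditions that can be checked pointwise.\<close>

lemma free_linI:
  assumes S: "finite S'"
    and cl: "\<And>c t. c :> FreeM S \<Longrightarrow> F c t :> R"
    and z: "\<And>c t. \<lbrakk>c :> FreeM S; t \<notin> S'\<rbrakk> \<Longrightarrow> F c t = \<zero>"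
    and add: "\<And>c d t. \<lbrakk>c :> FreeM S; d :> FreeM S\<rbrakk> \<Longrightarrow>
      F (\<lambda>s. c s \<oplus> d s) t = F c t \<oplus> F d t"
    and smult: "\<And>a c t. \<lbrakk>a :> R; c :> FreeM S\<rbrakk> \<Longrightarrow> F (\<lambda>s. a \<otimes> c s) t = a \<otimes> F c t"
  shows "F \<in> Lin (FreeM S) (FreeM S')"
  using assms by (intro linI free_finiteI) (auto simp: free_simps fun_eq_iff)

lemma init_lact_lin:
  assumes \<sigma>: "\<sigma> \<in> perms n"
  shows "lact (init) m n \<sigma> p \<in> Lin (FreeM (init_basis m n p)) (FreeM (init_basis m n p))"
proof (rule free_linI[OF finite_init_basis])
  fix c t assume c: "c :> FreeM (init_basis m n p)"
  show "lact (init) m n \<sigma> p c t :> R" using free_carrierD(1)[OF c] by (simp add: initial_prop_def)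
  assume t: "t \<notin> init_basis m n p"
  have "pinv \<sigma> \<circ> t \<notin> init_basis m n p"
  proof
    assume a: "pinv \<sigma> \<circ> t \<in> init_basis m n p"
    have "\<sigma> \<circ> (pinv \<sigma> \<circ> t) = t" using permutes_inverses(1)[OF permsD[OF \<sigma>]] by (simp add: fun_eq_iff)
    then have "t \<in> perms n" using perms_comp[OF \<sigma>, of "pinv \<sigma> \<circ> t"] init_basisD[OF a] by simp
    then show False using t init_basisD[OF a] by (simp add: init_basis_def)
  qed
  then show "lact (init) m n \<sigma> p c t = \<zero>" using free_carrierD(2)[OF c] by (simp add: initial_prop_def)
qed (simp_all add: initial_prop_def)

lemma init_ract_lin:
  assumes \<sigma>: "\<sigma> \<in> perms m"
  shows "ract (init) m n \<sigma> p \<in> Lin (FreeM (init_basis m n p)) (FreeM (init_basis m n p))"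
proof (rule free_linI[OF finite_init_basis])
  fix c t assume c: "c :> FreeM (init_basis m n p)"
  show "ract (init) m n \<sigma> p c t :> R" using free_carrierD(1)[OF c] by (simp add: initial_prop_def)
  assume t: "t \<notin> init_basis m n p"
  have "t \<circ> pinv \<sigma> \<notin> init_basis m n p"
  proof
    assume a: "t \<circ> pinv \<sigma> \<in> init_basis m n p"
    have "(t \<circ> pinv \<sigma>) \<circ> \<sigma> = t" using permutes_inverses(2)[OF permsD[OF \<sigma>]] by (simp add: fun_eq_iff)
    then have "t \<in> perms n" using perms_comp[of "t \<circ> pinv \<sigma>" n \<sigma>] init_basisD[OF a] \<sigma> by simp
    then show False using t init_basisD[OF a] by (simp add: init_basis_def)
  qed
  then show "ract (init) m n \<sigma> p c t = \<zero>" using free_carrierD(2)[OF c] by (simp add: initial_prop_def)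
qed (simp_all add: initial_prop_def)

lemma init_lact_basis:
  assumes \<sigma>: "\<sigma> \<in> perms n"
  shows "lact (init) m n \<sigma> p (basis \<rho>) = basis (\<sigma> \<circ> \<rho>)"
proof -
  have "pinv \<sigma> \<circ> t = \<rho> \<longleftrightarrow> t = \<sigma> \<circ> \<rho>" for t :: "nat \<Rightarrow> nat"
    using permutes_inverses[OF permsD[OF \<sigma>]] unfolding fun_eq_iff comp_def by metis
  then show ?thesis by (simp add: initial_prop_def basis_elt_def)
qed

lemma init_ract_basis:
  assumes \<sigma>: "\<sigma> \<in> perms m"
  shows "ract (init) m n \<sigma> p (basis \<rho>) = basis (\<rho> \<circ> \<sigma>)"
proof -
  have "t \<circ> pinv \<sigma> = \<rho> \<longleftrightarrow> t = \<rho> \<circ> \<sigma>" for t :: "nat \<Rightarrow> nat"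
    using permutes_inverses[OF permsD[OF \<sigma>]] unfolding fun_eq_iff comp_def by metis
  then show ?thesis by (simp add: initial_prop_def basis_elt_def)
qed

abbreviation "init_pairs m n \<tau> \<equiv> {\<rho> \<in> perms m \<times> perms n. perm_sum m (fst \<rho>) (snd \<rho>) = \<tau>}"

lemma finite_init_pairs: "finite (init_pairs m n \<tau>)"
  by (simp add: finite_perms)

lemma init_horiz_app: "horiz (init) k m l n p q c c' \<tau> =
    (\<Oplus>\<rho>\<in>init_pairs m n \<tau>. c (fst \<rho>) \<otimes> c' (snd \<rho>))"
  by (simp add: initial_prop_def)

text \<open>If some summand has both factors nonzero, then the arities match, the degrees are zero
  and \<open>t\<close> is a block sum of permutations, hence a basis element.\<close>

lemma init_horiz_zero:
  assumes c: "c :> FreeM (init_basis k m p)" and c': "c' :> FreeM (init_basis l n q)"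
    and t: "t \<notin> init_basis (k + l) (m + n) (p + q)"
  shows "horiz (init) k m l n p q c c' t = \<zero>"
  unfolding init_horiz_app
proof (rule finsum_eq_zero)
  fix \<rho> assume \<rho>: "\<rho> \<in> init_pairs m n t"
  have "fst \<rho> \<notin> init_basis k m p \<or> snd \<rho> \<notin> init_basis l n q"
  proof (rule ccontr)
    assume "\<not> ?thesis"
    then have "k = m" "l = n" "p = 0" "q = 0" using init_basisD by blast+
    then show False using t \<rho> perm_sum_perms(1)[of "fst \<rho>" m "snd \<rho>" n] by (auto simp: init_basis_def)
  qed
  then show "c (fst \<rho>) \<otimes> c' (snd \<rho>) = \<zero>"
    using free_carrierD(1,2)[OF c] free_carrierD(1,2)[OF c'] by auto
qed

lemma init_horiz_lin:
  assumes c': "c' :> FreeM (init_basis l n q)"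
  shows "(\<lambda>c. horiz (init) k m l n p q c c') \<in>
    Lin (FreeM (init_basis k m p)) (FreeM (init_basis (k + l) (m + n) (p + q)))"
proof (rule free_linI[OF finite_init_basis])
  note c1' = free_carrierD(1)[OF c']
  fix c t assume c: "c :> FreeM (init_basis k m p)"
  note c1 = free_carrierD(1)[OF c]
  show "horiz (init) k m l n p q c c' t :> R"
    unfolding init_horiz_app by (intro finsum_closed) (simp add: c1 c1' Pi_iff)
  show "t \<notin> init_basis (k + l) (m + n) (p + q) \<Longrightarrow> horiz (init) k m l n p q c c' t = \<zero>"
    by (rule init_horiz_zero[OF c c'])
  { fix a assume a: "a :> R"
    show "horiz (init) k m l n p q (\<lambda>s. a \<otimes> c s) c' t = a \<otimes> horiz (init) k m l n p q c c' t"
      unfolding init_horiz_app using a c1 c1' by (subst finsum_rdistr[OF finite_init_pairs]) (auto simp: m_assoc) }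
  fix d assume d: "d :> FreeM (init_basis k m p)"
  note d1 = free_carrierD(1)[OF d]
  show "horiz (init) k m l n p q (\<lambda>s. c s \<oplus> d s) c' t = horiz (init) k m l n p q c c' t \<oplus> horiz (init) k m l n p q d c' t"
    unfolding init_horiz_app using c1 d1 c1' by (subst finsum_addf[symmetric]) (auto simp: l_distr)
qed

lemma init_horiz_lin2:
  assumes c: "c :> FreeM (init_basis k m p)"
  shows "horiz (init) k m l n p q c \<in>
    Lin (FreeM (init_basis l n q)) (FreeM (init_basis (k + l) (m + n) (p + q)))"
proof (rule free_linI[OF finite_init_basis])
  note c1 = free_carrierD(1)[OF c]
  fix c' t assume c': "c' :> FreeM (init_basis l n q)"
  note c1' = free_carrierD(1)[OF c']
  show "horiz (init) k m l n p q c c' t :> R"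
    unfolding init_horiz_app by (intro finsum_closed) (simp add: c1 c1' Pi_iff)
  show "t \<notin> init_basis (k + l) (m + n) (p + q) \<Longrightarrow> horiz (init) k m l n p q c c' t = \<zero>"
    by (rule init_horiz_zero[OF c c'])
  { fix a assume a: "a :> R"
    show "horiz (init) k m l n p q c (\<lambda>s. a \<otimes> c' s) t = a \<otimes> horiz (init) k m l n p q c c' t"
      unfolding init_horiz_app using a c1 c1' by (subst finsum_rdistr[OF finite_init_pairs]) (auto simp: m_lcomm) }
  fix d assume d: "d :> FreeM (init_basis l n q)"
  note d1 = free_carrierD(1)[OF d]
  show "horiz (init) k m l n p q c (\<lambda>s. c' s \<oplus> d s) t = horiz (init) k m l n p q c c' t \<oplus> horiz (init) k m l n p q c d t"
    unfolding init_horiz_app using c1 d1 c1' by (subst finsum_addf[symmetric]) (auto simp: r_distr)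
qed

lemma init_horiz_basis:
  assumes "\<sigma> \<in> perms m" "\<tau> \<in> perms n"
  shows "horiz (init) k m l n p q (basis \<sigma>) (basis \<tau>) = basis (perm_sum m \<sigma> \<tau>)"
proof
  fix t
  show "horiz (init) k m l n p q (basis \<sigma>) (basis \<tau>) t = basis (perm_sum m \<sigma> \<tau>) t"
  proof (cases "t = perm_sum m \<sigma> \<tau>")
    case True
    have "(\<Oplus>\<rho>\<in>init_pairs m n t. basis \<sigma> (fst \<rho>) \<otimes> basis \<tau> (snd \<rho>)) =
      basis \<sigma> (fst (\<sigma>, \<tau>)) \<otimes> basis \<tau> (snd (\<sigma>, \<tau>))"
      by (rule finsum_eq_single[OF finite_init_pairs]) (use True assms in \<open>auto simp: basis_elt_def\<close>)
    then show ?thesis unfolding init_horiz_app using True by (simp add: basis_elt_def)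
  next
    case False
    have "(\<Oplus>\<rho>\<in>init_pairs m n t. basis \<sigma> (fst \<rho>) \<otimes> basis \<tau> (snd \<rho>)) = \<zero>"
      by (rule finsum_eq_zero) (use False in \<open>auto simp: basis_elt_def\<close>)
    then show ?thesis unfolding init_horiz_app using False by (simp add: basis_elt_def)
  qed
qed

lemma init_vert_app: "vert (init) n k m p q c c' \<tau> = (\<Oplus>\<rho>\<in>perms k. c \<rho> \<otimes> c' (pinv \<rho> \<circ> \<tau>))"
  by (simp add: initial_prop_def)

lemma init_vert_zero:
  assumes c: "c :> FreeM (init_basis k m p)" and c': "c' :> FreeM (init_basis n k q)"
    and t: "t \<notin> init_basis n m (p + q)"
  shows "vert (init) n k m p q c c' t = \<zero>"
  unfolding init_vert_app
proof (rule finsum_eq_zero)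
  fix \<rho> assume \<rho>: "\<rho> \<in> perms k"
  have "\<rho> \<notin> init_basis k m p \<or> pinv \<rho> \<circ> t \<notin> init_basis n k q"
  proof (rule ccontr)
    assume "\<not> ?thesis"
    then have a: "k = m" "n = k" "p = 0" "q = 0" "pinv \<rho> \<circ> t \<in> perms k" using init_basisD by blast+
    have "\<rho> \<circ> (pinv \<rho> \<circ> t) = t" using permutes_inverses(1)[OF permsD[OF \<rho>]] by (simp add: fun_eq_iff)
    then have "t \<in> perms k" using perms_comp[OF \<rho> a(5)] by simp
    then show False using t a by (simp add: init_basis_def)
  qed
  then show "c \<rho> \<otimes> c' (pinv \<rho> \<circ> t) = \<zero>"
    using free_carrierD(1,2)[OF c] free_carrierD(1,2)[OF c'] by auto
qed

lemma init_vert_lin: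
  assumes c': "c' :> FreeM (init_basis n k q)"
  shows "(\<lambda>c. vert (init) n k m p q c c') \<in>
    Lin (FreeM (init_basis k m p)) (FreeM (init_basis n m (p + q)))"
proof (rule free_linI[OF finite_init_basis])
  note c1' = free_carrierD(1)[OF c']
  fix c t assume c: "c :> FreeM (init_basis k m p)"
  note c1 = free_carrierD(1)[OF c]
  show "vert (init) n k m p q c c' t :> R"
    unfolding init_vert_app by (intro finsum_closed) (simp add: c1 c1' Pi_iff)
  show "t \<notin> init_basis n m (p + q) \<Longrightarrow> vert (init) n k m p q c c' t = \<zero>"
    by (rule init_vert_zero[OF c c'])
  { fix a assume a: "a :> R"
    show "vert (init) n k m p q (\<lambda>s. a \<otimes> c s) c' t = a \<otimes> vert (init) n k m p q c c' t"
      unfolding init_vert_app using a c1 c1' by (subst finsum_rdistr[OF finite_perms]) (auto simp: m_assoc) }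
  fix d assume d: "d :> FreeM (init_basis k m p)"
  note d1 = free_carrierD(1)[OF d]
  show "vert (init) n k m p q (\<lambda>s. c s \<oplus> d s) c' t = vert (init) n k m p q c c' t \<oplus> vert (init) n k m p q d c' t"
    unfolding init_vert_app using c1 d1 c1' by (subst finsum_addf[symmetric]) (auto simp: l_distr)
qed

lemma init_vert_lin2:
  assumes c: "c :> FreeM (init_basis k m p)"
  shows "vert (init) n k m p q c \<in>
    Lin (FreeM (init_basis n k q)) (FreeM (init_basis n m (p + q)))"
proof (rule free_linI[OF finite_init_basis])
  note c1 = free_carrierD(1)[OF c]
  fix c' t assume c': "c' :> FreeM (init_basis n k q)"
  note c1' = free_carrierD(1)[OF c']
  show "vert (init) n k m p q c c' t :> R"
    unfolding init_vert_app by (intro finsum_closed) (simp add: c1 c1' Pi_iff)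
  show "t \<notin> init_basis n m (p + q) \<Longrightarrow> vert (init) n k m p q c c' t = \<zero>"
    by (rule init_vert_zero[OF c c'])
  { fix a assume a: "a :> R"
    show "vert (init) n k m p q c (\<lambda>s. a \<otimes> c' s) t = a \<otimes> vert (init) n k m p q c c' t"
      unfolding init_vert_app using a c1 c1' by (subst finsum_rdistr[OF finite_perms]) (auto simp: m_lcomm) }
  fix d assume d: "d :> FreeM (init_basis n k q)"
  note d1 = free_carrierD(1)[OF d]
  show "vert (init) n k m p q c (\<lambda>s. c' s \<oplus> d s) t = vert (init) n k m p q c c' t \<oplus> vert (init) n k m p q c d t"
    unfolding init_vert_app using c1 d1 c1' by (subst finsum_addf[symmetric]) (auto simp: r_distr)
qed

lemma init_vert_basis:
  assumes \<sigma>: "\<sigma> \<in> perms k"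
  shows "vert (init) n k m p q (basis \<sigma>) (basis \<tau>) = basis (\<sigma> \<circ> \<tau>)"
proof
  fix t
  have "(\<Oplus>\<rho>\<in>perms k. basis \<sigma> \<rho> \<otimes> basis \<tau> (pinv \<rho> \<circ> t)) = basis \<sigma> \<sigma> \<otimes> basis \<tau> (pinv \<sigma> \<circ> t)"
    by (rule finsum_eq_single[OF finite_perms \<sigma>]) (auto simp: basis_elt_def)
  moreover have "pinv \<sigma> \<circ> t = \<tau> \<longleftrightarrow> t = \<sigma> \<circ> \<tau>"
    using permutes_inverses[OF permsD[OF \<sigma>]] unfolding fun_eq_iff comp_def by metis
  ultimately show "vert (init) n k m p q (basis \<sigma>) (basis \<tau>) t = basis (\<sigma> \<circ> \<tau>) t"
    by (simp add: init_vert_app basis_elt_def)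
qed

section \<open>The morphism from the initial prop\<close>

lemma dg_bilinearD:
  assumes "dg_bilinear R X Y Z \<mu>"
  shows "x :> gr X p \<Longrightarrow> \<mu> p q x \<in> Lin (gr Y q) (gr Z (p + q))"
    "y :> gr Y q \<Longrightarrow> (\<lambda>x. \<mu> p q x y) \<in> Lin (gr X p) (gr Z (p + q))"
    "\<lbrakk>x :> gr X p; y :> gr Y q\<rbrakk> \<Longrightarrow> diff Z (p + q) (\<mu> p q x y) =
          \<mu> (p - 1) q (diff X p x) y
          +[gr Z (p + q - 1)] signed (gr Z (p + q - 1)) p (\<mu> p (q - 1) x (diff Y q y))"
  using assms by (auto simp: dg_bilinear_def)

context
  fixes P :: "('k, 'p) prop_data"
  assumes P: "dg_prop R P"
begin

lemma prop_module: "module R (gr (ops P m n) p)"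
  by (rule cx_module[OF dg_prop.complexes[OF P]])

lemma prop_lact_lin: "\<sigma> \<in> perms n \<Longrightarrow> lact P m n \<sigma> p \<in> Lin (gr (ops P m n) p) (gr (ops P m n) p)"
  by (rule chain_mapD(1)[OF dg_prop.lact_chain_map[OF P]])

lemma prop_ract_lin: "\<sigma> \<in> perms m \<Longrightarrow> ract P m n \<sigma> p \<in> Lin (gr (ops P m n) p) (gr (ops P m n) p)"
  by (rule chain_mapD(1)[OF dg_prop.ract_chain_map[OF P]])

lemmas prop_horiz_lin = dg_bilinearD(1,2)[OF dg_prop.horiz_bilinear[OF P]]
lemmas prop_vert_lin = dg_bilinearD(1,2)[OF dg_prop.vert_bilinear[OF P]]

lemma prop_lact_closed: "\<lbrakk>\<sigma> \<in> perms n; f \<in> ops_in P m n p\<rbrakk> \<Longrightarrow> lact P m n \<sigma> p f \<in> ops_in P m n p"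
  by (rule lin_closed[OF prop_lact_lin])

lemma prop_ract_closed: "\<lbrakk>\<sigma> \<in> perms m; f \<in> ops_in P m n p\<rbrakk> \<Longrightarrow> ract P m n \<sigma> p f \<in> ops_in P m n p"
  by (rule lin_closed[OF prop_ract_lin])

lemma prop_horiz_closed: "\<lbrakk>f \<in> ops_in P k m p; g \<in> ops_in P l n q\<rbrakk> \<Longrightarrow>
    horiz P k m l n p q f g \<in> ops_in P (k + l) (m + n) (p + q)"
  by (rule lin_closed[OF prop_horiz_lin(1)])

lemma prop_vert_closed: "\<lbrakk>f \<in> ops_in P k m p; g \<in> ops_in P n k q\<rbrakk> \<Longrightarrow>
    vert P n k m p q f g \<in> ops_in P n m (p + q)"
  by (rule lin_closed[OF prop_vert_lin(1)])

lemma prop_diff_closed: "f \<in> ops_in P m n p \<Longrightarrow> diff (ops P m n) p f \<in> ops_in P m n (p - 1)"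
  by (rule lin_closed[OF cx_diff_lin[OF dg_prop.complexes[OF P]]])

lemma init_value_closed: "\<sigma> \<in> init_basis m n p \<Longrightarrow> lact P m n \<sigma> p (punit P n) \<in> ops_in P m n p"
  using init_basisD[of \<sigma> m n p] dg_prop.unit_closed[OF P, of n] by (auto intro: prop_lact_closed)

lemma initial_map_free: "initial_map R P m n p = free_lift (gr (ops P m n) p) (\<lambda>\<sigma>. lact P m n \<sigma> p (punit P n))"
  by (simp add: initial_map_def free_lift_def fun_eq_iff)

lemma initial_map_lin: "initial_map R P m n p \<in> Lin (FreeM (init_basis m n p)) (gr (ops P m n) p)"
  unfolding initial_map_free by (rule free_lift_lin[OF prop_module init_value_closed])

lemma initial_map_basis: "\<sigma> \<in> init_basis m n p \<Longrightarrow> initial_map R P m n p (basis \<sigma>) = lact P m n \<sigma> p (punit P n)"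
  unfolding initial_map_free by (rule free_lift_basis[OF prop_module init_value_closed])

text \<open>Composing two units, the balancing law moves \<sigma> from the right of one to the left
  of the other. This gives compatibility of \<open>initial_map\<close> with right actions, although
  its formula only mentions left actions.\<close>

lemma unit_ract: "\<sigma> \<in> perms n \<Longrightarrow> ract P n n \<sigma> 0 (punit P n) = lact P n n \<sigma> 0 (punit P n)"
proof -
  assume \<sigma>: "\<sigma> \<in> perms n"
  note u = dg_prop.unit_closed[OF P, of n]
  have "ract P n n \<sigma> 0 (punit P n) = vert P n n n 0 0 (ract P n n \<sigma> 0 (punit P n)) (punit P n)"
    by (rule dg_prop.vert_unit_right[OF P prop_ract_closed[OF \<sigma> u], symmetric])
  also have "\<dots> = vert P n n n 0 0 (punit P n) (lact P n n \<sigma> 0 (punit P n))"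
    by (rule dg_prop.vert_balanced[OF P \<sigma> u u])
  also have "\<dots> = lact P n n \<sigma> 0 (punit P n)"
    by (rule dg_prop.vert_unit_left[OF P prop_lact_closed[OF \<sigma> u]])
  finally show ?thesis .
qed

text \<open>Each condition is linear in every argument and is therefore checked on permutations,
  where it reduces to axioms of \<open>P\<close> applied to units.\<close>

lemma initial_map_hom: "prop_hom R (init) P (initial_map R P)"
proof (rule prop_hom.intro, unfold init_gr)
  note L = initial_map_lin and M = prop_module and B = initial_map_basis and u = dg_prop.unit_closed[OF P]
  show "cmap (ops (init) m n) (ops P m n) (initial_map R P m n)" for m n
    unfolding chain_map_def init_gr
  proof (intro allI conjI ballI)
    fix p
    show "initial_map R P m n p \<in> Lin (FreeM (init_basis m n p)) (gr (ops P m n) p)" by (rule L)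
    fix c assume c: "c :> FreeM (init_basis m n p)"
    have 1: "initial_map R P m n (p - 1) (diff (ops (init) m n) p c) = 0[gr (ops P m n) (p - 1)]"
      using lin_zero[OF free_module M L, of m n "p - 1"] by (simp add: initial_prop_def free_simps)
    \<comment> \<open>Basis elements only exist in degree zero, so this differential lands in degree
      -1, where \<open>P\<close> vanishes.\<close>
    have 2: "diff (ops P m n) p (initial_map R P m n p c) = 0[gr (ops P m n) (p - 1)]"
    proof (rule free_ext[OF M lin_comp[OF L cx_diff_lin[OF dg_prop.complexes[OF P]]] lin_zerof[OF M] _ c])
      fix \<sigma> assume \<sigma>: "\<sigma> \<in> init_basis m n p"
      then have p: "p = 0" using init_basisD by blast
      show "diff (ops P m n) p (initial_map R P m n p (basis \<sigma>)) = 0[gr (ops P m n) (p - 1)]"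
        using prop_diff_closed[OF init_value_closed[OF \<sigma>]] chain_complex.nonneg[OF dg_prop.complexes[OF P], of "p - 1" m n]
        unfolding B[OF \<sigma>] by (simp add: p)
    qed
    show "initial_map R P m n (p - 1) (diff (ops (init) m n) p c) = diff (ops P m n) p (initial_map R P m n p c)"
      by (simp only: 1 2)
  qed
  fix m n f p assume f: "f :> FreeM (init_basis m n p)"
  show "initial_map R P m n p (lact (init) m n \<sigma> p f) = lact P m n \<sigma> p (initial_map R P m n p f)"
    if \<sigma>: "\<sigma> \<in> perms n" for \<sigma>
  proof (rule free_ext[OF M lin_comp[OF init_lact_lin[OF \<sigma>] L] lin_comp[OF L prop_lact_lin[OF \<sigma>]] _ f])
    fix \<rho> assume \<rho>: "\<rho> \<in> init_basis m n p"
    note d = init_basisD[OF \<rho>]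
    have c: "\<sigma> \<circ> \<rho> \<in> init_basis m n p" using d perms_comp[OF \<sigma>] by (simp add: init_basis_def)
    show "initial_map R P m n p (lact (init) m n \<sigma> p (basis \<rho>)) = lact P m n \<sigma> p (initial_map R P m n p (basis \<rho>))"
      unfolding init_lact_basis[OF \<sigma>] B[OF c] B[OF \<rho>] using dg_prop.lact_comp[OF P \<sigma>] u d by blast
  qed
  show "initial_map R P m n p (ract (init) m n \<sigma> p f) = ract P m n \<sigma> p (initial_map R P m n p f)"
    if \<sigma>: "\<sigma> \<in> perms m" for \<sigma>
  proof (rule free_ext[OF M lin_comp[OF init_ract_lin[OF \<sigma>] L] lin_comp[OF L prop_ract_lin[OF \<sigma>]] _ f])
    fix \<rho> assume \<rho>: "\<rho> \<in> init_basis m n p"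
    note d = init_basisD[OF \<rho>]
    have c: "\<rho> \<circ> \<sigma> \<in> init_basis m n p" using d perms_comp[of \<rho> n \<sigma>] \<sigma> by (simp add: init_basis_def)
    have "lact P n n (\<rho> \<circ> \<sigma>) 0 (punit P n) = lact P n n \<rho> 0 (lact P n n \<sigma> 0 (punit P n))"
      using dg_prop.lact_comp[OF P _ _ u] d \<sigma> by blast
    also have "\<dots> = lact P n n \<rho> 0 (ract P n n \<sigma> 0 (punit P n))" using unit_ract[of \<sigma> n] d \<sigma> by simp
    also have "\<dots> = ract P n n \<sigma> 0 (lact P n n \<rho> 0 (punit P n))" using dg_prop.lact_ract[OF P _ _ u] d \<sigma> by blast
    finally show "initial_map R P m n p (ract (init) m n \<sigma> p (basis \<rho>)) = ract P m n \<sigma> p (initial_map R P m n p (basis \<rho>))"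
      unfolding init_ract_basis[OF \<sigma>] B[OF c] B[OF \<rho>] using d by simp
  qed
next
  note L = initial_map_lin and M = prop_module and B = initial_map_basis and u = dg_prop.unit_closed[OF P]
  fix k m l n p q f g assume f: "f :> FreeM (init_basis k m p)" and g: "g :> FreeM (init_basis l n q)"
  show "initial_map R P (k + l) (m + n) (p + q) (horiz (init) k m l n p q f g) =
       horiz P k m l n p q (initial_map R P k m p f) (initial_map R P l n q g)"
  proof (rule free_ext[OF M lin_comp[OF init_horiz_lin[OF g] L] lin_comp[OF L prop_horiz_lin(2)[OF lin_closed[OF L g]]] _ f])
    fix \<sigma> assume \<sigma>: "\<sigma> \<in> init_basis k m p"
    note s = init_basisD[OF \<sigma>]
    show "initial_map R P (k + l) (m + n) (p + q) (horiz (init) k m l n p q (basis \<sigma>) g) =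
       horiz P k m l n p q (initial_map R P k m p (basis \<sigma>)) (initial_map R P l n q g)"
    proof (rule free_ext[OF M lin_comp[OF init_horiz_lin2[OF basis_closed[OF \<sigma>]] L]
          lin_comp[OF L prop_horiz_lin(1)[OF lin_closed[OF L basis_closed[OF \<sigma>]]]] _ g])
      fix \<tau> assume \<tau>: "\<tau> \<in> init_basis l n q"
      note t = init_basisD[OF \<tau>]
      have c: "perm_sum m \<sigma> \<tau> \<in> init_basis (k + l) (m + n) (p + q)"
        using s t perm_sum_perms(1)[of \<sigma> m \<tau> n] by (simp add: init_basis_def)
      have st: "\<sigma> \<in> perms m" "\<tau> \<in> perms n" using s t by auto
      show "initial_map R P (k + l) (m + n) (p + q) (horiz (init) k m l n p q (basis \<sigma>) (basis \<tau>)) =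
         horiz P k m l n p q (initial_map R P k m p (basis \<sigma>)) (initial_map R P l n q (basis \<tau>))"
        unfolding init_horiz_basis[OF st] B[OF c] B[OF \<sigma>] B[OF \<tau>]
        using dg_prop.horiz_lact[OF P st u u] dg_prop.horiz_units[OF P, of m n] s t by simp
    qed
  qed
next
  note L = initial_map_lin and M = prop_module and B = initial_map_basis and u = dg_prop.unit_closed[OF P]
  fix k m n p q f g assume f: "f :> FreeM (init_basis k m p)" and g: "g :> FreeM (init_basis n k q)"
  show "initial_map R P n m (p + q) (vert (init) n k m p q f g) =
       vert P n k m p q (initial_map R P k m p f) (initial_map R P n k q g)"
  proof (rule free_ext[OF M lin_comp[OF init_vert_lin[OF g] L] lin_comp[OF L prop_vert_lin(2)[OF lin_closed[OF L g]]] _ f])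
    fix \<sigma> assume \<sigma>: "\<sigma> \<in> init_basis k m p"
    note s = init_basisD[OF \<sigma>]
    show "initial_map R P n m (p + q) (vert (init) n k m p q (basis \<sigma>) g) =
       vert P n k m p q (initial_map R P k m p (basis \<sigma>)) (initial_map R P n k q g)"
    proof (rule free_ext[OF M lin_comp[OF init_vert_lin2[OF basis_closed[OF \<sigma>]] L]
          lin_comp[OF L prop_vert_lin(1)[OF lin_closed[OF L basis_closed[OF \<sigma>]]]] _ g])
      fix \<tau> assume \<tau>: "\<tau> \<in> init_basis n k q"
      note t = init_basisD[OF \<tau>]
      have st: "\<sigma> \<in> perms k" "\<tau> \<in> perms k" using s t by auto
      have c: "\<sigma> \<circ> \<tau> \<in> init_basis n m (p + q)"
        using s t perms_comp[OF st] by (simp add: init_basis_def)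
      have "vert P k k k 0 0 (lact P k k \<sigma> 0 (punit P k)) (lact P k k \<tau> 0 (punit P k)) = lact P k k (\<sigma> \<circ> \<tau>) 0 (punit P k)"
        using dg_prop.vert_lact[OF P st(1) u prop_lact_closed[OF st(2) u]]
          dg_prop.vert_unit_left[OF P prop_lact_closed[OF st(2) u]] dg_prop.lact_comp[OF P st u] by simp
      then show "initial_map R P n m (p + q) (vert (init) n k m p q (basis \<sigma>) (basis \<tau>)) =
         vert P n k m p q (initial_map R P k m p (basis \<sigma>)) (initial_map R P n k q (basis \<tau>))"
        unfolding init_vert_basis[OF st(1)] B[OF c] B[OF \<sigma>] B[OF \<tau>] using s t by simp
    qed
  qed
next
  show "initial_map R P n n 0 (punit (init) n) = punit P n" for n
    using initial_map_basis[of id n n 0] perms_id dg_prop.lact_id[OF P dg_prop.unit_closed[OF P]]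
    by (simp add: initial_prop_def init_basis_def)
qed

end

text \<open>A morphism preserves units and left actions. As a consequence, every square that starts
  at the initial prop commutes, as the lifting property demands.\<close>

lemma initial_map_natural:
  assumes P: "dg_prop R P" and Q: "dg_prop R Q" and \<phi>: "prop_hom R P Q \<phi>" and c: "c \<in> ops_in (init) m n p"
  shows "\<phi> m n p (initial_map R P m n p c) = initial_map R Q m n p c"
proof (rule free_ext[OF prop_module[OF Q] lin_comp[OF initial_map_lin[OF P] chain_mapD(1)[OF prop_hom.hom_chain_map[OF \<phi>]]]
      initial_map_lin[OF Q] _ c[unfolded init_gr]])
  fix \<sigma> assume \<sigma>: "\<sigma> \<in> init_basis m n p"
  note s = init_basisD[OF \<sigma>]
  show "\<phi> m n p (initial_map R P m n p (basis \<sigma>)) = initial_map R Q m n p (basis \<sigma>)"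
    unfolding initial_map_basis[OF P \<sigma>] initial_map_basis[OF Q \<sigma>]
    using prop_hom.hom_lact[OF \<phi> _ dg_prop.unit_closed[OF P], of \<sigma> n] prop_hom.hom_unit[OF \<phi>, of n] s by simp
qed

end

subsection \<open>Subobjects of threefold products\<close>

text \<open>An arbitrary encoding of three components in one type \<open>'u\<close>. With suitable
  encodings the same construction yields the mapping cylinder, the test prop, the copy of
  \<open>P\<close> below it and the copy of \<open>H\<close>, each inside a type prescribed by the
  theorem.\<close>

locale triple = ground_ring R for R :: "'k ring" (structure) +
  fixes mk :: "'p \<Rightarrow> 'q \<Rightarrow> 'r \<Rightarrow> 'u" and pr1 :: "'u \<Rightarrow> 'p" and pr2 :: "'u \<Rightarrow> 'q" and pr3 :: "'u \<Rightarrow> 'r"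
  assumes pr_mk [simp]: "pr1 (mk x y z) = x" "pr2 (mk x y z) = y" "pr3 (mk x y z) = z"
begin

lemma mk_eq_iff [simp]: "mk x y z = mk x' y' z' \<longleftrightarrow> x = x' \<and> y = y' \<and> z = z'"
  by (metis pr_mk)

definition tmod :: "('k, 'p) module \<Rightarrow> ('k, 'q) module \<Rightarrow> ('k, 'r) module \<Rightarrow> ('p \<Rightarrow> 'q \<Rightarrow> 'r \<Rightarrow> bool) \<Rightarrow> ('k, 'u) module" where
  "tmod M1 M2 M3 Q =
    \<lparr>carrier = {mk x y z | x y z. x :> M1 \<and> y :> M2 \<and> z :> M3 \<and> Q x y z},
     monoid.mult = undefined, one = undefined, zero = mk 0[M1] 0[M2] 0[M3],
     add = (\<lambda>u v. mk (pr1 u +[M1] pr1 v) (pr2 u +[M2] pr2 v) (pr3 u +[M3] pr3 v)),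
     smult = (\<lambda>a u. mk (a *[M1] pr1 u) (a *[M2] pr2 u) (a *[M3] pr3 u))\<rparr>"

lemma tmod_simps:
  "mk x y z :> tmod M1 M2 M3 Q \<longleftrightarrow> x :> M1 \<and> y :> M2 \<and> z :> M3 \<and> Q x y z"
  "0[tmod M1 M2 M3 Q] = mk 0[M1] 0[M2] 0[M3]"
  "mk x y z +[tmod M1 M2 M3 Q] mk x' y' z' = mk (x +[M1] x') (y +[M2] y') (z +[M3] z')"
  "a *[tmod M1 M2 M3 Q] mk x y z = mk (a *[M1] x) (a *[M2] y) (a *[M3] z)"
  by (auto simp: tmod_def)

lemma tmod_cases:
  assumes "u :> tmod M1 M2 M3 Q"
  obtains x y z where "u = mk x y z" "x :> M1" "y :> M2" "z :> M3" "Q x y z"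
  using assms by (auto simp: tmod_def)

definition tclosed :: "('k, 'p) module \<Rightarrow> ('k, 'q) module \<Rightarrow> ('k, 'r) module \<Rightarrow> ('p \<Rightarrow> 'q \<Rightarrow> 'r \<Rightarrow> bool) \<Rightarrow> bool" where
  "tclosed M1 M2 M3 Q \<longleftrightarrow> Q 0[M1] 0[M2] 0[M3] \<and>
    (\<forall>x\<in>carrier M1. \<forall>y\<in>carrier M2. \<forall>z\<in>carrier M3. \<forall>x'\<in>carrier M1. \<forall>y'\<in>carrier M2. \<forall>z'\<in>carrier M3.
      Q x y z \<longrightarrow> Q x' y' z' \<longrightarrow> Q (x +[M1] x') (y +[M2] y') (z +[M3] z')) \<and>
    (\<forall>a\<in>carrier R. \<forall>x\<in>carrier M1. \<forall>y\<in>carrier M2. \<forall>z\<in>carrier M3.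
      Q x y z \<longrightarrow> Q (a *[M1] x) (a *[M2] y) (a *[M3] z))"

context
  fixes M1 :: "('k, 'p) module" and M2 :: "('k, 'q) module" and M3 :: "('k, 'r) module" and Q :: "'p \<Rightarrow> 'q \<Rightarrow> 'r \<Rightarrow> bool"
  assumes M1: "module R M1" and M2: "module R M2" and M3: "module R M3" and Q: "tclosed M1 M2 M3 Q"
begin

lemma tmod_module: "module R (tmod M1 M2 M3 Q)"
proof (intro moduleI abelian_groupI)
  let ?T = "tmod M1 M2 M3 Q"
  interpret M1: module R M1 by (rule M1)
  interpret M2: module R M2 by (rule M2)
  interpret M3: module R M3 by (rule M3)
  have Q0: "Q 0[M1] 0[M2] 0[M3]" using Q by (simp add: tclosed_def)
  have Qs: "Q (a *[M1] x) (a *[M2] y) (a *[M3] z)" if "a :> R" "x :> M1" "y :> M2" "z :> M3" "Q x y z" for a x y z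
    using Q that by (simp add: tclosed_def)
  show "cring R" by (rule is_cring)
  show "0[?T] :> ?T" by (simp add: tmod_simps Q0)
  fix u assume "u :> ?T"
  then obtain x y z where u: "u = mk x y z" "x :> M1" "y :> M2" "z :> M3" "Q x y z" by (rule tmod_cases)
  show "0[?T] +[?T] u = u" "\<one> *[?T] u = u" using u by (simp_all add: tmod_simps)
  show "\<exists>v\<in>carrier ?T. v +[?T] u = 0[?T]"
    by (rule bexI[of _ "mk ((\<ominus> \<one>) *[M1] x) ((\<ominus> \<one>) *[M2] y) ((\<ominus> \<one>) *[M3] z)"])
      (use u Qs[of "\<ominus> \<one>" x y z] in \<open>simp_all add: tmod_simps M1.smult_l_minus M2.smult_l_minus M3.smult_l_minus M1.M.l_neg M2.M.l_neg M3.M.l_neg\<close>)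
  fix a assume a: "a :> R"
  show "a *[?T] u :> ?T" using u a by (simp add: tmod_simps Qs)
  { fix b assume b: "b :> R"
    show "(a \<oplus> b) *[?T] u = a *[?T] u +[?T] b *[?T] u" "(a \<otimes> b) *[?T] u = a *[?T] (b *[?T] u)"
      using u a b M1 M2 M3 by (simp_all add: tmod_simps mod_add_smult mod_mult_smult) }
  fix v assume "v :> ?T"
  then obtain x' y' z' where v: "v = mk x' y' z'" "x' :> M1" "y' :> M2" "z' :> M3" "Q x' y' z'" by (rule tmod_cases)
  show "a *[?T] (u +[?T] v) = a *[?T] u +[?T] a *[?T] v"
    using u a v M1 M2 M3 by (simp add: tmod_simps mod_smult_add)
next
  let ?T = "tmod M1 M2 M3 Q"
  interpret M1: module R M1 by (rule M1)
  interpret M2: module R M2 by (rule M2)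
  interpret M3: module R M3 by (rule M3)
  have Qa: "Q (x +[M1] x') (y +[M2] y') (z +[M3] z')" if "x :> M1" "y :> M2" "z :> M3" "Q x y z"
    "x' :> M1" "y' :> M2" "z' :> M3" "Q x' y' z'" for x y z x' y' z'
    using Q that by (simp add: tclosed_def)
  fix u v assume asm: "u :> ?T" "v :> ?T"
  obtain x y z where u: "u = mk x y z" "x :> M1" "y :> M2" "z :> M3" "Q x y z" by (rule tmod_cases[OF asm(1)])
  obtain x' y' z' where v: "v = mk x' y' z'" "x' :> M1" "y' :> M2" "z' :> M3" "Q x' y' z'" by (rule tmod_cases[OF asm(2)])
  show "u +[?T] v :> ?T" using u v by (simp add: tmod_simps Qa)
  show "u +[?T] v = v +[?T] u" using u v by (simp add: tmod_simps M1.M.a_comm M2.M.a_comm M3.M.a_comm)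
  fix w assume "w :> ?T"
  then obtain x'' y'' z'' where w: "w = mk x'' y'' z''" "x'' :> M1" "y'' :> M2" "z'' :> M3" "Q x'' y'' z''"
    by (rule tmod_cases)
  show "u +[?T] v +[?T] w = u +[?T] (v +[?T] w)"
    using u v w by (simp add: tmod_simps M1.M.a_assoc M2.M.a_assoc M3.M.a_assoc)
qed

lemma tmod_pr_lin:
  "pr1 \<in> Lin (tmod M1 M2 M3 Q) M1" "pr2 \<in> Lin (tmod M1 M2 M3 Q) M2" "pr3 \<in> Lin (tmod M1 M2 M3 Q) M3"
  by (auto intro!: linI elim!: tmod_cases simp: tmod_simps)

text \<open>Subtraction and signs are derived from the record rather than stored in it. Their
  components are read off by applying the linear projections.\<close>

lemma tmod_minus: "\<lbrakk>mk x y z :> tmod M1 M2 M3 Q; mk x' y' z' :> tmod M1 M2 M3 Q\<rbrakk> \<Longrightarrow>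
    mk x y z -[tmod M1 M2 M3 Q] mk x' y' z' = mk (x -[M1] x') (y -[M2] y') (z -[M3] z')"
proof -
  let ?T = "tmod M1 M2 M3 Q"
  assume a: "mk x y z :> ?T" "mk x' y' z' :> ?T"
  obtain x'' y'' z'' where d: "mk x y z -[?T] mk x' y' z' = mk x'' y'' z''"
    using mod_minus_closed[OF tmod_module a] by (rule tmod_cases)
  then show ?thesis
    using lin_minus[OF tmod_module M1 tmod_pr_lin(1) a] lin_minus[OF tmod_module M2 tmod_pr_lin(2) a]
      lin_minus[OF tmod_module M3 tmod_pr_lin(3) a] by simp
qed

lemma tmod_signed: "mk x y z :> tmod M1 M2 M3 Q \<Longrightarrow>
    signed (tmod M1 M2 M3 Q) e (mk x y z) = mk (signed M1 e x) (signed M2 e y) (signed M3 e z)"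
proof -
  let ?T = "tmod M1 M2 M3 Q"
  assume a: "mk x y z :> ?T"
  obtain x'' y'' z'' where d: "signed ?T e (mk x y z) = mk x'' y'' z''"
    using signed_closed[OF tmod_module a] by (rule tmod_cases)
  then show ?thesis
    using lin_signed[OF tmod_module M1 tmod_pr_lin(1) a, of e] lin_signed[OF tmod_module M2 tmod_pr_lin(2) a, of e]
      lin_signed[OF tmod_module M3 tmod_pr_lin(3) a, of e] by simp
qed

lemma tmod_mk_lin:
  assumes "module R N" and f: "f1 \<in> Lin N M1" "f2 \<in> Lin N M2" "f3 \<in> Lin N M3"
    and "\<And>x. x :> N \<Longrightarrow> Q (f1 x) (f2 x) (f3 x)"
  shows "(\<lambda>x. mk (f1 x) (f2 x) (f3 x)) \<in> Lin N (tmod M1 M2 M3 Q)"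
  using assms by (intro linI) (auto simp: tmod_simps lin_add lin_smult intro: lin_closed)

end

definition tprop :: "('k, 'p) prop_data \<Rightarrow> ('k, 'q) prop_data \<Rightarrow> ('k, 'r) prop_data \<Rightarrow>
    (nat \<Rightarrow> nat \<Rightarrow> int \<Rightarrow> 'p \<Rightarrow> 'q \<Rightarrow> 'r \<Rightarrow> bool) \<Rightarrow> ('k, 'u) prop_data" where
  "tprop P1 P2 P3 Q =
    \<lparr>ops = (\<lambda>m n. \<lparr>gr = (\<lambda>p. tmod (gr (ops P1 m n) p) (gr (ops P2 m n) p) (gr (ops P3 m n) p) (Q m n p)),
       diff = (\<lambda>p u. mk (diff (ops P1 m n) p (pr1 u)) (diff (ops P2 m n) p (pr2 u)) (diff (ops P3 m n) p (pr3 u)))\<rparr>),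
     lact = (\<lambda>m n \<sigma> p u. mk (lact P1 m n \<sigma> p (pr1 u)) (lact P2 m n \<sigma> p (pr2 u)) (lact P3 m n \<sigma> p (pr3 u))),
     ract = (\<lambda>m n \<sigma> p u. mk (ract P1 m n \<sigma> p (pr1 u)) (ract P2 m n \<sigma> p (pr2 u)) (ract P3 m n \<sigma> p (pr3 u))),
     horiz = (\<lambda>k m l n p q u v. mk (horiz P1 k m l n p q (pr1 u) (pr1 v)) (horiz P2 k m l n p q (pr2 u) (pr2 v)) (horiz P3 k m l n p q (pr3 u) (pr3 v))),
     vert = (\<lambda>n k m p q u v. mk (vert P1 n k m p q (pr1 u) (pr1 v)) (vert P2 n k m p q (pr2 u) (pr2 v)) (vert P3 n k m p q (pr3 u) (pr3 v))),
     punit = (\<lambda>n. mk (punit P1 n) (punit P2 n) (punit P3 n))\<rparr>"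

end

text \<open>Defined ahead of the locale because the assumptions of \<open>triple_prop\<close> are
  stated with it.\<close>

definition in3 :: "('k, 'p) prop_data \<Rightarrow> ('k, 'q) prop_data \<Rightarrow> ('k, 'r) prop_data \<Rightarrow>
    (nat \<Rightarrow> nat \<Rightarrow> int \<Rightarrow> 'p \<Rightarrow> 'q \<Rightarrow> 'r \<Rightarrow> bool) \<Rightarrow> nat \<Rightarrow> nat \<Rightarrow> int \<Rightarrow> 'p \<Rightarrow> 'q \<Rightarrow> 'r \<Rightarrow> bool" where
  "in3 P1 P2 P3 Q m n p x y z \<longleftrightarrow> x \<in> ops_in P1 m n p \<and> y \<in> ops_in P2 m n p \<and> z \<in> ops_in P3 m n p \<and> Q m n p x y z"

text \<open>The assumptions say that \<open>Q\<close> cuts out a subprop of the product of three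
  props. They are only required for elements of the carriers, as relations between operations say
  nothing about other values.\<close>

locale triple_prop = triple R mk pr1 pr2 pr3
  for R :: "'k ring" (structure) and mk :: "'p \<Rightarrow> 'q \<Rightarrow> 'r \<Rightarrow> 'u" and pr1 :: "'u \<Rightarrow> 'p" and pr2 :: "'u \<Rightarrow> 'q" and pr3 :: "'u \<Rightarrow> 'r" +
  fixes P1 :: "('k, 'p) prop_data" and P2 :: "('k, 'q) prop_data" and P3 :: "('k, 'r) prop_data"
    and Q :: "nat \<Rightarrow> nat \<Rightarrow> int \<Rightarrow> 'p \<Rightarrow> 'q \<Rightarrow> 'r \<Rightarrow> bool"
  assumes P1: "dg_prop R P1" and P2: "dg_prop R P2" and P3: "dg_prop R P3" and Q_zero: "Q m n p 0[gr (ops P1 m n) p] 0[gr (ops P2 m n) p] 0[gr (ops P3 m n) p]" and Q_add: "\<lbrakk>in3 P1 P2 P3 Q m n p x y z; in3 P1 P2 P3 Q m n p x' y' z'\<rbrakk> \<Longrightarrow>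
      Q m n p (x +[gr (ops P1 m n) p] x') (y +[gr (ops P2 m n) p] y') (z +[gr (ops P3 m n) p] z')" and Q_smult: "\<lbrakk>a :> R; in3 P1 P2 P3 Q m n p x y z\<rbrakk> \<Longrightarrow>
      Q m n p (a *[gr (ops P1 m n) p] x) (a *[gr (ops P2 m n) p] y) (a *[gr (ops P3 m n) p] z)" and Q_diff: "in3 P1 P2 P3 Q m n p x y z \<Longrightarrow>
      Q m n (p - 1) (diff (ops P1 m n) p x) (diff (ops P2 m n) p y) (diff (ops P3 m n) p z)" and Q_lact: "\<lbrakk>\<sigma> \<in> perms n; in3 P1 P2 P3 Q m n p x y z\<rbrakk> \<Longrightarrow> Q m n p (lact P1 m n \<sigma> p x) (lact P2 m n \<sigma> p y) (lact P3 m n \<sigma> p z)" and Q_ract: "\<lbrakk>\<sigma> \<in> perms m; in3 P1 P2 P3 Q m n p x y z\<rbrakk> \<Longrightarrow> Q m n p (ract P1 m n \<sigma> p x) (ract P2 m n \<sigma> p y) (ract P3 m n \<sigma> p z)" and Q_horiz: "\<lbrakk>in3 P1 P2 P3 Q k m p x y z; in3 P1 P2 P3 Q l n q x' y' z'\<rbrakk> \<Longrightarrow>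
      Q (k + l) (m + n) (p + q) (horiz P1 k m l n p q x x') (horiz P2 k m l n p q y y') (horiz P3 k m l n p q z z')" and Q_vert: "\<lbrakk>in3 P1 P2 P3 Q k m p x y z; in3 P1 P2 P3 Q n k q x' y' z'\<rbrakk> \<Longrightarrow>
      Q n m (p + q) (vert P1 n k m p q x x') (vert P2 n k m p q y y') (vert P3 n k m p q z z')" and Q_unit: "Q n n 0 (punit P1 n) (punit P2 n) (punit P3 n)"
begin

abbreviation "T \<equiv> tprop P1 P2 P3 Q"
abbreviation "I3 \<equiv> in3 P1 P2 P3 Q"

lemma T_gr: "gr (ops T m n) p = tmod (gr (ops P1 m n) p) (gr (ops P2 m n) p) (gr (ops P3 m n) p) (Q m n p)"
  by (simp add: tprop_def)

lemma T_simps: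
  "diff (ops T m n) p (mk x y z) = mk (diff (ops P1 m n) p x) (diff (ops P2 m n) p y) (diff (ops P3 m n) p z)"
  "lact T m n \<sigma> p (mk x y z) = mk (lact P1 m n \<sigma> p x) (lact P2 m n \<sigma> p y) (lact P3 m n \<sigma> p z)"
  "ract T m n \<sigma> p (mk x y z) = mk (ract P1 m n \<sigma> p x) (ract P2 m n \<sigma> p y) (ract P3 m n \<sigma> p z)"
  "horiz T k m l n p q (mk x y z) (mk x' y' z') = mk (horiz P1 k m l n p q x x') (horiz P2 k m l n p q y y') (horiz P3 k m l n p q z z')"
  "vert T n k m p q (mk x y z) (mk x' y' z') = mk (vert P1 n k m p q x x') (vert P2 n k m p q y y') (vert P3 n k m p q z z')"
  "punit T n = mk (punit P1 n) (punit P2 n) (punit P3 n)"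
  by (simp_all add: tprop_def)

lemma T_in: "mk x y z \<in> ops_in T m n p \<longleftrightarrow> I3 m n p x y z"
  by (simp add: T_gr tmod_simps in3_def)

lemma T_cases:
  assumes "u \<in> ops_in T m n p"
  obtains x y z where "u = mk x y z" "I3 m n p x y z"
proof -
  obtain x y z where "u = mk x y z" "x \<in> ops_in P1 m n p" "y \<in> ops_in P2 m n p" "z \<in> ops_in P3 m n p" "Q m n p x y z"
    using assms unfolding T_gr by (rule tmod_cases)
  then show ?thesis by (intro that[of x y z]) (simp_all add: in3_def)
qed

lemma I3D:
  assumes "I3 m n p x y z"
  shows "x \<in> ops_in P1 m n p" "y \<in> ops_in P2 m n p" "z \<in> ops_in P3 m n p"
  using assms by (auto simp: in3_def)

lemmas PM = prop_module[OF P1] prop_module[OF P2] prop_module[OF P3]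

lemma T_tclosed: "tclosed (gr (ops P1 m n) p) (gr (ops P2 m n) p) (gr (ops P3 m n) p) (Q m n p)"
  using Q_zero Q_add[of m n p] Q_smult[of _ m n p] by (simp add: tclosed_def in3_def)

lemma T_module: "module R (gr (ops T m n) p)"
  unfolding T_gr by (rule tmod_module[OF PM T_tclosed])

lemma T_ops:
  "0[gr (ops T m n) p] = mk 0[gr (ops P1 m n) p] 0[gr (ops P2 m n) p] 0[gr (ops P3 m n) p]"
  "mk x y z +[gr (ops T m n) p] mk x' y' z' =
    mk (x +[gr (ops P1 m n) p] x') (y +[gr (ops P2 m n) p] y') (z +[gr (ops P3 m n) p] z')"
  "a *[gr (ops T m n) p] mk x y z = mk (a *[gr (ops P1 m n) p] x) (a *[gr (ops P2 m n) p] y) (a *[gr (ops P3 m n) p] z)"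
  by (simp_all add: T_gr tmod_simps)

lemma T_signed: "I3 m n p x y z \<Longrightarrow> signed (gr (ops T m n) p) e (mk x y z) =
    mk (signed (gr (ops P1 m n) p) e x) (signed (gr (ops P2 m n) p) e y) (signed (gr (ops P3 m n) p) e z)"
  using tmod_signed[OF PM T_tclosed] by (simp add: T_gr tmod_simps in3_def)

lemma I3_smult: "\<lbrakk>a :> R; I3 m n p x y z\<rbrakk> \<Longrightarrow>
    I3 m n p (a *[gr (ops P1 m n) p] x) (a *[gr (ops P2 m n) p] y) (a *[gr (ops P3 m n) p] z)"
  using Q_smult[of a m n p x y z] PM by (auto simp: in3_def)

lemma I3_diff: "I3 m n p x y z \<Longrightarrow>
    I3 m n (p - 1) (diff (ops P1 m n) p x) (diff (ops P2 m n) p y) (diff (ops P3 m n) p z)"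
  using Q_diff[of m n p x y z] prop_diff_closed[OF P1] prop_diff_closed[OF P2] prop_diff_closed[OF P3] by (auto simp: in3_def)

lemma I3_lact: "\<lbrakk>\<sigma> \<in> perms n; I3 m n p x y z\<rbrakk> \<Longrightarrow> I3 m n p (lact P1 m n \<sigma> p x) (lact P2 m n \<sigma> p y) (lact P3 m n \<sigma> p z)"
  using Q_lact[of \<sigma> n m p x y z] prop_lact_closed[OF P1] prop_lact_closed[OF P2] prop_lact_closed[OF P3] by (auto simp: in3_def)

lemma I3_ract: "\<lbrakk>\<sigma> \<in> perms m; I3 m n p x y z\<rbrakk> \<Longrightarrow> I3 m n p (ract P1 m n \<sigma> p x) (ract P2 m n \<sigma> p y) (ract P3 m n \<sigma> p z)"
  using Q_ract[of \<sigma> m n p x y z] prop_ract_closed[OF P1] prop_ract_closed[OF P2] prop_ract_closed[OF P3] by (auto simp: in3_def)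

lemma I3_horiz: "\<lbrakk>I3 k m p x y z; I3 l n q x' y' z'\<rbrakk> \<Longrightarrow>
    I3 (k + l) (m + n) (p + q) (horiz P1 k m l n p q x x') (horiz P2 k m l n p q y y') (horiz P3 k m l n p q z z')"
  using Q_horiz[of k m p x y z l n q x' y' z'] prop_horiz_closed[OF P1] prop_horiz_closed[OF P2] prop_horiz_closed[OF P3]
  by (auto simp: in3_def)

lemma I3_vert: "\<lbrakk>I3 k m p x y z; I3 n k q x' y' z'\<rbrakk> \<Longrightarrow>
    I3 n m (p + q) (vert P1 n k m p q x x') (vert P2 n k m p q y y') (vert P3 n k m p q z z')"
  using Q_vert[of k m p x y z n q x' y' z'] prop_vert_closed[OF P1] prop_vert_closed[OF P2] prop_vert_closed[OF P3]
  by (auto simp: in3_def)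

lemma I3_unit: "I3 n n 0 (punit P1 n) (punit P2 n) (punit P3 n)"
  using Q_unit dg_prop.unit_closed[OF P1] dg_prop.unit_closed[OF P2] dg_prop.unit_closed[OF P3] by (auto simp: in3_def)

lemma I3_zero: "I3 m n p 0[gr (ops P1 m n) p] 0[gr (ops P2 m n) p] 0[gr (ops P3 m n) p]"
  using Q_zero PM by (simp add: in3_def)

lemma T_linI:
  assumes M: "module R M" and F: "\<And>w. F w = mk (F1 w) (F2 w) (F3 w)" and l: "F1 \<in> Lin M (gr (ops P1 m n) p)" "F2 \<in> Lin M (gr (ops P2 m n) p)" "F3 \<in> Lin M (gr (ops P3 m n) p)" and Q: "\<And>w. w :> M \<Longrightarrow> I3 m n p (F1 w) (F2 w) (F3 w)"
  shows "F \<in> Lin M (gr (ops T m n) p)"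
  unfolding T_gr F[abs_def] by (rule tmod_mk_lin[OF PM T_tclosed M l]) (use Q in \<open>simp add: in3_def\<close>)

lemma T_pr_lin: "pr1 \<in> Lin (gr (ops T m n) p) (gr (ops P1 m n) p)"
  "pr2 \<in> Lin (gr (ops T m n) p) (gr (ops P2 m n) p)" "pr3 \<in> Lin (gr (ops T m n) p) (gr (ops P3 m n) p)"
  unfolding T_gr by (rule tmod_pr_lin[OF PM T_tclosed])+

lemma T_diff_app: "diff (ops T m n) p u = mk (diff (ops P1 m n) p (pr1 u)) (diff (ops P2 m n) p (pr2 u)) (diff (ops P3 m n) p (pr3 u))"
  by (simp add: tprop_def)

lemma T_lact_app: "lact T m n \<sigma> p u = mk (lact P1 m n \<sigma> p (pr1 u)) (lact P2 m n \<sigma> p (pr2 u)) (lact P3 m n \<sigma> p (pr3 u))"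
  by (simp add: tprop_def)

lemma T_ract_app: "ract T m n \<sigma> p u = mk (ract P1 m n \<sigma> p (pr1 u)) (ract P2 m n \<sigma> p (pr2 u)) (ract P3 m n \<sigma> p (pr3 u))"
  by (simp add: tprop_def)

lemma T_horiz_app: "horiz T k m l n p q u v = mk (horiz P1 k m l n p q (pr1 u) (pr1 v)) (horiz P2 k m l n p q (pr2 u) (pr2 v)) (horiz P3 k m l n p q (pr3 u) (pr3 v))"
  by (simp add: tprop_def)

lemma T_vert_app: "vert T n k m p q u v = mk (vert P1 n k m p q (pr1 u) (pr1 v)) (vert P2 n k m p q (pr2 u) (pr2 v)) (vert P3 n k m p q (pr3 u) (pr3 v))"
  by (simp add: tprop_def)

lemmas PC = dg_prop.complexes[OF P1] dg_prop.complexes[OF P2] dg_prop.complexes[OF P3]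

lemma T_complex: "cplx (ops T m n)"
proof (rule chain_complex.intro)
  fix p
  show "module R (gr (ops T m n) p)" by (rule T_module)
  show "diff (ops T m n) p \<in> Lin (gr (ops T m n) p) (gr (ops T m n) (p - 1))"
    by (rule T_linI[OF T_module T_diff_app lin_comp[OF T_pr_lin(1) cx_diff_lin[OF PC(1)]]
          lin_comp[OF T_pr_lin(2) cx_diff_lin[OF PC(2)]] lin_comp[OF T_pr_lin(3) cx_diff_lin[OF PC(3)]]])
      (erule T_cases, simp add: I3_diff)
  show "p < 0 \<Longrightarrow> ops_in T m n p = {0[gr (ops T m n) p]}"
  proof -
    assume p: "p < 0"
    have "u = 0[gr (ops T m n) p]" if "u \<in> ops_in T m n p" for u
      using that
    proof (rule T_cases)
      fix x y z assume u: "u = mk x y z" "I3 m n p x y z"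
      show ?thesis
        using I3D[OF u(2)] chain_complex.nonneg[OF PC(1) p, of m n] chain_complex.nonneg[OF PC(2) p, of m n]
          chain_complex.nonneg[OF PC(3) p, of m n] by (simp add: u(1) T_ops)
    qed
    moreover have "0[gr (ops T m n) p] \<in> ops_in T m n p" using T_module by simp
    ultimately show ?thesis by blast
  qed
  show "diff (ops T m n) (p - 1) (diff (ops T m n) p u) = 0[gr (ops T m n) (p - 2)]" if "u \<in> ops_in T m n p" for u
    using that by (rule T_cases) (simp add: T_simps T_ops cx_diff_diff[OF PC(1)] cx_diff_diff[OF PC(2)] cx_diff_diff[OF PC(3)] I3D)
qed

lemma T_in_pr:
  assumes "u \<in> ops_in T m n p"
  shows "pr1 u \<in> ops_in P1 m n p" "pr2 u \<in> ops_in P2 m n p" "pr3 u \<in> ops_in P3 m n p" "mk (pr1 u) (pr2 u) (pr3 u) = u"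
    "I3 m n p (pr1 u) (pr2 u) (pr3 u)"
  using assms by (auto elim!: T_cases simp: I3D)

lemma T_chain:
  assumes F: "\<And>p u. F p u = mk (f1 p (pr1 u)) (f2 p (pr2 u)) (f3 p (pr3 u))"
    and f: "cmap (ops P1 m n) (ops P1 m n) f1" "cmap (ops P2 m n) (ops P2 m n) f2" "cmap (ops P3 m n) (ops P3 m n) f3"
    and I: "\<And>p x y z. I3 m n p x y z \<Longrightarrow> I3 m n p (f1 p x) (f2 p y) (f3 p z)"
  shows "cmap (ops T m n) (ops T m n) F"
  unfolding chain_map_def
proof (intro allI conjI ballI)
  fix p
  show "F p \<in> Lin (gr (ops T m n) p) (gr (ops T m n) p)"
    by (rule T_linI[OF T_module F lin_comp[OF T_pr_lin(1) chain_mapD(1)[OF f(1)]] lin_comp[OF T_pr_lin(2) chain_mapD(1)[OF f(2)]]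
          lin_comp[OF T_pr_lin(3) chain_mapD(1)[OF f(3)]] I[OF T_in_pr(5)]])
  show "F (p - 1) (diff (ops T m n) p u) = diff (ops T m n) p (F p u)" if "u \<in> ops_in T m n p" for u
    using T_in_pr[OF that] by (simp add: F T_diff_app f[THEN chain_mapD(2)])
qed

lemma T_bilinear:
  assumes F: "\<And>p q u v. F p q u v = mk (b1 p q (pr1 u) (pr1 v)) (b2 p q (pr2 u) (pr2 v)) (b3 p q (pr3 u) (pr3 v))"
    and b: "dg_bilinear R (ops P1 k m) (ops P1 l n) (ops P1 k' m') b1" "dg_bilinear R (ops P2 k m) (ops P2 l n) (ops P2 k' m') b2"
      "dg_bilinear R (ops P3 k m) (ops P3 l n) (ops P3 k' m') b3"
    and I: "\<And>p q x y z x' y' z'. \<lbrakk>I3 k m p x y z; I3 l n q x' y' z'\<rbrakk> \<Longrightarrow> I3 k' m' (p + q) (b1 p q x x') (b2 p q y y') (b3 p q z z')"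
  shows "dg_bilinear R (ops T k m) (ops T l n) (ops T k' m') F"
  unfolding dg_bilinear_def
proof (intro allI conjI ballI)
  fix p q
  show "F p q u \<in> Lin (gr (ops T l n) q) (gr (ops T k' m') (p + q))" if "u \<in> ops_in T k m p" for u
    by (rule T_linI[OF T_module F lin_comp[OF T_pr_lin(1) dg_bilinearD(1)[OF b(1)]] lin_comp[OF T_pr_lin(2) dg_bilinearD(1)[OF b(2)]]
      lin_comp[OF T_pr_lin(3) dg_bilinearD(1)[OF b(3)]] I[OF _ T_in_pr(5)]]) (use T_in_pr[OF that] in simp_all)
  show "(\<lambda>u. F p q u v) \<in> Lin (gr (ops T k m) p) (gr (ops T k' m') (p + q))" if "v \<in> ops_in T l n q" for v
    by (rule T_linI[OF T_module F lin_comp[OF T_pr_lin(1) dg_bilinearD(2)[OF b(1)]] lin_comp[OF T_pr_lin(2) dg_bilinearD(2)[OF b(2)]]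
      lin_comp[OF T_pr_lin(3) dg_bilinearD(2)[OF b(3)]] I[OF T_in_pr(5)]]) (use T_in_pr[OF that] in simp_all)
  fix u v assume "u \<in> ops_in T k m p" "v \<in> ops_in T l n q"
  note u = T_in_pr[OF this(1)] and v = T_in_pr[OF this(2)]
  note i = I[OF u(5) I3_diff[OF v(5)], unfolded add_diff_eq]
  show "diff (ops T k' m') (p + q) (F p q u v) = F (p - 1) q (diff (ops T k m) p u) v
    +[gr (ops T k' m') (p + q - 1)] signed (gr (ops T k' m') (p + q - 1)) p (F p (q - 1) u (diff (ops T l n) q v))"
    using u(1-3) v(1-3) by (simp add: F T_diff_app T_ops T_signed[OF i] b[THEN dg_bilinearD(3)])
qed

lemmas dg_prop_equations = dg_prop.lact_id dg_prop.lact_comp dg_prop.ract_id dg_prop.ract_comp dg_prop.lact_ract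
  dg_prop.vert_assoc dg_prop.vert_unit_left dg_prop.vert_unit_right dg_prop.vert_lact dg_prop.vert_ract dg_prop.vert_balanced
  dg_prop.horiz_assoc dg_prop.horiz_unit_left dg_prop.horiz_unit_right dg_prop.horiz_units dg_prop.horiz_lact dg_prop.horiz_ract

text \<open>Everything holds componentwise. Among the equations, symmetry and interchange carry a
  sign; to compute it componentwise, the signed element must be known to satisfy
  \<open>Q\<close>.\<close>

theorem T_dg_prop: "dg_prop R T"
proof (rule dg_prop.intro)
  show "cplx (ops T m n)" for m n by (rule T_complex)
  show "cmap (ops T m n) (ops T m n) (lact T m n \<sigma>)" if \<sigma>: "\<sigma> \<in> perms n" for m n \<sigma>
    by (rule T_chain[OF T_lact_app P1[THEN dg_prop.lact_chain_map] P2[THEN dg_prop.lact_chain_map] P3[THEN dg_prop.lact_chain_map] I3_lact]) (rule \<sigma> | assumption)+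
  show "cmap (ops T m n) (ops T m n) (ract T m n \<sigma>)" if \<sigma>: "\<sigma> \<in> perms m" for m n \<sigma>
    by (rule T_chain[OF T_ract_app P1[THEN dg_prop.ract_chain_map] P2[THEN dg_prop.ract_chain_map] P3[THEN dg_prop.ract_chain_map] I3_ract]) (rule \<sigma> | assumption)+
  show "dg_bilinear R (ops T k m) (ops T n k) (ops T n m) (vert T n k m)" for k m n
    by (rule T_bilinear[OF T_vert_app P1[THEN dg_prop.vert_bilinear] P2[THEN dg_prop.vert_bilinear] P3[THEN dg_prop.vert_bilinear] I3_vert])
  show "dg_bilinear R (ops T k m) (ops T l n) (ops T (k + l) (m + n)) (horiz T k m l n)" for k m l n
    by (rule T_bilinear[OF T_horiz_app P1[THEN dg_prop.horiz_bilinear] P2[THEN dg_prop.horiz_bilinear] P3[THEN dg_prop.horiz_bilinear] I3_horiz])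
  show "punit T n \<in> ops_in T n n 0" for n unfolding T_simps T_in by (rule I3_unit)
next
  fix f g k m l n p q assume "f \<in> ops_in T k m p" "g \<in> ops_in T l n q"
  note f = T_in_pr[OF this(1)] and g = T_in_pr[OF this(2)]
  have "I3 (k + l) (n + m) (p + q) (ract P1 (k + l) (n + m) (block_swap k l) (p + q) (horiz P1 l n k m q p (pr1 g) (pr1 f)))
      (ract P2 (k + l) (n + m) (block_swap k l) (p + q) (horiz P2 l n k m q p (pr2 g) (pr2 f)))
      (ract P3 (k + l) (n + m) (block_swap k l) (p + q) (horiz P3 l n k m q p (pr3 g) (pr3 f)))"
    using I3_ract[OF block_swap_perms(1) I3_horiz[OF g(5) f(5), unfolded add.commute[of l] add.commute[of q]]] .
  then show "lact T (k + l) (n + m) (block_swap m n) (p + q) (horiz T k m l n p q f g) =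
      signed (gr (ops T (k + l) (n + m)) (p + q)) (p * q) (ract T (k + l) (n + m) (block_swap k l) (p + q) (horiz T l n k m q p g f))"
    using f(1-3) g(1-3) by (simp add: T_lact_app T_ract_app T_horiz_app T_signed P1[THEN dg_prop.symmetry] P2[THEN dg_prop.symmetry] P3[THEN dg_prop.symmetry])
next
  fix f g f' g' k m k' m' l l' p q r s
  assume "f \<in> ops_in T k m p" "g \<in> ops_in T k' m' q" "f' \<in> ops_in T l k r" "g' \<in> ops_in T l' k' s"
  note f = T_in_pr[OF this(1)] and g = T_in_pr[OF this(2)] and f' = T_in_pr[OF this(3)] and g' = T_in_pr[OF this(4)]
  have e: "p + r + (q + s) = p + q + r + s" by simp
  note i = I3_horiz[OF I3_vert[OF f(5) f'(5)] I3_vert[OF g(5) g'(5)], unfolded e]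
  show "vert T (l + l') (k + k') (m + m') (p + q) (r + s) (horiz T k m k' m' p q f g) (horiz T l k l' k' r s f' g') =
      signed (gr (ops T (l + l') (m + m')) (p + q + r + s)) (q * r)
        (horiz T l m l' m' (p + r) (q + s) (vert T l k m p r f f') (vert T l' k' m' q s g g'))"
    using f(1-3) g(1-3) f'(1-3) g'(1-3) i by (simp add: T_horiz_app T_vert_app T_signed P1[THEN dg_prop.interchange] P2[THEN dg_prop.interchange] P3[THEN dg_prop.interchange])
qed (use T_in_pr in \<open>simp_all add: T_lact_app T_ract_app T_horiz_app T_vert_app T_simps dg_prop_equations[OF P1] dg_prop_equations[OF P2] dg_prop_equations[OF P3]\<close>)

lemma T_pr_hom: "prop_hom R T P1 (\<lambda>m n p. pr1)" "prop_hom R T P2 (\<lambda>m n p. pr2)" "prop_hom R T P3 (\<lambda>m n p. pr3)"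
  by (intro prop_hom.intro; force simp: chain_map_def T_pr_lin T_diff_app T_lact_app T_ract_app T_horiz_app T_vert_app T_simps)+

end

section \<open>Composition of prop morphisms and the terminal prop\<close>

context ground_ring begin

lemma prop_hom_comp:
  assumes \<phi>: "prop_hom R P Q \<phi>" and \<psi>: "prop_hom R Q S \<psi>"
  shows "prop_hom R P S (\<lambda>m n p f. \<psi> m n p (\<phi> m n p f))"
proof -
  interpret \<phi>: prop_hom R P Q \<phi> by (rule \<phi>)
  interpret \<psi>: prop_hom R Q S \<psi> by (rule \<psi>)
  note L = chain_mapD(1)[OF \<phi>.hom_chain_map]
  note C = lin_closed[OF L]
  show ?thesis
    by (rule prop_hom.intro)
      (auto simp: chain_map_def \<phi>.hom_lact \<psi>.hom_lact \<phi>.hom_ract \<psi>.hom_ract \<phi>.hom_horiz \<psi>.hom_horiz \<phi>.hom_vert \<psi>.hom_vert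
        \<phi>.hom_unit \<psi>.hom_unit C chain_mapD(2)[OF \<phi>.hom_chain_map] chain_mapD(2)[OF \<psi>.hom_chain_map]
        intro: lin_comp[OF L chain_mapD(1)[OF \<psi>.hom_chain_map]])
qed

definition trivial_module :: "('k, unit) module" where
  "trivial_module = \<lparr>carrier = UNIV, monoid.mult = undefined, one = undefined, zero = (), add = (\<lambda>_ _. ()), smult = (\<lambda>_ _. ())\<rparr>"

text \<open>The terminal prop. A product with two factors of this kind is a copy of the remaining
  factor in another type.\<close>

definition trivial_prop :: "('k, unit) prop_data" where
  "trivial_prop = \<lparr>ops = (\<lambda>m n. \<lparr>gr = (\<lambda>p. trivial_module), diff = (\<lambda>p u. ())\<rparr>), lact = (\<lambda>m n \<sigma> p u. ()), ract = (\<lambda>m n \<sigma> p u. ()),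
    horiz = (\<lambda>k m l n p q u v. ()), vert = (\<lambda>n k m p q u v. ()), punit = (\<lambda>n. ())\<rparr>"

lemma trivial_module: "module R trivial_module"
  by (intro moduleI abelian_groupI) (auto simp: trivial_module_def intro: is_cring)

lemma trivial_in [simp]: "u :> trivial_module"
  by (simp add: trivial_module_def)

lemma trivial_lin [simp]: "F \<in> Lin M trivial_module"
  by (intro linI) simp_all

lemma trivial_gr: "gr (ops trivial_prop m n) p = trivial_module"
  by (simp add: trivial_prop_def)

lemma trivial_prop: "dg_prop R trivial_prop"
  by (rule dg_prop.intro)
    (auto simp: trivial_gr trivial_module chain_complex_def chain_map_def dg_bilinear_def trivial_module_def[THEN arg_cong, of carrier])

subsection \<open>Homology\<close>

context
  fixes X :: "('k, 'a) cx"
  assumes X: "cplx X"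
begin

abbreviation "cyc n \<equiv> (gr X n)\<lparr>carrier := cycles X n\<rparr>"

lemma cycles_submodule: "submodule (cycles X n) R (gr X n)"
proof -
  interpret M: module R "gr X n" using X by simp
  note d = cx_diff_lin[OF X, of n]
  show ?thesis
    using X by (intro M.submoduleI) (auto simp: cycles_def lin_zero[OF _ _ d] lin_neg[OF _ _ d] lin_add[OF d] lin_smult[OF d])
qed

lemma cyc_module: "module R (cyc n)"
  by (rule submodule.submodule_is_module[OF cycles_submodule cx_module[OF X]])

lemma cyc_incl: "(\<lambda>x. x) \<in> Lin (cyc n) (gr X n)"
  by (rule linI) (auto simp: cycles_def)

lemma cycles_closed: "x \<in> cycles X n \<Longrightarrow> x :> gr X n"
  by (simp add: cycles_def)

lemma cyc_minus: "\<lbrakk>x \<in> cycles X n; y \<in> cycles X n\<rbrakk> \<Longrightarrow> x -[cyc n] y = x -[gr X n] y"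
  using lin_minus[OF cyc_module cx_module[OF X] cyc_incl] by simp

lemma diff_cycle: "y :> gr X (n + 1) \<Longrightarrow> diff X (n + 1) y \<in> cycles X n"
  using lin_closed[OF cx_diff_lin[OF X], of y "n + 1"] cx_diff_diff[OF X, of y "n + 1"] by (simp add: cycles_def)

lemma boundaries_cycles: "boundaries X n \<subseteq> cycles X n"
  by (auto simp: boundaries_def intro: diff_cycle)

lemma boundaries_submodule: "submodule (boundaries X n) R (cyc n)"
proof -
  interpret M: module R "cyc n" by (rule cyc_module)
  have d: "diff X (n + 1) \<in> Lin (gr X (n + 1)) (cyc n)"
    using lin_add[OF cx_diff_lin[OF X], of _ "n + 1"] lin_smult[OF cx_diff_lin[OF X], of _ _ "n + 1"]
    by (intro linI) (auto simp: diff_cycle)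
  note T = cx_module[OF X, of "n + 1"]
  show ?thesis
  proof (rule M.submoduleI)
    show "boundaries X n \<subseteq> carrier (cyc n)" using boundaries_cycles by simp
    show "0[cyc n] \<in> boundaries X n"
      using lin_zero[OF T cyc_module d] T unfolding boundaries_def by (metis image_eqI mod_zero_closed)
    fix a assume "a \<in> boundaries X n"
    then obtain x where x: "x :> gr X (n + 1)" "a = diff X (n + 1) x" by (auto simp: boundaries_def)
    show "-[cyc n] a \<in> boundaries X n"
      using lin_neg[OF T cyc_module d x(1)] T x unfolding boundaries_def by (metis image_eqI mod_neg_closed)
    show "c *[cyc n] a \<in> boundaries X n" if "c :> R" for c
      using lin_smult[OF d that x(1)] T x that unfolding boundaries_def by (metis image_eqI mod_smult_closed)
    fix b assume "b \<in> boundaries X n"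
    then obtain y where y: "y :> gr X (n + 1)" "b = diff X (n + 1) y" by (auto simp: boundaries_def)
    show "a +[cyc n] b \<in> boundaries X n"
      using lin_add[OF d x(1) y(1)] T x y unfolding boundaries_def by (metis image_eqI mod_add_closed)
  qed
qed

abbreviation "cls n x \<equiv> boundaries X n +>[gr X n] x"

text \<open>Cosets are formed with the addition only, so restricting the carrier to cycles does not
  affect them.\<close>

lemma cls_cyc: "boundaries X n +>[cyc n] x = cls n x"
  by (simp add: a_r_coset_def')

lemma homology_module: "module R (homology X n)"
  unfolding homology_def by (rule quotient_module[OF cyc_module boundaries_submodule])

lemma cls_lin: "cls n \<in> Lin (cyc n) (homology X n)"
  using coset_lin[OF cyc_module boundaries_submodule] unfolding homology_def cls_cyc .

lemma cls_closed: "x \<in> cycles X n \<Longrightarrow> cls n x :> homology X n"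
  using lin_closed[OF cls_lin] by simp

lemma homology_cases:
  assumes "\<xi> :> homology X n"
  obtains x where "x \<in> cycles X n" "\<xi> = cls n x"
  using quotient_cases[OF cyc_module boundaries_submodule assms[unfolded homology_def]] by (auto simp: cls_cyc)

lemma cls_eq_iff: "\<lbrakk>x \<in> cycles X n; y \<in> cycles X n\<rbrakk> \<Longrightarrow> cls n x = cls n y \<longleftrightarrow> x -[gr X n] y \<in> boundaries X n"
  using coset_eq_iff[OF cyc_module boundaries_submodule, of x n y] by (simp add: cls_cyc cyc_minus)

lemma cls_zero_iff: "x \<in> cycles X n \<Longrightarrow> cls n x = 0[homology X n] \<longleftrightarrow> x \<in> boundaries X n"
proof -
  assume x: "x \<in> cycles X n"
  interpret M: module R "gr X n" using X by simp
  have z: "0[gr X n] \<in> cycles X n" using submodule_subset[OF cycles_submodule] mod_zero_closed[OF cyc_module] by simp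
  have "0[homology X n] = cls n 0[gr X n]"
    using lin_zero[OF cyc_module homology_module cls_lin] by simp
  moreover have "x -[gr X n] 0[gr X n] = x" using cycles_closed[OF x] by algebra
  ultimately show ?thesis using cls_eq_iff[OF x z] by simp
qed

lemma cls_mem: "\<lbrakk>x \<in> cycles X n; y \<in> cls n x\<rbrakk> \<Longrightarrow> y \<in> cycles X n \<and> cls n y = cls n x"
  using coset_mem[OF cyc_module boundaries_submodule, of x n y] by (simp add: cls_cyc)

lemma cls_self: "x \<in> cycles X n \<Longrightarrow> x \<in> cls n x"
  using coset_self[OF cyc_module boundaries_submodule, of x n] by (simp add: cls_cyc)

lemma homology_cx_complex: "cplx (homology_cx X)"
proof (rule chain_complex.intro)
  fix n
  show "module R (gr (homology_cx X) n)" by (simp add: homology_cx_def homology_module)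
  show "diff (homology_cx X) n \<in> Lin (gr (homology_cx X) n) (gr (homology_cx X) (n - 1))"
    by (simp add: homology_cx_def lin_zerof homology_module)
  { assume n: "n < 0"
    have "\<xi> = 0[homology X n]" if "\<xi> :> homology X n" for \<xi>
      using that
    proof (rule homology_cases)
      fix x assume x: "x \<in> cycles X n" "\<xi> = cls n x"
      have "x = 0[gr X n]" using chain_complex.nonneg[OF X n] cycles_closed[OF x(1)] by simp
      then show ?thesis using x lin_zero[OF cyc_module homology_module cls_lin] by simp
    qed
    then show "carrier (gr (homology_cx X) n) = {0[gr (homology_cx X) n]}"
      using homology_module by (auto simp: homology_cx_def) }
  show "x :> gr (homology_cx X) n \<Longrightarrow> diff (homology_cx X) (n - 1) (diff (homology_cx X) n x) = 0[gr (homology_cx X) (n - 2)]" for x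
    by (simp add: homology_cx_def)
qed

end

text \<open>Bijectivity on homology, expressed by representatives. As \<open>f\<close> preserves
  cycles and boundaries, the union in \<open>homology_map\<close> runs over one single
  class.\<close>

lemma quasi_isoI:
  assumes X: "cplx X" and Y: "cplx Y" and f: "cmap X Y f"
    and inj: "\<And>n x. \<lbrakk>x \<in> cycles X n; f n x \<in> boundaries Y n\<rbrakk> \<Longrightarrow> x \<in> boundaries X n"
    and surj: "\<And>n y. y \<in> cycles Y n \<Longrightarrow> \<exists>x\<in>cycles X n. y -[gr Y n] f n x \<in> boundaries Y n"
  shows "quasi_iso X Y f"
  unfolding quasi_iso_def
proof
  fix n
  note fl = chain_mapD(1)[OF f] and fd = chain_mapD(2)[OF f]
  have fc: "f n x \<in> cycles Y n" if "x \<in> cycles X n" for x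
    using that lin_closed[OF fl] fd[of x n] lin_zero[OF cx_module[OF X] cx_module[OF Y] fl, of "n - 1"] by (simp add: cycles_def)
  have fb: "f n x \<in> boundaries Y n" if xb: "x \<in> boundaries X n" for x
  proof -
    obtain z where z: "z :> gr X (n + 1)" "x = diff X (n + 1) z" using xb unfolding boundaries_def by blast
    have "f n x = diff Y (n + 1) (f (n + 1) z)" using fd[OF z(1)] z(2) by simp
    then show ?thesis using lin_closed[OF fl z(1)] by (auto simp: boundaries_def)
  qed
  let ?h = "homology_map Y f n"
  have map: "?h (boundaries X n +>[gr X n] x) = boundaries Y n +>[gr Y n] f n x" if x: "x \<in> cycles X n" for x
  proof -
    have "boundaries Y n +>[gr Y n] f n y = boundaries Y n +>[gr Y n] f n x" if y: "y \<in> boundaries X n +>[gr X n] x" for y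
    proof -
      have y: "y \<in> cycles X n" "y -[gr X n] x \<in> boundaries X n"
        using cls_mem[OF X x y] cls_eq_iff[OF X _ x, of y] by auto
      have "f n y -[gr Y n] f n x \<in> boundaries Y n"
        using fb[OF y(2)] lin_minus[OF cx_module[OF X] cx_module[OF Y] fl cycles_closed[OF X y(1)] cycles_closed[OF X x]] by simp
      then show ?thesis using cls_eq_iff[OF Y fc[OF y(1)] fc[OF x]] by simp
    qed
    then show ?thesis unfolding homology_map_def using cls_self[OF X x] by blast
  qed
  show "bij_betw ?h (carrier (homology X n)) (carrier (homology Y n))"
  proof (rule bij_betwI')
    fix \<xi> \<eta> assume \<xi>: "\<xi> :> homology X n" and \<eta>: "\<eta> :> homology X n"
    obtain x where x: "x \<in> cycles X n" "\<xi> = boundaries X n +>[gr X n] x" using \<xi> by (rule homology_cases[OF X])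
    obtain y where y: "y \<in> cycles X n" "\<eta> = boundaries X n +>[gr X n] y" using \<eta> by (rule homology_cases[OF X])
    have xy: "x -[gr X n] y \<in> cycles X n"
      using mod_minus_closed[OF cyc_module[OF X], of x n y] x(1) y(1) cyc_minus[OF X x(1) y(1)] by simp
    show "?h \<xi> = ?h \<eta> \<longleftrightarrow> \<xi> = \<eta>"
      unfolding x(2) y(2) map[OF x(1)] map[OF y(1)] cls_eq_iff[OF X x(1) y(1)] cls_eq_iff[OF Y fc[OF x(1)] fc[OF y(1)]]
      using inj[OF xy] fb[of "x -[gr X n] y"]
      unfolding lin_minus[OF cx_module[OF X] cx_module[OF Y] fl cycles_closed[OF X x(1)] cycles_closed[OF X y(1)]] by blast
  next
    fix \<xi> assume "\<xi> :> homology X n"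
    then obtain x where x: "x \<in> cycles X n" "\<xi> = boundaries X n +>[gr X n] x" by (rule homology_cases[OF X])
    show "?h \<xi> :> homology Y n" unfolding x(2) map[OF x(1)] by (rule cls_closed[OF Y fc[OF x(1)]])
  next
    fix \<eta> assume "\<eta> :> homology Y n"
    then obtain y where y: "y \<in> cycles Y n" "\<eta> = boundaries Y n +>[gr Y n] y" by (rule homology_cases[OF Y])
    obtain x where x: "x \<in> cycles X n" "y -[gr Y n] f n x \<in> boundaries Y n" using surj[OF y(1)] by blast
    show "\<exists>\<xi>\<in>carrier (homology X n). \<eta> = ?h \<xi>"
      using cls_closed[OF X x(1)] map[OF x(1)] cls_eq_iff[OF Y y(1) fc[OF x(1)]] x(2) y(2) by metis
  qed
qed

text \<open>On a cycle the second term of the homotopy vanishes, so \<open>x\<close> differs from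
  \<open>g (f x)\<close> by a boundary; this gives injectivity on homology, and the section
  \<open>g\<close> gives surjectivity.\<close>

lemma quasi_iso_retract:
  assumes X: "cplx X" and Y: "cplx Y" and f: "cmap X Y f" and g: "cmap Y X g"
    and fg: "\<And>n y. y :> gr Y n \<Longrightarrow> f n (g n y) = y"
    and h: "\<And>n. h n \<in> Lin (gr X n) (gr X (n + 1))"
    and hom: "\<And>n x. x :> gr X n \<Longrightarrow>
      x -[gr X n] g n (f n x) = diff X (n + 1) (h n x) +[gr X n] h (n - 1) (diff X n x)"
  shows "quasi_iso X Y f"
proof (rule quasi_isoI[OF X Y f])
  fix n
  interpret MX: module R "gr X n" using X by simp
  note fl = chain_mapD(1)[OF f] and gl = chain_mapD(1)[OF g]
  have hl: "h (n - 1) \<in> Lin (gr X (n - 1)) (gr X n)" using h[of "n - 1"] by simp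
  show "x \<in> boundaries X n" if x: "x \<in> cycles X n" and fx: "f n x \<in> boundaries Y n" for x
  proof -
    have xc: "x :> gr X n" by (rule cycles_closed[OF X x])
    obtain y where y: "y :> gr Y (n + 1)" "f n x = diff Y (n + 1) y" using fx by (auto simp: boundaries_def)
    note dl = cx_diff_lin[OF X, of "n + 1", simplified]
    have gy: "g (n + 1) y :> gr X (n + 1)" and hx: "h n x :> gr X (n + 1)"
      using lin_closed[OF gl y(1)] lin_closed[OF h xc] .
    have gf: "g n (f n x) = diff X (n + 1) (g (n + 1) y)"
      using chain_mapD(2)[OF g y(1)] y(2) by simp
    have "h (n - 1) (diff X n x) = 0[gr X n]"
      using x lin_zero[OF cx_module[OF X] cx_module[OF X] hl] by (simp add: cycles_def)
    then have e: "x -[gr X n] diff X (n + 1) (g (n + 1) y) = diff X (n + 1) (h n x)"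
      using hom[OF xc] lin_closed[OF dl hx] X by (simp add: gf)
    have "x = (x -[gr X n] diff X (n + 1) (g (n + 1) y)) +[gr X n] diff X (n + 1) (g (n + 1) y)"
      using xc lin_closed[OF dl gy] by algebra
    also have "\<dots> = diff X (n + 1) (h n x +[gr X (n + 1)] g (n + 1) y)"
      unfolding e by (rule lin_add[OF dl hx gy, symmetric])
    finally show ?thesis using hx gy X unfolding boundaries_def by (metis image_eqI mod_add_closed cx_module)
  qed
  show "\<exists>x\<in>cycles X n. y -[gr Y n] f n x \<in> boundaries Y n" if y: "y \<in> cycles Y n" for y
  proof (rule bexI)
    have yc: "y :> gr Y n" by (rule cycles_closed[OF Y y])
    show "g n y \<in> cycles X n"
      using y lin_closed[OF gl yc] chain_mapD(2)[OF g yc] lin_zero[OF cx_module[OF Y] cx_module[OF X] gl, of "n - 1"] by (simp add: cycles_def)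
    have "y -[gr Y n] f n (g n y) = 0[gr Y n]" using yc mod_minus_eq_zero_iff[OF cx_module[OF Y] yc yc] by (simp add: fg)
    also have "0[gr Y n] \<in> boundaries Y n"
      using lin_zero[OF cx_module[OF Y] cx_module[OF Y] cx_diff_lin[OF Y, of "n + 1"]] Y unfolding boundaries_def
      by (metis add_diff_cancel_right' cx_module image_eqI mod_zero_closed)
    finally show "y -[gr Y n] f n (g n y) \<in> boundaries Y n" .
  qed
qed

subsection \<open>Splitting a complex with projective homology\<close>

context
  fixes A :: "('k, 'a) cx"
  assumes A: "cplx A" and proj_A: "\<And>n. projective_module R (gr A n)"
    and proj_H: "\<And>n. projective_module R (homology A n)"
begin

text \<open>A section of the differential over the boundaries, extended to all of
  \<open>gr A (n - 1)\<close>: that is the projective module out of which maps can be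
  lifted.\<close>

definition split_pre :: "int \<Rightarrow> ('a \<Rightarrow> 'a) \<Rightarrow> bool" where
  "split_pre n \<kappa> \<longleftrightarrow> \<kappa> \<in> Lin (gr A (n - 1)) (gr A n) \<and> (\<forall>b\<in>boundaries A (n - 1). diff A n (\<kappa> b) = b)"

text \<open>The part of a deformation retraction of \<open>A\<close> onto its homology that concerns
  degree \<open>n\<close>. The homotopies below and above this degree are \<open>\<kappa>\<close>
  and \<open>\<kappa>'\<close>.\<close>

definition split_step :: "int \<Rightarrow> ('a \<Rightarrow> 'a) \<Rightarrow> ('a \<Rightarrow> 'a) \<Rightarrow> ('a \<Rightarrow> 'a set) \<Rightarrow> ('a set \<Rightarrow> 'a) \<Rightarrow> bool" where
  "split_step n \<kappa> \<kappa>' r i \<longleftrightarrow> \<kappa>' \<in> Lin (gr A n) (gr A (n + 1)) \<and>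
    r \<in> Lin (gr A n) (homology A n) \<and> i \<in> Lin (homology A n) (gr A n) \<and>
    (\<forall>\<xi>\<in>carrier (homology A n). diff A n (i \<xi>) = 0[gr A (n - 1)] \<and> r (i \<xi>) = \<xi>) \<and>
    (\<forall>b\<in>boundaries A n. r b = 0[homology A n]) \<and>
    (\<forall>a\<in>carrier (gr A n). a -[gr A n] i (r a) = diff A (n + 1) (\<kappa>' a) +[gr A n] \<kappa> (diff A n a))"

text \<open>The splitting below degree \<open>n\<close> retracts chains to cycles. Projectivity of
  homology then chooses representing cycles, and projectivity of the chains lifts the remaining
  part, whose values are boundaries, along the next differential. This lift is the splitting for the
  next degree, so the induction can go on.\<close>

lemma split_step_exists:
  assumes pre: "split_pre n \<kappa>"
  shows "\<exists>\<kappa>'. split_pre (n + 1) \<kappa>' \<and> (\<exists>r i. split_step n \<kappa> \<kappa>' r i)"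
proof -
  let ?A = "gr A n" and ?H = "homology A n"
  note MA = cx_module[OF A] and MH = homology_module[OF A] and MZ = cyc_module[OF A, of n]
  interpret M: module R ?A by (rule MA)
  have \<kappa>: "\<kappa> \<in> Lin (gr A (n - 1)) ?A" and \<kappa>b: "\<And>b. b \<in> boundaries A (n - 1) \<Longrightarrow> diff A n (\<kappa> b) = b"
    using pre by (auto simp: split_pre_def)
  note dl = cx_diff_lin[OF A, of n]
  \<comment> \<open>A projection of all chains onto the cycles: the subtracted term has the same
    differential as \<open>a\<close>.\<close>
  define \<zeta> where "\<zeta> a = a -[?A] \<kappa> (diff A n a)" for a
  have \<zeta>l: "\<zeta> \<in> Lin ?A ?A"
    unfolding \<zeta>_def[abs_def] by (rule lin_minusf[OF MA lin_id lin_comp[OF dl \<kappa>]])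
  have \<zeta>c: "\<zeta> a \<in> cycles A n" if a: "a :> ?A" for a
  proof -
    have da: "diff A n a :> gr A (n - 1)" by (rule lin_closed[OF dl a])
    have "diff A n a \<in> boundaries A (n - 1)" using a by (auto simp: boundaries_def)
    then have "diff A n (\<zeta> a) = 0[gr A (n - 1)]"
      using lin_minus[OF MA MA dl a lin_closed[OF \<kappa> da]] \<kappa>b mod_minus_eq_zero_iff[OF MA da da] by (simp add: \<zeta>_def)
    then show ?thesis using lin_closed[OF \<zeta>l a] by (simp add: cycles_def)
  qed
  have \<zeta>id: "\<zeta> z = z" if z: "z \<in> cycles A n" for z
  proof -
    have zc: "z :> ?A" by (rule cycles_closed[OF A z])
    have "\<kappa> (diff A n z) = 0[?A]" using z lin_zero[OF MA MA \<kappa>] by (simp add: cycles_def)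
    then show ?thesis using zc by (simp add: \<zeta>_def) algebra
  qed
  have \<zeta>Z: "\<zeta> \<in> Lin ?A ((gr A n)\<lparr>carrier := cycles A n\<rparr>)"
    using \<zeta>c lin_add[OF \<zeta>l] lin_smult[OF \<zeta>l] by (intro linI) auto
  define r where "r a = boundaries A n +>[?A] \<zeta> a" for a
  have rl: "r \<in> Lin ?A ?H" unfolding r_def[abs_def] by (rule lin_comp[OF \<zeta>Z cls_lin[OF A]])
  have onto: "\<xi> \<in> (\<lambda>x. boundaries A n +>[?A] x) ` carrier ((gr A n)\<lparr>carrier := cycles A n\<rparr>)" if "\<xi> :> ?H" for \<xi>
    using that by (rule homology_cases[OF A]) (rule image_eqI, simp_all)
  \<comment> \<open>A linear choice of representing cycles, obtained by lifting the identity of the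
    homology along the class map.\<close>
  obtain i where i: "i \<in> Lin ?H ((gr A n)\<lparr>carrier := cycles A n\<rparr>)"
    "\<And>\<xi>. \<xi> :> ?H \<Longrightarrow> boundaries A n +>[?A] i \<xi> = \<xi>"
    by (rule projective_lift[OF proj_H MZ MH cls_lin[OF A] lin_id onto]) (assumption, rule that, assumption+)
  have ic: "i \<xi> \<in> cycles A n" if "\<xi> :> ?H" for \<xi> using lin_closed[OF i(1) that] by simp
  have il: "i \<in> Lin ?H ?A" by (rule lin_comp[OF i(1) cyc_incl[OF A]])
  have ri: "r (i \<xi>) = \<xi>" if "\<xi> :> ?H" for \<xi>
    by (simp add: r_def \<zeta>id[OF ic[OF that]] i(2)[OF that])
  have bc: "b \<in> cycles A n" if "b \<in> boundaries A n" for b using boundaries_cycles[OF A] that by blast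
  have rb: "r b = 0[?H]" if "b \<in> boundaries A n" for b
    using cls_zero_iff[OF A bc[OF that]] that by (simp add: r_def \<zeta>id[OF bc[OF that]])
  \<comment> \<open>Both terms are cycles with the same class, so the difference is a boundary; on
    boundaries it is the identity, which makes the lift of it a splitting.\<close>
  define \<rho> where "\<rho> a = \<zeta> a -[?A] i (r a)" for a
  have \<rho>l: "\<rho> \<in> Lin ?A ?A" unfolding \<rho>_def[abs_def] by (rule lin_minusf[OF MA \<zeta>l lin_comp[OF rl il]])
  have \<rho>b: "\<rho> a \<in> boundaries A n" if a: "a :> ?A" for a
  proof -
    have ra: "r a :> ?H" by (rule lin_closed[OF rl a])
    have "boundaries A n +>[?A] \<zeta> a = boundaries A n +>[?A] i (r a)" using i(2)[OF ra] by (simp add: r_def)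
    then show ?thesis using cls_eq_iff[OF A \<zeta>c[OF a] ic[OF ra]] by (simp add: \<rho>_def)
  qed
  have d1: "diff A (n + 1) \<in> Lin (gr A (n + 1)) ?A" using cx_diff_lin[OF A, of "n + 1"] by simp
  have im: "\<rho> a \<in> diff A (n + 1) ` carrier (gr A (n + 1))" if "a :> ?A" for a
    using \<rho>b[OF that] by (simp add: boundaries_def)
  obtain \<kappa>' where \<kappa>': "\<kappa>' \<in> Lin ?A (gr A (n + 1))" "\<And>a. a :> ?A \<Longrightarrow> diff A (n + 1) (\<kappa>' a) = \<rho> a"
    by (rule projective_lift[OF proj_A MA MA d1 \<rho>l im]) (assumption, rule that, assumption+)
  have "split_pre (n + 1) \<kappa>'"
    unfolding split_pre_def
  proof (intro conjI ballI)
    show "\<kappa>' \<in> Lin (gr A (n + 1 - 1)) (gr A (n + 1))" using \<kappa>'(1) by simp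
    fix b assume "b \<in> boundaries A (n + 1 - 1)"
    then have b: "b \<in> boundaries A n" by simp
    have bA: "b :> ?A" by (rule cycles_closed[OF A bc[OF b]])
    have "\<rho> b = b" using bA lin_zero[OF MH MA il] by (simp add: \<rho>_def \<zeta>id[OF bc[OF b]] rb[OF b]) algebra
    then show "diff A (n + 1) (\<kappa>' b) = b" using \<kappa>'(2)[OF bA] by simp
  qed
  moreover have "split_step n \<kappa> \<kappa>' r i"
    unfolding split_step_def
  proof (intro conjI ballI \<kappa>'(1) rl il ri rb)
    show "diff A n (i \<xi>) = 0[gr A (n - 1)]" if "\<xi> :> ?H" for \<xi> using ic[OF that] by (simp add: cycles_def)
    fix a assume a: "a :> ?A"
    have c: "\<kappa> (diff A n a) :> ?A" "i (r a) :> ?A"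
      using lin_closed[OF \<kappa> lin_closed[OF dl a]] lin_closed[OF il lin_closed[OF rl a]] .
    show "a -[?A] i (r a) = diff A (n + 1) (\<kappa>' a) +[?A] \<kappa> (diff A n a)"
      unfolding \<kappa>'(2)[OF a] \<rho>_def \<zeta>_def using a c by algebra
  qed assumption
  ultimately show ?thesis by blast
qed

lemma splitting:
  obtains r i k where "cmap A (homology_cx A) r" "cmap (homology_cx A) A i"
    "\<And>n. k n \<in> Lin (gr A n) (gr A (n + 1))"
    "\<And>n \<xi>. \<xi> :> homology A n \<Longrightarrow> r n (i n \<xi>) = \<xi>"
    "\<And>n a. a :> gr A n \<Longrightarrow> a -[gr A n] i n (r n a) = diff A (n + 1) (k n a) +[gr A n] k (n - 1) (diff A n a)"
proof -
  note MA = cx_module[OF A] and MH = homology_module[OF A]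
  have zero: "x = 0[gr A n]" if "n < 0" "x :> gr A n" for n x
    using chain_complex.nonneg[OF A that(1)] that(2) by simp
  \<comment> \<open>The induction starts with zero, since there are no nonzero boundaries in degree
    -1.\<close>
  have base: "split_pre (int 0) (\<lambda>_. 0[gr A 0])"
  proof -
    have "b = 0[gr A (- 1)]" if "b \<in> boundaries A (- 1)" for b
      using zero[of "-1" b] that boundaries_cycles[OF A, of "-1"] cycles_closed[OF A] by auto
    then show ?thesis using lin_zero[OF MA MA cx_diff_lin[OF A, of 0]] lin_zerof[OF MA] by (auto simp: split_pre_def)
  qed
  have "\<exists>F. \<forall>n. split_pre (int n) (F n) \<and> (\<exists>r i. split_step (int n) (F n) (F (Suc n)) r i)"
  proof (rule dependent_nat_choice)
    show "\<exists>\<kappa>. split_pre (int 0) \<kappa>" using base by blast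
    show "\<exists>\<kappa>'. split_pre (int (Suc n)) \<kappa>' \<and> (\<exists>r i. split_step (int n) \<kappa> \<kappa>' r i)" if "split_pre (int n) \<kappa>" for \<kappa> n
      using split_step_exists[OF that] by (simp add: add.commute)
  qed
  then obtain F where F: "\<And>n. split_pre (int n) (F n)" "\<And>n. \<exists>r i. split_step (int n) (F n) (F (Suc n)) r i" by blast
  \<comment> \<open>\<open>F n\<close> maps degree \<open>n - 1\<close> to degree \<open>n\<close>,
    so it becomes \<open>k (n - 1)\<close>. The first value from the recursion is therefore
    \<open>k (-1)\<close>; below it only the zero map is possible.\<close>
  define k where "k n = (if n < -1 then \<lambda>_. 0[gr A (n + 1)] else F (nat (n + 1)))" for n :: int
  have kl: "k n \<in> Lin (gr A n) (gr A (n + 1))" for n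
    using F(1)[of "nat (n + 1)"] lin_zerof[OF MA] by (auto simp: k_def split_pre_def)
  have "\<exists>ri. split_step n (k (n - 1)) (k n) (fst ri) (snd ri)" for n
  proof (cases "n < 0")
    case True
    note z = zero[OF True]
    have zH: "\<xi> = 0[homology A n]" if "\<xi> :> homology A n" for \<xi>
      using chain_complex.nonneg[OF homology_cx_complex[OF A] True] that by (simp add: homology_cx_def)
    have kl': "k (n - 1) \<in> Lin (gr A (n - 1)) (gr A n)" using kl[of "n - 1"] by simp
    have d1: "diff A (n + 1) \<in> Lin (gr A (n + 1)) (gr A n)" using cx_diff_lin[OF A, of "n + 1"] by simp
    have "split_step n (k (n - 1)) (k n) (\<lambda>_. 0[homology A n]) (\<lambda>_. 0[gr A n])"
      unfolding split_step_def
    proof (intro conjI ballI kl lin_zerof MA MH)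
      fix a assume a: "a :> gr A n"
      have "diff A (n + 1) (k n a) = 0[gr A n]" "k (n - 1) (diff A n a) = 0[gr A n]"
        using z lin_closed[OF d1 lin_closed[OF kl a]] lin_closed[OF kl' lin_closed[OF cx_diff_lin[OF A] a]] by blast+
      then show "a -[gr A n] 0[gr A n] = diff A (n + 1) (k n a) +[gr A n] k (n - 1) (diff A n a)"
        using z[OF a] MA mod_minus_eq_zero_iff[OF MA, of a n a] a by simp
    qed (use lin_zero[OF MA MA cx_diff_lin[OF A]] zH in auto)
    then show ?thesis by (intro exI[of _ "(\<lambda>_. 0[homology A n], \<lambda>_. 0[gr A n])"]) simp
  next
    case False
    have "k (n - 1) = F (nat n)" "k n = F (Suc (nat n))" using False by (auto simp: k_def nat_add_distrib)
    then show ?thesis using F(2)[of "nat n"] False by auto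
  qed
  then obtain ri where "\<And>n. split_step n (k (n - 1)) (k n) (fst (ri n)) (snd (ri n))" by metis
  then have S: "\<And>n. split_step n (k (n - 1)) (k n) ((\<lambda>n. fst (ri n)) n) ((\<lambda>n. snd (ri n)) n)" by simp
  let ?r = "\<lambda>n. fst (ri n)" and ?i = "\<lambda>n. snd (ri n)"
  show ?thesis
  proof (rule that[of ?r ?i k])
    have b: "diff A n x \<in> boundaries A (n - 1)" if "x :> gr A n" for n x using that by (auto simp: boundaries_def)
    show "cmap A (homology_cx A) ?r"
      using S b by (auto simp: chain_map_def homology_cx_def split_step_def)
    show "cmap (homology_cx A) A ?i"
      using S lin_zero[OF MH MA] by (auto simp: chain_map_def homology_cx_def split_step_def)
  qed (use S kl in \<open>auto simp: split_step_def\<close>)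
qed

end

subsection \<open>Homotopies of tensor powers\<close>

lemma singleton_lin:
  assumes X: "cplx X"
  shows "(\<lambda>x. Pure X [(n, x)]) \<in> Lin (gr X n) (Tens X 1 n)"
proof -
  have w: "[(n, 0[gr X n])] \<in> words X 1 n" by (rule words_singleton[OF mod_zero_closed[OF cx_module[OF X]]])
  show ?thesis using multilinear_lin[OF pure_multilinear[OF X] w, of 0] by simp
qed

context
  fixes X :: "('k, 'a) cx"
  assumes X: "cplx X"
begin

abbreviation "TX \<equiv> Tens X"
abbreviation "TPX \<equiv> tpow X"

lemma words_1_cases:
  assumes "w \<in> words X 1 d"
  obtains x where "w = [(d, x)]" "x :> gr X d"
proof -
  obtain a where a: "w = [a]" using words_length[OF assms] by (metis One_nat_def length_0_conv length_Suc_conv)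
  show ?thesis by (rule that[of "snd a"]) (use assms a in \<open>auto simp: words_def wdeg_def\<close>)
qed

lemma words_0: "w \<in> words X 0 d \<Longrightarrow> w = []"
  by (simp add: words_def)

lemma tensor_map_length_0:
  assumes e: "\<And>n. e n \<in> Lin (gr X n) (gr X n)" and \<xi>: "\<xi> :> TX 0 d"
  shows "tmap X e 0 d \<xi> = \<xi>"
  by (rule tensor_ext[OF X tensor_module[OF X] tensor_map_lin[where f = e, OF X X e] lin_id _ \<xi>])
    (use tensor_map_pure[where f = e, OF X X e] words_0 in fastforce)

text \<open>The map \<open>G\<close> carried over to the first tensor power, where a word is a
  single letter.\<close>

definition letter_map :: "(int \<Rightarrow> 'a \<Rightarrow> 'a) \<Rightarrow> int \<Rightarrow> ('k, 'a) tensor \<Rightarrow> ('k, 'a) tensor" where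
  "letter_map G d = tlift (TX 1 (d + 1)) (\<lambda>w. Pure X [(d + 1, G d (snd (hd w)))])"

context
  fixes G :: "int \<Rightarrow> 'a \<Rightarrow> 'a"
  assumes G: "\<And>n. G n \<in> Lin (gr X n) (gr X (n + 1))"
begin

lemma letter_multilinear: "multilinear X 1 d (TX 1 (d + 1)) (\<lambda>w. Pure X [(d + 1, G d (snd (hd w)))])"
proof (rule multilinearI)
  show "Pure X [(d + 1, G d (snd (hd w)))] :> TX 1 (d + 1)" if "w \<in> words X 1 d" for w
    using that by (rule words_1_cases) (use lin_closed[OF G] in \<open>auto intro!: pure_closed[OF X] words_singleton simp del: One_nat_def\<close>)
  show "(\<lambda>x. Pure X [(d + 1, G d (snd (hd (w[i := (fst (w ! i), x)]))))]) \<in> Lin (gr X (fst (w ! i))) (TX 1 (d + 1))"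
    if w: "w \<in> words X 1 d" and i: "i < 1" for w i
    using w by (rule words_1_cases) (use i lin_comp[OF G singleton_lin[OF X]] in auto)
qed

lemma letter_lin: "letter_map G d \<in> Lin (TX 1 d) (TX 1 (d + 1))"
  unfolding letter_map_def by (rule tensor_lift_lin[OF X tensor_module[OF X] letter_multilinear])

lemma letter_pure: "x :> gr X d \<Longrightarrow> letter_map G d (Pure X [(d, x)]) = Pure X [(d + 1, G d x)]"
  unfolding letter_map_def using tensor_lift_pure[OF X tensor_module[OF X] letter_multilinear words_singleton, of x] by simp

end

text \<open>In degree one the sign of the hom differential becomes a plus, and the formula is that
  of a chain homotopy. Homotopies can thus be treated as families of degree one with a prescribed
  differential.\<close>

lemma hom_diff_one:
  assumes f: "hom_fam (TPX m) (TPX n) 1 f" and x: "x :> TX m d"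
  shows "diff (Hom (TPX m) (TPX n)) 1 f d x = tdiff X n (d + 1) (f d x) +[TX n d] f (d - 1) (tdiff X m d x)"
proof -
  interpret N: module R "TX n d" by (rule tensor_module[OF X])
  have c: "f (d - 1) (tdiff X m d x) :> TX n d"
    using lin_closed[OF hom_famD[OF f, of d "d - 1"]] tensor_diff_closed[OF X x] by simp
  have c2: "tdiff X n (d + 1) (f d x) :> TX n d"
    using lin_closed[OF hom_famD[OF f, of "d + 1" d]] tensor_diff_closed[OF X, of _ n "d + 1"] x by simp
  show ?thesis using hom_app_simps(4)[OF TP_complex[OF X] TP_complex[OF X], of x m d n 1 f] x c c2 by (simp add: signed_def) algebra
qed

text \<open>Induction on \<open>m\<close>. Vanishing of \<open>p\<close> on the homotopy is
  inherited because each of the two summands contains, in one of its factors, a homotopy which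
  \<open>p\<close> already kills. With \<open>p\<close> zero, the statement reduces to the existence
  of the homotopy.\<close>

lemma tensor_homotopy:
  fixes Z :: "('k, 'b) cx"
  assumes Z: "cplx Z" and e: "cmap X X e"
    and G: "\<And>n. G n \<in> Lin (gr X n) (gr X (n + 1))"
    and hom: "\<And>n x. x :> gr X n \<Longrightarrow>
      x -[gr X n] e n x = diff X (n + 1) (G n x) +[gr X n] G (n - 1) (diff X n x)"
    and p: "\<And>n. p n \<in> Lin (gr X n) (gr Z n)"
    and pG: "\<And>n x. x :> gr X n \<Longrightarrow> p (n + 1) (G n x) = 0[gr Z (n + 1)]"
  shows "\<exists>K. hom_fam (TPX m) (TPX m) 1 K \<and> (\<forall>d. \<forall>\<xi>\<in>carrier (TX m d).
    diff (Hom (TPX m) (TPX m)) 1 K d \<xi> = \<xi> -[TX m d] tmap X e m d \<xi> \<and>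
    tmap Z p m (d + 1) (K d \<xi>) = 0[Tens Z m (d + 1)])"
proof (induction m)
  note el = chain_mapD(1)[OF e]
  note MX = tensor_module[OF X] and MZ = tensor_module[OF Z]
  note pl = tensor_map_lin[where f = p, OF X Z p]
  case 0
  let ?K = "\<lambda>d (\<xi> :: ('k, 'a) tensor). 0[TX 0 (d + 1)]"
  have K: "hom_fam (TPX 0) (TPX 0) 1 ?K" using MX by (simp add: hom_fam_def lin_zerof)
  have "\<xi> -[TX 0 d] tmap X e 0 d \<xi> = 0[TX 0 d]" if "\<xi> :> TX 0 d" for \<xi> d
    using tensor_map_length_0[where e = e, OF el that] mod_minus_eq_zero_iff[OF MX that that] by simp
  moreover have "diff (Hom (TPX 0) (TPX 0)) 1 ?K d \<xi> = 0[TX 0 d]" if "\<xi> :> TX 0 d" for \<xi> d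
    using hom_diff_one[OF K that] lin_zero[OF MX MX tensor_diff_lin[OF X], of 0 "d + 1"] MX by simp
  ultimately show ?case using K lin_zero[OF MX MZ pl] by (intro exI[of _ ?K]) simp
next
  note el = chain_mapD(1)[OF e]
  note MX = tensor_module[OF X] and MZ = tensor_module[OF Z]
  note pl = tensor_map_lin[where f = p, OF X Z p]
  note ec = tensor_map_closed[where f = e, OF X X el]
  note pc = tensor_map_closed[where f = p, OF X Z p]
  case (Suc m)
  then obtain K where K: "hom_fam (TPX m) (TPX m) 1 K"
    and K1: "\<And>d \<xi>. \<xi> :> TX m d \<Longrightarrow> diff (Hom (TPX m) (TPX m)) 1 K d \<xi> = \<xi> -[TX m d] tmap X e m d \<xi>"
    and K2: "\<And>d \<xi>. \<xi> :> TX m d \<Longrightarrow> tmap Z p m (d + 1) (K d \<xi>) = 0[Tens Z m (d + 1)]" by blast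
  let ?L = "letter_map G" and ?e = "tmap X e 1" and ?id = "\<lambda>d (\<xi> :: ('k, 'a) tensor). \<xi>"
  have L: "hom_fam (TPX 1) (TPX 1) 1 ?L" using letter_lin[where G = G, OF G] by (simp add: hom_fam_def)
  have idf: "hom_fam (TPX m) (TPX m) 0 ?id" by (simp add: hom_fam_def lin_id)
  have ef: "hom_fam (TPX 1) (TPX 1) 0 ?e" using chain_map_fam[OF tensor_map_chain[OF X X e]] .
  have L1: "diff (Hom (TPX 1) (TPX 1)) 1 ?L d \<xi> = \<xi> -[TX 1 d] ?e d \<xi>" if \<xi>: "\<xi> :> TX 1 d" for d \<xi>
  proof (rule tensor_ext[OF X MX _ lin_minusf[OF MX lin_id tensor_map_lin[where f = e, OF X X el]] _ \<xi>])
    show "diff (Hom (TPX 1) (TPX 1)) 1 ?L d \<in> Lin (TX 1 d) (TX 1 d)"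
      using hom_famD[OF hom_diff_fam[OF TP_complex[OF X] TP_complex[OF X] L], of d d] by simp
    fix w assume "w \<in> words X 1 d"
    then obtain x where w: "w = [(d, x)]" and x: "x :> gr X d" by (rule words_1_cases)
    have ww: "[(d, x)] \<in> words X 1 d" by (rule words_singleton[OF x])
    have Gx: "G d x :> gr X (d + 1)" by (rule lin_closed[OF G x])
    have dx: "diff X d x :> gr X (d - 1)" by (rule lin_closed[OF cx_diff_lin[OF X] x])
    have Gd: "G (d - 1) (diff X d x) :> gr X d" using lin_closed[OF G dx] by simp
    have dG: "diff X (d + 1) (G d x) :> gr X d" using lin_closed[OF cx_diff_lin[OF X] Gx] by simp
    have ex: "e d x :> gr X d" by (rule lin_closed[OF el x])
    note s = singleton_lin[OF X, of d]
    have "diff (Hom (TPX 1) (TPX 1)) 1 ?L d (Pure X [(d, x)]) =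
      Pure X [(d, diff X (d + 1) (G d x))] +[TX 1 d] Pure X [(d, G (d - 1) (diff X d x))]"
      using hom_diff_one[OF L pure_closed[OF X ww]] letter_pure[where G = G, OF G x] letter_pure[where G = G, OF G dx]
        tensor_diff_singleton[OF X Gx] tensor_diff_singleton[OF X x] by simp
    also have "\<dots> = Pure X [(d, x -[gr X d] e d x)]"
      using lin_add[OF s dG Gd] hom[OF x] by simp
    also have "\<dots> = Pure X [(d, x)] -[TX 1 d] ?e d (Pure X [(d, x)])"
      using lin_minus[OF cx_module[OF X] MX s x ex] tensor_map_pure[where f = e, OF X X el ww] by simp
    finally show "diff (Hom (TPX 1) (TPX 1)) 1 ?L d (Pure X w) = Pure X w -[TX 1 d] ?e d (Pure X w)"
      by (simp add: w)
  qed
  have L2: "tmap Z p 1 (d + 1) (?L d \<xi>) = 0[Tens Z 1 (d + 1)]" if \<xi>: "\<xi> :> TX 1 d" for d \<xi>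
  proof (rule tensor_induct_lin[OF X MZ lin_comp[OF letter_lin[where G = G, OF G] pl] _ \<xi>])
    fix w assume "w \<in> words X 1 d"
    then obtain x where w: "w = [(d, x)]" and x: "x :> gr X d" by (rule words_1_cases)
    have Gx: "G d x :> gr X (d + 1)" by (rule lin_closed[OF G x])
    show "tmap Z p 1 (d + 1) (?L d (Pure X w)) = 0[Tens Z 1 (d + 1)]"
      using letter_pure[where G = G, OF G x] tensor_map_pure[where f = p, OF X Z p words_singleton[OF Gx]] pG[OF x]
        lin_zero[OF cx_module[OF Z] MZ singleton_lin[OF Z], of "d + 1"] by (simp add: w)
  qed
  (* The homotopy on one more factor is G tensor 1 + e tensor K. *)
  define H1 where "H1 = horiz (End X) 1 1 m m 1 0 ?L ?id"
  define H2 where "H2 = horiz (End X) 1 1 m m 0 1 ?e K"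
  have H1: "hom_fam (TPX (1 + m)) (TPX (1 + m)) 1 H1" using horiz_fam[OF X L idf] by (simp add: H1_def del: One_nat_def plus_1_eq_Suc)
  have H2: "hom_fam (TPX (1 + m)) (TPX (1 + m)) 1 H2" using horiz_fam[OF X ef K] by (simp add: H2_def del: One_nat_def plus_1_eq_Suc)
  let ?K = "\<lambda>d \<xi>. H1 d \<xi> +[TX (1 + m) (d + 1)] H2 d \<xi>"
  have H: "hom_fam (TPX (1 + m)) (TPX (1 + m)) 1 ?K"
    unfolding hom_fam_def
    using lin_addf[OF MX H1[unfolded hom_fam_def, rule_format, unfolded tensor_power_simps] H2[unfolded hom_fam_def, rule_format, unfolded tensor_power_simps]]
    unfolding tensor_power_simps by blast
  let ?D = "diff (Hom (TPX (1 + m)) (TPX (1 + m))) 1"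
  have D: "?D ?K d \<xi> = ?D H1 d \<xi> +[TX (1 + m) d] ?D H2 d \<xi>" if \<xi>: "\<xi> :> TX (1 + m) d" for d \<xi>
  proof -
    interpret N: module R "TX (1 + m) d" by (rule MX)
    note d\<xi> = tensor_diff_closed[OF X \<xi>]
    have c: "H1 d \<xi> :> TX (1 + m) (d + 1)" "H2 d \<xi> :> TX (1 + m) (d + 1)"
      using lin_closed[OF hom_famD[OF H1, of "d + 1" d]] lin_closed[OF hom_famD[OF H2, of "d + 1" d]] \<xi> by (simp_all del: One_nat_def plus_1_eq_Suc)
    have c': "H1 (d - 1) (tdiff X (1 + m) d \<xi>) :> TX (1 + m) d" "H2 (d - 1) (tdiff X (1 + m) d \<xi>) :> TX (1 + m) d"
      using lin_closed[OF hom_famD[OF H1, of d "d - 1"]] lin_closed[OF hom_famD[OF H2, of d "d - 1"]] d\<xi> by (simp_all del: One_nat_def plus_1_eq_Suc)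
    have dl: "tdiff X (1 + m) (d + 1) \<in> Lin (TX (1 + m) (d + 1)) (TX (1 + m) d)" using tensor_diff_lin[OF X, of "1 + m" "d + 1"] by simp
    show ?thesis
      unfolding hom_diff_one[OF H \<xi>] hom_diff_one[OF H1 \<xi>] hom_diff_one[OF H2 \<xi>] lin_add[OF dl c]
      using lin_closed[OF dl c(1)] lin_closed[OF dl c(2)] c' by (simp del: One_nat_def plus_1_eq_Suc) algebra
  qed
  \<comment> \<open>The identity and the tensor powers of \<open>e\<close> are chain maps. Their
    differentials vanish, so that each of the two Leibniz rules below keeps only one term.\<close>
  have idz: "diff (Hom (TPX m) (TPX m)) 0 ?id b \<eta> = 0[TX m (b + (0 - 1))]" if "\<eta> :> TX m b" for b \<eta>
    using hom_diff_zero_iff_chain[OF TP_complex[OF X] TP_complex[OF X] idf, of \<eta> b] that by simp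
  have ez: "diff (Hom (TPX 1) (TPX 1)) 0 ?e a \<xi> = 0[TX 1 (a + (0 - 1))]" if "\<xi> :> TX 1 a" for a \<xi>
    using hom_diff_zero_iff_chain[OF TP_complex[OF X] TP_complex[OF X] ef, of \<xi> a] that chain_mapD(2)[OF tensor_map_chain[OF X X e], of \<xi> 1 a] by simp
  note dfL = hom_diff_fam[OF TP_complex[OF X] TP_complex[OF X] L] and dfK = hom_diff_fam[OF TP_complex[OF X] TP_complex[OF X] K]
    and dfi = hom_diff_fam[OF TP_complex[OF X] TP_complex[OF X] idf] and dfe = hom_diff_fam[OF TP_complex[OF X] TP_complex[OF X] ef]
  have homot: "?D ?K d x = x -[TX (1 + m) d] tmap X e (1 + m) d x" if x: "x :> TX (1 + m) d" for d x
  proof (rule concat_ext[OF X MX _ lin_minusf[OF MX lin_id tensor_map_lin[where f = e, OF X X el]] _ x])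
    show "?D ?K d \<in> Lin (TX (1 + m) d) (TX (1 + m) d)"
      using hom_famD[OF hom_diff_fam[OF TP_complex[OF X] TP_complex[OF X] H], of d d] by (simp del: One_nat_def plus_1_eq_Suc)
    fix a b \<xi> \<eta> assume d: "a + b = d" and \<xi>: "\<xi> :> TX 1 a" and \<eta>: "\<eta> :> TX m b"
    interpret N: module R "TX (1 + m) d" by (rule MX)
    let ?c = "tcat X 1 m a b"
    have cl: "?c u v :> TX (1 + m) d" if "u :> TX 1 a" "v :> TX m b" for u v
      using concat_closed[OF X that] d by simp
    note e\<xi> = ec[OF \<xi>] and e\<eta> = ec[OF \<eta>]
    have z1: "horiz (End X) 1 1 m m 1 (0 - 1) ?L (diff (Hom (TPX m) (TPX m)) 0 ?id) d (?c \<xi> \<eta>) = 0[TX (1 + m) d]"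
      by (rule horiz_zero[OF X L dfi _ cl[OF \<xi> \<eta>]]) (use idz in simp_all)
    have z2: "horiz (End X) 1 1 m m (0 - 1) 1 (diff (Hom (TPX 1) (TPX 1)) 0 ?e) K d (?c \<xi> \<eta>) = 0[TX (1 + m) d]"
      by (rule horiz_zero[OF X dfe K _ cl[OF \<xi> \<eta>]]) (use ez in simp_all)
    have s1: "horiz (End X) 1 1 m m (1 - 1) 0 (diff (Hom (TPX 1) (TPX 1)) 1 ?L) ?id d (?c \<xi> \<eta>) =
        ?c (\<xi> -[TX 1 a] ?e a \<xi>) \<eta>"
      using horiz_concat[OF X dfL idf \<xi> \<eta> d[symmetric], of d] L1[OF \<xi>] by (simp add: signed_def del: One_nat_def plus_1_eq_Suc)
    have s2: "horiz (End X) 1 1 m m 0 (1 - 1) ?e (diff (Hom (TPX m) (TPX m)) 1 K) d (?c \<xi> \<eta>) =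
        ?c (?e a \<xi>) (\<eta> -[TX m b] tmap X e m b \<eta>)"
      using horiz_concat[OF X ef dfK \<xi> \<eta> d[symmetric], of d] K1[OF \<eta>] by (simp add: signed_def del: One_nat_def plus_1_eq_Suc)
    have m1: "?c (\<xi> -[TX 1 a] ?e a \<xi>) \<eta> = ?c \<xi> \<eta> -[TX (1 + m) d] ?c (?e a \<xi>) \<eta>"
      using lin_minus[OF MX MX concat_lin_left[OF X \<eta>] \<xi> e\<xi>] d by simp
    have m2: "?c (?e a \<xi>) (\<eta> -[TX m b] tmap X e m b \<eta>) = ?c (?e a \<xi>) \<eta> -[TX (1 + m) d] ?c (?e a \<xi>) (tmap X e m b \<eta>)"
      using lin_minus[OF MX MX concat_lin_right[OF X e\<xi>] \<eta> e\<eta>] d by simp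
    have D1: "?D H1 d (?c \<xi> \<eta>) = ?c \<xi> \<eta> -[TX (1 + m) d] ?c (?e a \<xi>) \<eta>"
      using horiz_diff_concat[OF X L idf \<xi> \<eta> d[symmetric], of d] cl[OF \<xi> \<eta>] cl[OF e\<xi> \<eta>] unfolding H1_def z1 s1 m1
      by (simp add: signed_def MX del: One_nat_def plus_1_eq_Suc)
    have D2: "?D H2 d (?c \<xi> \<eta>) = ?c (?e a \<xi>) \<eta> -[TX (1 + m) d] ?c (?e a \<xi>) (tmap X e m b \<eta>)"
      using horiz_diff_concat[OF X ef K \<xi> \<eta> d[symmetric], of d] cl[OF e\<xi> \<eta>] cl[OF e\<xi> e\<eta>] unfolding H2_def z2 s2 m2
      by (simp add: signed_def MX del: One_nat_def plus_1_eq_Suc)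
    have em: "tmap X e (1 + m) d (?c \<xi> \<eta>) = ?c (?e a \<xi>) (tmap X e m b \<eta>)"
      using tensor_map_concat[where f = e, OF X X el \<xi> \<eta>] d by simp
    \<comment> \<open>The two differentials telescope: \<open>1 - e\<close> on the first factor,
      plus \<open>e\<close> on the first factor times \<open>1 - e\<close> on the others, is
      \<open>1 - e\<close> on the whole power.\<close>
    show "?D ?K d (?c \<xi> \<eta>) = ?c \<xi> \<eta> -[TX (1 + m) d] tmap X e (1 + m) d (?c \<xi> \<eta>)"
      unfolding D[OF cl[OF \<xi> \<eta>]] D1 D2 em using cl[OF \<xi> \<eta>] cl[OF e\<xi> \<eta>] cl[OF e\<xi> e\<eta>] by algebra
  qed
  have van: "tmap Z p (1 + m) (d + 1) (?K d x) = 0[Tens Z (1 + m) (d + 1)]" if x: "x :> TX (1 + m) d" for d x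
  proof (rule concat_ext[OF X MZ lin_comp[OF _ pl] lin_zerof[OF MZ] _ x])
    show "?K d \<in> Lin (TX (1 + m) d) (TX (1 + m) (d + 1))"
      using hom_famD[OF H, of "d + 1" d] by (simp del: One_nat_def plus_1_eq_Suc)
    fix a b \<xi> \<eta> assume d: "a + b = d" and \<xi>: "\<xi> :> TX 1 a" and \<eta>: "\<eta> :> TX m b"
    let ?N = "Tens Z (1 + m) (d + 1)"
    note e\<xi> = ec[OF \<xi>]
    have L\<xi>: "?L a \<xi> :> TX 1 (a + 1)" by (rule lin_closed[OF letter_lin[where G = G, OF G] \<xi>])
    have K\<eta>: "K b \<eta> :> TX m (b + 1)" using lin_closed[OF hom_famD[OF K, of "b + 1" b]] \<eta> by simp
    have c1: "tcat X 1 m (a + 1) b (?L a \<xi>) \<eta> :> TX (1 + m) (d + 1)"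
      using concat_closed[OF X L\<xi> \<eta>] d by (simp add: ac_simps)
    have c2: "tcat X 1 m a (b + 1) (?e a \<xi>) (K b \<eta>) :> TX (1 + m) (d + 1)"
      using concat_closed[OF X e\<xi> K\<eta>] d by (simp add: ac_simps)
    have h1: "H1 d (tcat X 1 m a b \<xi> \<eta>) = tcat X 1 m (a + 1) b (?L a \<xi>) \<eta>"
      using horiz_concat[OF X L idf \<xi> \<eta> d[symmetric], of "d + 1"] by (simp add: signed_def H1_def del: One_nat_def plus_1_eq_Suc)
    have h2: "H2 d (tcat X 1 m a b \<xi> \<eta>) = signed (TX (1 + m) (d + 1)) a (tcat X 1 m a (b + 1) (?e a \<xi>) (K b \<eta>))"
      using horiz_concat[OF X ef K \<xi> \<eta> d[symmetric], of "d + 1"] by (simp add: H2_def del: One_nat_def plus_1_eq_Suc)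
    have q1: "tmap Z p (1 + m) (d + 1) (tcat X 1 m (a + 1) b (?L a \<xi>) \<eta>) = 0[?N]"
      using tensor_map_concat[where f = p, OF X Z p L\<xi> \<eta>] L2[OF \<xi>] lin_zero[OF MZ MZ concat_lin_left[OF Z pc[OF \<eta>]], of 1 "a + 1"] d
      by (simp add: ac_simps del: One_nat_def plus_1_eq_Suc)
    have q2: "tmap Z p (1 + m) (d + 1) (tcat X 1 m a (b + 1) (?e a \<xi>) (K b \<eta>)) = 0[?N]"
      using tensor_map_concat[where f = p, OF X Z p e\<xi> K\<eta>] K2[OF \<eta>] lin_zero[OF MZ MZ concat_lin_right[OF Z pc[OF e\<xi>]], of m "b + 1"] d
      by (simp add: ac_simps del: One_nat_def plus_1_eq_Suc)
    have "tmap Z p (1 + m) (d + 1) (signed (TX (1 + m) (d + 1)) a (tcat X 1 m a (b + 1) (?e a \<xi>) (K b \<eta>))) = 0[?N]"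
      using lin_signed[OF MX MZ pl c2] q2 MZ by (simp add: signed_def del: One_nat_def plus_1_eq_Suc)
    then show "tmap Z p (1 + m) (d + 1) (?K d (tcat X 1 m a b \<xi> \<eta>)) = 0[?N]"
      unfolding h1 h2 using lin_add[OF pl c1 signed_closed[OF MX c2]] q1 MZ by (simp del: One_nat_def plus_1_eq_Suc)
  qed
  show ?case using H homot van unfolding plus_1_eq_Suc by blast
qed

end
end

subsection \<open>A strictification of the zigzag between a complex and its homology\<close>

text \<open>The section \<open>s\<close> of the fibration \<open>q\<close> need not commute with the differentials, but \<open>p\<close> kills it in positive degrees.\<close>

locale strict_zigzag = ground_ring R for R :: "'k ring" (structure) +
  fixes A :: "('k, 'a) cx" and H :: "('k, 'h) cx" and Y :: "('k, 'y) cx"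
    and p :: "int \<Rightarrow> 'y \<Rightarrow> 'a" and t :: "int \<Rightarrow> 'a \<Rightarrow> 'y" and q :: "int \<Rightarrow> 'y \<Rightarrow> 'h" and j :: "int \<Rightarrow> 'h \<Rightarrow> 'y"
    and s :: "int \<Rightarrow> 'h \<Rightarrow> 'y" and C :: "int \<Rightarrow> 'y \<Rightarrow> 'y" and G :: "int \<Rightarrow> 'y \<Rightarrow> 'y"
  assumes A: "cplx A" and H: "cplx H" and Y: "cplx Y"
    and dH: "h :> gr H n \<Longrightarrow> diff H n h = 0[gr H (n - 1)]"
    and p: "cmap Y A p" and t: "cmap A Y t" and q: "cmap Y H q" and j: "cmap H Y j"
    and s: "s n \<in> Lin (gr H n) (gr Y n)"
    and C: "C n \<in> Lin (gr Y n) (gr Y (n + 1))" and G: "G n \<in> Lin (gr Y n) (gr Y (n + 1))"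
    and pt: "x :> gr A n \<Longrightarrow> p n (t n x) = x"
    and qj: "h :> gr H n \<Longrightarrow> q n (j n h) = h"
    and qs: "h :> gr H n \<Longrightarrow> q n (s n h) = h"
    and ps: "\<lbrakk>n > 0; h :> gr H n\<rbrakk> \<Longrightarrow> p n (s n h) = 0[gr A n]"
    and pC: "y :> gr Y n \<Longrightarrow> p (n + 1) (C n y) = 0[gr A (n + 1)]"
    and C_htpy: "y :> gr Y n \<Longrightarrow> y -[gr Y n] t n (p n y) = diff Y (n + 1) (C n y) +[gr Y n] C (n - 1) (diff Y n y)"
    and G_htpy: "y :> gr Y n \<Longrightarrow> y -[gr Y n] j n (q n y) = diff Y (n + 1) (G n y) +[gr Y n] G (n - 1) (diff Y n y)"

text \<open>The retraction data produced by \<open>splitting\<close>, with an encoding for triples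
  made of a chain of \<open>A\<close> and two elements of \<open>H\<close>, the second of which will
  have degree one higher than the first.\<close>

locale retract_triple = triple R mk pr1 pr2 pr3
  for R :: "'k ring" (structure) and mk :: "'a \<Rightarrow> 'h \<Rightarrow> 'h \<Rightarrow> 'y" and pr1 pr2 pr3 +
  fixes A :: "('k, 'a) cx" and H :: "('k, 'h) cx" and r :: "int \<Rightarrow> 'a \<Rightarrow> 'h" and i :: "int \<Rightarrow> 'h \<Rightarrow> 'a" and k :: "int \<Rightarrow> 'a \<Rightarrow> 'a"
  assumes A: "cplx A" and H: "cplx H" and dH: "diff H n h = 0[gr H (n - 1)]"
    and r: "cmap A H r" and i: "cmap H A i" and k: "k n \<in> Lin (gr A n) (gr A (n + 1))"
    and ri: "h :> gr H n \<Longrightarrow> r n (i n h) = h"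
    and htpy: "x :> gr A n \<Longrightarrow> x -[gr A n] i n (r n x) = diff A (n + 1) (k n x) +[gr A n] k (n - 1) (diff A n x)"
begin

text \<open>A mapping cylinder of \<open>r\<close>: the last component is the suspension coordinate. In degree zero
  the middle component is dropped, so that there is nothing of negative degree.\<close>

abbreviation Yq :: "int \<Rightarrow> 'a \<Rightarrow> 'h \<Rightarrow> 'h \<Rightarrow> bool" where
  "Yq n a h v \<equiv> (n \<le> 0 \<longrightarrow> h = 0[gr H n]) \<and> (n < 0 \<longrightarrow> v = 0[gr H (n + 1)])"

definition cyl :: "('k, 'y) cx" where
  "cyl = \<lparr>gr = (\<lambda>n. tmod (gr A n) (gr H n) (gr H (n + 1)) (Yq n)),
    diff = (\<lambda>n y. mk (diff A n (pr1 y)) 0[gr H (n - 1)] (pr2 y))\<rparr>"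

lemmas MA = cx_module[OF A] and MH = cx_module[OF H]
lemmas rl = chain_mapD(1)[OF r] and il = chain_mapD(1)[OF i] and rd = chain_mapD(2)[OF r] and id = chain_mapD(2)[OF i]
lemmas dl = cx_diff_lin[OF A]

lemma k': "k (n - 1) \<in> Lin (gr A (n - 1)) (gr A n)"
  using k[of "n - 1"] by simp

lemma d': "diff A (n + 1) \<in> Lin (gr A (n + 1)) (gr A n)"
  using dl[of "n + 1"] by simp

lemmas closed = lin_closed[OF rl] lin_closed[OF il] lin_closed[OF dl] lin_closed[OF k] lin_closed[OF k'] lin_closed[OF d']

lemma cyl_tclosed: "tclosed (gr A n) (gr H n) (gr H (n + 1)) (Yq n)"
  using MH by (simp add: tclosed_def)

lemmas cyl_facts = MA[of n] MH[of n] MH[of "n + 1"] cyl_tclosed[of n] for n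

lemma cyl_gr: "gr cyl n = tmod (gr A n) (gr H n) (gr H (n + 1)) (Yq n)"
  by (simp add: cyl_def)

lemma cyl_in: "mk a h v :> gr cyl n \<longleftrightarrow> a :> gr A n \<and> h :> gr H n \<and> v :> gr H (n + 1) \<and> Yq n a h v"
  by (simp add: cyl_gr tmod_simps)

lemma cyl_cases:
  assumes "y :> gr cyl n"
  obtains a h v where "y = mk a h v" "a :> gr A n" "h :> gr H n" "v :> gr H (n + 1)" "Yq n a h v"
  using assms unfolding cyl_gr by (rule tmod_cases)

lemma cyl_module: "module R (gr cyl n)"
  unfolding cyl_gr by (rule tmod_module[OF cyl_facts])

lemma cyl_ops:
  "0[gr cyl n] = mk 0[gr A n] 0[gr H n] 0[gr H (n + 1)]"
  "mk a h v +[gr cyl n] mk a' h' v' = mk (a +[gr A n] a') (h +[gr H n] h') (v +[gr H (n + 1)] v')"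
  by (simp_all add: cyl_gr tmod_simps)

lemma cyl_minus: "\<lbrakk>mk a h v :> gr cyl n; mk a' h' v' :> gr cyl n\<rbrakk> \<Longrightarrow>
    mk a h v -[gr cyl n] mk a' h' v' = mk (a -[gr A n] a') (h -[gr H n] h') (v -[gr H (n + 1)] v')"
  unfolding cyl_gr by (rule tmod_minus[OF cyl_facts])

lemma cyl_pr: "pr1 \<in> Lin (gr cyl n) (gr A n)" "pr2 \<in> Lin (gr cyl n) (gr H n)" "pr3 \<in> Lin (gr cyl n) (gr H (n + 1))"
  unfolding cyl_gr by (rule tmod_pr_lin[OF cyl_facts])+

lemma cyl_diff: "diff cyl n y = mk (diff A n (pr1 y)) 0[gr H (n - 1)] (pr2 y)"
  by (simp add: cyl_def)

lemma cyl_lin: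
  assumes "module R N" "f1 \<in> Lin N (gr A n)" "f2 \<in> Lin N (gr H n)" "f3 \<in> Lin N (gr H (n + 1))"
    and "\<And>x. x :> N \<Longrightarrow> Yq n (f1 x) (f2 x) (f3 x)"
  shows "(\<lambda>x. mk (f1 x) (f2 x) (f3 x)) \<in> Lin N (gr cyl n)"
  unfolding cyl_gr by (rule tmod_mk_lin[OF cyl_facts assms])

lemma cyl_complex: "cplx cyl"
proof (rule chain_complex.intro)
  fix n
  show "module R (gr cyl n)" by (rule cyl_module)
  have p2: "pr2 \<in> Lin (gr cyl n) (gr H (n - 1 + 1))" using cyl_pr(2) by simp
  show "diff cyl n \<in> Lin (gr cyl n) (gr cyl (n - 1))"
    unfolding cyl_diff[abs_def]
    by (rule cyl_lin[OF cyl_module lin_comp[OF cyl_pr(1) dl] lin_zerof[OF MH] p2]) (auto elim!: cyl_cases)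
  show "diff cyl (n - 1) (diff cyl n y) = 0[gr cyl (n - 2)]" if "y :> gr cyl n" for y
    using that by (rule cyl_cases) (simp add: cyl_diff cyl_ops cx_diff_diff[OF A])
  assume n: "n < 0"
  show "carrier (gr cyl n) = {0[gr cyl n]}"
  proof (intro equalityI subsetI)
    fix y assume "y :> gr cyl n"
    then show "y \<in> {0[gr cyl n]}" by (rule cyl_cases) (use chain_complex.nonneg[OF A n] n in \<open>simp add: cyl_ops\<close>)
  qed (use mod_zero_closed[OF cyl_module] in simp)
qed

text \<open>The second and third components span a contractible complex, whose differential moves
  the former to the place of the latter. Hence projection to and inclusion of the first component
  are \<open>p\<close> and \<open>t\<close>. In \<open>cq\<close> the middle component is
  subtracted, which makes the map onto in positive degrees independently of
  \<open>r\<close>.\<close>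

definition "cp (n :: int) = pr1"
definition "ct (n :: int) a = mk a 0[gr H n] 0[gr H (n + 1)]"
definition "cq n y = r n (pr1 y) -[gr H n] pr2 y"
definition "cj n h = ct n (i n h)"
text \<open>In positive degrees the section of \<open>q\<close> goes into the middle component,
  which \<open>p\<close> does not see. In degree zero this component is missing and \<open>i\<close>
  takes over.\<close>

definition "cs n h = (if n \<le> 0 then ct n (i n h) else mk 0[gr A n] (-[gr H n] h) 0[gr H (n + 1)])"
text \<open>The contraction of the complementary summand: it moves the third component back to the
  middle, against the differential.\<close>

definition "cC n y = mk 0[gr A (n + 1)] (pr3 y) 0[gr H (n + 1 + 1)]"
text \<open>The contraction \<open>cC\<close> together with the homotopy \<open>k\<close> on
  \<open>A\<close>. The additional term through \<open>i\<close> compensates the middle component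
  that \<open>cq\<close> subtracts.\<close>

definition "cG n y = mk (k n (pr1 y) +[gr A (n + 1)] i (n + 1) (pr3 y)) (pr3 y) 0[gr H (n + 1 + 1)]"

lemma ct_lin: "ct n \<in> Lin (gr A n) (gr cyl n)"
  unfolding ct_def[abs_def] by (rule cyl_lin[OF MA lin_id lin_zerof[OF MH] lin_zerof[OF MH]]) simp

lemma strict_zigzag: "strict_zigzag R A H cyl cp ct cq cj cs cC cG"
proof (rule strict_zigzag.intro[OF ground_ring_axioms], rule strict_zigzag_axioms.intro)
  show "cplx A" "cplx H" "cplx cyl" by (rule A H cyl_complex)+
  show "diff H n h = 0[gr H (n - 1)]" for n h by (rule dH)
  show "cmap cyl A cp" using cyl_pr by (auto simp: chain_map_def cp_def cyl_diff)
  have ctd: "ct (n - 1) (diff A n x) = diff cyl n (ct n x)" if "x :> gr A n" for n x by (simp add: ct_def cyl_diff)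
  show "cmap A cyl ct" using ctd ct_lin by (simp add: chain_map_def)
  show "cmap H cyl cj"
    unfolding chain_map_def cj_def[abs_def]
    using lin_comp[OF il ct_lin] id ctd closed by simp
  have cql: "cq n \<in> Lin (gr cyl n) (gr H n)" for n
    unfolding cq_def[abs_def] by (rule lin_minusf[OF MH lin_comp[OF cyl_pr(1) rl] cyl_pr(2)])
  have "cq (n - 1) (diff cyl n y) = diff H n (cq n y)" if "y :> gr cyl n" for n y
    using that
  proof (rule cyl_cases)
    fix a h v assume y: "y = mk a h v" "a :> gr A n"
    have "r (n - 1) (diff A n a) = 0[gr H (n - 1)]" using rd[OF y(2)] dH by simp
    then show ?thesis using MH mod_minus_eq_zero_iff[OF MH, of "0[gr H (n - 1)]" "n - 1" "0[gr H (n - 1)]"] by (simp add: y(1) cq_def cyl_diff dH)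
  qed
  then show "cmap cyl H cq" using cql by (simp add: chain_map_def)
  fix n
  show "cs n \<in> Lin (gr H n) (gr cyl n)"
  proof (cases "n \<le> 0")
    case True
    then show ?thesis using lin_comp[OF il ct_lin, of n] by (simp add: cs_def[abs_def])
  next
    case False
    have "(\<lambda>h. mk 0[gr A n] (-[gr H n] h) 0[gr H (n + 1)]) \<in> Lin (gr H n) (gr cyl n)"
      by (rule cyl_lin[OF MH lin_zerof[OF MA] lin_negf[OF MH lin_id] lin_zerof[OF MH]]) (use False in simp)
    then show ?thesis using False by (simp add: cs_def[abs_def])
  qed
  \<comment> \<open>The third component in degree \<open>n\<close> becomes the middle one in degree
    \<open>n + 1\<close>. The bounds in \<open>Yq\<close> are placed such that both are required to
    vanish in the same cases.\<close>
  have C3: "n + 1 \<le> 0 \<Longrightarrow> y :> gr cyl n \<Longrightarrow> pr3 y = 0[gr H (n + 1)]" for y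
    by (erule cyl_cases) simp
  show "cC n \<in> Lin (gr cyl n) (gr cyl (n + 1))"
    unfolding cC_def[abs_def] by (rule cyl_lin[OF cyl_module lin_zerof[OF MA] cyl_pr(3) lin_zerof[OF MH]]) (use C3 in simp)
  show "cG n \<in> Lin (gr cyl n) (gr cyl (n + 1))"
    unfolding cG_def[abs_def]
    by (rule cyl_lin[OF cyl_module lin_addf[OF MA lin_comp[OF cyl_pr(1) k] lin_comp[OF cyl_pr(3) il]] cyl_pr(3) lin_zerof[OF MH]])
      (use C3 in simp)
  interpret MH: module R "gr H n" by (rule MH)
  interpret MH1: module R "gr H (n + 1)" by (rule MH)
  interpret MA: module R "gr A n" by (rule MA)
  show "x :> gr A n \<Longrightarrow> cp n (ct n x) = x" for x by (simp add: cp_def ct_def)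
  { fix h assume h: "h :> gr H n"
    have m0: "h -[gr H n] 0[gr H n] = h" "0[gr H n] -[gr H n] (-[gr H n] h) = h" using h by algebra+
    show j1: "cq n (cj n h) = h" using h m0 by (simp add: cq_def cj_def ct_def ri)
    show "cq n (cs n h) = h"
      using j1 m0 lin_zero[OF MA MH rl] by (simp add: cs_def cj_def[symmetric]) (simp add: cq_def)
    show "n > 0 \<Longrightarrow> cp n (cs n h) = 0[gr A n]" by (simp add: cp_def cs_def) }
  fix y assume "y :> gr cyl n"
  then obtain a h v where y: "y = mk a h v" and a: "a :> gr A n" and h: "h :> gr H n" and v: "v :> gr H (n + 1)"
    and Yq: "Yq n a h v" by (rule cyl_cases)
  have yc: "mk a h v :> gr cyl n" using a h v Yq by (simp add: cyl_in)
  have m0: "h -[gr H n] 0[gr H n] = h" "v -[gr H (n + 1)] 0[gr H (n + 1)] = v" "a -[gr A n] a = 0[gr A n]"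
    using a h v by algebra+
  have ctc: "mk x 0[gr H n] 0[gr H (n + 1)] :> gr cyl n" if "x :> gr A n" for x using that MH by (simp add: cyl_in)
  show "cp (n + 1) (cC n y) = 0[gr A (n + 1)]" by (simp add: cp_def cC_def)
  have dz: "diff A (n + 1) 0[gr A (n + 1)] = 0[gr A n]" using lin_zero[OF MA MA d'] .
  show "y -[gr cyl n] ct n (cp n y) = diff cyl (n + 1) (cC n y) +[gr cyl n] cC (n - 1) (diff cyl n y)"
    using a h v cyl_minus[OF yc ctc[OF a]] by (simp add: y ct_def cp_def cC_def cyl_diff cyl_ops dz m0)
  define w where "w = r n a -[gr H n] h"
  have w: "w :> gr H n" using a h by (simp add: w_def closed)
  \<comment> \<open>The homotopy in the first component: \<open>htpy\<close> accounts for
    \<open>i n (r n a)\<close>, the term \<open>i n h\<close> remains, and the term with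
    \<open>v\<close> has zero differential because \<open>i\<close> is a chain map and
    \<open>H\<close> has zero differential.\<close>
  have e1: "a -[gr A n] i n w = diff A (n + 1) (k n a +[gr A (n + 1)] i (n + 1) v) +[gr A n] (k (n - 1) (diff A n a) +[gr A n] i n h)"
  proof -
    have di: "diff A (n + 1) (i (n + 1) v) = 0[gr A n]" using id[OF v] dH lin_zero[OF MH MA il, of n] by simp
    have c: "diff A (n + 1) (k n a) :> gr A n" "k (n - 1) (diff A n a) :> gr A n" "i n (r n a) :> gr A n" "i n h :> gr A n"
      using a h closed by auto
    have "a = (a -[gr A n] i n (r n a)) +[gr A n] i n (r n a)" using a c by algebra
    also have "\<dots> = diff A (n + 1) (k n a) +[gr A n] k (n - 1) (diff A n a) +[gr A n] i n (r n a)" using htpy[OF a] by simp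
    finally have a': "a = diff A (n + 1) (k n a) +[gr A n] k (n - 1) (diff A n a) +[gr A n] i n (r n a)" .
    have "a -[gr A n] i n w = diff A (n + 1) (k n a) +[gr A n] k (n - 1) (diff A n a) +[gr A n] i n (r n a) -[gr A n] (i n (r n a) -[gr A n] i n h)"
      using a' lin_minus[OF MH MA il lin_closed[OF rl a] h] by (simp add: w_def)
    also have "\<dots> = (diff A (n + 1) (k n a) +[gr A n] 0[gr A n]) +[gr A n] (k (n - 1) (diff A n a) +[gr A n] i n h)"
      using c by algebra
    finally show ?thesis using lin_add[OF d' lin_closed[OF k a] lin_closed[OF il v]] di by simp
  qed
  show "y -[gr cyl n] cj n (cq n y) = diff cyl (n + 1) (cG n y) +[gr cyl n] cG (n - 1) (diff cyl n y)"
    using h v cyl_minus[OF yc ctc[OF lin_closed[OF il w]]] e1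
    by (simp add: y cq_def w_def[symmetric] cj_def ct_def cG_def cyl_diff cyl_ops m0)
qed

end

context ground_ring begin

subsection \<open>Operations related by a morphism of complexes\<close>

context
  fixes U :: "('k, 'a) cx" and V :: "('k, 'b) cx" and f :: "int \<Rightarrow> 'a \<Rightarrow> 'b"
  assumes U: "cplx U" and V: "cplx V" and f: "cmap U V f"
begin

text \<open>The condition of \<open>algebra_hom\<close> for a single operation. A relation is used
  since \<open>f\<close> need not be invertible: an operation on one side need not determine one on
  the other.\<close>

definition endo_rel :: "nat \<Rightarrow> nat \<Rightarrow> int \<Rightarrow> ('k, 'a) endo \<Rightarrow> ('k, 'b) endo \<Rightarrow> bool" where
  "endo_rel m n p x y \<longleftrightarrow> (\<forall>d. \<forall>\<xi>\<in>carrier (Tens U m d).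
     tmap V f n (d + p) (x d \<xi>) = y d (tmap V f m d \<xi>))"

abbreviation "UE m n p \<equiv> gr (Hom (tpow U m) (tpow U n)) p"
abbreviation "VE m n p \<equiv> gr (Hom (tpow V m) (tpow V n)) p"
abbreviation "fT \<equiv> tmap V f"

lemma endo_relD: "\<lbrakk>endo_rel m n p x y; \<xi> :> Tens U m d; e = d + p\<rbrakk> \<Longrightarrow> fT n e (x d \<xi>) = y d (fT m d \<xi>)"
  by (simp add: endo_rel_def)

lemmas f_lin = chain_mapD(1)[OF f]
lemmas fT_lin = tensor_map_lin[where f = f, OF U V f_lin]
lemmas fT_closed = tensor_map_closed[where f = f, OF U V f_lin]
lemmas MU = tensor_module[OF U] and MV = tensor_module[OF V]

text \<open>The closure rules from here to \<open>rel_unit\<close> say that related pairs form a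
  subprop of the product of the two endomorphism props.\<close>

lemma rel_zero: "endo_rel m n p 0[UE m n p] 0[VE m n p]"
  unfolding endo_rel_def using EH_simps(1)[OF U] EH_simps(1)[OF V] fT_closed lin_zero[OF MU MV fT_lin] by simp

lemma rel_add:
  assumes x: "x :> UE m n p" "x' :> UE m n p" and r: "endo_rel m n p x y" "endo_rel m n p x' y'"
  shows "endo_rel m n p (x +[UE m n p] x') (y +[VE m n p] y')"
  unfolding endo_rel_def
proof (intro allI ballI)
  fix d \<xi> assume \<xi>: "\<xi> :> Tens U m d"
  note c = EH_app[OF U x(1) \<xi> refl] EH_app[OF U x(2) \<xi> refl]
  show "fT n (d + p) ((x +[UE m n p] x') d \<xi>) = (y +[VE m n p] y') d (fT m d \<xi>)"
    unfolding EH_simps(2)[OF U \<xi>] EH_simps(2)[OF V fT_closed[OF \<xi>]] lin_add[OF fT_lin c]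
      endo_relD[OF r(1) \<xi> refl] endo_relD[OF r(2) \<xi> refl] ..
qed

lemma rel_smult:
  assumes x: "x :> UE m n p" and a: "a :> R" and r: "endo_rel m n p x y"
  shows "endo_rel m n p (a *[UE m n p] x) (a *[VE m n p] y)"
  unfolding endo_rel_def
proof (intro allI ballI)
  fix d \<xi> assume \<xi>: "\<xi> :> Tens U m d"
  show "fT n (d + p) ((a *[UE m n p] x) d \<xi>) = (a *[VE m n p] y) d (fT m d \<xi>)"
    unfolding EH_simps(3)[OF U \<xi>] EH_simps(3)[OF V fT_closed[OF \<xi>]] lin_smult[OF fT_lin a EH_app[OF U x(1) \<xi> refl]]
      endo_relD[OF r(1) \<xi> refl] ..
qed

lemma fT_diff: "\<xi> :> Tens U m d \<Longrightarrow> fT m (d - 1) (tdiff U m d \<xi>) = tdiff V m d (fT m d \<xi>)"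
  by (rule tensor_map_diff[OF U V f_lin f])

lemma rel_diff:
  assumes x: "x :> UE m n p" and r: "endo_rel m n p x y"
  shows "endo_rel m n (p - 1) (diff (Hom (tpow U m) (tpow U n)) p x)
    (diff (Hom (tpow V m) (tpow V n)) p y)"
  unfolding endo_rel_def
proof (intro allI ballI)
  fix d \<xi> assume \<xi>: "\<xi> :> Tens U m d"
  note x\<xi> = EH_app[OF U x \<xi> refl] and d\<xi> = tensor_diff_closed[OF U \<xi>]
  have e: "d + p - 1 = d - 1 + p" "d + (p - 1) = d + p - 1" by simp_all
  note xd = EH_app[OF U x d\<xi> e(1)] and dx = tensor_diff_closed[OF U x\<xi>]
  show "fT n (d + (p - 1)) (diff (Hom (tpow U m) (tpow U n)) p x d \<xi>) =
     diff (Hom (tpow V m) (tpow V n)) p y d (fT m d \<xi>)"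
    unfolding EH_simps(4)[OF U \<xi>] EH_simps(4)[OF V fT_closed[OF \<xi>]] e(2) lin_minus[OF MU MV fT_lin dx signed_closed[OF MU xd]]
      lin_signed[OF MU MV fT_lin xd] fT_diff[OF x\<xi>] endo_relD[OF r \<xi> refl] endo_relD[OF r d\<xi> e(1)] fT_diff[OF \<xi>] ..
qed

lemma rel_lact:
  assumes x: "x :> UE m n p" and r: "endo_rel m n p x y" and \<sigma>: "\<sigma> \<in> perms n"
  shows "endo_rel m n p (lact (End U) m n \<sigma> p x) (lact (End V) m n \<sigma> p y)"
  unfolding endo_rel_def
  using tensor_map_perm[where f = f, OF U V f_lin \<sigma>] lact_app[OF U _ refl] lact_app[OF V _ refl] fT_closed endo_relD[OF r] EH_app[OF U x _ refl] by simp

lemma rel_ract: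
  assumes x: "x :> UE m n p" and r: "endo_rel m n p x y" and \<sigma>: "\<sigma> \<in> perms m"
  shows "endo_rel m n p (ract (End U) m n \<sigma> p x) (ract (End V) m n \<sigma> p y)"
  unfolding endo_rel_def
  using tensor_map_perm[where f = f, OF U V f_lin \<sigma>] ract_app[OF U] ract_app[OF V] fT_closed endo_relD[OF r] perm_closed[OF U \<sigma>] by simp

lemma rel_vert:
  assumes x: "x' :> UE n k q" and r: "endo_rel k m p x y" "endo_rel n k q x' y'"
  shows "endo_rel n m (p + q) (vert (End U) n k m p q x x') (vert (End V) n k m p q y y')"
  unfolding endo_rel_def End_simps(4)[OF U] End_simps(4)[OF V]
proof (intro allI ballI)
  fix d \<xi> assume \<xi>: "\<xi> :> Tens U n d"
  have e: "d + (p + q) = (d + q) + p" by simp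
  show "fT m (d + (p + q)) (hom_comp (tpow U n) p q x x' d \<xi>) = hom_comp (tpow V n) p q y y' d (fT n d \<xi>)"
    unfolding vert_app[OF U \<xi> refl] vert_app[OF V fT_closed[OF \<xi>] refl] endo_relD[OF r(1) EH_app[OF U x \<xi> refl] e] endo_relD[OF r(2) \<xi> refl] ..
qed

lemma rel_horiz:
  assumes x: "x :> UE k m p" "x' :> UE l n q" and y: "y :> VE k m p" "y' :> VE l n q"
    and r: "endo_rel k m p x y" "endo_rel l n q x' y'"
  shows "endo_rel (k + l) (m + n) (p + q) (horiz (End U) k m l n p q x x') (horiz (End V) k m l n p q y y')"
  unfolding endo_rel_def
proof (intro allI ballI)
  fix d \<zeta> assume \<zeta>: "\<zeta> :> Tens U (k + l) d"
  let ?x = "horiz (End U) k m l n p q x x'" and ?y = "horiz (End V) k m l n p q y y'"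
  note hx = horiz_closed[OF U x] and hy = horiz_closed[OF V y]
  show "fT (m + n) (d + (p + q)) (?x d \<zeta>) = ?y d (fT (k + l) d \<zeta>)"
  proof (rule concat_ext[OF U MV lin_comp[OF EH_lin[OF U hx refl] fT_lin] lin_comp[OF fT_lin EH_lin[OF V hy refl]] _ \<zeta>])
    fix a b \<xi> \<eta> assume d: "a + b = d" and \<xi>: "\<xi> :> Tens U k a" and \<eta>: "\<eta> :> Tens U l b"
    note x\<xi> = EH_app[OF U x(1) \<xi> refl] and x\<eta> = EH_app[OF U x(2) \<eta> refl]
    have e: "d + (p + q) = d + p + q" "a + p + (b + q) = d + (p + q)" using d by simp_all
    have "fT (m + n) (d + (p + q)) (?x d (tcat U k l a b \<xi> \<eta>)) =
      signed (Tens V (m + n) (d + (p + q))) (q * a) (fT (m + n) (d + (p + q)) (tcat U m n (a + p) (b + q) (x a \<xi>) (x' b \<eta>)))"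
      unfolding horiz_app_concat[OF U x \<xi> \<eta> d[symmetric] e(1) refl refl]
      by (rule lin_signed[OF MU MV fT_lin concat_closed[OF U x\<xi> x\<eta>, unfolded e(2)]])
    also have "\<dots> = signed (Tens V (m + n) (d + (p + q))) (q * a) (tcat V m n (a + p) (b + q) (y a (fT k a \<xi>)) (y' b (fT l b \<eta>)))"
      using tensor_map_concat[where f = f, OF U V f_lin x\<xi> x\<eta>] endo_relD[OF r(1) \<xi> refl] endo_relD[OF r(2) \<eta> refl] by (simp add: e(2))
    also have "\<dots> = ?y d (tcat V k l a b (fT k a \<xi>) (fT l b \<eta>))"
      unfolding horiz_app_concat[OF V y fT_closed[OF \<xi>] fT_closed[OF \<eta>] d[symmetric] e(1) refl refl] ..
    finally show "fT (m + n) (d + (p + q)) (?x d (tcat U k l a b \<xi> \<eta>)) = ?y d (fT (k + l) d (tcat U k l a b \<xi> \<eta>))"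
      using tensor_map_concat[where f = f, OF U V f_lin \<xi> \<eta>] d by simp
  qed
qed

lemma rel_unit: "endo_rel n n 0 (punit (End U) n) (punit (End V) n)"
  by (simp add: endo_rel_def End_simps(5)[OF U] End_simps(5)[OF V] fT_closed)

text \<open>If \<open>f\<close> has a linear section, related operations on \<open>V\<close> are
  determined by those on \<open>U\<close>: evaluate on a lift of the argument. The section need not
  respect differentials.\<close>

lemma rel_unique:
  assumes g: "\<And>n. g n \<in> Lin (gr V n) (gr U n)" and fg: "\<And>n v. v :> gr V n \<Longrightarrow> f n (g n v) = v"
    and y: "y :> VE m n p" "y' :> VE m n p" and r: "endo_rel m n p x y" "endo_rel m n p x y'"
  shows "y = y'"
proof (rule EH_eqI[OF V y])
  fix d \<xi> assume \<xi>: "\<xi> :> Tens V m d"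
  have c: "tmap U g m d \<xi> :> Tens U m d" by (rule tensor_map_closed[where f = g, OF V U g \<xi>])
  have "fT m d (tmap U g m d \<xi>) = \<xi>"
    using tensor_map_comp[where f = g and g = f and h = "\<lambda>n x. x", OF V U V g f_lin lin_id fg \<xi>]
      tensor_map_id[where f = "\<lambda>n x. x", OF V lin_id refl \<xi>] by simp
  then show "y d \<xi> = y' d \<xi>" using endo_relD[OF r(1) c refl] endo_relD[OF r(2) c refl] by metis
qed

end

subsection \<open>Conjugation of operations\<close>

text \<open>Conjugation is a chain map between hom complexes for any two chain maps \<open>f\<close>
  and \<open>g\<close>; it respects products only under further conditions, such as being mutually
  inverse.\<close>

definition conj_map :: "('k, 'a) cx \<Rightarrow> ('k, 'b) cx \<Rightarrow> (int \<Rightarrow> 'a \<Rightarrow> 'b) \<Rightarrow> (int \<Rightarrow> 'b \<Rightarrow> 'a) \<Rightarrow> nat \<Rightarrow> nat \<Rightarrow> int \<Rightarrow> ('k, 'a) endo \<Rightarrow> ('k, 'b) endo" where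
  "conj_map U V f g m n p x = (\<lambda>d. \<lambda>\<xi>\<in>carrier (Tens V m d).
     tmap V f n (d + p) (x d (tmap U g m d \<xi>)))"

lemma conj_map_chain:
  assumes U: "cplx U" and V: "cplx V" and f: "cmap U V f" and g: "cmap V U g"
  shows "cmap (Hom (tpow U m) (tpow U n)) (Hom (tpow V m) (tpow V n)) (conj_map U V f g m n)"
proof -
  let ?U = "tpow U" and ?V = "tpow V"
  define F where "F = (\<lambda>p x d. \<lambda>\<xi>\<in>carrier (gr (?U m) d). tmap V f n (d + p) (x d \<xi>))"
  define G where "G = (\<lambda>(p :: int) x d. \<lambda>\<xi>\<in>carrier (gr (?V m) d). (x d (tmap U g m d \<xi>) :: ('k, 'b) tensor))"
  have 1: "cmap (Hom (?U m) (?U n)) (Hom (?U m) (?V n)) F"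
    unfolding F_def by (rule hom_postcomp[OF TP_complex[OF U] TP_complex[OF U] TP_complex[OF V] tensor_map_chain[OF U V f]])
  have 2: "cmap (Hom (?U m) (?V n)) (Hom (?V m) (?V n)) G"
    unfolding G_def by (rule hom_precomp[OF TP_complex[OF U] TP_complex[OF V] TP_complex[OF V] tensor_map_chain[OF V U g]])
  have eq: "conj_map U V f g m n p x = G p (F p x)" for p x
    unfolding conj_map_def F_def G_def using tensor_map_closed[where f = g, OF V U chain_mapD(1)[OF g]] by (intro ext) (simp cong: restrict_cong)
  show ?thesis
    unfolding chain_map_def
  proof (intro allI conjI ballI)
    fix p x assume x: "x :> gr (Hom (?U m) (?U n)) p"
    have "G (p - 1) (F (p - 1) (diff (Hom (?U m) (?U n)) p x)) = diff (Hom (?V m) (?V n)) p (G p (F p x))"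
      unfolding chain_mapD(2)[OF 1 x] by (rule chain_mapD(2)[OF 2 lin_closed[OF chain_mapD(1)[OF 1] x]])
    then show "conj_map U V f g m n (p - 1) (diff (Hom (?U m) (?U n)) p x) = diff (Hom (?V m) (?V n)) p (conj_map U V f g m n p x)"
      unfolding eq .
  next
    fix p
    have "(\<lambda>x. G p (F p x)) \<in> Lin (gr (Hom (?U m) (?U n)) p) (gr (Hom (?V m) (?V n)) p)"
      by (rule lin_comp[OF chain_mapD(1)[OF 1] chain_mapD(1)[OF 2]])
    then show "conj_map U V f g m n p \<in> Lin (gr (Hom (?U m) (?U n)) p) (gr (Hom (?V m) (?V n)) p)"
      unfolding eq[abs_def] .
  qed
qed

lemma conj_map_app: "\<xi> :> Tens V m d \<Longrightarrow>
    conj_map U V f g m n p x d \<xi> = tmap V f n (d + p) (x d (tmap U g m d \<xi>))"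
  by (simp add: conj_map_def)

text \<open>The action is conjugated by an isomorphism of complexes. Compatibility with the prop
  structure requires no computation: both sides are related by \<open>f\<close> to the same
  operation on \<open>U\<close>, so \<open>rel_unique\<close> identifies them.\<close>

lemma prop_hom_transport:
  fixes \<theta> :: "('p, ('k, 'a) endo) prop_map"
  assumes U: "cplx U" and V: "cplx V" and f: "cmap U V f" and g: "cmap V U g"
    and fg: "\<And>n v. v :> gr V n \<Longrightarrow> f n (g n v) = v" and gf: "\<And>n u. u :> gr U n \<Longrightarrow> g n (f n u) = u"
    and P: "dg_prop R P" and \<theta>: "prop_hom R P (End U) \<theta>"
  obtains \<chi> where "prop_hom R P (End V) \<chi>" "\<And>m n p a. a \<in> ops_in P m n p \<Longrightarrow> endo_rel U V f m n p (\<theta> m n p a) (\<chi> m n p a)"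
proof
  define \<chi> where "\<chi> m n p a = conj_map U V f g m n p (\<theta> m n p a)" for m n p a
  interpret \<theta>: prop_hom R P "End U" \<theta> by (rule \<theta>)
  interpret P: dg_prop R P by (rule P)
  interpret EV: dg_prop R "End V" by (rule dg_prop_End[OF V])
  note cm = conj_map_chain[OF U V f g]
  have th: "\<theta> m n p a :> UE U m n p" if "a \<in> ops_in P m n p" for m n p a
    using lin_closed[OF chain_mapD(1)[OF \<theta>.hom_chain_map] that] by (simp add: End_simps[OF U])
  have ch: "\<chi> m n p a :> VE V m n p" if "a \<in> ops_in P m n p" for m n p a
    unfolding \<chi>_def by (rule lin_closed[OF chain_mapD(1)[OF cm] th[OF that]])
  show rel: "endo_rel U V f m n p (\<theta> m n p a) (\<chi> m n p a)" if a: "a \<in> ops_in P m n p" for m n p a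
    unfolding endo_rel_def[OF U V f]
  proof (intro allI ballI)
    fix d \<xi> assume \<xi>: "\<xi> :> Tens U m d"
    note fl = chain_mapD(1)[OF f] and gl = chain_mapD(1)[OF g]
    have "tmap U g m d (tmap V f m d \<xi>) = \<xi>"
      using tensor_map_comp[where f = f and g = g and h = "\<lambda>n x. x", OF U V U fl gl lin_id gf \<xi>]
        tensor_map_id[where f = "\<lambda>n x. x", OF U lin_id refl \<xi>] by simp
    then show "tmap V f n (d + p) (\<theta> m n p a d \<xi>) = \<chi> m n p a d (tmap V f m d \<xi>)"
      by (simp add: \<chi>_def conj_map_app[OF tensor_map_closed[where f = f, OF U V fl \<xi>]])
  qed
  have uniq: "y = y'" if "y :> VE V m n p" "y' :> VE V m n p" "endo_rel U V f m n p x y" "endo_rel U V f m n p x y'" for m n p x y y'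
    by (rule rel_unique[where g = g, OF U V f chain_mapD(1)[OF g] _ that]) (rule fg)
  note Vc = EV.lact_chain_map EV.ract_chain_map
  show "prop_hom R P (End V) \<chi>"
  proof (rule prop_hom.intro)
    show "cmap (ops P m n) (ops (End V) m n) (\<chi> m n)" for m n
      unfolding chain_map_def
    proof (intro allI conjI ballI)
      show "\<chi> m n p \<in> Lin (gr (ops P m n) p) (gr (ops (End V) m n) p)" for p
        using lin_comp[OF chain_mapD(1)[OF \<theta>.hom_chain_map] chain_mapD(1)[OF cm[of m n], folded End_simps(1)[OF V], folded End_simps(1)[OF U]]] unfolding \<chi>_def[abs_def] .
      show "\<chi> m n (p - 1) (diff (ops P m n) p x) = diff (ops (End V) m n) p (\<chi> m n p x)" if "x \<in> ops_in P m n p" for p x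
        using chain_mapD(2)[OF \<theta>.hom_chain_map that] chain_mapD(2)[OF cm th[OF that]] by (simp add: \<chi>_def End_simps[OF U] End_simps[OF V])
    qed
    fix m n p a \<sigma> assume a: "a \<in> ops_in P m n p"
    show "\<chi> m n p (lact P m n \<sigma> p a) = lact (End V) m n \<sigma> p (\<chi> m n p a)" if \<sigma>: "\<sigma> \<in> perms n"
    proof (rule uniq[OF ch lact_closed[OF V \<sigma> ch[OF a]] rel])
      show la: "lact P m n \<sigma> p a \<in> ops_in P m n p" by (rule lin_closed[OF chain_mapD(1)[OF P.lact_chain_map[OF \<sigma>]] a])
      then show "lact P m n \<sigma> p a \<in> ops_in P m n p" .
      show "endo_rel U V f m n p (\<theta> m n p (lact P m n \<sigma> p a)) (lact (End V) m n \<sigma> p (\<chi> m n p a))"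
        unfolding \<theta>.hom_lact[OF \<sigma> a] by (rule rel_lact[OF U V f th[OF a] rel[OF a] \<sigma>])
    qed
    show "\<chi> m n p (ract P m n \<sigma> p a) = ract (End V) m n \<sigma> p (\<chi> m n p a)" if \<sigma>: "\<sigma> \<in> perms m"
    proof (rule uniq[OF ch ract_closed[OF V \<sigma> ch[OF a]] rel])
      show la: "ract P m n \<sigma> p a \<in> ops_in P m n p" by (rule lin_closed[OF chain_mapD(1)[OF P.ract_chain_map[OF \<sigma>]] a])
      then show "ract P m n \<sigma> p a \<in> ops_in P m n p" .
      show "endo_rel U V f m n p (\<theta> m n p (ract P m n \<sigma> p a)) (ract (End V) m n \<sigma> p (\<chi> m n p a))"
        unfolding \<theta>.hom_ract[OF \<sigma> a] by (rule rel_ract[OF U V f th[OF a] rel[OF a] \<sigma>])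
    qed
  next
    fix k m l n p q a b assume a: "a \<in> ops_in P k m p" and b: "b \<in> ops_in P l n q"
    have ab: "horiz P k m l n p q a b \<in> ops_in P (k + l) (m + n) (p + q)"
      by (rule lin_closed[OF dg_bilinearD(1)[OF P.horiz_bilinear a] b])
    show "\<chi> (k + l) (m + n) (p + q) (horiz P k m l n p q a b) = horiz (End V) k m l n p q (\<chi> k m p a) (\<chi> l n q b)"
      by (rule uniq[OF ch[OF ab] horiz_closed[OF V ch[OF a] ch[OF b]] rel[OF ab]])
        (unfold \<theta>.hom_horiz[OF a b], rule rel_horiz[OF U V f th[OF a] th[OF b] ch[OF a] ch[OF b] rel[OF a] rel[OF b]])
  next
    fix k m n p q a b assume a: "a \<in> ops_in P k m p" and b: "b \<in> ops_in P n k q"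
    have ab: "vert P n k m p q a b \<in> ops_in P n m (p + q)"
      by (rule lin_closed[OF dg_bilinearD(1)[OF P.vert_bilinear a] b])
    show "\<chi> n m (p + q) (vert P n k m p q a b) = vert (End V) n k m p q (\<chi> k m p a) (\<chi> n k q b)"
      by (rule uniq[OF ch[OF ab] _ rel[OF ab]])
        (unfold \<theta>.hom_vert[OF a b] End_simps(4)[OF V], rule vert_closed[OF V ch[OF a] ch[OF b]],
         rule rel_vert[OF U V f th[OF b] rel[OF a] rel[OF b], unfolded End_simps(4)[OF V]])
  next
    fix n
    have u: "punit P n \<in> ops_in P n n 0" by (rule P.unit_closed)
    show "\<chi> n n 0 (punit P n) = punit (End V) n"
      by (rule uniq[OF ch[OF u] EV.unit_closed[unfolded End_simps(1)[OF V]] rel[OF u]]) (unfold \<theta>.hom_unit, rule rel_unit[OF U V f])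
  qed
qed

text \<open>Each term of the Leibniz sum contains a zero letter.\<close>

lemma tensor_diff_zero:
  assumes X: "cplx X" and d: "\<And>n x. x :> gr X n \<Longrightarrow> diff X n x = 0[gr X (n - 1)]"
    and \<xi>: "\<xi> :> Tens X m e"
  shows "tdiff X m e \<xi> = 0[Tens X m (e - 1)]"
proof (rule tensor_induct_lin[OF X tensor_module[OF X] tensor_diff_lin[OF X] _ \<xi>])
  fix w assume w: "w \<in> words X m e"
  let ?N = "Tens X m (e - 1)"
  interpret N: module R ?N by (rule tensor_module[OF X])
  have "Pure X (diff_at X i w) = 0[?N]" if i: "i < m" for i
  proof (rule multilinear_zero[OF X tensor_module[OF X] pure_multilinear[OF X] diff_at_words[OF X w i] i])
    have l: "i < length w" using words_length[OF w] i by simp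
    show "snd (diff_at X i w ! i) = 0[gr X (fst (diff_at X i w ! i))]"
      using l d[OF words_nth[OF w i]] by (simp add: diff_at_def)
  qed
  then have "tdiff X m e (Pure X w) = (\<Oplus>\<^bsub>?N\<^esub>i\<in>{..<m}. 0[?N])"
    unfolding tensor_diff_pure[OF X w] by (intro N.M.finsum_cong') (auto simp: signed_def)
  then show "tdiff X m e (Pure X w) = 0[?N]" by simp
qed

lemma EH_minus:
  assumes X: "cplx X" and f: "f :> UE X m n D" and g: "g :> UE X m n D"
    and \<xi>: "\<xi> :> Tens X m d" and e: "e = d + D"
  shows "(f -[UE X m n D] g) d \<xi> = f d \<xi> -[Tens X n e] g d \<xi>"
proof -
  have "(\<lambda>f. f d \<xi>) \<in> Lin (UE X m n D) (gr (tpow X n) e)"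
    by (rule hom_eval_lin[OF TP_complex[OF X] TP_complex[OF X] _ e]) (simp add: \<xi>)
  then show ?thesis
    using lin_minus[OF EH_module[OF X] tensor_module[OF X] _ f g] by simp
qed

end

context strict_zigzag begin

abbreviation "TA \<equiv> Tens A"
abbreviation "TH \<equiv> Tens H"
abbreviation "TY \<equiv> Tens Y"
abbreviation "EndA \<equiv> UE A"
abbreviation "EndH \<equiv> UE H"
abbreviation "EndY \<equiv> UE Y"
abbreviation "dE X m n \<equiv> diff (Hom (tpow X m) (tpow X n))"
abbreviation "pT \<equiv> tmap A p"
abbreviation "tT \<equiv> tmap Y t"
abbreviation "qT \<equiv> tmap H q"
abbreviation "jT \<equiv> tmap Y j"
abbreviation "sT \<equiv> tmap Y s"

lemmas pl = chain_mapD(1)[OF p] and tl = chain_mapD(1)[OF t] and ql = chain_mapD(1)[OF q] and jl = chain_mapD(1)[OF j]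
lemmas MA = tensor_module[OF A] and MH = tensor_module[OF H] and MY = tensor_module[OF Y]
lemmas pT_lin = tensor_map_lin[where f = p, OF Y A pl] and tT_lin = tensor_map_lin[where f = t, OF A Y tl]
  and qT_lin = tensor_map_lin[where f = q, OF Y H ql] and jT_lin = tensor_map_lin[where f = j, OF H Y jl]
  and sT_lin = tensor_map_lin[where f = s, OF H Y s]
lemmas T_closed = lin_closed[OF pT_lin] lin_closed[OF tT_lin] lin_closed[OF qT_lin] lin_closed[OF jT_lin] lin_closed[OF sT_lin]

lemma TH_diff: "\<eta> :> TH m d \<Longrightarrow> tdiff H m d \<eta> = 0[TH m (d - 1)]"
  by (rule tensor_diff_zero[OF H dH])

lemma qT_sT: "\<eta> :> TH m d \<Longrightarrow> qT m d (sT m d \<eta>) = \<eta>"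
  using tensor_map_comp[where f = s and g = q and h = "\<lambda>n x. x", OF H Y H s ql lin_id qs]
    tensor_map_id[where f = "\<lambda>n x. x", OF H lin_id refl] by simp

lemma qT_jT: "\<eta> :> TH m d \<Longrightarrow> qT m d (jT m d \<eta>) = \<eta>"
  using tensor_map_comp[where f = j and g = q and h = "\<lambda>n x. x", OF H Y H jl ql lin_id qj]
    tensor_map_id[where f = "\<lambda>n x. x", OF H lin_id refl] by simp

lemma pT_tT: "\<eta> :> TA m d \<Longrightarrow> pT m d (tT m d \<eta>) = \<eta>"
  using tensor_map_comp[where f = t and g = p and h = "\<lambda>n x. x", OF A Y A tl pl lin_id pt]
    tensor_map_id[where f = "\<lambda>n x. x", OF A lin_id refl] by simp

lemma pT_sT: "\<lbrakk>d > 0; \<eta> :> TH m d\<rbrakk> \<Longrightarrow> pT m d (sT m d \<eta>) = 0[TA m d]"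
  using tensor_map_comp[where f = s and g = p and h = "\<lambda>n x. p n (s n x)", OF H Y A s pl lin_comp[OF s pl] refl]
    tensor_map_zero_positive[where f = "\<lambda>n x. p n (s n x)", OF H A lin_comp[OF s pl] ps] by simp

lemma pT_diff: "\<xi> :> TY m d \<Longrightarrow> pT m (d - 1) (tdiff Y m d \<xi>) = tdiff A m d (pT m d \<xi>)"
  by (rule tensor_map_diff[OF Y A pl p])

lemma qT_diff: "\<xi> :> TY m d \<Longrightarrow> qT m (d - 1) (tdiff Y m d \<xi>) = 0[TH m (d - 1)]"
  using tensor_map_diff[OF Y H ql q] TH_diff T_closed(3) by simp

lemma G_homotopy:
  obtains K where "hom_fam (tpow Y m) (tpow Y m) 1 K"
    "\<And>d \<xi>. \<xi> :> TY m d \<Longrightarrow> dE Y m m 1 K d \<xi> = \<xi> -[TY m d] jT m d (qT m d \<xi>)"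
proof -
  let ?e = "\<lambda>n y. j n (q n y)"
  have e: "cmap Y Y ?e"
    unfolding chain_map_def using lin_comp[OF ql jl] chain_mapD(2)[OF q] chain_mapD(2)[OF j] lin_closed[OF ql] by simp
  obtain K where K: "hom_fam (tpow Y m) (tpow Y m) 1 K"
    "\<And>d \<xi>. \<xi> :> TY m d \<Longrightarrow> dE Y m m 1 K d \<xi> = \<xi> -[TY m d] tmap Y ?e m d \<xi>"
    using tensor_homotopy[where G = G and p = "\<lambda>n y. 0[gr Y n]" and m = m, OF Y Y e G G_htpy lin_zerof[OF cx_module[OF Y]] refl] by blast
  show ?thesis
    by (rule that[OF K(1)])
      (use K(2) tensor_map_comp[where f = q and g = j and h = ?e, OF Y H Y ql jl lin_comp[OF ql jl] refl] in simp)
qed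

lemma C_homotopy:
  obtains K where "hom_fam (tpow Y m) (tpow Y m) 1 K"
    "\<And>d \<xi>. \<xi> :> TY m d \<Longrightarrow> dE Y m m 1 K d \<xi> = \<xi> -[TY m d] tT m d (pT m d \<xi>)"
    "\<And>d \<xi>. \<xi> :> TY m d \<Longrightarrow> pT m (d + 1) (K d \<xi>) = 0[TA m (d + 1)]"
proof -
  let ?e = "\<lambda>n y. t n (p n y)"
  have e: "cmap Y Y ?e"
    unfolding chain_map_def using lin_comp[OF pl tl] chain_mapD(2)[OF p] chain_mapD(2)[OF t] lin_closed[OF pl] by simp
  obtain K where K: "hom_fam (tpow Y m) (tpow Y m) 1 K"
    "\<And>d \<xi>. \<xi> :> TY m d \<Longrightarrow> dE Y m m 1 K d \<xi> = \<xi> -[TY m d] tmap Y ?e m d \<xi>"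
    "\<And>d \<xi>. \<xi> :> TY m d \<Longrightarrow> pT m (d + 1) (K d \<xi>) = 0[TA m (d + 1)]"
    using tensor_homotopy[where G = C and p = p and m = m, OF Y A e C C_htpy pl pC] by blast
  show ?thesis
    by (rule that[OF K(1) _ K(3)])
      (use K(2) tensor_map_comp[where f = p and g = t and h = ?e, OF Y A Y pl tl lin_comp[OF pl tl] refl] in simp)
qed

text \<open>As \<open>H\<close> has zero differential, the premise on the boundary of
  \<open>y0\<close> says that \<open>u\<close>, which is \<open>q\<close> after \<open>y0\<close>,
  kills boundaries. By the homotopy between the identity and \<open>j\<close> after
  \<open>q\<close>, it agrees up to a boundary with a map that factors through \<open>q\<close>; the
  factor is \<open>u\<close> after \<open>j\<close>.\<close>

lemma correction:
  assumes y0: "y0 :> EndY m n D"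
    and z0: "\<And>d \<xi>. \<xi> :> TY m d \<Longrightarrow> qT n (d + D - 1) (dE Y m n D y0 d \<xi>) = 0[TH n (d + D - 1)]"
  obtains y h where "y :> EndY m n D" "h :> EndH m n D" "endo_rel Y H q m n D y h"
    "\<And>d \<xi>. \<xi> :> TY m d \<Longrightarrow> pT n (d + D) (y d \<xi>) = pT n (d + D) (y0 d \<xi>)"
    "dE Y m n D y = dE Y m n D y0"
proof (cases "D < 0")
  \<comment> \<open>In negative degrees all operations are zero, so nothing has to be
    corrected.\<close>
  case True
  show ?thesis
  proof (rule that[OF y0 mod_zero_closed[OF EH_module[OF H]] _ refl refl])
    show "endo_rel Y H q m n D y0 0[EndH m n D]"
      unfolding endo_rel_def[OF Y H q]
      using hom_carrierD(4)[OF TP_complex[OF Y] TP_complex[OF Y] y0 True] EH_simps(1)[OF H] T_closed(3) lin_zero[OF MY MH qT_lin] by simp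
  qed
next
  case False
  define u where "u d \<xi> = qT n (d + D) (y0 d \<xi>)" for d \<xi>
  have ul: "u d \<in> Lin (TY m d) (TH n e)" if "e = d + D" for d e
    unfolding u_def[abs_def] that by (rule lin_comp[OF EH_lin[OF Y y0 refl] qT_lin])
  \<comment> \<open>Applying \<open>q\<close> to the boundary of \<open>y0\<close> gives two terms.
    The one that is a boundary in the target is killed by \<open>q\<close>, so the premise concerns
    this one alone, up to sign.\<close>
  have ud: "u (d - 1) (tdiff Y m d \<xi>) = 0[TH n (d + D - 1)]" if \<xi>: "\<xi> :> TY m d" for d \<xi>
  proof -
    interpret N: module R "TH n (d + D - 1)" by (rule MH)
    have e: "d + D - 1 = d - 1 + D" by simp
    note yd = EH_app[OF Y y0 tensor_diff_closed[OF Y \<xi>] e] and y\<xi> = EH_app[OF Y y0 \<xi> refl]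
    have uc: "u (d - 1) (tdiff Y m d \<xi>) :> TH n (d + D - 1)" by (rule lin_closed[OF ul[OF e] tensor_diff_closed[OF Y \<xi>]])
    have "0[TH n (d + D - 1)] -[TH n (d + D - 1)] signed (TH n (d + D - 1)) D (u (d - 1) (tdiff Y m d \<xi>)) = 0[TH n (d + D - 1)]"
      using z0[OF \<xi>] unfolding EH_simps(4)[OF Y \<xi>] lin_minus[OF MY MH qT_lin tensor_diff_closed[OF Y y\<xi>] signed_closed[OF MY yd]]
        lin_signed[OF MY MH qT_lin yd] qT_diff[OF y\<xi>] by (simp add: u_def e)
    then have "signed (TH n (d + D - 1)) D (u (d - 1) (tdiff Y m d \<xi>)) = 0[TH n (d + D - 1)]"
      using mod_minus_eq_zero_iff[OF MH mod_zero_closed[OF MH] signed_closed[OF MH uc]] by simp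
    then have "signed (TH n (d + D - 1)) D (signed (TH n (d + D - 1)) D (u (d - 1) (tdiff Y m d \<xi>))) = 0[TH n (d + D - 1)]"
      by (simp add: signed_def)
    then show ?thesis using uc by (simp add: signed_def split: if_splits)
  qed
  obtain K where K: "hom_fam (tpow Y m) (tpow Y m) 1 K"
    and K1: "\<And>d \<xi>. \<xi> :> TY m d \<Longrightarrow> dE Y m m 1 K d \<xi> = \<xi> -[TY m d] jT m d (qT m d \<xi>)"
    by (rule G_homotopy[of m]) (rule that)
  have Kl: "K d \<in> Lin (TY m d) (TY m e)" if "e = d + 1" for d e using hom_famD[OF K that] by simp
  (* As u kills boundaries and H has zero differential, u - u j q = u K d is, up to sign, the boundary of u K, which
     lifts along q to the boundary of s u K. *)
  define g where "g = (\<lambda>d. \<lambda>\<xi>\<in>carrier (gr (tpow Y m) d). sT n (d + (D + 1)) (u (d + 1) (K d \<xi>)))"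
  have gc: "g :> EndY m n (D + 1)"
    unfolding g_def
  proof (rule hom_restrictI[OF TP_complex[OF Y] TP_complex[OF Y]])
    have e: "d + (D + 1) = d + 1 + D" for d by simp
    show "hom_fam (tpow Y m) (tpow Y n) (D + 1) (\<lambda>d \<xi>. sT n (d + (D + 1)) (u (d + 1) (K d \<xi>)))"
      unfolding hom_fam_def tensor_power_simps by (intro allI lin_comp[OF Kl[OF refl]] lin_comp[OF ul[OF e] sT_lin])
  qed (use False in auto)
  have g_app: "g d \<xi> = sT n e (u (d + 1) (K d \<xi>))" if "\<xi> :> TY m d" "e = d + (D + 1)" for d e \<xi>
    using that by (simp add: g_def)
  have uK: "u (d + 1) (K d \<xi>) :> TH n e" if "\<xi> :> TY m d" "e = d + (D + 1)" for d e \<xi>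
    using lin_closed[OF ul lin_closed[OF Kl[OF refl] that(1)], of e] that(2) by simp
  have qg: "qT n e (g d \<xi>) = u (d + 1) (K d \<xi>)" if "\<xi> :> TY m d" "e = d + (D + 1)" for d e \<xi>
    unfolding g_app[OF that] by (rule qT_sT[OF uK[OF that]])
  have pg: "pT n e (g d \<xi>) = 0[TA n e]" if \<xi>: "\<xi> :> TY m d" and e: "e = d + (D + 1)" for d e \<xi>
  \<comment> \<open>For arguments of negative degree there is nothing to show. Otherwise the value
    of \<open>g\<close> has degree at least one, where \<open>p\<close> kills the section
    \<open>s\<close>.\<close>
  proof (cases "d < 0")
    case True
    then have "\<xi> = 0[TY m d]" using tensor_negative[OF Y, of d m] \<xi> by simp
    then have "g d \<xi> = 0[TY n e]" using lin_zero[OF MY MY EH_lin[OF Y gc e]] by simp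
    then show ?thesis using lin_zero[OF MY MA pT_lin] by simp
  next
    case d: False
    then show ?thesis unfolding g_app[OF \<xi> e] using pT_sT[OF _ uK[OF \<xi> e]] e False by simp
  qed
  have e1: "D + 1 - 1 = D" and e2: "d + (D + 1) - 1 = d + D" "d + (D + 1) - 1 = (d - 1) + (D + 1)" for d by simp_all
  let ?w = "dE Y m n (D + 1) g"
  have wc: "?w :> EndY m n D"
    using hom_diff_closed[OF TP_complex[OF Y] TP_complex[OF Y] gc] unfolding e1 .
  have w_app: "?w d \<xi> = tdiff Y n (d + (D + 1)) (g d \<xi>) -[TY n (d + D)] signed (TY n (d + D)) (D + 1) (g (d - 1) (tdiff Y m d \<xi>))"
    and gd: "g (d - 1) (tdiff Y m d \<xi>) :> TY n (d + D)" and dg: "tdiff Y n (d + (D + 1)) (g d \<xi>) :> TY n (d + D)"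
    if \<xi>: "\<xi> :> TY m d" for d \<xi>
    using EH_simps(4)[OF Y \<xi>, of n "D + 1" g] EH_app[OF Y gc tensor_diff_closed[OF Y \<xi>] e2(2)] tensor_diff_closed[OF Y EH_app[OF Y gc \<xi> refl]]
    unfolding e2(1) by simp_all
  \<comment> \<open>The sign with exponent \<open>D\<close> cancels the one found in
    \<open>qw\<close> below.\<close>
  define y where "y = y0 -[EndY m n D] signed (EndY m n D) D ?w"
  note swc = signed_closed[OF EH_module[OF Y] wc]
  have yc: "y :> EndY m n D" unfolding y_def by (rule mod_minus_closed[OF EH_module[OF Y] y0 swc])
  have y_app: "y d \<xi> = y0 d \<xi> -[TY n (d + D)] signed (TY n (d + D)) D (?w d \<xi>)" if \<xi>: "\<xi> :> TY m d" for d \<xi>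
    unfolding y_def EH_minus[OF Y y0 swc \<xi> refl] EH_signed[OF Y wc \<xi> refl] ..
  \<comment> \<open>The chain section \<open>j\<close> is used here and not \<open>s\<close>: the
    result has to be a chain map if \<open>D\<close> is zero, and it is the composite that the
    homotopy of \<open>q\<close> produces.\<close>
  define h where "h = (\<lambda>d. \<lambda>\<eta>\<in>carrier (gr (tpow H m) d). u d (jT m d \<eta>))"
  have hc: "h :> EndH m n D"
    unfolding h_def
  proof (rule hom_restrictI[OF TP_complex[OF H] TP_complex[OF H]])
    show "hom_fam (tpow H m) (tpow H n) D (\<lambda>d \<eta>. u d (jT m d \<eta>))"
      unfolding hom_fam_def tensor_power_simps by (intro allI lin_comp[OF jT_lin ul[OF refl]])
    fix d \<eta> assume D: "D = 0" and "\<eta> :> gr (tpow H m) d"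
    then have \<eta>: "\<eta> :> TH m d" by simp
    have "u d (jT m d \<eta>) :> TH n d" by (rule lin_closed[OF ul T_closed(4)[OF \<eta>]]) (simp add: D)
    then show "u (d - 1) (jT m (d - 1) (diff (tpow H m) d \<eta>)) = diff (tpow H n) d (u d (jT m d \<eta>))"
      using TH_diff \<eta> lin_zero[OF MH MY jT_lin] lin_zero[OF MY MH ul[of "d - 1" "d - 1"]] by (simp add: D)
  qed (use False in auto)
  show ?thesis
  proof (rule that[OF yc hc])
    show "endo_rel Y H q m n D y h"
      unfolding endo_rel_def[OF Y H q]
    proof (intro allI ballI)
      fix d \<xi> assume \<xi>: "\<xi> :> TY m d"
      interpret N: module R "TH n (d + D)" by (rule MH)
      note d\<xi> = tensor_diff_closed[OF Y \<xi>]
      let ?v = "u d (K (d - 1) (tdiff Y m d \<xi>))"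
      have v: "?v :> TH n (d + D)" using uK[OF d\<xi>, of "d + D"] by simp
      have u\<xi>: "u d \<xi> :> TH n (d + D)" by (rule lin_closed[OF ul[OF refl] \<xi>])
      note jq = T_closed(4)[OF T_closed(3)[OF \<xi>]]
      have uj: "u d (jT m d (qT m d \<xi>)) :> TH n (d + D)" by (rule lin_closed[OF ul[OF refl] jq])
      have K\<xi>: "K d \<xi> :> TY m (d + 1)" by (rule lin_closed[OF Kl[OF refl] \<xi>])
      have dK: "tdiff Y m (d + 1) (K d \<xi>) :> TY m d" using tensor_diff_closed[OF Y K\<xi>] by simp
      have Kd: "K (d - 1) (tdiff Y m d \<xi>) :> TY m d" by (rule lin_closed[OF Kl d\<xi>]) simp
      have "u d \<xi> -[TH n (d + D)] u d (jT m d (qT m d \<xi>)) = u d (dE Y m m 1 K d \<xi>)"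
        unfolding K1[OF \<xi>] by (rule lin_minus[OF MY MH ul[OF refl] \<xi> jq, symmetric])
      also have "\<dots> = 0[TH n (d + D)] +[TH n (d + D)] ?v"
        unfolding hom_diff_one[OF Y K \<xi>] lin_add[OF ul[OF refl] dK Kd] using ud[OF K\<xi>] by simp
      finally have j1: "u d \<xi> -[TH n (d + D)] u d (jT m d (qT m d \<xi>)) = ?v" using v by simp
      have qw: "qT n (d + D) (?w d \<xi>) = signed (TH n (d + D)) D ?v"
      proof -
        have "qT n (d + D) (tdiff Y n (d + (D + 1)) (g d \<xi>)) = 0[TH n (d + D)]"
          using qT_diff[OF EH_app[OF Y gc \<xi> refl]] unfolding e2(1) .
        then have "qT n (d + D) (?w d \<xi>) = 0[TH n (d + D)] -[TH n (d + D)] signed (TH n (d + D)) (D + 1) ?v"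
          unfolding w_app[OF \<xi>] lin_minus[OF MY MH qT_lin dg[OF \<xi>] signed_closed[OF MY gd[OF \<xi>]]] lin_signed[OF MY MH qT_lin gd[OF \<xi>]]
          using qg[OF d\<xi>, of "d + D"] by simp
        moreover have "0[TH n (d + D)] -[TH n (d + D)] ?v = -[TH n (d + D)] ?v"
          "0[TH n (d + D)] -[TH n (d + D)] (-[TH n (d + D)] ?v) = ?v" using v by algebra+
        then have "0[TH n (d + D)] -[TH n (d + D)] signed (TH n (d + D)) (D + 1) ?v = signed (TH n (d + D)) D ?v" by (simp add: signed_def)
        ultimately show ?thesis by simp
      qed
      have wd: "?w d \<xi> :> TY n (d + D)" by (rule EH_app[OF Y wc \<xi> refl])
      have "qT n (d + D) (y d \<xi>) = u d \<xi> -[TH n (d + D)] signed (TH n (d + D)) D (signed (TH n (d + D)) D ?v)"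
        unfolding y_app[OF \<xi>] lin_minus[OF MY MH qT_lin EH_app[OF Y y0 \<xi> refl] signed_closed[OF MY wd]] lin_signed[OF MY MH qT_lin wd] qw
        by (simp add: u_def)
      also have "\<dots> = u d \<xi> -[TH n (d + D)] ?v" using v by (simp add: signed_def)
      also have "\<dots> = u d (jT m d (qT m d \<xi>))" unfolding j1[symmetric] using u\<xi> uj by algebra
      also have "\<dots> = h d (qT m d \<xi>)" using T_closed(3)[OF \<xi>] by (simp add: h_def)
      finally show "qT n (d + D) (y d \<xi>) = h d (qT m d \<xi>)" .
    qed
    fix d \<xi> assume \<xi>: "\<xi> :> TY m d"
    interpret N: module R "TA n (d + D)" by (rule MA)
    have "pT n (d + D) (tdiff Y n (d + (D + 1)) (g d \<xi>)) = 0[TA n (d + D)]"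
      using pT_diff[OF EH_app[OF Y gc \<xi> refl]] pg[OF \<xi> refl] lin_zero[OF MA MA tensor_diff_lin[OF A], of n "d + (D + 1)"] unfolding e2(1) by simp
    then have pw: "pT n (d + D) (?w d \<xi>) = 0[TA n (d + D)]"
      unfolding w_app[OF \<xi>] lin_minus[OF MY MA pT_lin dg[OF \<xi>] signed_closed[OF MY gd[OF \<xi>]]] lin_signed[OF MY MA pT_lin gd[OF \<xi>]]
      using pg[OF tensor_diff_closed[OF Y \<xi>], of "d + D"] mod_minus_eq_zero_iff[OF MA mod_zero_closed[OF MA] mod_zero_closed[OF MA]] MA by (simp add: signed_def)
    have wd: "?w d \<xi> :> TY n (d + D)" and yd: "y0 d \<xi> :> TY n (d + D)" by (rule EH_app[OF Y wc \<xi> refl], rule EH_app[OF Y y0 \<xi> refl])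
    have "pT n (d + D) (y0 d \<xi>) -[TA n (d + D)] 0[TA n (d + D)] = pT n (d + D) (y0 d \<xi>)" using T_closed(1)[OF yd] by algebra
    then show "pT n (d + D) (y d \<xi>) = pT n (d + D) (y0 d \<xi>)"
      unfolding y_app[OF \<xi>] lin_minus[OF MY MA pT_lin yd signed_closed[OF MY wd]] lin_signed[OF MY MA pT_lin wd] pw using MA by (simp add: signed_def)
  next
    note dl = hom_diff_lin[OF TP_complex[OF Y] TP_complex[OF Y], of m n D] and ME = EH_module[OF Y]
    interpret N: module R "EndY m n (D - 1)" by (rule ME)
    have "dE Y m n D ?w = 0[EndY m n (D - 1)]"
      using cx_diff_diff[OF hom_complex[OF TP_complex[OF Y] TP_complex[OF Y]] gc] by (simp add: e1)
    then have "dE Y m n D (signed (EndY m n D) D ?w) = 0[EndY m n (D - 1)]"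
      using lin_signed[OF ME ME dl wc] ME by (simp add: signed_def)
    moreover have "dE Y m n D y0 -[EndY m n (D - 1)] 0[EndY m n (D - 1)] = dE Y m n D y0" using lin_closed[OF dl y0] by algebra
    ultimately show "dE Y m n D y = dE Y m n D y0"
      unfolding y_def lin_minus[OF ME ME dl y0 swc] by simp
  qed
qed

end

subsection \<open>The test prop\<close>

definition uncounted :: "prop_category \<Rightarrow> nat \<Rightarrow> nat \<Rightarrow> bool" where
  "uncounted \<C> m n \<longleftrightarrow> (m, n) \<notin> counted_arities \<C> \<and> (m, n) \<noteq> (0, 0)"

text \<open>An uncounted arity can only arise from an uncounted factor, so operations forced to be
  zero stay consistent with products.\<close>

lemma uncounted_horiz: "uncounted \<C> (k + l) (m + n) \<Longrightarrow> uncounted \<C> k m \<or> uncounted \<C> l n"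
  by (cases \<C>) (auto simp: uncounted_def)

text \<open>Whether the intermediate arity \<open>k\<close> is zero decides which of the two factors
  is uncounted.\<close>

lemma uncounted_vert: "uncounted \<C> n m \<Longrightarrow> uncounted \<C> k m \<or> uncounted \<C> n k"
  by (cases \<C>) (auto simp: uncounted_def)

lemma uncounted_unit: "\<not> uncounted \<C> n n"
  by (cases \<C>) (auto simp: uncounted_def)

lemma in_category_prop: "in_category R \<C> P \<Longrightarrow> dg_prop R P"
  by (cases \<C>) auto

context ground_ring begin

lemma prop_bilinear_zero:
  assumes P: "dg_prop R P"
  shows "\<lbrakk>f \<in> ops_in P k m p; g \<in> ops_in P l n q; f = 0[gr (ops P k m) p] \<or> g = 0[gr (ops P l n) q]\<rbrakk> \<Longrightarrow>
      horiz P k m l n p q f g = 0[gr (ops P (k + l) (m + n)) (p + q)]"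
    "\<lbrakk>f \<in> ops_in P k m p; g' \<in> ops_in P n k q; f = 0[gr (ops P k m) p] \<or> g' = 0[gr (ops P n k) q]\<rbrakk> \<Longrightarrow>
      vert P n k m p q f g' = 0[gr (ops P n m) (p + q)]"
  using lin_zero[OF prop_module[OF P] prop_module[OF P] prop_horiz_lin(1)[OF P], of f k m p l n q]
    lin_zero[OF prop_module[OF P] prop_module[OF P] prop_horiz_lin(2)[OF P], of g l n q k m p]
    lin_zero[OF prop_module[OF P] prop_module[OF P] prop_vert_lin(1)[OF P], of f k m p n q]
    lin_zero[OF prop_module[OF P] prop_module[OF P] prop_vert_lin(2)[OF P], of g' n k q m p] by auto

end

text \<open>In the arities that are not counted the operations on \<open>H\<close> and \<open>Y\<close> are forced to vanish, to stay inside the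
  category of props at hand. At arity \<open>(0, 0)\<close> this would exclude the unit, but there they are
  determined by \<open>f\<close> anyway.\<close>

locale lift_test = strict_zigzag R A H Y p t q j s C G + triple R mk pr1 pr2 pr3
  for R :: "'k ring" (structure) and A :: "('k, 'a) cx" and H :: "('k, 'h) cx" and Y :: "('k, 'y) cx"
    and p t q j s C G and mk :: "'p \<Rightarrow> ('k, 'h) endo \<Rightarrow> ('k, 'y) endo \<Rightarrow> 'u" and pr1 pr2 pr3 +
  fixes P :: "('k, 'p) prop_data" and \<phi> :: "('p, ('k, 'a) endo) prop_map" and \<C> :: prop_category
  assumes cat: "in_category R \<C> P" and \<phi>: "prop_hom R P (End A) \<phi>"
begin

lemmas P = in_category_prop[OF cat]

definition compat :: "nat \<Rightarrow> nat \<Rightarrow> int \<Rightarrow> 'p \<Rightarrow> ('k, 'h) endo \<Rightarrow> ('k, 'y) endo \<Rightarrow> bool" where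
  "compat m n d f h y \<longleftrightarrow> endo_rel Y H q m n d y h \<and> endo_rel Y A p m n d y (\<phi> m n d f) \<and>
     (uncounted \<C> m n \<longrightarrow> h = 0[EndH m n d] \<and> y = 0[EndY m n d])"

abbreviation "cin \<equiv> in3 P (End H) (End Y) compat"

lemma cin_iff: "cin m n d f h y \<longleftrightarrow> f \<in> ops_in P m n d \<and> h :> EndH m n d \<and> y :> EndY m n d \<and> compat m n d f h y"
  by (simp add: in3_def End_simps(1)[OF H] End_simps(1)[OF Y])

lemma cinD:
  assumes "cin m n d f h y"
  shows "f \<in> ops_in P m n d" "h :> EndH m n d" "y :> EndY m n d" "endo_rel Y H q m n d y h"
    "endo_rel Y A p m n d y (\<phi> m n d f)" "uncounted \<C> m n \<Longrightarrow> h = 0[EndH m n d]" "uncounted \<C> m n \<Longrightarrow> y = 0[EndY m n d]"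
  using assms by (auto simp: cin_iff compat_def)

lemma \<phi>_chain: "cmap (ops P m n) (Hom (tpow A m) (tpow A n)) (\<phi> m n)"
  using prop_hom.hom_chain_map[OF \<phi>, of m n] by (simp add: End_simps(1)[OF A])

lemmas \<phi>_lin = chain_mapD(1)[OF \<phi>_chain] and \<phi>_diff = chain_mapD(2)[OF \<phi>_chain, symmetric]

lemma \<phi>_closed: "f \<in> ops_in P m n d \<Longrightarrow> \<phi> m n d f :> EndA m n d"
  by (rule lin_closed[OF \<phi>_lin])

lemmas dgH = dg_prop_End[OF H] and dgY = dg_prop_End[OF Y]
lemmas EMH = EH_module[OF H] and EMY = EH_module[OF Y] and EMA = EH_module[OF A]

text \<open>Each condition combines a closure rule for \<open>q\<close>, the same rule for
  \<open>p\<close> and the corresponding property of \<phi>. The zero operations in uncounted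
  arities are preserved by linearity.\<close>

sublocale E: triple_prop R mk pr1 pr2 pr3 P "End H" "End Y" compat
proof (rule triple_prop.intro[OF triple_axioms], rule triple_prop_axioms.intro)
  show "dg_prop R P" "dg_prop R (End H)" "dg_prop R (End Y)" by (rule P dgH dgY)+
  note oH = End_simps(1)[OF H] and oY = End_simps(1)[OF Y]
  show "compat m n d 0[gr (ops P m n) d] 0[gr (ops (End H) m n) d] 0[gr (ops (End Y) m n) d]" for m n d
    unfolding compat_def oH oY using rel_zero[OF Y H q] rel_zero[OF Y A p, of m n d] lin_zero[OF prop_module[OF P] EMA \<phi>_lin, of m n d] by simp
next
  note oH = End_simps(1)[OF H] and oY = End_simps(1)[OF Y]
  fix m n d f h y assume 1: "cin m n d f h y"
  note c = cinD[OF 1]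
  show "compat m n (d - 1) (diff (ops P m n) d f) (diff (ops (End H) m n) d h) (diff (ops (End Y) m n) d y)"
    unfolding compat_def oH oY
    using rel_diff[OF Y H q c(3) c(4)] rel_diff[OF Y A p c(3) c(5)] \<phi>_diff[OF c(1)] c(6,7)
      lin_zero[OF EMH EMH hom_diff_lin[OF TP_complex[OF H] TP_complex[OF H]], of m n d]
      lin_zero[OF EMY EMY hom_diff_lin[OF TP_complex[OF Y] TP_complex[OF Y]], of m n d] by auto
  show "compat m n d (lact P m n \<sigma> d f) (lact (End H) m n \<sigma> d h) (lact (End Y) m n \<sigma> d y)" if \<sigma>: "\<sigma> \<in> perms n" for \<sigma>
    unfolding compat_def
    using rel_lact[OF Y H q c(3) c(4) \<sigma>] rel_lact[OF Y A p c(3) c(5) \<sigma>] prop_hom.hom_lact[OF \<phi> \<sigma> c(1)] c(6,7)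
      lin_zero[OF EMH EMH prop_lact_lin[OF dgH \<sigma>, unfolded oH], of m d]
      lin_zero[OF EMY EMY prop_lact_lin[OF dgY \<sigma>, unfolded oY], of m d] by auto
  show "compat m n d (ract P m n \<sigma> d f) (ract (End H) m n \<sigma> d h) (ract (End Y) m n \<sigma> d y)" if \<sigma>: "\<sigma> \<in> perms m" for \<sigma>
    unfolding compat_def
    using rel_ract[OF Y H q c(3) c(4) \<sigma>] rel_ract[OF Y A p c(3) c(5) \<sigma>] prop_hom.hom_ract[OF \<phi> \<sigma> c(1)] c(6,7)
      lin_zero[OF EMH EMH prop_ract_lin[OF dgH \<sigma>, unfolded oH], of n d]
      lin_zero[OF EMY EMY prop_ract_lin[OF dgY \<sigma>, unfolded oY], of n d] by auto
  show "compat m n d (a *[gr (ops P m n) d] f) (a *[gr (ops (End H) m n) d] h) (a *[gr (ops (End Y) m n) d] y)"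
    if a: "a :> R" for a
    unfolding compat_def oH oY
    using rel_smult[OF Y H q c(3) a c(4)] rel_smult[OF Y A p c(3) a c(5)] lin_smult[OF \<phi>_lin a c(1)] c(6,7) mod_smult_zero[OF EMH a, of m n d] mod_smult_zero[OF EMY a, of m n d] by auto
  show "compat m n d (f +[gr (ops P m n) d] f') (h +[gr (ops (End H) m n) d] h') (y +[gr (ops (End Y) m n) d] y')"
    if 2: "cin m n d f' h' y'" for f' h' y'
  proof -
    note c' = cinD[OF 2]
    show ?thesis
      unfolding compat_def oH oY
      using rel_add[OF Y H q c(3) c'(3) c(4) c'(4)] rel_add[OF Y A p c(3) c'(3) c(5) c'(5)] lin_add[OF \<phi>_lin c(1) c'(1)] c(6,7) c'(6,7) EMH EMY by auto
  qed
next
  note oH = End_simps(1)[OF H] and oY = End_simps(1)[OF Y]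
  fix k m l n d e f h y f' h' y' assume 1: "cin k m d f h y" and 2: "cin l n e f' h' y'"
  note c = cinD[OF 1] and c' = cinD[OF 2]
  have "horiz (End H) k m l n d e h h' = 0[EndH (k + l) (m + n) (d + e)]"
    "horiz (End Y) k m l n d e y y' = 0[EndY (k + l) (m + n) (d + e)]" if "uncounted \<C> (k + l) (m + n)"
    using prop_bilinear_zero(1)[OF dgH, unfolded oH, OF c(2) c'(2)] prop_bilinear_zero(1)[OF dgY, unfolded oY, OF c(3) c'(3)]
      uncounted_horiz[OF that] c(6,7) c'(6,7) by blast+
  then show "compat (k + l) (m + n) (d + e) (horiz P k m l n d e f f') (horiz (End H) k m l n d e h h') (horiz (End Y) k m l n d e y y')"
    unfolding compat_def
    using rel_horiz[OF Y H q c(3) c'(3) c(2) c'(2) c(4) c'(4)] rel_horiz[OF Y A p c(3) c'(3) \<phi>_closed[OF c(1)] \<phi>_closed[OF c'(1)] c(5) c'(5)]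
      prop_hom.hom_horiz[OF \<phi> c(1) c'(1)] by simp
next
  note oH = End_simps(1)[OF H] and oY = End_simps(1)[OF Y]
  fix k m n d e f h y f' h' y' assume 1: "cin k m d f h y" and 2: "cin n k e f' h' y'"
  note c = cinD[OF 1] and c' = cinD[OF 2]
  have "vert (End H) n k m d e h h' = 0[EndH n m (d + e)]"
    "vert (End Y) n k m d e y y' = 0[EndY n m (d + e)]" if "uncounted \<C> n m"
    using prop_bilinear_zero(2)[OF dgH, unfolded oH, OF c(2) c'(2)] prop_bilinear_zero(2)[OF dgY, unfolded oY, OF c(3) c'(3)]
      uncounted_vert[OF that, of k] c(6,7) c'(6,7) by blast+
  then show "compat n m (d + e) (vert P n k m d e f f') (vert (End H) n k m d e h h') (vert (End Y) n k m d e y y')"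
    unfolding compat_def
    using rel_vert[OF Y H q c'(3) c(4) c'(4)] rel_vert[OF Y A p c'(3) c(5) c'(5)]
      prop_hom.hom_vert[OF \<phi> c(1) c'(1)] by simp
next
  fix n
  show "compat n n 0 (punit P n) (punit (End H) n) (punit (End Y) n)"
    unfolding compat_def using rel_unit[OF Y H q] rel_unit[OF Y A p] prop_hom.hom_unit[OF \<phi>] uncounted_unit by simp
qed

lemma counted_cinI:
  assumes "(m, n) \<in> counted_arities \<C>" "f \<in> ops_in P m n d" "h :> EndH m n d" "y :> EndY m n d"
    "endo_rel Y H q m n d y h" "endo_rel Y A p m n d y (\<phi> m n d f)"
  shows "cin m n d f h y"
  using assms by (simp add: cin_iff compat_def uncounted_def)

lemma q_unique: "\<lbrakk>h :> EndH m n d; h' :> EndH m n d; endo_rel Y H q m n d y h; endo_rel Y H q m n d y h'\<rbrakk> \<Longrightarrow> h = h'"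
  by (rule rel_unique[where g = j, OF Y H q jl qj])

section \<open>Lifting cycles, elements of positive degree and boundaries to triples\<close>

definition "lift_op m n d f = conj_map A Y t p m n d (\<phi> m n d f)"

lemmas conj_chain = conj_map_chain[OF A Y t p]

lemma lift_op_closed: "f \<in> ops_in P m n d \<Longrightarrow> lift_op m n d f :> EndY m n d"
  unfolding lift_op_def by (rule lin_closed[OF chain_mapD(1)[OF conj_chain] \<phi>_closed])

lemma lift_op_diff: "f \<in> ops_in P m n d \<Longrightarrow> dE Y m n d (lift_op m n d f) = lift_op m n (d - 1) (diff (ops P m n) d f)"
  unfolding lift_op_def using chain_mapD(2)[OF conj_chain \<phi>_closed] chain_mapD(2)[OF \<phi>_chain] by simp

lemma pT_lift_op:
  assumes f: "f \<in> ops_in P m n d" and \<xi>: "\<xi> :> TY m e" and e': "e' = e + d"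
  shows "pT n e' (lift_op m n d f e \<xi>) = \<phi> m n d f e (pT m e \<xi>)"
  unfolding lift_op_def conj_map_app[OF \<xi>] e' by (rule pT_tT[OF EH_app[OF A \<phi>_closed[OF f] T_closed(1)[OF \<xi>] refl]])

lemma lift_op_zero: "lift_op m n d 0[gr (ops P m n) d] = 0[EndY m n d]"
  unfolding lift_op_def using lin_zero[OF prop_module[OF P] EMA \<phi>_lin] lin_zero[OF EMA EMY chain_mapD(1)[OF conj_chain]] by simp

text \<open>Surjectivity on homology. Conjugation is a chain map, so \<open>lift_op\<close> of a
  cycle is a cycle and \<open>correction\<close> applies to it. The operation on \<open>H\<close> is
  again a cycle because the one on \<open>Y\<close> determines it.\<close>

lemma lift_cycle:
  assumes mn: "(m, n) \<in> counted_arities \<C>" and f: "f \<in> cycles (ops P m n) d"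
  obtains h y where "cin m n d f h y" "dE H m n d h = 0[EndH m n (d - 1)]" "dE Y m n d y = 0[EndY m n (d - 1)]"
proof -
  have fc: "f \<in> ops_in P m n d" and df: "diff (ops P m n) d f = 0[gr (ops P m n) (d - 1)]" using f by (auto simp: cycles_def)
  let ?y0 = "lift_op m n d f"
  have d0: "dE Y m n d ?y0 = 0[EndY m n (d - 1)]" using lift_op_diff[OF fc] df lift_op_zero by simp
  obtain y h where y: "y :> EndY m n d" "h :> EndH m n d" "endo_rel Y H q m n d y h"
    "\<And>e \<xi>. \<xi> :> TY m e \<Longrightarrow> pT n (e + d) (y e \<xi>) = pT n (e + d) (?y0 e \<xi>)" "dE Y m n d y = dE Y m n d ?y0"
  proof (rule correction[OF lift_op_closed[OF fc]])
    show "qT n (e + d - 1) (dE Y m n d ?y0 e \<xi>) = 0[TH n (e + d - 1)]" if "\<xi> :> TY m e" for e \<xi>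
      unfolding d0 EH_simps(1)[OF Y that] using lin_zero[OF MY MH qT_lin] by (simp add: add_diff_eq)
  qed (rule that, assumption+)
  have dy: "dE Y m n d y = 0[EndY m n (d - 1)]" using y(5) d0 by simp
  have "endo_rel Y A p m n d y (\<phi> m n d f)"
    unfolding endo_rel_def[OF Y A p] using y(4) pT_lift_op[OF fc _ refl] by simp
  then have c: "cin m n d f h y" by (rule counted_cinI[OF mn fc y(2,1,3)])
  have "dE H m n d h = 0[EndH m n (d - 1)]"
    using q_unique[OF hom_diff_closed[OF TP_complex[OF H] TP_complex[OF H] y(2)] mod_zero_closed[OF EMH] rel_diff[OF Y H q y(1) y(3)]]
      rel_zero[OF Y H q] dy by simp
  then show ?thesis by (rule that[OF c _ dy])
qed

text \<open>Surjectivity in positive degrees, where an operation need not be a chain map.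
  Subtracting \<open>s\<close> after \<open>q\<close> from \<open>lift_op\<close> gives an operation
  that \<open>q\<close> kills, so zero can be taken on \<open>H\<close>; the subtracted term is
  invisible to \<open>p\<close>.\<close>

lemma lift_positive:
  assumes mn: "(m, n) \<in> counted_arities \<C>" and f: "f \<in> ops_in P m n d" and d: "d > 0"
  obtains h y where "cin m n d f h y"
proof -
  let ?y0 = "lift_op m n d f"
  note y0 = lift_op_closed[OF f]
  define y where "y = (\<lambda>e. \<lambda>\<xi>\<in>carrier (gr (tpow Y m) e). ?y0 e \<xi> -[TY n (e + d)] sT n (e + d) (qT n (e + d) (?y0 e \<xi>)))"
  have yc: "y :> EndY m n d"
    unfolding y_def
  proof (rule hom_restrictI[OF TP_complex[OF Y] TP_complex[OF Y]])
    show "hom_fam (tpow Y m) (tpow Y n) d (\<lambda>e \<xi>. ?y0 e \<xi> -[TY n (e + d)] sT n (e + d) (qT n (e + d) (?y0 e \<xi>)))"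
      unfolding hom_fam_def tensor_power_simps
      using lin_minusf[OF MY EH_lin[OF Y y0 refl] lin_comp[OF EH_lin[OF Y y0 refl] lin_comp[OF qT_lin sT_lin]]] by blast
  qed (use d in auto)
  have y: "y e \<xi> = ?y0 e \<xi> -[TY n (e + d)] sT n (e + d) (qT n (e + d) (?y0 e \<xi>))" if "\<xi> :> TY m e" for e \<xi>
    using that by (simp add: y_def)
  have rq: "endo_rel Y H q m n d y 0[EndH m n d]"
    unfolding endo_rel_def[OF Y H q]
  proof (intro allI ballI)
    fix e \<xi> assume \<xi>: "\<xi> :> TY m e"
    note c = EH_app[OF Y y0 \<xi> refl]
    note qc = T_closed(3)[OF c]
    show "qT n (e + d) (y e \<xi>) = 0[EndH m n d] e (qT m e \<xi>)"
      unfolding y[OF \<xi>] EH_simps(1)[OF H T_closed(3)[OF \<xi>]] lin_minus[OF MY MH qT_lin c T_closed(5)[OF qc]] qT_sT[OF qc]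
      using mod_minus_eq_zero_iff[OF MH qc qc] by simp
  qed
  have "endo_rel Y A p m n d y (\<phi> m n d f)"
    unfolding endo_rel_def[OF Y A p]
  proof (intro allI ballI)
    fix e \<xi> assume \<xi>: "\<xi> :> TY m e"
    note c = EH_app[OF Y y0 \<xi> refl]
    note qc = T_closed(3)[OF c]
    interpret N: module R "TA n (e + d)" by (rule MA)
    have "pT n (e + d) (sT n (e + d) (qT n (e + d) (?y0 e \<xi>))) = 0[TA n (e + d)]"
    \<comment> \<open>As in \<open>correction\<close>: either the argument is zero, or the value has
      positive degree because \<open>d\<close> is positive.\<close>
    proof (cases "e < 0")
      case True
      then have "\<xi> = 0[TY m e]" using tensor_negative[OF Y, of e m] \<xi> by simp
      then have "?y0 e \<xi> = 0[TY n (e + d)]" using lin_zero[OF MY MY EH_lin[OF Y y0 refl]] by simp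
      then show ?thesis using lin_zero[OF MY MH qT_lin] lin_zero[OF MH MY sT_lin] lin_zero[OF MY MA pT_lin] by simp
    next
      case False
      then show ?thesis using pT_sT[OF _ qc] d by simp
    qed
    moreover have "pT n (e + d) (?y0 e \<xi>) -[TA n (e + d)] 0[TA n (e + d)] = pT n (e + d) (?y0 e \<xi>)" using T_closed(1)[OF c] by algebra
    ultimately show "pT n (e + d) (y e \<xi>) = \<phi> m n d f e (pT m e \<xi>)"
      unfolding y[OF \<xi>] lin_minus[OF MY MA pT_lin c T_closed(5)[OF qc]] using pT_lift_op[OF f \<xi> refl] by simp
  qed
  then show ?thesis by (rule that[OF counted_cinI[OF mn f mod_zero_closed[OF EMH] yc rq]])
qed

text \<open>Injectivity on homology. A bounding operation for \<open>y\<close> over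
  \<open>f'\<close> is built first without regard to \<open>q\<close> and then made to descend by
  \<open>correction\<close>, which changes neither its boundary nor its image under
  \<open>p\<close>. As \<open>d\<close> is nonnegative, all new operations have positive degree and
  are not subject to a chain condition.\<close>

lemma lift_boundary:
  assumes mn: "(m, n) \<in> counted_arities \<C>" and c: "cin m n d f h y" and d: "d \<ge> 0"
    and dy: "dE Y m n d y = 0[EndY m n (d - 1)]"
    and f': "f' \<in> ops_in P m n (d + 1)" and ff': "diff (ops P m n) (d + 1) f' = f"
  obtains h' y' where "cin m n (d + 1) f' h' y'" "dE H m n (d + 1) h' = h" "dE Y m n (d + 1) y' = y"
proof -
  note c = cinD[OF c]
  let ?y1 = "lift_op m n (d + 1) f'" and ?l = "lift_op m n d f"
  have e1: "d + 1 - 1 = d" by simp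
  note y1 = lift_op_closed[OF f']
  have dy1: "dE Y m n (d + 1) ?y1 = ?l" using lift_op_diff[OF f'] ff' by simp
  note l = lift_op_closed[OF c(1)]
  \<comment> \<open>What \<open>lift_op\<close> of \<open>f'\<close> fails to bound. It lies over
    zero, so its values are in the kernel of \<open>p\<close>, which the homotopy of
    \<open>C_homotopy\<close> contracts.\<close>
  define z where "z = y -[EndY m n d] ?l"
  have zc: "z :> EndY m n d" unfolding z_def by (rule mod_minus_closed[OF EMY c(3) l])
  have pz: "pT n (e + d) (z e \<xi>) = 0[TA n (e + d)]" if \<xi>: "\<xi> :> TY m e" for e \<xi>
  proof -
    have cl: "\<phi> m n d f e (pT m e \<xi>) :> TA n (e + d)" by (rule EH_app[OF A \<phi>_closed[OF c(1)] T_closed(1)[OF \<xi>] refl])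
    show ?thesis
      unfolding z_def EH_minus[OF Y c(3) l \<xi> refl] lin_minus[OF MY MA pT_lin EH_app[OF Y c(3) \<xi> refl] EH_app[OF Y l \<xi> refl]]
        pT_lift_op[OF c(1) \<xi> refl] endo_relD[OF Y A p c(5) \<xi> refl]
      using mod_minus_eq_zero_iff[OF MA cl cl] by simp
  qed
  note dl = hom_diff_lin[OF TP_complex[OF Y] TP_complex[OF Y]]
  have dz: "dE Y m n d z = 0[EndY m n (d - 1)]"
  proof -
    have "dE Y m n d ?l = 0[EndY m n (d - 1)]"
      using cx_diff_diff[OF hom_complex[OF TP_complex[OF Y] TP_complex[OF Y]] y1] unfolding e1 dy1 by simp
    then show ?thesis unfolding z_def lin_minus[OF EMY EMY dl c(3) l] dy
      using mod_minus_eq_zero_iff[OF EMY mod_zero_closed[OF EMY] mod_zero_closed[OF EMY]] by simp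
  qed
  obtain K where K: "hom_fam (tpow Y n) (tpow Y n) 1 K"
    and K1: "\<And>d \<xi>. \<xi> :> TY n d \<Longrightarrow> dE Y n n 1 K d \<xi> = \<xi> -[TY n d] tT n d (pT n d \<xi>)"
    and K2: "\<And>d \<xi>. \<xi> :> TY n d \<Longrightarrow> pT n (d + 1) (K d \<xi>) = 0[TA n (d + 1)]"
    by (rule C_homotopy[of n]) (rule that)
  have Kl: "K e \<in> Lin (TY n e) (TY n e')" if "e' = e + 1" for e e' using hom_famD[OF K that] by simp
  (* Since p z = 0 and z is a cycle, composing z with the homotopy from 1 to t p exhibits z as a boundary. *)
  define w where "w = (\<lambda>e. \<lambda>\<xi>\<in>carrier (gr (tpow Y m) e). K (e + d) (z e \<xi>))"
  have wc: "w :> EndY m n (d + 1)"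
    unfolding w_def
  proof (rule hom_restrictI[OF TP_complex[OF Y] TP_complex[OF Y]])
    have a: "e + (d + 1) = e + d + 1" for e by simp
    show "hom_fam (tpow Y m) (tpow Y n) (d + 1) (\<lambda>e \<xi>. K (e + d) (z e \<xi>))"
      unfolding hom_fam_def tensor_power_simps by (intro allI lin_comp[OF EH_lin[OF Y zc refl] Kl[OF a]])
  qed (use d in auto)
  have w: "w e \<xi> = K (e + d) (z e \<xi>)" if "\<xi> :> TY m e" for e \<xi> using that by (simp add: w_def)
  have dw: "dE Y m n (d + 1) w = z"
  proof (rule EH_eqI[OF Y _ zc])
    show "dE Y m n (d + 1) w :> EndY m n d" using hom_diff_closed[OF TP_complex[OF Y] TP_complex[OF Y] wc] unfolding e1 .
    fix e \<xi> assume \<xi>: "\<xi> :> TY m e"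
    interpret N: module R "TY n (e + d)" by (rule MY)
    interpret N1: module R "TY n (e + d - 1)" by (rule MY)
    note d\<xi> = tensor_diff_closed[OF Y \<xi>]
    have z\<xi>: "z e \<xi> :> TY n (e + d)" by (rule EH_app[OF Y zc \<xi> refl])
    have zd: "z (e - 1) (tdiff Y m e \<xi>) :> TY n (e + d - 1)" by (rule EH_app[OF Y zc d\<xi>]) simp
    have tz: "tdiff Y n (e + d) (z e \<xi>) :> TY n (e + d - 1)" by (rule tensor_diff_closed[OF Y z\<xi>])
    have Kz: "K (e + d - 1) (z (e - 1) (tdiff Y m e \<xi>)) :> TY n (e + d)" by (rule lin_closed[OF Kl zd]) simp
    have Kz1: "K (e + d) (z e \<xi>) :> TY n (e + d + 1)" by (rule lin_closed[OF Kl z\<xi>]) simp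
    have tK: "tdiff Y n (e + d + 1) (K (e + d) (z e \<xi>)) :> TY n (e + d)" using tensor_diff_closed[OF Y Kz1] by simp
    have "tdiff Y n (e + d) (z e \<xi>) -[TY n (e + d - 1)] signed (TY n (e + d - 1)) d (z (e - 1) (tdiff Y m e \<xi>)) = 0[TY n (e + d - 1)]"
      using arg_cong[OF dz, of "\<lambda>F. F e \<xi>"] unfolding EH_simps(4)[OF Y \<xi>] EH_simps(1)[OF Y \<xi>] by (simp add: add_diff_eq)
    then have "tdiff Y n (e + d) (z e \<xi>) = signed (TY n (e + d - 1)) d (z (e - 1) (tdiff Y m e \<xi>))"
      using mod_minus_eq_zero_iff[OF MY tz signed_closed[OF MY zd]] by simp
    then have Kd: "K (e + d - 1) (tdiff Y n (e + d) (z e \<xi>)) = signed (TY n (e + d)) d (K (e + d - 1) (z (e - 1) (tdiff Y m e \<xi>)))"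
      using lin_signed[OF MY MY Kl zd, of "e + d" d] by simp
    have "dE Y m n (d + 1) w e \<xi> = tdiff Y n (e + d + 1) (K (e + d) (z e \<xi>)) -[TY n (e + d)]
      signed (TY n (e + d)) (d + 1) (K (e + d - 1) (z (e - 1) (tdiff Y m e \<xi>)))"
      using EH_simps(4)[OF Y \<xi>, of n "d + 1" w] w[OF \<xi>] w[OF d\<xi>] by (simp add: algebra_simps)
    also have "\<dots> = tdiff Y n (e + d + 1) (K (e + d) (z e \<xi>)) +[TY n (e + d)] K (e + d - 1) (tdiff Y n (e + d) (z e \<xi>))"
    proof -
      let ?a = "tdiff Y n (e + d + 1) (K (e + d) (z e \<xi>))" and ?b = "K (e + d - 1) (z (e - 1) (tdiff Y m e \<xi>))"
      have "?a -[TY n (e + d)] (-[TY n (e + d)] ?b) = ?a +[TY n (e + d)] ?b" "?a -[TY n (e + d)] ?b = ?a +[TY n (e + d)] (-[TY n (e + d)] ?b)"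
        using tK Kz by algebra+
      then show ?thesis unfolding Kd by (simp add: signed_def)
    qed
    also have "\<dots> = z e \<xi> -[TY n (e + d)] tT n (e + d) 0[TA n (e + d)]"
      using hom_diff_one[OF Y K z\<xi>] K1[OF z\<xi>] pz[OF \<xi>] by simp
    also have "\<dots> = z e \<xi>" unfolding lin_zero[OF MA MY tT_lin] using z\<xi> by algebra
    finally show "dE Y m n (d + 1) w e \<xi> = z e \<xi>" .
  qed
  define y0 where "y0 = ?y1 +[EndY m n (d + 1)] w"
  have y0: "y0 :> EndY m n (d + 1)" unfolding y0_def by (rule mod_add_closed[OF EMY y1 wc])
  have dy0: "dE Y m n (d + 1) y0 = y"
  proof -
    interpret N: module R "EndY m n d" by (rule EMY)
    have "dE Y m n (d + 1) y0 = ?l +[EndY m n d] z"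
      using lin_add[OF dl y1 wc] unfolding y0_def dy1 dw e1 .
    also have "\<dots> = y" unfolding z_def using c(3) l by algebra
    finally show ?thesis .
  qed
  have py0: "pT n (e + (d + 1)) (y0 e \<xi>) = \<phi> m n (d + 1) f' e (pT m e \<xi>)" if \<xi>: "\<xi> :> TY m e" for e \<xi>
  proof -
    interpret N: module R "TA n (e + (d + 1))" by (rule MA)
    have "pT n (e + (d + 1)) (w e \<xi>) = 0[TA n (e + (d + 1))]"
      using K2[OF EH_app[OF Y zc \<xi> refl]] w[OF \<xi>] by (simp add: add.assoc)
    then show ?thesis
      unfolding y0_def EH_simps(2)[OF Y \<xi>] lin_add[OF pT_lin EH_app[OF Y y1 \<xi> refl] EH_app[OF Y wc \<xi> refl]] pT_lift_op[OF f' \<xi> refl]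
      using EH_app[OF A \<phi>_closed[OF f'] T_closed(1)[OF \<xi>] refl] by simp
  qed
  \<comment> \<open>Elements of \<open>H\<close> are cycles and so are their images under
    \<open>j\<close>. On such arguments \<open>y\<close>, being the boundary of \<open>y0\<close>,
    only takes boundaries as values, and \<open>q\<close> kills these.\<close>
  have qj0: "qT n (e + d) (y e (jT m e \<eta>)) = 0[TH n (e + d)]" if \<eta>: "\<eta> :> TH m e" for e \<eta>
  proof -
    note j\<eta> = T_closed(4)[OF \<eta>]
    have e2: "e + (d + 1) - 1 = e + d" by simp
    have jd: "tdiff Y m e (jT m e \<eta>) = 0[TY m (e - 1)]"
      using tensor_map_diff[OF H Y jl j \<eta>] TH_diff[OF \<eta>] lin_zero[OF MH MY jT_lin] by simp
    have "y0 (e - 1) 0[TY m (e - 1)] = 0[TY n (e + d)]" using lin_zero[OF MY MY EH_lin[OF Y y0, of "e + d" "e - 1"]] by simp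
    moreover have "-[TY n (e + d)] 0[TY n (e + d)] = 0[TY n (e + d)]"
    proof -
      interpret N: module R "TY n (e + d)" by (rule MY)
      show ?thesis by algebra
    qed
    ultimately have "y e (jT m e \<eta>) = tdiff Y n (e + (d + 1)) (y0 e (jT m e \<eta>)) -[TY n (e + d)] 0[TY n (e + d)]"
      using arg_cong[OF dy0, of "\<lambda>F. F e (jT m e \<eta>)"] unfolding EH_simps(4)[OF Y j\<eta>] jd e2 by (cases "odd d") (simp_all add: signed_def)
    moreover have "0[TH n (e + d)] -[TH n (e + d)] 0[TH n (e + d)] = 0[TH n (e + d)]"
      using mod_minus_eq_zero_iff[OF MH mod_zero_closed[OF MH] mod_zero_closed[OF MH]] by simp
    ultimately show ?thesis
      using qT_diff[OF EH_app[OF Y y0 j\<eta> refl]] lin_minus[OF MY MH qT_lin _ mod_zero_closed[OF MY], of "tdiff Y n (e + (d + 1)) (y0 e (jT m e \<eta>))" n "e + d"]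
        tensor_diff_closed[OF Y EH_app[OF Y y0 j\<eta> refl]] lin_zero[OF MY MH qT_lin, of n "e + d"] unfolding e2 by simp
  qed
  obtain y' h' where y': "y' :> EndY m n (d + 1)" "h' :> EndH m n (d + 1)" "endo_rel Y H q m n (d + 1) y' h'"
    "\<And>e \<xi>. \<xi> :> TY m e \<Longrightarrow> pT n (e + (d + 1)) (y' e \<xi>) = pT n (e + (d + 1)) (y0 e \<xi>)" "dE Y m n (d + 1) y' = dE Y m n (d + 1) y0"
  proof (rule correction[OF y0])
    show "qT n (e + (d + 1) - 1) (dE Y m n (d + 1) y0 e \<xi>) = 0[TH n (e + (d + 1) - 1)]" if \<xi>: "\<xi> :> TY m e" for e \<xi>
    proof -
      note q\<xi> = T_closed(3)[OF \<xi>]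
      \<comment> \<open>Since \<open>y\<close> descends to \<open>h\<close>, its image under
        \<open>q\<close> can be computed after replacing the argument by \<open>j\<close> of
        \<open>q\<close> of it, where \<open>qj0\<close> applies.\<close>
      have "qT n (e + d) (y e \<xi>) = h e (qT m e (jT m e (qT m e \<xi>)))"
        using endo_relD[OF Y H q c(4) \<xi> refl] qT_jT[OF q\<xi>] by simp
      also have "\<dots> = 0[TH n (e + d)]" using endo_relD[OF Y H q c(4) T_closed(4)[OF q\<xi>] refl] qj0[OF q\<xi>] by simp
      finally show ?thesis by (simp add: dy0)
    qed
  qed (rule that, assumption+)
  have "endo_rel Y A p m n (d + 1) y' (\<phi> m n (d + 1) f')"
    unfolding endo_rel_def[OF Y A p] using y'(4) py0 by simp
  then have c': "cin m n (d + 1) f' h' y'" by (rule counted_cinI[OF mn f' y'(2,1,3)])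
  have dy': "dE Y m n (d + 1) y' = y" using y'(5) dy0 by simp
  \<comment> \<open>Both are related by \<open>q\<close> to \<open>y\<close>, and \<open>q\<close>
    has a section.\<close>
  have "dE H m n (d + 1) h' = h"
    using q_unique[OF hom_diff_closed[OF TP_complex[OF H] TP_complex[OF H] y'(2), unfolded e1] c(2)
      rel_diff[OF Y H q y'(1) y'(3), unfolded e1 dy'] c(4)] .
  then show ?thesis by (rule that[OF c' _ dy'])
qed

text \<open>On zeroth tensor powers induced endomorphisms such as \<open>t\<close> after
  \<open>p\<close> are identities. So \<open>f\<close> determines \<open>y\<close> by way of
  \<open>p\<close>, and \<open>y\<close> determines \<open>h\<close> by way of
  \<open>q\<close>.\<close>

lemma unital_unique:
  assumes c: "cin 0 0 d f h y" "cin 0 0 d f h' y'"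
  shows "h = h' \<and> y = y'"
proof
  note c1 = cinD[OF c(1)] and c2 = cinD[OF c(2)]
  have tp: "tT 0 e (pT 0 e \<xi>) = \<xi>" if \<xi>: "\<xi> :> TY 0 e" for e \<xi>
    using tensor_map_comp[where f = p and g = t and h = "\<lambda>n y. t n (p n y)", OF Y A Y pl tl lin_comp[OF pl tl] refl \<xi>]
      tensor_map_length_0[where e = "\<lambda>n y. t n (p n y)", OF Y lin_comp[OF pl tl] \<xi>] by simp
  show yy: "y = y'"
  proof (rule EH_eqI[OF Y c1(3) c2(3)])
    fix e \<xi> assume \<xi>: "\<xi> :> TY 0 e"
    show "y e \<xi> = y' e \<xi>"
      using endo_relD[OF Y A p c1(5) \<xi> refl] endo_relD[OF Y A p c2(5) \<xi> refl] tp[OF EH_app[OF Y c1(3) \<xi> refl]] tp[OF EH_app[OF Y c2(3) \<xi> refl]] by metis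
  qed
  show "h = h'" using q_unique[OF c1(2) c2(2) c1(4)] c2(4) yy by simp
qed

end

subsection \<open>Lifting against the test prop\<close>

text \<open>The projection to \<open>P1\<close> is bijective at arity \<open>(0, 0)\<close> because
  the other components are unique there, and it is bijective in uncounted arities because they
  vanish. The conditions that define the category are thus inherited from \<open>P1\<close>.\<close>

lemma (in triple_prop) T_in_category:
  assumes cat: "in_category R \<C> P1"
    and uniq: "\<And>d x y z y' z'. \<lbrakk>I3 0 0 d x y z; I3 0 0 d x y' z'\<rbrakk> \<Longrightarrow> y = y' \<and> z = z'"
    and zero: "\<And>m n d x y z. \<lbrakk>uncounted \<C> m n; I3 m n d x y z\<rbrakk> \<Longrightarrow> y = 0[gr (ops P2 m n) d] \<and> z = 0[gr (ops P3 m n) d]"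
  shows "in_category R \<C> T"
proof -
  have zc: "zero_cx (ops T m n)" if u: "uncounted \<C> m n" and z: "zero_cx (ops P1 m n)" for m n
    unfolding zero_cx_def
  proof (intro allI equalityI subsetI)
    fix d w assume "w :> gr (ops T m n) d"
    then obtain x y z' where w: "w = mk x y z'" and i: "I3 m n d x y z'" by (rule T_cases)
    have "x = 0[gr (ops P1 m n) d]" using I3D(1)[OF i] z by (simp add: zero_cx_def)
    then show "w \<in> {0[gr (ops T m n) d]}" using zero[OF u i] by (simp add: w T_ops)
  qed (use mod_zero_closed[OF T_module] in simp)
  have un: "unital_at_0 R T" if u: "unital_at_0 R P1"
    unfolding unital_at_0_def
  proof (intro conjI allI impI)
    have b: "bij_betw (\<lambda>a. a *[gr (ops P1 0 0) 0] punit P1 0) (carrier R) (ops_in P1 0 0 0)"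
      and z: "\<And>d. d \<noteq> 0 \<Longrightarrow> ops_in P1 0 0 d = {0[gr (ops P1 0 0) d]}"
      using u by (auto simp: unital_at_0_def)
    show "bij_betw (\<lambda>a. a *[gr (ops T 0 0) 0] punit T 0) (carrier R) (ops_in T 0 0 0)"
    proof (rule bij_betwI')
      show "a *[gr (ops T 0 0) 0] punit T 0 = b *[gr (ops T 0 0) 0] punit T 0 \<longleftrightarrow> a = b"
        if "a :> R" "b :> R" for a b
        using inj_onD[OF bij_betw_imp_inj_on[OF b] _ that] by (auto simp: T_ops T_simps)
      show "a *[gr (ops T 0 0) 0] punit T 0 \<in> ops_in T 0 0 0" if "a :> R" for a
        using I3_smult[OF that I3_unit] by (simp add: T_ops T_simps T_in)
      fix w assume "w \<in> ops_in T 0 0 0"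
      then obtain x y z where w: "w = mk x y z" and i: "I3 0 0 0 x y z" by (rule T_cases)
      have "x \<in> (\<lambda>a. a *[gr (ops P1 0 0) 0] punit P1 0) ` carrier R" using I3D(1)[OF i] bij_betw_imp_surj_on[OF b] by simp
      then obtain a where a: "a :> R" "x = a *[gr (ops P1 0 0) 0] punit P1 0" by blast
      show "\<exists>a\<in>carrier R. w = a *[gr (ops T 0 0) 0] punit T 0"
        using uniq[OF i[unfolded a(2)] I3_smult[OF a(1) I3_unit]] a by (intro bexI[of _ a]) (simp_all add: w T_ops T_simps)
    qed
    fix d :: int assume d: "d \<noteq> 0"
    show "ops_in T 0 0 d = {0[gr (ops T 0 0) d]}"
    proof (intro equalityI subsetI)
      fix w assume "w \<in> ops_in T 0 0 d"
      then obtain x y z' where w: "w = mk x y z'" and i: "I3 0 0 d x y z'" by (rule T_cases)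
      have x: "x = 0[gr (ops P1 0 0) d]" using I3D(1)[OF i] z[OF d] by simp
      show "w \<in> {0[gr (ops T 0 0) d]}" using uniq[OF i[unfolded x] I3_zero] by (simp add: w x T_ops)
    qed (use mod_zero_closed[OF T_module] in simp)
  qed
  show ?thesis
    using cat T_dg_prop un zc by (cases \<C>) (auto simp: uncounted_def)
qed

text \<open>The second encoding puts a copy of \<open>P\<close> into the type \<open>'u\<close> of
  the test prop, as \<open>cofibration\<close> requires source and target of the fibration to have
  elements in the same type.\<close>

locale lifting = lift_test R A H Y p t q j s C G mk pr1 pr2 pr3 P \<phi> \<C> + base: triple R mk' pb1 pb2 pb3
  for R :: "'k ring" (structure) and A :: "('k, 'a) cx" and H :: "('k, 'h) cx" and Y :: "('k, 'y) cx"
    and p t q j s C G and mk :: "'p \<Rightarrow> ('k, 'h) endo \<Rightarrow> ('k, 'y) endo \<Rightarrow> 'u" and pr1 pr2 pr3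
    and P :: "('k, 'p) prop_data" and \<phi> :: "('p, ('k, 'a) endo) prop_map" and \<C> :: prop_category
    and mk' :: "'p \<Rightarrow> unit \<Rightarrow> unit \<Rightarrow> 'u" and pb1 pb2 pb3
begin

sublocale B: triple_prop R mk' pb1 pb2 pb3 P trivial_prop trivial_prop "\<lambda>_ _ _ _ _ _. True"
  by (rule triple_prop.intro[OF base.triple_axioms], rule triple_prop_axioms.intro) (rule P trivial_prop TrueI)+

lemma E_category: "in_category R \<C> E.T"
  by (rule E.T_in_category[OF cat unital_unique]) (auto dest: cinD(6,7) simp: End_simps(1)[OF H] End_simps(1)[OF Y])

lemma B_category: "in_category R \<C> B.T"
  by (rule B.T_in_category[OF cat]) auto

definition inc :: "('p, 'u) prop_map" where
  "inc m n d f = mk' f () ()"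

lemma inc_hom: "prop_hom R P B.T inc"
proof (rule prop_hom.intro)
  fix m n
  have tl: "F \<in> Lin M (gr (ops trivial_prop m n) d)" for F M d by (simp add: trivial_gr)
  have l: "inc m n d \<in> Lin (gr (ops P m n) d) (gr (ops B.T m n) d)" for d
    by (rule B.T_linI[OF prop_module[OF P] inc_def lin_id tl tl]) (simp add: in3_def trivial_gr)
  show "cmap (ops P m n) (ops B.T m n) (inc m n)"
    using l by (simp add: chain_map_def inc_def B.T_simps)
qed (simp_all add: inc_def B.T_simps)

definition proj :: "('u, 'u) prop_map" where
  "proj m n d u = inc m n d (pr1 u)"

lemma proj_hom: "prop_hom R E.T B.T proj"
  unfolding proj_def[abs_def] by (rule prop_hom_comp[OF E.T_pr_hom(1) inc_hom])

text \<open>The three lifting lemmas correspond to the three parts of the claim: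
  \<open>lift_boundary\<close> to injectivity on homology, \<open>lift_cycle\<close> to surjectivity
  on homology, and \<open>lift_positive\<close> to the fibration property.\<close>

lemma proj_acyclic: "acyclic_fibration \<C> E.T B.T proj"
proof -
  interpret proj: prop_hom R E.T B.T proj by (rule proj_hom)
  have "quasi_iso (ops E.T m n) (ops B.T m n) (proj m n) \<and> cx_fibration (ops E.T m n) (ops B.T m n) (proj m n)"
    if mn: "(m, n) \<in> counted_arities \<C>" for m n
  proof
    note oH = End_simps(1)[OF H] and oY = End_simps(1)[OF Y]
    show "quasi_iso (ops E.T m n) (ops B.T m n) (proj m n)"
    proof (rule quasi_isoI[OF E.T_complex B.T_complex proj.hom_chain_map])
      fix d u assume u: "u \<in> cycles (ops E.T m n) d" and b: "proj m n d u \<in> boundaries (ops B.T m n) d"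
      have "u \<in> ops_in E.T m n d" using u by (simp add: cycles_def)
      then obtain f h y where u': "u = mk f h y" and i: "cin m n d f h y" by (rule E.T_cases)
      have dy: "dE Y m n d y = 0[EndY m n (d - 1)]" using u by (simp add: cycles_def u' E.T_simps E.T_ops oY)
      obtain w where w: "w \<in> ops_in B.T m n (d + 1)" "proj m n d u = diff (ops B.T m n) (d + 1) w"
        using b unfolding boundaries_def by blast
      obtain f' a c where w': "w = mk' f' a c" "f' \<in> ops_in P m n (d + 1)"
        using w(1) by (rule B.T_cases) (auto simp: in3_def)
      have f: "diff (ops P m n) (d + 1) f' = f" using w(2) by (simp add: w' u' proj_def inc_def B.T_simps)
      show "u \<in> boundaries (ops E.T m n) d"
      \<comment> \<open>\<open>lift_boundary\<close> asks for a nonnegative degree. In negative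
        degrees \<open>u\<close> is zero, hence a boundary.\<close>
      proof (cases "d < 0")
        case True
        then have "u = 0[gr (ops E.T m n) d]" using chain_complex.nonneg[OF E.T_complex True] \<open>u \<in> ops_in E.T m n d\<close> by simp
        also have "\<dots> = diff (ops E.T m n) (d + 1) 0[gr (ops E.T m n) (d + 1)]"
          using lin_zero[OF E.T_module E.T_module cx_diff_lin[OF E.T_complex], of m n "d + 1"] by simp
        finally show ?thesis unfolding boundaries_def using mod_zero_closed[OF E.T_module] by (rule image_eqI)
      next
        case False
        obtain h' y' where h': "cin m n (d + 1) f' h' y'" "dE H m n (d + 1) h' = h" "dE Y m n (d + 1) y' = y"
          by (rule lift_boundary[OF mn i _ dy w'(2) f]) (use False in simp, rule that)
        have "u = diff (ops E.T m n) (d + 1) (mk f' h' y')" using h' f by (simp add: E.T_simps u' oH oY)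
        moreover have "mk f' h' y' \<in> ops_in E.T m n (d + 1)" using h'(1) by (simp add: E.T_in)
        ultimately show ?thesis unfolding boundaries_def by (rule image_eqI)
      qed
    next
      fix d v assume v: "v \<in> cycles (ops B.T m n) d"
      have vc: "v \<in> ops_in B.T m n d" using v by (simp add: cycles_def)
      obtain f a c where v': "v = mk' f a c" "f \<in> ops_in P m n d" using vc by (rule B.T_cases) (auto simp: in3_def)
      have "f \<in> cycles (ops P m n) d" using v v'(2) by (simp add: cycles_def v'(1) B.T_simps B.T_ops)
      then obtain h y where i: "cin m n d f h y" "dE H m n d h = 0[EndH m n (d - 1)]" "dE Y m n d y = 0[EndY m n (d - 1)]"
        by (rule lift_cycle[OF mn])
      have "mk f h y \<in> cycles (ops E.T m n) d"
        using i \<open>f \<in> cycles (ops P m n) d\<close> by (simp add: cycles_def E.T_in E.T_simps E.T_ops oH oY)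
      moreover have "v -[gr (ops B.T m n) d] proj m n d (mk f h y) = 0[gr (ops B.T m n) d]"
        using mod_minus_eq_zero_iff[OF B.T_module vc vc] by (simp add: proj_def inc_def v'(1))
      moreover have "0[gr (ops B.T m n) d] \<in> boundaries (ops B.T m n) d"
        unfolding boundaries_def
        by (rule image_eqI[OF _ mod_zero_closed[OF B.T_module]])
          (use lin_zero[OF B.T_module B.T_module cx_diff_lin[OF B.T_complex], of m n "d + 1"] in simp)
      ultimately show "\<exists>u\<in>cycles (ops E.T m n) d. v -[gr (ops B.T m n) d] proj m n d u \<in> boundaries (ops B.T m n) d" by metis
    qed
    show "cx_fibration (ops E.T m n) (ops B.T m n) (proj m n)"
      unfolding cx_fibration_def
    proof (intro allI impI equalityI subsetI)
      fix d :: int and v assume d: "d > 0"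
      { assume "v \<in> proj m n d ` ops_in E.T m n d"
        then show "v \<in> ops_in B.T m n d" using lin_closed[OF chain_mapD(1)[OF proj.hom_chain_map]] by blast }
      assume "v \<in> ops_in B.T m n d"
      then obtain f a c where v': "v = mk' f a c" "f \<in> ops_in P m n d" by (rule B.T_cases) (auto simp: in3_def)
      obtain h y where i: "cin m n d f h y" by (rule lift_positive[OF mn v'(2) d])
      show "v \<in> proj m n d ` ops_in E.T m n d"
        by (rule image_eqI[of _ _ "mk f h y"]) (use i in \<open>simp_all add: proj_def inc_def v'(1) E.T_in\<close>)
    qed
  qed
  then show ?thesis by (auto simp: acyclic_fibration_def)
qed

lemma lifted_actions:
  assumes cof: "cofibration TYPE('u) R \<C> (init) P (initial_map R P)"
  obtains \<theta> \<psi> where "prop_hom R P (End H) \<theta>" "prop_hom R P (End Y) \<psi>"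
    "\<And>m n d f. f \<in> ops_in P m n d \<Longrightarrow> endo_rel Y H q m n d (\<psi> m n d f) (\<theta> m n d f)"
    "\<And>m n d f. f \<in> ops_in P m n d \<Longrightarrow> endo_rel Y A p m n d (\<psi> m n d f) (\<phi> m n d f)"
proof -
  have comm: "proj m n d (initial_map R E.T m n d c) = inc m n d (initial_map R P m n d c)" if "c \<in> ops_in (init) m n d" for m n d c
    using initial_map_natural[OF E.T_dg_prop B.T_dg_prop proj_hom that] initial_map_natural[OF P B.T_dg_prop inc_hom that] by simp
  \<comment> \<open>The lower edge of the square is the isomorphism \<open>inc\<close> of
    \<open>P\<close> with its copy, and the two vertical source maps come from the initial prop. The
    lift is a section of the projection from triples to \<open>P\<close>.\<close>
  obtain \<gamma> where \<gamma>: "prop_hom R P E.T \<gamma>" and pg: "\<And>m n d f. f \<in> ops_in P m n d \<Longrightarrow> proj m n d (\<gamma> m n d f) = inc m n d f"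
    using cof[unfolded cofibration_def, THEN conjunct2, rule_format, OF E_category B_category proj_hom proj_acyclic
      initial_map_hom[OF E.T_dg_prop] inc_hom comm] by blast
  have c: "cin m n d f (pr2 (\<gamma> m n d f)) (pr3 (\<gamma> m n d f))" if f: "f \<in> ops_in P m n d" for m n d f
  proof -
    have "\<gamma> m n d f \<in> ops_in E.T m n d" by (rule lin_closed[OF chain_mapD(1)[OF prop_hom.hom_chain_map[OF \<gamma>]] f])
    then obtain f' h y where u: "\<gamma> m n d f = mk f' h y" "cin m n d f' h y" by (rule E.T_cases)
    have "f' = f" using pg[OF f] by (simp add: u proj_def inc_def)
    then show ?thesis using u by simp
  qed
  show ?thesis
    by (rule that[OF prop_hom_comp[OF \<gamma> E.T_pr_hom(2)] prop_hom_comp[OF \<gamma> E.T_pr_hom(3)] cinD(4)[OF c] cinD(5)[OF c]])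
qed

end

subsection \<open>Copies of a complex\<close>

text \<open>The theorem fixes one type for the two intermediate complexes, while homology has its
  elements in \<open>'a set\<close>. The encoding moves \<open>H\<close> to that type.\<close>

locale copy = triple R mk pr1 pr2 pr3 for R :: "'k ring" (structure) and mk :: "'h \<Rightarrow> unit \<Rightarrow> unit \<Rightarrow> 'x" and pr1 pr2 pr3 +
  fixes H :: "('k, 'h) cx"
  assumes H: "cplx H"
begin

definition copy_cx :: "('k, 'x) cx" where
  "copy_cx = \<lparr>gr = (\<lambda>n. tmod (gr H n) trivial_module trivial_module (\<lambda>_ _ _. True)),
    diff = (\<lambda>n x. mk (diff H n (pr1 x)) () ())\<rparr>"

lemma copy_facts: "module R (gr H n)" "module R trivial_module" "module R trivial_module"
    "tclosed (gr H n) trivial_module trivial_module (\<lambda>_ _ _. True)"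
  using H trivial_module by (simp_all add: tclosed_def)

lemma copy_module: "module R (gr copy_cx n)"
  using tmod_module[OF copy_facts] by (simp add: copy_cx_def)

lemma copy_cases:
  assumes "x :> gr copy_cx n"
  obtains h where "x = mk h () ()" "h :> gr H n"
  using assms by (auto simp: copy_cx_def elim!: tmod_cases)

lemma copy_zero: "0[gr copy_cx n] = mk 0[gr H n] () ()"
  by (simp add: copy_cx_def tmod_simps)

lemma copy_diff: "diff copy_cx n (mk h u v) = mk (diff H n h) () ()"
  by (simp add: copy_cx_def)

lemma copy_lin: "f \<in> Lin N (gr H n) \<Longrightarrow> module R N \<Longrightarrow> (\<lambda>x. mk (f x) () ()) \<in> Lin N (gr copy_cx n)"
  using tmod_mk_lin[OF copy_facts _ _ trivial_lin trivial_lin, of N f n "\<lambda>_. ()" "\<lambda>_. ()"] by (simp add: copy_cx_def)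

lemma copy_pr: "pr1 \<in> Lin (gr copy_cx n) (gr H n)"
  using tmod_pr_lin(1)[OF copy_facts] by (simp add: copy_cx_def)

lemma copy_complex: "cplx copy_cx"
proof (rule chain_complex.intro)
  fix n
  show "module R (gr copy_cx n)" by (rule copy_module)
  show "diff copy_cx n \<in> Lin (gr copy_cx n) (gr copy_cx (n - 1))"
    using copy_lin[OF lin_comp[OF copy_pr cx_diff_lin[OF H]] copy_module, of n] by (simp add: copy_cx_def)
  show "diff copy_cx (n - 1) (diff copy_cx n x) = 0[gr copy_cx (n - 2)]" if "x :> gr copy_cx n" for x
    using that by (rule copy_cases) (simp add: copy_diff copy_zero cx_diff_diff[OF H])
  assume n: "n < 0"
  show "carrier (gr copy_cx n) = {0[gr copy_cx n]}"
  proof (intro equalityI subsetI)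
    fix x assume "x :> gr copy_cx n"
    then show "x \<in> {0[gr copy_cx n]}" by (rule copy_cases) (use chain_complex.nonneg[OF H n] in \<open>simp add: copy_zero\<close>)
  qed (use mod_zero_closed[OF copy_module] in simp)
qed

lemma copy_maps: "cmap H copy_cx (\<lambda>n h. mk h () ())" "cmap copy_cx H (\<lambda>n. pr1)"
  using copy_lin[OF lin_id cx_module[OF H]] copy_pr by (auto simp: chain_map_def copy_diff elim!: copy_cases)

end

section \<open>Morphisms of algebras from related operations\<close>

context ground_ring begin

lemma algebra_homI:
  assumes "cplx U" "cplx V" "cmap U V f"
    and "\<And>m n d a. a \<in> ops_in P m n d \<Longrightarrow> endo_rel U V f m n d (\<phi> m n d a) (\<psi> m n d a)"
  shows "algebra_hom R P U \<phi> V \<psi> f"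
  using assms by (simp add: algebra_hom_def endo_rel_def)

lemma chain_map_comp: "\<lbrakk>cmap U V f; cmap V W g\<rbrakk> \<Longrightarrow> cmap U W (\<lambda>n x. g n (f n x))"
  unfolding chain_map_def by (metis lin_comp lin_closed)

text \<open>Needed because the map from \<open>Y\<close> to the copy of \<open>H\<close> is
  \<open>q\<close> followed by the isomorphism with the copy, and the relations are known for these
  two separately.\<close>

lemma endo_rel_comp:
  assumes U: "cplx U" and V: "cplx V" and W: "cplx W"
    and f: "cmap U V f" and g: "cmap V W g"
    and x: "x :> UE U m n d" and r: "endo_rel U V f m n d x y" "endo_rel V W g m n d y z"
  shows "endo_rel U W (\<lambda>n x. g n (f n x)) m n d x z"
proof -
  note fl = chain_mapD(1)[OF f] and gl = chain_mapD(1)[OF g]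
  have c: "tmap W (\<lambda>n x. g n (f n x)) k e \<xi> = tmap W g k e (tmap V f k e \<xi>)"
    if "\<xi> :> Tens U k e" for k e \<xi>
    using tensor_map_comp[where f = f and g = g and h = "\<lambda>n x. g n (f n x)", OF U V W fl gl lin_comp[OF fl gl] refl that] by simp
  show ?thesis
    unfolding endo_rel_def[OF U W chain_map_comp[OF f g]]
    using c endo_relD[OF U V f r(1)] endo_relD[OF V W g r(2)] EH_app[OF U x _ refl] tensor_map_closed[where f = f, OF U V fl] by simp
qed

end

theorem theorem2:
  fixes R :: "'k ring"
    and P :: "('k, 'p) prop_data"
    and A :: "('k, 'a) cx"
    and \<phi> :: "('p, ('k, 'a) endo) prop_map"
    and \<C> :: prop_category
  assumes "cring R"
    and "cofibrant TYPE(('k, 'a, 'p) universe) R \<C> P"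
    and "prop_algebra R P A \<phi>"
    and "\<And>n. projective_module R (gr A n)"
    and "\<And>n. projective_module R (homology A n)"
  shows "\<exists>(\<theta> :: ('p, ('k, 'a set) endo) prop_map)
          (X :: ('k, 'a roomy) cx) \<chi> (Y :: ('k, 'a roomy) cx) \<psi> f g h.
    prop_algebra R P (homology_cx A) \<theta> \<and> prop_algebra R P X \<chi> \<and> prop_algebra R P Y \<psi> \<and>
    algebra_weq R P (homology_cx A) \<theta> X \<chi> f \<and>
    algebra_weq R P Y \<psi> X \<chi> g \<and>
    algebra_weq R P Y \<psi> A \<phi> h"
proof -
  interpret ground_ring R by (rule ground_ring.intro[OF assms(1)])
  have A: "cplx A" and \<phi>: "prop_hom R P (End A) \<phi>" using assms(3) by (auto simp: prop_algebra_def)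
  have cat: "in_category R \<C> P" and cof: "cofibration TYPE(('k, 'a, 'p) universe) R \<C> (init) P (initial_map R P)"
    using assms(2) by (auto simp: cofibrant_def)
  let ?H = "homology_cx A"
  note H = homology_cx_complex[OF A]
  obtain r i k where ri: "cmap A ?H r" "cmap ?H A i" "\<And>n. k n \<in> Lin (gr A n) (gr A (n + 1))"
    "\<And>n \<xi>. \<xi> :> homology A n \<Longrightarrow> r n (i n \<xi>) = \<xi>"
    "\<And>n a. a :> gr A n \<Longrightarrow> a -[gr A n] i n (r n a) = diff A (n + 1) (k n a) +[gr A n] k (n - 1) (diff A n a)"
    by (rule splitting[OF A assms(4,5)]) (rule that, assumption+)
  \<comment> \<open>A chain is stored as a singleton at place 0, so that it fits next to the two
    homology classes, which are sets already; place 1 is the middle component and place 2 the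
    third.\<close>
  define mkY :: "'a \<Rightarrow> 'a set \<Rightarrow> 'a set \<Rightarrow> 'a roomy" where "mkY a h v = (\<lambda>n. if n = 0 then {a} else if n = 1 then h else v)" for a h v
  interpret cyl: retract_triple R mkY "\<lambda>y. the_elem (y 0)" "\<lambda>y. y 1" "\<lambda>y. y 2" A ?H r i k
  proof (rule retract_triple.intro, rule triple.intro[OF ground_ring_axioms], rule triple_axioms.intro)
    show "retract_triple_axioms R A ?H r i k"
      by (rule retract_triple_axioms.intro) (use A H ri in \<open>auto simp: homology_cx_def\<close>)
  qed (simp_all add: mkY_def)
  interpret Z: strict_zigzag R A ?H cyl.cyl cyl.cp cyl.ct cyl.cq cyl.cj cyl.cs cyl.cC cyl.cG
    by (rule cyl.strict_zigzag)
  \<comment> \<open>In \<open>universe\<close>, operations on \<open>H\<close> occupy the third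
    component and operations on \<open>Y\<close> the fourth. The latter consists of sequences; an
    operation is stored as a constant sequence and read at 0.\<close>
  interpret lifting R A ?H cyl.cyl cyl.cp cyl.ct cyl.cq cyl.cj cyl.cs cyl.cC cyl.cG
    "\<lambda>f h y. (f, undefined, h, \<lambda>_. y) :: ('k, 'a, 'p) universe" fst "\<lambda>u. fst (snd (snd u))" "\<lambda>u. snd (snd (snd u)) 0"
    P \<phi> \<C> "\<lambda>f _ _. (f, undefined, undefined, undefined) :: ('k, 'a, 'p) universe" fst "\<lambda>_. ()" "\<lambda>_. ()"
    by (intro lifting.intro lift_test.intro triple.intro lift_test_axioms.intro triple_axioms.intro)
      (simp_all add: Z.strict_zigzag_axioms ground_ring_axioms cat \<phi> del: One_nat_def)
  note Y = Z.Y and q = Z.q and p = Z.p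
  let ?Y = cyl.cyl
  obtain \<theta> \<psi> where \<theta>: "prop_hom R P (End ?H) \<theta>" and \<psi>: "prop_hom R P (End ?Y) \<psi>"
    and rq: "\<And>m n d f. f \<in> ops_in P m n d \<Longrightarrow> endo_rel ?Y ?H cyl.cq m n d (\<psi> m n d f) (\<theta> m n d f)"
    and rp: "\<And>m n d f. f \<in> ops_in P m n d \<Longrightarrow> endo_rel ?Y A cyl.cp m n d (\<psi> m n d f) (\<phi> m n d f)"
    by (rule lifted_actions[OF cof]) (rule that, assumption+)
  \<comment> \<open>A homology class becomes the constant sequence with this value, and evaluation
    at 0 recovers it.\<close>
  interpret X: copy R "\<lambda>h _ _. (\<lambda>_. h) :: 'a roomy" "\<lambda>x. x 0" "\<lambda>_. ()" "\<lambda>_. ()" ?H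
    by (intro copy.intro triple.intro copy_axioms.intro triple_axioms.intro) (simp_all add: ground_ring_axioms H)
  let ?X = X.copy_cx and ?f = "\<lambda>(n :: int) h. (\<lambda>_. h) :: 'a roomy" and ?f' = "\<lambda>(n :: int) (x :: 'a roomy). x 0"
  note X = X.copy_complex and f = X.copy_maps(1) and f' = X.copy_maps(2)
  have ff': "?f n (?f' n x) = x" if "x :> gr ?X n" for n x using that by (rule X.copy_cases) simp
  obtain \<chi> where \<chi>: "prop_hom R P (End ?X) \<chi>"
    and rf: "\<And>m n d a. a \<in> ops_in P m n d \<Longrightarrow> endo_rel ?H ?X ?f m n d (\<theta> m n d a) (\<chi> m n d a)"
    \<comment> \<open>The action on the copy is the one on \<open>H\<close> carried along the
      isomorphism.\<close>
    by (rule prop_hom_transport[where f = ?f and g = ?f', OF H X f f' _ _ in_category_prop[OF cat] \<theta>]) (erule ff', rule refl, rule that, assumption+)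
  let ?g = "\<lambda>n y. ?f n (cyl.cq n y)"
  note g = chain_map_comp[OF q f]
  have wf: "quasi_iso ?H ?X ?f"
  \<comment> \<open>An isomorphism is treated as a retraction whose homotopy is zero.\<close>
  proof (rule quasi_iso_retract[OF H X f f' ff'])
    fix n x assume x: "x :> gr ?H n"
    show "x -[gr ?H n] ?f' n (?f n x) = diff ?H (n + 1) 0[gr ?H (n + 1)] +[gr ?H n] 0[gr ?H (n - 1 + 1)]"
      using mod_minus_eq_zero_iff[OF cx_module[OF H] x x] lin_zero[OF cx_module[OF H] cx_module[OF H] cx_diff_lin[OF H], of "n + 1"] H by simp
  qed (simp_all add: lin_zerof H)
  \<comment> \<open>A section of \<open>?g\<close> is the inverse isomorphism followed by
    \<open>j\<close>. The composite of \<open>?g\<close> with it is then \<open>j\<close> after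
    \<open>q\<close>, so the homotopy of \<open>q\<close> can be reused.\<close>
  have wg: "quasi_iso ?Y ?X ?g"
    by (rule quasi_iso_retract[OF Y X g chain_map_comp[OF f' Z.j] _ Z.G])
      (auto elim!: X.copy_cases simp: Z.qj Z.G_htpy simp del: One_nat_def)
  have wp: "quasi_iso ?Y A cyl.cp"
    by (rule quasi_iso_retract[OF Y A p Z.t Z.pt Z.C Z.C_htpy])
  have "algebra_hom R P ?H \<theta> ?X \<chi> ?f" by (rule algebra_homI[OF H X f rf])
  moreover have "algebra_hom R P ?Y \<psi> ?X \<chi> ?g"
  proof (rule algebra_homI[OF Y X g])
    fix m n d a assume a: "a \<in> ops_in P m n d"
    have "\<psi> m n d a :> UE ?Y m n d"
      using lin_closed[OF chain_mapD(1)[OF prop_hom.hom_chain_map[OF \<psi>]] a] by (simp add: End_simps(1)[OF Y] del: One_nat_def)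
    then show "endo_rel ?Y ?X ?g m n d (\<psi> m n d a) (\<chi> m n d a)" by (rule endo_rel_comp[OF Y H X q f _ rq[OF a] rf[OF a]])
  qed
  moreover have "algebra_hom R P ?Y \<psi> A \<phi> cyl.cp" by (rule algebra_homI[OF Y A p rp])
  moreover have "prop_algebra R P ?H \<theta>" "prop_algebra R P ?X \<chi>" "prop_algebra R P ?Y \<psi>"
    using H X Y \<theta> \<chi> \<psi> by (simp_all add: prop_algebra_def)
  ultimately show ?thesis using wf wg wp unfolding algebra_weq_def by blast
qed

end
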